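(* Let $(M,h)$ be a compact astheno-Kähler manifold (i.e. $\partial\bar\partial\omega_h^{m-2}=0$, where $m=\dim_{\mathbb{C}}M$) and let $(N,g)$ be a Riemannian manifold with non-positive complex sectional curvature. Let $f:(M,h)\to(N,g)$ be a Hermitian harmonic map. If $M$ admits a Hermitian metric $h_0$ with uniformly RC-positive curvature, then $f$ is a constant map.
   Context: Manifolds are connected and maps are smooth. $\omega_h$ denotes the fundamental $(1,1)$-form of the Hermitian metric $h$; the astheno-Kähler condition is regarded as automatically satisfied when $m\le 2$. Hermitian harmonic: a smooth map $f:(M,h)\to(N,g)$ is Hermitian harmonic if, in local holomorphic coordinates $\{z^\alpha\}$ on $M$ and local coordinates $\{y^i\}$ on $N$, with $\Gamma^i_{jk}$ the Christoffel symbols of $g$ evaluated along $f$ and $e_i=f^*(\partial/\partial y^i)$, $$h^{\alpha\bar\beta}\left(\frac{\partial^2 f^i}{\partial z^\alpha\partial\bar z^\beta}+\Gamma^i_{jk}\frac{\partial f^j}{\partial\bar z^\beta}\frac{\partial f^k}{\partial z^\alpha}\right)\otimes e_i=0.$$ Uniform RC-positivity: for a Hermitian metric $h_0$ on $M$, let $R_{\alpha\bar\beta\gamma\bar\delta}=-\frac{\partial^2 (h_0)_{\gamma\bar\delta}}{\partial z^\alpha\partial\bar z^\beta}+h_0^{\mu\bar\nu}\frac{\partial (h_0)_{\gamma\bar\nu}}{\partial z^\alpha}\frac{\partial (h_0)_{\mu\bar\delta}}{\partial\bar z^\beta}$ be the Chern curvature tensor of $(T^{1,0}M,h_0)$ and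 $R(u,\bar u,v,\bar v)=R_{\alpha\bar\beta\gamma\bar\delta}u^\alpha\bar u^\beta v^\gamma\bar v^\delta$. $h_0$ has uniformly RC-positive curvature if at every point $q\in M$ there exists $u\in T^{1,0}_qM$ such that $R(u,\bar u,v,\bar v)>0$ for every nonzero $v\in T^{1,0}_qM$. Non-positive complex sectional curvature: for $(N,g)$ with Levi-Civita connection $\nabla$, put $R(X,Y)Z=\nabla_X\nabla_YZ-\nabla_Y\nabla_XZ-\nabla_{[X,Y]}Z$ and $R(X,Y,Z,W)=g(R(X,Y)Z,W)$, extended $\mathbb{C}$-multilinearly to $T_{\mathbb{C}}N=TN\otimes\mathbb{C}$. $(N,g)$ has non-positive complex sectional curvature if $R(Z,\bar W,W,\bar Z)\le 0$ for all $Z,W\in T_{\mathbb{C}}N$ (at the same point). *)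

theory Defs
  imports "HOL-Analysis.Analysis" "HOL-Combinatorics.Permutations"
begin

section \<open>Smooth and holomorphic maps between open sets of coordinate spaces\<close>

text \<open>These notions are used on open sets only.\<close>

fun Ck_on :: "nat \<Rightarrow> 'a::real_normed_vector set \<Rightarrow> ('a \<Rightarrow> 'b::real_normed_vector) \<Rightarrow> bool" where
  "Ck_on 0 S F \<longleftrightarrow> continuous_on S F"
| "Ck_on (Suc k) S F \<longleftrightarrow>
     (\<forall>x\<in>S. F differentiable (at x)) \<and> (\<forall>v. Ck_on k S (\<lambda>x. frechet_derivative F (at x) v))"

definition smooth_on :: "'a::real_normed_vector set \<Rightarrow> ('a \<Rightarrow> 'b::real_normed_vector) \<Rightarrow> bool" where
  "smooth_on S F \<longleftrightarrow> (\<forall>k. Ck_on k S F)"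

text \<open>Holomorphy in several variables: the real Frechet derivative is complex linear
  (Cauchy-Riemann equations).\<close>

definition holo_map_on :: "(complex^'m) set \<Rightarrow> (complex^'m \<Rightarrow> complex^'k) \<Rightarrow> bool" where
  "holo_map_on S F \<longleftrightarrow> smooth_on S F \<and>
     (\<forall>z\<in>S. \<forall>c v. frechet_derivative F (at z) (c *s v) = c *s frechet_derivative F (at z) v)"

definition pderiv_at :: "'n::finite \<Rightarrow> (real^'n \<Rightarrow> real) \<Rightarrow> real^'n \<Rightarrow> real" where
  "pderiv_at j F y = frechet_derivative F (at y) (axis j 1)"

text \<open>Wirtinger derivatives, with \<open>z\<^sup>a = x\<^sup>a + \<i> y\<^sup>a\<close>.\<close>

definition dz :: "'m::finite \<Rightarrow> (complex^'m \<Rightarrow> complex) \<Rightarrow> complex^'m \<Rightarrow> complex" where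
  "dz a F z = (frechet_derivative F (at z) (axis a 1)
     - \<i> * frechet_derivative F (at z) (axis a \<i>)) / 2"

definition dzbar :: "'m::finite \<Rightarrow> (complex^'m \<Rightarrow> complex) \<Rightarrow> complex^'m \<Rightarrow> complex" where
  "dzbar a F z = (frechet_derivative F (at z) (axis a 1)
     + \<i> * frechet_derivative F (at z) (axis a \<i>)) / 2"


section \<open>Manifolds, given by an atlas on a Hausdorff second countable type\<close>

type_synonym ('a, 'e) chart = "'a set \<times> ('a \<Rightarrow> 'e)"

abbreviation (input) cdom :: "('a, 'e) chart \<Rightarrow> 'a set" where "cdom c \<equiv> fst c"
abbreviation (input) crd :: "('a, 'e) chart \<Rightarrow> 'a \<Rightarrow> 'e" where "crd c \<equiv> snd c"

definition img :: "('a, 'e) chart \<Rightarrow> 'e set" where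
  "img c = crd c ` cdom c"

definition param :: "('a, 'e) chart \<Rightarrow> 'e \<Rightarrow> 'a" where
  "param c = inv_into (cdom c) (crd c)"

definition is_chart :: "('a::topological_space, 'e::topological_space) chart \<Rightarrow> bool" where
  "is_chart c \<longleftrightarrow> open (cdom c) \<and> open (img c) \<and> homeomorphism (cdom c) (img c) (crd c) (param c)"

definition overlap :: "('a, 'e) chart \<Rightarrow> ('a, 'e) chart \<Rightarrow> 'e set" where
  "overlap c c' = crd c ` (cdom c \<inter> cdom c')"

definition transition :: "('a, 'e) chart \<Rightarrow> ('a, 'e) chart \<Rightarrow> 'e \<Rightarrow> 'e" where
  "transition c c' = crd c' \<circ> param c"

definition smooth_manifold ::
  "('a::{t2_space,second_countable_topology}, real^'n) chart set \<Rightarrow> bool" where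
  "smooth_manifold B \<longleftrightarrow> connected (UNIV :: 'a set) \<and>
     (\<forall>c\<in>B. is_chart c) \<and> (\<Union>c\<in>B. cdom c) = UNIV \<and>
     (\<forall>c\<in>B. \<forall>c'\<in>B. smooth_on (overlap c c') (transition c c'))"

definition complex_manifold ::
  "('a::{t2_space,second_countable_topology}, complex^'m) chart set \<Rightarrow> bool" where
  "complex_manifold A \<longleftrightarrow> connected (UNIV :: 'a set) \<and>
     (\<forall>c\<in>A. is_chart c) \<and> (\<Union>c\<in>A. cdom c) = UNIV \<and>
     (\<forall>c\<in>A. \<forall>c'\<in>A. holo_map_on (overlap c c') (transition c c'))"

definition local_dom ::
  "('a, 'e) chart \<Rightarrow> ('b, 'd) chart \<Rightarrow> ('a \<Rightarrow> 'b) \<Rightarrow> 'e set" where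
  "local_dom c d f = crd c ` (cdom c \<inter> f -` cdom d)"

definition local_rep ::
  "('a, 'e) chart \<Rightarrow> ('b, 'd) chart \<Rightarrow> ('a \<Rightarrow> 'b) \<Rightarrow> 'e \<Rightarrow> 'd" where
  "local_rep c d f = crd d \<circ> f \<circ> param c"

definition smooth_map ::
  "('a::topological_space, 'e::real_normed_vector) chart set
   \<Rightarrow> ('b::topological_space, 'd::real_normed_vector) chart set \<Rightarrow> ('a \<Rightarrow> 'b) \<Rightarrow> bool" where
  "smooth_map A B f \<longleftrightarrow> continuous_on UNIV f \<and>
     (\<forall>c\<in>A. \<forall>d\<in>B. smooth_on (local_dom c d f) (local_rep c d f))"


section \<open>Riemannian metrics and complex sectional curvature\<close>

text \<open>A metric is the family of its coefficient matrices \<open>g c y\<close> in the charts \<open>c\<close>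
  of the atlas, as functions of the coordinates \<open>y\<close>; tensoriality is the invariance of the bilinear
  form under the differentials of the coordinate changes.\<close>

type_synonym ('b, 'n) real_metric = "('b, real^'n) chart \<Rightarrow> real^'n \<Rightarrow> real^'n^'n"

definition riemannian_metric :: "('b, real^'n) chart set \<Rightarrow> ('b, 'n::finite) real_metric \<Rightarrow> bool" where
  "riemannian_metric B g \<longleftrightarrow>
     (\<forall>c\<in>B. smooth_on (img c) (g c)) \<and>
     (\<forall>c\<in>B. \<forall>y\<in>img c. transpose (g c y) = g c y \<and> (\<forall>v. v \<noteq> 0 \<longrightarrow> 0 < v \<bullet> (g c y *v v))) \<and>
     (\<forall>c\<in>B. \<forall>c'\<in>B. \<forall>y\<in>overlap c c'. \<forall>u v.
        u \<bullet> (g c y *v v) =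
        (let D = frechet_derivative (transition c c') (at y)
         in D u \<bullet> (g c' (transition c c' y) *v D v)))"

definition christoffel :: "(real^'n \<Rightarrow> real^'n^'n) \<Rightarrow> real^'n \<Rightarrow> 'n::finite \<Rightarrow> 'n \<Rightarrow> 'n \<Rightarrow> real" where
  "christoffel G y i j k = (\<Sum>l\<in>UNIV. matrix_inv (G y) $ i $ l *
     (pderiv_at j (\<lambda>x. G x $ k $ l) y + pderiv_at k (\<lambda>x. G x $ j $ l) y
       - pderiv_at l (\<lambda>x. G x $ j $ k) y)) / 2"

text \<open>The Levi-Civita connection, the Lie bracket and the curvature operator, applied to vector
  fields on a coordinate domain.\<close>

definition nabla ::
  "(real^'n \<Rightarrow> real^'n^'n) \<Rightarrow> (real^'n \<Rightarrow> real^'n) \<Rightarrow> (real^'n \<Rightarrow> real^'n) \<Rightarrow> real^'n \<Rightarrow> real^'n" where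
  "nabla G X Y y = frechet_derivative Y (at y) (X y) +
     (\<chi> i. \<Sum>j\<in>UNIV. \<Sum>k\<in>UNIV. christoffel G y i j k * X y $ j * Y y $ k)"

definition lie_bracket ::
  "(real^'n \<Rightarrow> real^'n) \<Rightarrow> (real^'n \<Rightarrow> real^'n) \<Rightarrow> real^'n \<Rightarrow> real^'n" where
  "lie_bracket X Y y = frechet_derivative Y (at y) (X y) - frechet_derivative X (at y) (Y y)"

definition curv_op ::
  "(real^'n \<Rightarrow> real^'n^'n) \<Rightarrow> (real^'n \<Rightarrow> real^'n) \<Rightarrow> (real^'n \<Rightarrow> real^'n) \<Rightarrow> (real^'n \<Rightarrow> real^'n)
   \<Rightarrow> real^'n \<Rightarrow> real^'n" where
  "curv_op G X Y Z y = nabla G X (nabla G Y Z) y - nabla G Y (nabla G X Z) y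
     - nabla G (lie_bracket X Y) Z y"

text \<open>The component \<open>R(\<partial>\<^sub>i, \<partial>\<^sub>j, \<partial>\<^sub>k, \<partial>\<^sub>l) = g(R(\<partial>\<^sub>i, \<partial>\<^sub>j)\<partial>\<^sub>k, \<partial>\<^sub>l)\<close>.\<close>

definition riem :: "(real^'n \<Rightarrow> real^'n^'n) \<Rightarrow> real^'n \<Rightarrow> 'n::finite \<Rightarrow> 'n \<Rightarrow> 'n \<Rightarrow> 'n \<Rightarrow> real" where
  "riem G y i j k l =
     curv_op G (\<lambda>_. axis i 1) (\<lambda>_. axis j 1) (\<lambda>_. axis k 1) y \<bullet> (G y *v axis l 1)"

text \<open>Complex multilinear extension to the complexified tangent space.\<close>

definition riem_cplx ::
  "(real^'n \<Rightarrow> real^'n^'n) \<Rightarrow> real^'n \<Rightarrow> complex^'n \<Rightarrow> complex^'n \<Rightarrow> complex^'n \<Rightarrow> complex^'n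
   \<Rightarrow> complex" where
  "riem_cplx G y Z1 Z2 Z3 Z4 =
     (\<Sum>i\<in>UNIV. \<Sum>j\<in>UNIV. \<Sum>k\<in>UNIV. \<Sum>l\<in>UNIV.
        of_real (riem G y i j k l) * Z1 $ i * Z2 $ j * Z3 $ k * Z4 $ l)"

definition vcnj :: "complex^'n \<Rightarrow> complex^'n" where
  "vcnj Z = (\<chi> i. cnj (Z $ i))"

text \<open>The quantity below is real by the symmetries of the curvature tensor, so \<open>Re\<close>
  only changes the type.\<close>

definition nonpos_complex_sectional_curvature ::
  "('b, real^'n) chart set \<Rightarrow> ('b, 'n::finite) real_metric \<Rightarrow> bool" where
  "nonpos_complex_sectional_curvature B g \<longleftrightarrow>
     (\<forall>c\<in>B. \<forall>y\<in>img c. \<forall>Z W. Re (riem_cplx (g c) y Z (vcnj W) W (vcnj Z)) \<le> 0)"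


section \<open>Hermitian metrics and RC-positivity\<close>

text \<open>\<open>h c z $ a $ b\<close> is the coefficient with holomorphic index \<open>a\<close> and antiholomorphic
  index \<open>b\<close>. A chart identifies the holomorphic tangent spaces over its domain with the coordinate
  space, and coordinate changes act by their differentials, which are complex linear.\<close>

type_synonym ('a, 'm) herm_metric = "('a, complex^'m) chart \<Rightarrow> complex^'m \<Rightarrow> complex^'m^'m"

definition herm_form :: "complex^'m^'m \<Rightarrow> complex^'m \<Rightarrow> complex^'m \<Rightarrow> complex" where
  "herm_form H u v = (\<Sum>a\<in>UNIV. \<Sum>b\<in>UNIV. H $ a $ b * u $ a * cnj (v $ b))"

definition hermitian_metric :: "('a, complex^'m) chart set \<Rightarrow> ('a, 'm::finite) herm_metric \<Rightarrow> bool" where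
  "hermitian_metric A h \<longleftrightarrow>
     (\<forall>c\<in>A. smooth_on (img c) (h c)) \<and>
     (\<forall>c\<in>A. \<forall>z\<in>img c. (\<forall>a b. h c z $ b $ a = cnj (h c z $ a $ b)) \<and>
        (\<forall>v. v \<noteq> 0 \<longrightarrow> 0 < Re (herm_form (h c z) v v))) \<and>
     (\<forall>c\<in>A. \<forall>c'\<in>A. \<forall>z\<in>overlap c c'. \<forall>u v.
        herm_form (h c z) u v =
        (let D = frechet_derivative (transition c c') (at z)
         in herm_form (h c' (transition c c' z)) (D u) (D v)))"

text \<open>The inverse coefficients are normalised by
  \<open>\<Sum>b. herm_inv H a b * H $ c $ b = (if a = c then 1 else 0)\<close>, hence the transposition.\<close>

definition herm_inv :: "complex^'m^'m \<Rightarrow> 'm::finite \<Rightarrow> 'm \<Rightarrow> complex" where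
  "herm_inv H a b = matrix_inv H $ b $ a"

definition chern_curv ::
  "(complex^'m \<Rightarrow> complex^'m^'m) \<Rightarrow> complex^'m \<Rightarrow> 'm::finite \<Rightarrow> 'm \<Rightarrow> 'm \<Rightarrow> 'm \<Rightarrow> complex" where
  "chern_curv H z a b c d =
     - dz a (dzbar b (\<lambda>w. H w $ c $ d)) z +
     (\<Sum>\<mu>\<in>UNIV. \<Sum>\<nu>\<in>UNIV. herm_inv (H z) \<mu> \<nu> *
        dz a (\<lambda>w. H w $ c $ \<nu>) z * dzbar b (\<lambda>w. H w $ \<mu> $ d) z)"

text \<open>\<open>chern_form H z u v\<close> is \<open>R(u, \<^bold>u, v, \<^bold>v)\<close>, bold letters denoting conjugates; it is real
  for a Hermitian metric.\<close>

definition chern_form :: "(complex^'m \<Rightarrow> complex^'m^'m) \<Rightarrow> complex^'m \<Rightarrow> complex^'m \<Rightarrow> complex^'m \<Rightarrow> complex" where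
  "chern_form H z u v =
     (\<Sum>a\<in>UNIV. \<Sum>b\<in>UNIV. \<Sum>c\<in>UNIV. \<Sum>d\<in>UNIV.
        chern_curv H z a b c d * u $ a * cnj (u $ b) * v $ c * cnj (v $ d))"

definition uniformly_RC_positive :: "('a, complex^'m) chart set \<Rightarrow> ('a, 'm::finite) herm_metric \<Rightarrow> bool" where
  "uniformly_RC_positive A h \<longleftrightarrow>
     (\<forall>c\<in>A. \<forall>z\<in>img c. \<exists>u. \<forall>v. v \<noteq> 0 \<longrightarrow> 0 < Re (chern_form (h c) z u v))"


section \<open>Differential forms in coordinates and the astheno-Kaehler condition\<close>

text \<open>A complex valued \<open>k\<close>-form at a point is a function of \<open>k\<close> real tangent vectors
  \<open>v 0, \<dots>, v (k - 1)\<close>; real tangent vectors are elements of \<open>complex^'m\<close>, on which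
  \<open>dz\<^sup>a v = v $ a\<close>. The degree is passed explicitly where it matters.\<close>

type_synonym 'm cform = "(nat \<Rightarrow> complex^'m) \<Rightarrow> complex"

definition wedge :: "nat \<Rightarrow> nat \<Rightarrow> 'm cform \<Rightarrow> 'm cform \<Rightarrow> 'm cform" where
  "wedge k l \<eta> \<theta> v =
     (\<Sum>p\<in>{p. p permutes {..<k + l}}.
        of_int (sign p) * \<eta> (\<lambda>i. v (p i)) * \<theta> (\<lambda>i. v (p (k + i)))) / (fact k * fact l)"

text \<open>The fundamental form \<open>\<i> \<Sum>a b. H $ a $ b dz\<^sup>a \<and> d\<^bold>z\<^sup>b\<close> and its wedge powers.\<close>

definition fund_form :: "complex^'m^'m \<Rightarrow> 'm cform" where
  "fund_form H v = \<i> * (\<Sum>a\<in>UNIV. \<Sum>b\<in>UNIV.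
     H $ a $ b * (v 0 $ a * cnj (v 1 $ b) - v 1 $ a * cnj (v 0 $ b)))"

fun fund_form_power :: "complex^'m^'m \<Rightarrow> nat \<Rightarrow> 'm cform" where
  "fund_form_power H 0 = (\<lambda>v. 1)"
| "fund_form_power H (Suc k) = wedge 2 (2 * k) (fund_form H) (fund_form_power H k)"

definition omit :: "nat \<Rightarrow> (nat \<Rightarrow> 'v) \<Rightarrow> nat \<Rightarrow> 'v" where
  "omit i v = (\<lambda>j. if j < i then v j else v (Suc j))"

text \<open>\<open>\<partial>\<eta> = \<Sum>a. dz\<^sup>a \<and> \<partial>\<eta>/\<partial>z\<^sup>a\<close> for a \<open>k\<close>-form \<open>\<eta>\<close>, where the derivative acts
  on the coefficients; similarly for the conjugate operator.\<close>

definition del :: "nat \<Rightarrow> (complex^'m \<Rightarrow> 'm::finite cform) \<Rightarrow> complex^'m \<Rightarrow> 'm cform" where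
  "del k \<eta> z v = (\<Sum>i\<le>k. (-1) ^ i * (\<Sum>a\<in>UNIV. v i $ a * dz a (\<lambda>w. \<eta> w (omit i v)) z))"

definition delbar :: "nat \<Rightarrow> (complex^'m \<Rightarrow> 'm::finite cform) \<Rightarrow> complex^'m \<Rightarrow> 'm cform" where
  "delbar k \<eta> z v = (\<Sum>i\<le>k. (-1) ^ i * (\<Sum>a\<in>UNIV. cnj (v i $ a) * dzbar a (\<lambda>w. \<eta> w (omit i v)) z))"

definition astheno_kaehler :: "('a, complex^'m) chart set \<Rightarrow> ('a, 'm::finite) herm_metric \<Rightarrow> bool" where
  "astheno_kaehler A h \<longleftrightarrow>
     (let m = CARD('m); k = 2 * (m - 2) in
      m \<le> 2 \<or>
      (\<forall>c\<in>A. \<forall>z\<in>img c. \<forall>v.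
         del (k + 1) (delbar k (\<lambda>w. fund_form_power (h c w) (m - 2))) z v = 0))"


section \<open>Hermitian harmonic maps\<close>

definition hermitian_harmonic ::
  "('a, complex^'m) chart set \<Rightarrow> ('a, 'm::finite) herm_metric
   \<Rightarrow> ('b, real^'n) chart set \<Rightarrow> ('b, 'n::finite) real_metric \<Rightarrow> ('a \<Rightarrow> 'b) \<Rightarrow> bool" where
  "hermitian_harmonic A h B g f \<longleftrightarrow>
     (\<forall>c\<in>A. \<forall>d\<in>B. \<forall>z\<in>local_dom c d f. \<forall>i.
        let F = (\<lambda>j w. complex_of_real (local_rep c d f w $ j)) in
        (\<Sum>a\<in>UNIV. \<Sum>b\<in>UNIV. herm_inv (h c z) a b *
           (dz a (dzbar b (F i)) z +
            (\<Sum>j\<in>UNIV. \<Sum>k\<in>UNIV.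
               of_real (christoffel (g d) (local_rep c d f z) i j k) *
               dzbar b (F j) z * dz a (F k) z))) = 0)"

end

theory Submission
  imports Defs
begin

text \<open>
  The \<open>(1,1)\<close>-part \<open>T\<close> of the pullback of \<open>g\<close> is a semipositive Hermitian form on \<open>M\<close>. A Bochner
  identity expresses the top degree form \<open>\<i>\<partial>\<close>-\<open>\<partial>\<close>-bar of \<open>T\<close>, wedged with \<open>\<omega>\<close> to the power \<open>m - 2\<close>, as the volume
  form times curvature terms of \<open>N\<close>, which have a sign, and \<open>|H|\<^sup>2 - |tr H|\<^sup>2\<close>, where \<open>H\<close> is the complex
  Hessian of \<open>f\<close> and \<open>tr H = 0\<close> because \<open>f\<close> is Hermitian harmonic. By the astheno-Kaehler condition the
  integral of this form vanishes. Hence \<open>H = 0\<close>, that is, \<open>f\<close> is pluriharmonic.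

  Now let \<open>\<kappa>\<close> be the maximum of \<open>T(v,v) / h\<^sub>0(v,v)\<close>, attained at a tangent vector \<open>v\<close> at \<open>q\<close>, and let \<open>u\<close>
  be an RC-positive direction at \<open>q\<close>. Extend \<open>v\<close> to a holomorphic field \<open>V\<close> whose Chern derivative with
  respect to \<open>h\<^sub>0\<close> along \<open>u\<close> vanishes at \<open>q\<close>. The Levi form of \<open>T(V,V)\<close> in direction \<open>u\<close> is nonnegative by
  pluriharmonicity and the curvature condition on \<open>N\<close>, while that of \<open>h\<^sub>0(V,V)\<close> is minus the RC-positive
  curvature term. So \<open>\<kappa> > 0\<close> would contradict the maximality of \<open>T(V,V) - \<kappa> h\<^sub>0(V,V) \<le> 0\<close> at \<open>q\<close>.
  Therefore \<open>T = 0\<close> and the derivative of \<open>f\<close> vanishes.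
\<close>

section \<open>Calculus of \<open>k\<close> times continuously differentiable maps\<close>

text \<open>No integral over M is formed. The quotient of the top degree form by the volume form is
  a scalar, \<open>Lam\<close>; \<open>Lam_frame\<close> writes it as a sum of tensorial terms over
  a unitary frame, which makes it independent of the chart and puts it in the shape to which the
  Bochner identity applies. It is integrated in single charts against the density
  \<open>norm (wt H)\<close>. This density absorbs the absolute value of the Jacobian, so
  orientations never have to be discussed.

  The astheno-Kaehler condition is used as a second order linear equation for the coefficients
  \<open>Ecoef\<close>; two integrations by parts move the derivatives from the cut off form onto
  them.

  In dimension one the form degenerates (\<open>wt\<close> carries the factor m - 1) and is
  bypassed: there the complex Hessian has a single component per target coordinate, which
  harmonicity kills.

  Uniformity of the RC-positivity matters because the maximal vector v is not under control: the
  direction u depends on q alone. The lower bound for the Levi form of T holds for every first order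
  correction of the field V, so V may be adapted to \<open>h0\<close>.\<close>

lemma frechet_derivative_cong_open:
  assumes "open S" "x \<in> S" "\<And>y. y \<in> S \<Longrightarrow> F y = G y"
  shows "frechet_derivative F (at x) = frechet_derivative G (at x)"
proof -
  have "(F has_derivative D) (at x) \<longleftrightarrow> (G has_derivative D) (at x)" for D
    using has_derivative_transform_within_open[of F D x UNIV S G]
      has_derivative_transform_within_open[of G D x UNIV S F] assms by auto
  then show ?thesis unfolding frechet_derivative_def by simp
qed

lemma differentiable_cong_open:
  assumes "open S" "x \<in> S" "\<And>y. y \<in> S \<Longrightarrow> F y = G y"
  shows "F differentiable (at x) \<longleftrightarrow> G differentiable (at x)"
proof -
  have "(F has_derivative D) (at x) \<longleftrightarrow> (G has_derivative D) (at x)" for D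
    using has_derivative_transform_within_open[of F D x UNIV S G]
      has_derivative_transform_within_open[of G D x UNIV S F] assms by auto
  then show ?thesis unfolding differentiable_def by simp
qed

lemma Ck_on_cong:
  assumes "open S" "\<And>y. y \<in> S \<Longrightarrow> F y = G y"
  shows "Ck_on k S F \<longleftrightarrow> Ck_on k S G"
  using assms(2)
proof (induction k arbitrary: F G)
  case 0
  then show ?case by (auto intro: continuous_on_cong[THEN iffD1])
next
  case (Suc k)
  have "Ck_on k S (\<lambda>x. frechet_derivative F (at x) v) = Ck_on k S (\<lambda>x. frechet_derivative G (at x) v)" for v
    by (rule Suc.IH) (use Suc.prems frechet_derivative_cong_open[OF \<open>open S\<close>] in metis)
  then show ?case using differentiable_cong_open[OF \<open>open S\<close> _ Suc.prems] by auto
qed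

lemma Ck_on_subset: "Ck_on k S F \<Longrightarrow> T \<subseteq> S \<Longrightarrow> Ck_on k T F"
  by (induction k arbitrary: F) (auto intro: continuous_on_subset)

lemma Ck_on_imp_continuous_on: "Ck_on k S F \<Longrightarrow> continuous_on S F"
  by (cases k) (auto intro: differentiable_imp_continuous_within continuous_at_imp_continuous_on)

lemma Ck_on_Suc_imp: "Ck_on (Suc k) S F \<Longrightarrow> Ck_on k S F"
proof (induction k arbitrary: F)
  case 0
  then show ?case using Ck_on_imp_continuous_on by (metis Ck_on.simps(1))
next
  case (Suc k)
  then show ?case by (metis Ck_on.simps(2))
qed

lemma Ck_on_mono: "Ck_on k S F \<Longrightarrow> j \<le> k \<Longrightarrow> Ck_on j S F"
  by (induction k) (auto simp: le_Suc_eq simp del: Ck_on.simps dest: Ck_on_Suc_imp)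

lemma Ck_on_differentiable: "Ck_on k S F \<Longrightarrow> 0 < k \<Longrightarrow> x \<in> S \<Longrightarrow> F differentiable (at x)"
  by (cases k) auto

lemma Ck_on_has_derivative:
  "Ck_on k S F \<Longrightarrow> 0 < k \<Longrightarrow> x \<in> S \<Longrightarrow> (F has_derivative frechet_derivative F (at x)) (at x)"
  using Ck_on_differentiable frechet_derivative_works by blast

lemma Ck_on_const: "Ck_on k S (\<lambda>x. c)"
proof (induction k arbitrary: c)
  case (Suc k)
  have "frechet_derivative (\<lambda>x. c) (at x) = (\<lambda>v. 0)" for x :: 'a
    by (rule frechet_derivative_const)
  then show ?case using Suc by simp
qed simp

text \<open>Used for functions that are given by different formulas near different points:
  extensions by zero, cut-offs, and the pullback form with its pointwise choice of target
  chart.\<close>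

lemma Ck_on_local:
  assumes "\<And>x. x \<in> S \<Longrightarrow> \<exists>T. open T \<and> x \<in> T \<and> Ck_on k T F"
  shows "Ck_on k S F"
  using assms
proof (induction k arbitrary: F)
  case 0
  have "continuous (at x) F" if x: "x \<in> S" for x
  proof -
    obtain T where "open T" "x \<in> T" "Ck_on 0 T F" using 0[OF x] by blast
    then show ?thesis using continuous_on_eq_continuous_at by (metis Ck_on.simps(1))
  qed
  then show ?case by (simp add: continuous_at_imp_continuous_on)
next
  case (Suc k)
  have "\<exists>T. open T \<and> x \<in> T \<and> Ck_on k T (\<lambda>x. frechet_derivative F (at x) v)" if "x \<in> S" for x v
    using Suc.prems[OF that] by auto
  then show ?case using Suc.IH Suc.prems by (metis Ck_on.simps(2))
qed

text \<open>The recursion in \<open>Ck_on\<close> speaks of the chosen derivative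
  \<open>frechet_derivative\<close>. On an open set any derivative coincides with it, so the usual
  differentiation rules can be fed in directly.\<close>

lemma Ck_on_SucI:
  assumes "open S" "\<And>x. x \<in> S \<Longrightarrow> (F has_derivative F' x) (at x)" "\<And>v. Ck_on k S (\<lambda>x. F' x v)"
  shows "Ck_on (Suc k) S F"
proof -
  have "frechet_derivative F (at x) = F' x" if "x \<in> S" for x
    using assms(2)[OF that] frechet_derivative_at by metis
  then have "Ck_on k S (\<lambda>x. frechet_derivative F (at x) v)" for v
    using Ck_on_cong[OF \<open>open S\<close>, of "\<lambda>x. frechet_derivative F (at x) v" "\<lambda>x. F' x v"] assms(3) by auto
  then show ?thesis using assms(2) by (auto simp: differentiable_def)
qed

lemma Ck_on_add:
  assumes "open S" "Ck_on k S F" "Ck_on k S G"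
  shows "Ck_on k S (\<lambda>x. F x + G x)"
  using assms(2,3)
proof (induction k arbitrary: F G)
  case 0
  then show ?case by (auto intro: continuous_on_add)
next
  case (Suc k)
  show ?case
    by (rule Ck_on_SucI[OF \<open>open S\<close>, of _ "\<lambda>x v. frechet_derivative F (at x) v + frechet_derivative G (at x) v"])
      (use Suc in \<open>auto intro!: has_derivative_add simp: frechet_derivative_works[symmetric]\<close>)
qed

lemma Ck_on_sum:
  assumes "open S" "\<And>i. i \<in> I \<Longrightarrow> Ck_on k S (F i)"
  shows "Ck_on k S (\<lambda>x. \<Sum>i\<in>I. F i x)"
  using assms(2)
  by (induction I rule: infinite_finite_induct) (auto intro: Ck_on_const Ck_on_add[OF \<open>open S\<close>])

lemma Ck_on_bilinear:
  assumes "bounded_bilinear P" "open S" "Ck_on k S F" "Ck_on k S G"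
  shows "Ck_on k S (\<lambda>x. P (F x) (G x))"
  using assms(3,4)
proof (induction k arbitrary: F G)
  case 0
  then show ?case using bounded_bilinear.continuous_on[OF assms(1)] by auto
next
  case (Suc k)
  have "Ck_on k S F" "Ck_on k S G" using Suc.prems Ck_on_Suc_imp by blast+
  then show ?case
    by (intro Ck_on_SucI[OF \<open>open S\<close>, of _
          "\<lambda>x v. P (F x) (frechet_derivative G (at x) v) + P (frechet_derivative F (at x) v) (G x)"])
      (use Suc in \<open>auto intro!: bounded_bilinear.FDERIV[OF assms(1)] Ck_on_add[OF \<open>open S\<close>]
        simp: frechet_derivative_works[symmetric]\<close>)
qed

lemmas Ck_on_mult = Ck_on_bilinear[OF bounded_bilinear_mult]
lemmas Ck_on_scaleR = Ck_on_bilinear[OF bounded_bilinear_scaleR]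
lemmas Ck_on_inner = Ck_on_bilinear[OF bounded_bilinear_inner]

lemma Ck_on_linear:
  assumes "bounded_linear L" "open S" "Ck_on k S F"
  shows "Ck_on k S (\<lambda>x. L (F x))"
  using assms(3)
proof (induction k arbitrary: F)
  case 0
  then show ?case using bounded_linear.continuous_on[OF assms(1)] by auto
next
  case (Suc k)
  then show ?case
    by (intro Ck_on_SucI[OF \<open>open S\<close>, of _ "\<lambda>x v. L (frechet_derivative F (at x) v)"])
      (auto intro!: bounded_linear.has_derivative[OF assms(1)] simp: frechet_derivative_works[symmetric])
qed

lemma Ck_on_ident: "Ck_on k S (\<lambda>x. x)"
proof (cases k)
  case (Suc n)
  have "frechet_derivative (\<lambda>x. x) (at x) = (\<lambda>v. v)" for x :: 'a
    by (rule frechet_derivative_at[symmetric]) (rule has_derivative_ident)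
  then show ?thesis by (simp add: Suc Ck_on_const)
qed simp

lemma Ck_on_uminus: "open S \<Longrightarrow> Ck_on k S F \<Longrightarrow> Ck_on k S (\<lambda>x. - F x)"
  by (rule Ck_on_linear[OF bounded_linear_minus[OF bounded_linear_ident]])

lemma Ck_on_diff: "open S \<Longrightarrow> Ck_on k S F \<Longrightarrow> Ck_on k S G \<Longrightarrow> Ck_on k S (\<lambda>x. F x - G x)"
  using Ck_on_add[of S k F "\<lambda>x. - G x"] Ck_on_uminus by auto

lemma Ck_on_prod:
  fixes F :: "'i \<Rightarrow> 'a::real_normed_vector \<Rightarrow> 'b::{real_normed_algebra,comm_ring_1}"
  assumes "open S" "\<And>i. i \<in> I \<Longrightarrow> Ck_on k S (F i)"
  shows "Ck_on k S (\<lambda>x. \<Prod>i\<in>I. F i x)"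
  using assms(2)
  by (induction I rule: infinite_finite_induct) (auto intro: Ck_on_const Ck_on_mult[OF \<open>open S\<close>])

lemma Ck_on_inverse:
  fixes F :: "'a::real_normed_vector \<Rightarrow> 'b::real_normed_field"
  assumes "open S" "Ck_on k S F" "\<And>x. x \<in> S \<Longrightarrow> F x \<noteq> 0"
  shows "Ck_on k S (\<lambda>x. inverse (F x))"
  using assms(2)
proof (induction k)
  case 0
  then show ?case using assms(3) by (auto intro: continuous_on_inverse)
next
  case (Suc k)
  then have F: "Ck_on k S (\<lambda>x. inverse (F x))" using Ck_on_Suc_imp by blast
  show ?case
    by (rule Ck_on_SucI[OF \<open>open S\<close>, of _
          "\<lambda>x v. - (inverse (F x) * frechet_derivative F (at x) v * inverse (F x))"])
     (use Suc.prems F assms(3) in \<open>auto intro!: has_derivative_inverse Ck_on_uminus Ck_on_mult assms(1)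
        simp: frechet_derivative_works[symmetric]\<close>)
qed

lemma Ck_on_divide:
  fixes F :: "'a::real_normed_vector \<Rightarrow> 'b::real_normed_field"
  assumes "open S" "Ck_on k S F" "Ck_on k S G" "\<And>x. x \<in> S \<Longrightarrow> G x \<noteq> 0"
  shows "Ck_on k S (\<lambda>x. F x / G x)"
  unfolding divide_inverse by (intro Ck_on_mult Ck_on_inverse assms)

lemma frechet_derivative_comp_apply:
  assumes "F differentiable (at x)" "G differentiable (at (F x))"
  shows "frechet_derivative (\<lambda>x. G (F x)) (at x) v
    = frechet_derivative G (at (F x)) (frechet_derivative F (at x) v)"
  using frechet_derivative_compose[OF assms] by (simp add: o_def fun_eq_iff)

text \<open>The chain rule produces \<open>frechet_derivative G\<close> in a direction that varies
  with x, whereas \<open>Ck_on\<close> only controls fixed directions. Expanding that direction in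
  the finite basis of the middle space turns the derivative into a finite sum of products, to which
  the induction hypothesis applies.\<close>

lemma Ck_on_compose:
  fixes F :: "'a::real_normed_vector \<Rightarrow> 'b::euclidean_space" and G :: "'b \<Rightarrow> 'c::real_normed_vector"
  assumes "open S" "open T" "Ck_on k S F" "Ck_on k T G" "F ` S \<subseteq> T"
  shows "Ck_on k S (\<lambda>x. G (F x))"
  using assms(3,4)
proof (induction k arbitrary: G)
  case 0
  then show ?case using assms(5) continuous_on_compose2 by (metis Ck_on.simps(1))
next
  case (Suc k)
  have F: "Ck_on k S F" using Suc.prems Ck_on_Suc_imp by blast
  have *: "frechet_derivative G (at (F x)) (frechet_derivative F (at x) v) =
     (\<Sum>b\<in>Basis. (frechet_derivative F (at x) v \<bullet> b) *\<^sub>R frechet_derivative G (at (F x)) b)"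
    if "x \<in> S" for x v
  proof -
    have "linear (frechet_derivative G (at (F x)))"
      using Suc.prems(2) assms(5) that by (intro linear_frechet_derivative) auto
    then show ?thesis
      by (subst euclidean_representation[of "frechet_derivative F (at x) v", symmetric])
         (simp add: linear_sum linear_scale del: euclidean_representation)
  qed
  show ?case
  proof (rule Ck_on_SucI[OF \<open>open S\<close>, of _ "\<lambda>x v. frechet_derivative G (at (F x)) (frechet_derivative F (at x) v)"])
    fix x assume x: "x \<in> S"
    show "((\<lambda>x. G (F x)) has_derivative (\<lambda>v. frechet_derivative G (at (F x)) (frechet_derivative F (at x) v))) (at x)"
      using has_derivative_compose[of F "frechet_derivative F (at x)" x UNIV G] Suc.prems assms(5) x
      by (auto simp: frechet_derivative_works[symmetric] image_subset_iff)
  next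
    fix v
    have "Ck_on k S (\<lambda>x. \<Sum>b\<in>Basis. (frechet_derivative F (at x) v \<bullet> b) *\<^sub>R frechet_derivative G (at (F x)) b)"
      by (intro Ck_on_sum Ck_on_scaleR Ck_on_inner Ck_on_const Suc.IH F assms(1)) (use Suc.prems in auto)
    then show "Ck_on k S (\<lambda>x. frechet_derivative G (at (F x)) (frechet_derivative F (at x) v))"
      using Ck_on_cong[OF \<open>open S\<close>, OF *] by simp
  qed
qed

lemma Ck_on_vec_nth: "open S \<Longrightarrow> Ck_on k S F \<Longrightarrow> Ck_on k S (\<lambda>x. F x $ i)"
  by (rule Ck_on_linear[OF bounded_linear_vec_nth])

lemma Ck_on_of_real:
  "open S \<Longrightarrow> Ck_on k S F \<Longrightarrow> Ck_on k S (\<lambda>x. of_real (F x) :: 'b::{real_normed_algebra_1})"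
  by (rule Ck_on_linear[OF bounded_linear_of_real])

lemma Ck_on_Re: "open S \<Longrightarrow> Ck_on k S F \<Longrightarrow> Ck_on k S (\<lambda>x. Re (F x))"
  by (rule Ck_on_linear[OF bounded_linear_Re])

lemma Ck_on_cnj: "open S \<Longrightarrow> Ck_on k S F \<Longrightarrow> Ck_on k S (\<lambda>x. cnj (F x))"
  by (rule Ck_on_linear[OF bounded_linear_cnj])

lemma Ck_on_det:
  fixes M :: "'a::real_normed_vector \<Rightarrow> 'b::{real_normed_field}^'n^'n"
  assumes "open S" "\<And>i j. Ck_on k S (\<lambda>x. M x $ i $ j)"
  shows "Ck_on k S (\<lambda>x. det (M x))"
  unfolding det_def by (intro Ck_on_sum Ck_on_mult Ck_on_const Ck_on_prod assms)

lemma Ck_on_frechet: "Ck_on (Suc k) S F \<Longrightarrow> Ck_on k S (\<lambda>x. frechet_derivative F (at x) v)"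
  by simp

text \<open>Two applications of the mean value theorem: first to the increment in direction v as a
  function of the step along u, then to \<open>?D\<close> along v. The left side is symmetric in u
  and v, which yields Schwarz's theorem; with opposite directions it is the second difference used
  at a maximum.\<close>

lemma second_difference_mvt:
  fixes F :: "'a::real_normed_vector \<Rightarrow> real"
  assumes C: "Ck_on 2 (ball x r) F" and h: "0 < h" "h * (norm u + norm v) < r"
  shows "\<exists>y. norm (y - x) \<le> h * (norm u + norm v) \<and>
     F (x + h *\<^sub>R u + h *\<^sub>R v) - F (x + h *\<^sub>R u) - F (x + h *\<^sub>R v) + F x
     = h * h * frechet_derivative (\<lambda>z. frechet_derivative F (at z) u) (at y) v"
proof -
  have in_ball: "x + s *\<^sub>R u + t *\<^sub>R v \<in> ball x r"
     "norm ((x + s *\<^sub>R u + t *\<^sub>R v) - x) \<le> h * (norm u + norm v)"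
     if "0 \<le> s" "s \<le> h" "0 \<le> t" "t \<le> h" for s t
  proof -
    have "norm (s *\<^sub>R u + t *\<^sub>R v) \<le> s * norm u + t * norm v"
      using norm_triangle_ineq[of "s *\<^sub>R u" "t *\<^sub>R v"] that by simp
    also have "\<dots> \<le> h * norm u + h * norm v"
      using that by (intro add_mono mult_right_mono) auto
    finally have *: "norm (s *\<^sub>R u + t *\<^sub>R v) \<le> h * (norm u + norm v)" by (simp add: algebra_simps)
    then show "norm ((x + s *\<^sub>R u + t *\<^sub>R v) - x) \<le> h * (norm u + norm v)" by (simp add: add.assoc)
    then show "x + s *\<^sub>R u + t *\<^sub>R v \<in> ball x r"
      using h by (simp only: mem_ball dist_norm norm_minus_commute[of x])
  qed
  let ?D = "\<lambda>z. frechet_derivative F (at z) u"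
  have C1: "Ck_on 1 (ball x r) F" and CD: "Ck_on 1 (ball x r) ?D"
    using C Ck_on_mono[OF C, of 1] by (auto simp: numeral_2_eq_2)
  define \<psi> where "\<psi> s = F (x + s *\<^sub>R u + h *\<^sub>R v) - F (x + s *\<^sub>R u)" for s
  have d1: "((\<lambda>s. F (x + s *\<^sub>R u + t *\<^sub>R v)) has_real_derivative ?D (x + s *\<^sub>R u + t *\<^sub>R v)) (at s)"
    if "0 \<le> s" "s \<le> h" "0 \<le> t" "t \<le> h" for s t
  proof -
    let ?z = "x + s *\<^sub>R u + t *\<^sub>R v"
    have "((\<lambda>s. F (x + s *\<^sub>R u + t *\<^sub>R v)) has_derivative (\<lambda>k. frechet_derivative F (at ?z) (k *\<^sub>R u))) (at s)"
      by (rule has_derivative_compose[where g=F])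
        (use C1 in_ball that in \<open>auto intro!: derivative_eq_intros simp: frechet_derivative_works[symmetric]\<close>)
    moreover have "linear (frechet_derivative F (at ?z))"
      using C1 in_ball that by (intro linear_frechet_derivative) auto
    ultimately have "((\<lambda>s. F (x + s *\<^sub>R u + t *\<^sub>R v)) has_derivative (\<lambda>k. k * frechet_derivative F (at ?z) u)) (at s)"
      by (simp add: linear_scale)
    then show ?thesis unfolding has_field_derivative_def by (simp only: mult_commute_abs)
  qed
  have d2: "((\<lambda>t. ?D (x + s *\<^sub>R u + t *\<^sub>R v)) has_real_derivative
       frechet_derivative ?D (at (x + s *\<^sub>R u + t *\<^sub>R v)) v) (at t)"
    if "0 \<le> s" "s \<le> h" "0 \<le> t" "t \<le> h" for s t
  proof -
    let ?z = "x + s *\<^sub>R u + t *\<^sub>R v"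
    have "((\<lambda>t. ?D (x + s *\<^sub>R u + t *\<^sub>R v)) has_derivative (\<lambda>k. frechet_derivative ?D (at ?z) (k *\<^sub>R v))) (at t)"
      by (rule has_derivative_compose[where g="?D"])
        (use CD in_ball that in \<open>auto intro!: derivative_eq_intros simp: frechet_derivative_works[symmetric]\<close>)
    moreover have "linear (frechet_derivative ?D (at ?z))"
      using CD in_ball that by (intro linear_frechet_derivative) auto
    ultimately have "((\<lambda>t. ?D (x + s *\<^sub>R u + t *\<^sub>R v)) has_derivative (\<lambda>k. k * frechet_derivative ?D (at ?z) v)) (at t)"
      by (simp add: linear_scale)
    then show ?thesis unfolding has_field_derivative_def by (simp only: mult_commute_abs)
  qed
  have "(\<psi> has_real_derivative ?D (x + s *\<^sub>R u + h *\<^sub>R v) - ?D (x + s *\<^sub>R u)) (at s)"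
    if "0 \<le> s" "s \<le> h" for s
    unfolding \<psi>_def using d1[of s h] d1[of s 0] that h(1) by (auto intro!: derivative_eq_intros)
  then obtain s where s: "0 < s" "s < h" "\<psi> h - \<psi> 0 = (h - 0) * (?D (x + s *\<^sub>R u + h *\<^sub>R v) - ?D (x + s *\<^sub>R u))"
    using MVT2[of 0 h \<psi> "\<lambda>s. ?D (x + s *\<^sub>R u + h *\<^sub>R v) - ?D (x + s *\<^sub>R u)"] h(1) by blast
  obtain t where t: "0 < t" "t < h"
    "?D (x + s *\<^sub>R u + h *\<^sub>R v) - ?D (x + s *\<^sub>R u + 0 *\<^sub>R v) = (h - 0) * frechet_derivative ?D (at (x + s *\<^sub>R u + t *\<^sub>R v)) v"
    using MVT2[of 0 h "\<lambda>t. ?D (x + s *\<^sub>R u + t *\<^sub>R v)"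
        "\<lambda>t. frechet_derivative ?D (at (x + s *\<^sub>R u + t *\<^sub>R v)) v", OF h(1) d2] s by auto
  have "F (x + h *\<^sub>R u + h *\<^sub>R v) - F (x + h *\<^sub>R u) - F (x + h *\<^sub>R v) + F x = \<psi> h - \<psi> 0"
    by (simp add: \<psi>_def)
  also have "\<dots> = h * h * frechet_derivative ?D (at (x + s *\<^sub>R u + t *\<^sub>R v)) v"
    using s t by simp
  finally show ?thesis using in_ball(2)[of s t] s(1,2) t(1,2)
    by (intro exI[of _ "x + s *\<^sub>R u + t *\<^sub>R v"]) simp
qed

text \<open>Schwarz's theorem: both orders of differentiation are limits of the same second
  difference divided by the square of the step.\<close>

lemma frechet_derivative_commute_real:
  fixes F :: "'a::real_normed_vector \<Rightarrow> real"
  assumes "open S" "Ck_on 2 S F" "x \<in> S"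
  shows "frechet_derivative (\<lambda>z. frechet_derivative F (at z) u) (at x) v
       = frechet_derivative (\<lambda>z. frechet_derivative F (at z) v) (at x) u"
proof -
  obtain r where r: "r > 0" "ball x r \<subseteq> S" using assms openE by blast
  have C: "Ck_on 2 (ball x r) F" using Ck_on_subset assms r by blast
  define A where "A = (\<lambda>y. frechet_derivative (\<lambda>z. frechet_derivative F (at z) u) (at y) v)"
  define B where "B = (\<lambda>y. frechet_derivative (\<lambda>z. frechet_derivative F (at z) v) (at y) u)"
  have "continuous_on (ball x r) A" "continuous_on (ball x r) B"
    using C unfolding A_def B_def by (auto simp: numeral_2_eq_2)
  then have iA: "isCont A x" and iB: "isCont B x"
    using r(1) by (auto simp: continuous_on_eq_continuous_at)
  \<comment> \<open>The summand 1 keeps \<open>N\<close> positive when both directions vanish; the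
    steps \<open>h n\<close> then stay small enough for the mean value formula in the ball.\<close>
  define N where "N = norm u + norm v + 1"
  have N: "N > 0" by (simp add: N_def add_nonneg_pos)
  define h where "h n = r / N / real (n + 2)" for n
  have h: "0 < h n" "h n * (norm u + norm v) < r" "h n * (norm v + norm u) < r" for n
  proof -
    show "0 < h n" using r N by (simp add: h_def)
    have "h n * (norm u + norm v) \<le> h n * N" using \<open>0 < h n\<close> by (simp add: N_def)
    also have "\<dots> = r / real (n + 2)" using N by (simp add: h_def)
    also have "\<dots> < r" using r by (simp add: divide_less_eq)
    finally show "h n * (norm u + norm v) < r" "h n * (norm v + norm u) < r" by (auto simp: add.commute)
  qed
  have "\<exists>y. norm (y - x) \<le> h n * (norm u + norm v) \<and>
     F (x + h n *\<^sub>R u + h n *\<^sub>R v) - F (x + h n *\<^sub>R u) - F (x + h n *\<^sub>R v) + F x = h n * h n * A y" for n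
    using second_difference_mvt[OF C h(1) h(2)] unfolding A_def .
  then obtain a where a: "\<And>n. norm (a n - x) \<le> h n * (norm u + norm v)"
    "\<And>n. F (x + h n *\<^sub>R u + h n *\<^sub>R v) - F (x + h n *\<^sub>R u) - F (x + h n *\<^sub>R v) + F x = h n * h n * A (a n)"
    by metis
  have "\<exists>y. norm (y - x) \<le> h n * (norm v + norm u) \<and>
     F (x + h n *\<^sub>R v + h n *\<^sub>R u) - F (x + h n *\<^sub>R v) - F (x + h n *\<^sub>R u) + F x = h n * h n * B y" for n
    using second_difference_mvt[OF C h(1) h(3)] unfolding B_def .
  then obtain b where b: "\<And>n. norm (b n - x) \<le> h n * (norm v + norm u)"
    "\<And>n. F (x + h n *\<^sub>R v + h n *\<^sub>R u) - F (x + h n *\<^sub>R v) - F (x + h n *\<^sub>R u) + F x = h n * h n * B (b n)"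
    by metis
  have AB: "A (a n) = B (b n)" for n
  proof -
    have "h n * h n * A (a n) = h n * h n * B (b n)"
      unfolding a(2)[symmetric] b(2)[symmetric] by (simp add: add.commute add.left_commute)
    then show ?thesis using h(1)[of n] by simp
  qed
  have h0: "h \<longlonglongrightarrow> 0" unfolding h_def
    by (intro real_tendsto_divide_at_top[OF tendsto_const] filterlim_compose[OF filterlim_real_sequentially] filterlim_add_const_nat_at_top)
  have "(\<lambda>n. a n - x) \<longlonglongrightarrow> 0"
    by (rule Lim_null_comparison[OF always_eventually tendsto_mult_left_zero[OF h0]]) (use a(1) in auto)
  then have "a \<longlonglongrightarrow> x" by (simp add: LIM_zero_iff)
  then have 1: "(\<lambda>n. A (a n)) \<longlonglongrightarrow> A x" using iA isCont_tendsto_compose by blast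
  have "(\<lambda>n. b n - x) \<longlonglongrightarrow> 0"
    by (rule Lim_null_comparison[OF always_eventually tendsto_mult_left_zero[OF h0]]) (use b(1) in auto)
  then have "b \<longlonglongrightarrow> x" by (simp add: LIM_zero_iff)
  then have "(\<lambda>n. B (b n)) \<longlonglongrightarrow> B x" using iB isCont_tendsto_compose by blast
  then have "A x = B x" using 1 AB LIMSEQ_unique by auto
  then show ?thesis by (simp add: A_def B_def)
qed

lemma frechet_derivative_linear_compose:
  assumes "bounded_linear L" "F differentiable (at x)"
  shows "frechet_derivative (\<lambda>x. L (F x)) (at x) v = L (frechet_derivative F (at x) v)"
proof -
  have "((\<lambda>x. L (F x)) has_derivative (\<lambda>v. L (frechet_derivative F (at x) v))) (at x)"
    using assms bounded_linear.has_derivative frechet_derivative_works by blast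
  then show ?thesis using frechet_derivative_at by metis
qed

lemma frechet_derivative_commute:
  fixes F :: "'a::real_normed_vector \<Rightarrow> 'b::euclidean_space"
  assumes "open S" "Ck_on 2 S F" "x \<in> S"
  shows "frechet_derivative (\<lambda>z. frechet_derivative F (at z) u) (at x) v
       = frechet_derivative (\<lambda>z. frechet_derivative F (at z) v) (at x) u"
proof (rule euclidean_eqI)
  fix b :: 'b assume "b \<in> Basis"
  have L: "bounded_linear (\<lambda>y :: 'b. y \<bullet> b)" by (rule bounded_linear_inner_left)
  have d: "F differentiable at z" if "z \<in> S" for z
    using assms(2) that by (auto simp: numeral_2_eq_2)
  have *: "frechet_derivative (\<lambda>z. frechet_derivative F (at z) u) (at x) v \<bullet> b =
     frechet_derivative (\<lambda>z. frechet_derivative (\<lambda>y. F y \<bullet> b) (at z) u) (at x) v" for u v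
  proof -
    have "frechet_derivative (\<lambda>z. frechet_derivative F (at z) u) (at x) v \<bullet> b =
       frechet_derivative (\<lambda>z. frechet_derivative F (at z) u \<bullet> b) (at x) v"
      by (rule frechet_derivative_linear_compose[OF L, symmetric]) (use assms in \<open>auto simp: numeral_2_eq_2\<close>)
    also have "\<dots> = frechet_derivative (\<lambda>z. frechet_derivative (\<lambda>y. F y \<bullet> b) (at z) u) (at x) v"
      using frechet_derivative_cong_open[OF assms(1,3), of "\<lambda>z. frechet_derivative F (at z) u \<bullet> b"
        "\<lambda>z. frechet_derivative (\<lambda>y. F y \<bullet> b) (at z) u"] frechet_derivative_linear_compose[OF L d] by simp
    finally show ?thesis .
  qed
  show "frechet_derivative (\<lambda>z. frechet_derivative F (at z) u) (at x) v \<bullet> b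
     = frechet_derivative (\<lambda>z. frechet_derivative F (at z) v) (at x) u \<bullet> b"
    unfolding * by (rule frechet_derivative_commute_real[OF assms(1) Ck_on_linear[OF L assms(1,2)] assms(3)])
qed

section \<open>Complex directional derivatives\<close>

text \<open>\<open>cd (a, b)\<close> is the derivative along the complexified vector \<open>a + \<i> b\<close>; \<open>dir10 u\<close> and \<open>dir01 u\<close>
  are the parts of type \<open>(1,0)\<close> and \<open>(0,1)\<close> of the real vector \<open>u\<close>.\<close>

definition cd :: "'a \<times> 'a \<Rightarrow> ('a::real_normed_vector \<Rightarrow> complex) \<Rightarrow> 'a \<Rightarrow> complex" where
  "cd p F z = frechet_derivative F (at z) (fst p) + \<i> * frechet_derivative F (at z) (snd p)"

definition dir10 :: "complex^'m \<Rightarrow> (complex^'m) \<times> (complex^'m)" where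
  "dir10 u = ((1/2) *\<^sub>R u, - ((1/2) *\<^sub>R (\<i> *s u)))"

definition dir01 :: "complex^'m \<Rightarrow> (complex^'m) \<times> (complex^'m)" where
  "dir01 u = ((1/2) *\<^sub>R u, (1/2) *\<^sub>R (\<i> *s u))"

abbreviation "dl u \<equiv> cd (dir10 u)"
abbreviation "db u \<equiv> cd (dir01 u)"

lemma frechet_derivative_eqI: "(F has_derivative D) (at x) \<Longrightarrow> frechet_derivative F (at x) = D"
  using frechet_derivative_at by metis

lemma has_derivative_frechetI: "F differentiable (at x) \<Longrightarrow> (F has_derivative frechet_derivative F (at x)) (at x)"
  using frechet_derivative_works by blast

lemma cd_cong_open:
  assumes "open S" "x \<in> S" "\<And>y. y \<in> S \<Longrightarrow> F y = G y"
  shows "cd p F x = cd p G x"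
  using frechet_derivative_cong_open[OF assms] by (simp add: cd_def)

lemma cd_const [simp]: "cd p (\<lambda>_. c) z = 0"
  by (simp add: cd_def frechet_derivative_const)

lemma cd_add:
  "F differentiable (at z) \<Longrightarrow> G differentiable (at z) \<Longrightarrow> cd p (\<lambda>z. F z + G z) z = cd p F z + cd p G z"
  unfolding cd_def
  by (simp add: frechet_derivative_eqI[OF has_derivative_add[OF has_derivative_frechetI has_derivative_frechetI]]
      algebra_simps)

lemma cd_diff:
  "F differentiable (at z) \<Longrightarrow> G differentiable (at z) \<Longrightarrow> cd p (\<lambda>z. F z - G z) z = cd p F z - cd p G z"
  unfolding cd_def
  by (simp add: frechet_derivative_eqI[OF has_derivative_diff[OF has_derivative_frechetI has_derivative_frechetI]]
      algebra_simps)

lemma cd_mult: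
  "F differentiable (at z) \<Longrightarrow> G differentiable (at z) \<Longrightarrow>
    cd p (\<lambda>z. F z * G z) z = cd p F z * G z + F z * cd p G z"
  unfolding cd_def
  by (simp add: frechet_derivative_eqI[OF has_derivative_mult[OF has_derivative_frechetI has_derivative_frechetI]]
      algebra_simps)

lemma cd_cmult: "F differentiable (at z) \<Longrightarrow> cd p (\<lambda>z. c * F z) z = c * cd p F z"
  using cd_mult[of "\<lambda>_. c" z F p] by simp

lemma cd_sum:
  "(\<And>i. i \<in> I \<Longrightarrow> F i differentiable (at z)) \<Longrightarrow> cd p (\<lambda>z. \<Sum>i\<in>I. F i z) z = (\<Sum>i\<in>I. cd p (F i) z)"
  by (induction I rule: infinite_finite_induct) (auto simp: cd_add)

lemma Ck_on_cd:
  fixes F :: "'a::real_normed_vector \<Rightarrow> complex"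
  shows "open S \<Longrightarrow> Ck_on (Suc k) S F \<Longrightarrow> Ck_on k S (cd p F)"
  unfolding cd_def by (intro Ck_on_add Ck_on_mult Ck_on_const) auto

lemma cd_commute:
  assumes "open S" "Ck_on 2 S F" "z \<in> S"
  shows "cd p (cd q F) z = cd q (cd p F) z"
proof -
  have d: "(\<lambda>z. frechet_derivative F (at z) v) differentiable (at z)" for v
    using assms(2,3) by (auto simp: numeral_2_eq_2)
  have *: "cd p (cd q F) z = cd p (\<lambda>z. frechet_derivative F (at z) (fst q)) z
     + \<i> * cd p (\<lambda>z. frechet_derivative F (at z) (snd q)) z" for p q
    unfolding cd_def[of q] by (subst cd_add) (auto simp: cd_cmult d)
  show ?thesis
    unfolding * unfolding cd_def
    using frechet_derivative_commute[OF assms(1,2,3)] by (simp add: algebra_simps)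
qed

definition cnj_dir :: "'a::real_vector \<times> 'a \<Rightarrow> 'a \<times> 'a" where
  "cnj_dir p = (fst p, - snd p)"

lemma cnj_dir_simps [simp]:
  "cnj_dir (dir10 u) = dir01 u" "cnj_dir (dir01 u) = dir10 u" "cnj_dir (cnj_dir p) = p"
  by (auto simp: cnj_dir_def dir10_def dir01_def)

lemma cd_cnj:
  assumes "F differentiable (at z)"
  shows "cd p (\<lambda>z. cnj (F z)) z = cnj (cd (cnj_dir p) F z)"
  using frechet_derivative_linear_compose[OF bounded_linear_cnj assms]
  by (auto simp: cd_def cnj_dir_def linear_neg[OF linear_frechet_derivative[OF assms]])

lemma differentiable_of_real:
  "F differentiable (at z) \<Longrightarrow> (\<lambda>z. complex_of_real (F z)) differentiable (at z)"
  using bounded_linear.has_derivative[OF bounded_linear_of_real] unfolding differentiable_def by blast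

lemma differentiable_cnj: "F differentiable (at z) \<Longrightarrow> (\<lambda>z. cnj (F z)) differentiable (at z)"
  using bounded_linear.has_derivative[OF bounded_linear_cnj] unfolding differentiable_def by blast

lemma cd_of_real_cnj:
  assumes "F differentiable (at z)"
  shows "cnj (cd p (\<lambda>z. complex_of_real (F z)) z) = cd (cnj_dir p) (\<lambda>z. complex_of_real (F z)) z"
  using cd_cnj[OF differentiable_of_real[OF assms], of "cnj_dir p"] by simp

text \<open>Metric coefficients and Christoffel symbols are real functions on the target;
  complexified derivatives along the map reach them through this rule.\<close>

lemma cd_chain_real:
  fixes \<phi> :: "real^'n \<Rightarrow> real" and F :: "'a::real_normed_vector \<Rightarrow> real^'n"
  assumes "F differentiable (at z)" "\<phi> differentiable (at (F z))"
  shows "cd p (\<lambda>z. complex_of_real (\<phi> (F z))) z =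
    (\<Sum>k\<in>UNIV. complex_of_real (pderiv_at k \<phi> (F z)) * cd p (\<lambda>z. complex_of_real (F z $ k)) z)"
proof -
  have d: "(\<lambda>z. \<phi> (F z)) differentiable (at z)"
    using differentiable_chain_at[OF assms] by (simp add: o_def)
  have *: "frechet_derivative (\<lambda>z. complex_of_real (\<phi> (F z))) (at z) v =
     (\<Sum>k\<in>UNIV. complex_of_real (pderiv_at k \<phi> (F z)) * frechet_derivative (\<lambda>z. complex_of_real (F z $ k)) (at z) v)" for v
  proof -
    have "frechet_derivative (\<lambda>z. complex_of_real (\<phi> (F z))) (at z) v
       = complex_of_real (frechet_derivative \<phi> (at (F z)) (frechet_derivative F (at z) v))"
      by (simp add: frechet_derivative_linear_compose[OF bounded_linear_of_real d] frechet_derivative_comp_apply[OF assms])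
    also have "frechet_derivative \<phi> (at (F z)) (frechet_derivative F (at z) v) =
      (\<Sum>k\<in>UNIV. pderiv_at k \<phi> (F z) * frechet_derivative F (at z) v $ k)"
    proof -
      have "frechet_derivative \<phi> (at (F z)) (frechet_derivative F (at z) v) =
        frechet_derivative \<phi> (at (F z)) (\<Sum>k\<in>UNIV. (frechet_derivative F (at z) v $ k) *\<^sub>R axis k 1)"
        by (simp add: basis_expansion[of "frechet_derivative F (at z) v", unfolded scalar_mult_eq_scaleR])
      then show ?thesis
        unfolding pderiv_at_def linear_sum[OF linear_frechet_derivative[OF assms(2)]]
          linear_scale[OF linear_frechet_derivative[OF assms(2)]] by (simp add: mult.commute)
    qed
    also have "complex_of_real (\<Sum>k\<in>UNIV. pderiv_at k \<phi> (F z) * frechet_derivative F (at z) v $ k) =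
      (\<Sum>k\<in>UNIV. complex_of_real (pderiv_at k \<phi> (F z)) * frechet_derivative (\<lambda>z. complex_of_real (F z $ k)) (at z) v)"
    proof -
      have "bounded_linear (\<lambda>v. complex_of_real (v $ k))" for k :: 'n
        by (rule bounded_linear_compose[OF bounded_linear_of_real bounded_linear_vec_nth])
      from frechet_derivative_linear_compose[OF this assms(1)] show ?thesis by simp
    qed
    finally show ?thesis .
  qed
  show ?thesis unfolding cd_def * by (simp add: sum.distrib algebra_simps sum_distrib_left)
qed

lemma i_smult_axis: "\<i> *s axis a 1 = (axis a \<i> :: complex^'m)"
  by (vector axis_def)

lemma complex_vec_expansion:
  fixes u :: "complex^'m"
  shows "u = (\<Sum>a\<in>UNIV. Re (u $ a) *\<^sub>R axis a 1 + Im (u $ a) *\<^sub>R axis a \<i>)"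
proof (subst vec_eq_iff, intro allI)
  fix i
  have "(\<Sum>a\<in>UNIV. (Re (u $ a) *\<^sub>R axis a 1 + Im (u $ a) *\<^sub>R axis a \<i>) $ i) =
     (\<Sum>a\<in>UNIV. if a = i then u $ i else 0)"
    by (rule sum.cong) (auto simp: axis_def complex_eq_iff)
  then show "u $ i = (\<Sum>a\<in>UNIV. Re (u $ a) *\<^sub>R axis a 1 + Im (u $ a) *\<^sub>R axis a \<i>) $ i"
    by (simp add: sum_component)
qed

lemma linear_complex_vec_expansion:
  fixes L :: "complex^'m \<Rightarrow> 'b::real_vector"
  assumes "linear L"
  shows "L u = (\<Sum>a\<in>UNIV. Re (u $ a) *\<^sub>R L (axis a 1) + Im (u $ a) *\<^sub>R L (axis a \<i>))"
  by (subst complex_vec_expansion) (simp add: linear_sum[OF assms] linear_add[OF assms] linear_scale[OF assms])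

lemma dl_alt:
  assumes "F differentiable (at z)"
  shows "dl u F z = (frechet_derivative F (at z) u - \<i> * frechet_derivative F (at z) (\<i> *s u)) / 2"
proof -
  note L = linear_frechet_derivative[OF assms]
  have "dl u F z = (1/2) *\<^sub>R frechet_derivative F (at z) u - \<i> * ((1/2) *\<^sub>R frechet_derivative F (at z) (\<i> *s u))"
    unfolding cd_def dir10_def by (simp only: fst_conv snd_conv linear_scale[OF L] linear_neg[OF L] mult_minus_right) simp
  then show ?thesis by (simp add: scaleR_conv_of_real field_simps)
qed

lemma db_alt:
  assumes "F differentiable (at z)"
  shows "db u F z = (frechet_derivative F (at z) u + \<i> * frechet_derivative F (at z) (\<i> *s u)) / 2"
proof -
  note L = linear_frechet_derivative[OF assms]
  have "db u F z = (1/2) *\<^sub>R frechet_derivative F (at z) u + \<i> * ((1/2) *\<^sub>R frechet_derivative F (at z) (\<i> *s u))"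
    unfolding cd_def dir01_def by (simp only: fst_conv snd_conv linear_scale[OF L] linear_neg[OF L])
  then show ?thesis by (simp add: scaleR_conv_of_real field_simps)
qed

lemma dz_eq_dl:
  assumes "F differentiable (at z)" shows "dz a F z = dl (axis a 1) F z"
  unfolding dz_def dl_alt[OF assms] i_smult_axis ..

lemma dzbar_eq_db:
  assumes "F differentiable (at z)" shows "dzbar a F z = db (axis a 1) F z"
  unfolding dzbar_def db_alt[OF assms] i_smult_axis ..

text \<open>F is merely real differentiable: the (1,0)-part of a real vector depends complex
  linearly on the vector, although the real derivative itself need not.\<close>

lemma dl_expansion:
  assumes "F differentiable (at z)"
  shows "dl u F z = (\<Sum>a\<in>UNIV. u $ a * dl (axis a 1) F z)"
proof -
  note L = linear_frechet_derivative[OF assms]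
  show ?thesis
    unfolding dl_alt[OF assms] i_smult_axis
    by (subst (1 2) linear_complex_vec_expansion[OF L])
       (simp add: sum_distrib_left sum_subtractf[symmetric] sum_divide_distrib,
        rule sum.cong, auto simp: complex_eq_iff algebra_simps diff_divide_distrib add_divide_distrib)
qed

lemma db_expansion:
  assumes "F differentiable (at z)"
  shows "db u F z = (\<Sum>a\<in>UNIV. cnj (u $ a) * db (axis a 1) F z)"
proof -
  have "db u F z = cnj (dl u (\<lambda>z. cnj (F z)) z)"
    using cd_cnj[OF differentiable_cnj[OF assms], of "dir01 u"] by simp
  also have "\<dots> = (\<Sum>a\<in>UNIV. cnj (u $ a) * cnj (dl (axis a 1) (\<lambda>z. cnj (F z)) z))"
    by (subst dl_expansion) (auto simp: assms differentiable_cnj)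
  also have "\<dots> = (\<Sum>a\<in>UNIV. cnj (u $ a) * db (axis a 1) F z)"
    using cd_cnj[OF differentiable_cnj[OF assms], of "dir01 _"] by simp
  finally show ?thesis .
qed

lemma dl_add_db:
  assumes "F differentiable (at z)"
  shows "dl u F z + db u F z = frechet_derivative F (at z) u"
  unfolding dl_alt[OF assms] db_alt[OF assms] by (simp add: field_simps)

section \<open>The Levi-Civita connection in coordinates\<close>

lemma sum_rot3: "(\<Sum>i\<in>A. \<Sum>j\<in>B. \<Sum>k\<in>C. f i j k) = (\<Sum>k\<in>C. \<Sum>i\<in>A. \<Sum>j\<in>B. f i j k)"
  by (subst sum.swap[of _ C B]) (rule sum.swap)

lemma sum_rot4: "(\<Sum>i\<in>A. \<Sum>j\<in>B. \<Sum>k\<in>C. \<Sum>l\<in>D. f i j k l) = (\<Sum>l\<in>D. \<Sum>i\<in>A. \<Sum>j\<in>B. \<Sum>k\<in>C. f i j k l)"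
  by (subst sum_rot3) (rule sum.swap)

lemma matrix_inv_right:
  fixes M :: "'a::field^'n^'n"
  assumes "invertible M" shows "M ** matrix_inv M = mat 1"
  using someI_ex[OF assms[unfolded invertible_def]] unfolding matrix_inv_def by blast

text \<open>Cramer's rule. It shows the entries of the inverse to be quotients of polynomials in the
  entries, hence as differentiable as the metric; \<open>Ck_christoffel\<close> rests on
  this.\<close>

lemma matrix_inv_nth:
  fixes M :: "real^'n^'n"
  assumes "det M \<noteq> 0"
  shows "matrix_inv M $ i $ l = det (\<chi> a b. if b = i then axis l 1 $ a else M $ a $ b) / det M"
proof -
  have inv: "invertible M" using assms by (simp add: invertible_det_nz)
  have "M *v (matrix_inv M *v axis l 1) = axis l 1"
    using matrix_inv_right[OF inv] by (simp add: matrix_vector_mul_assoc)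
  then have "matrix_inv M *v axis l 1 = (\<chi> k. det (\<chi> a b. if b = k then axis l 1 $ a else M $ a $ b) / det M)"
    using cramer[OF assms] by blast
  then have "(matrix_inv M *v axis l 1) $ i = det (\<chi> a b. if b = i then axis l 1 $ a else M $ a $ b) / det M"
    by simp
  then show ?thesis by (simp add: matrix_vector_mult_basis column_def)
qed

locale riemannian_coords =
  fixes V :: "(real^'n) set" and G :: "real^'n \<Rightarrow> real^'n^'n"
  assumes open_V: "open V" and smooth_G: "smooth_on V G"
    and sym_G: "y \<in> V \<Longrightarrow> transpose (G y) = G y"
    and pos_G: "y \<in> V \<Longrightarrow> v \<noteq> 0 \<Longrightarrow> 0 < v \<bullet> (G y *v v)"
begin

lemma G_sym: "y \<in> V \<Longrightarrow> G y $ i $ j = G y $ j $ i"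
  using arg_cong[OF sym_G[of y], of "\<lambda>M. M $ i $ j"] by (simp add: transpose_def)

lemma inv_G: assumes "y \<in> V" shows "invertible (G y)"
proof -
  have "v = 0" if "G y *v v = 0" for v
    using pos_G[OF assms, of v] that by (cases "v = 0") auto
  then show ?thesis using matrix_left_invertible_ker[of "G y"] invertible_left_inverse[of "G y"] by simp
qed

lemma Ck_G: "Ck_on k V (\<lambda>y. G y $ i $ j)"
  using smooth_G open_V by (auto simp: smooth_on_def intro!: Ck_on_vec_nth)

lemma Ck_pderiv_G: "Ck_on k V (pderiv_at l (\<lambda>y. G y $ i $ j))"
  unfolding pderiv_at_def[abs_def] by (rule Ck_on_frechet[OF Ck_G])

lemma pderiv_G_sym: "y \<in> V \<Longrightarrow> pderiv_at l (\<lambda>y. G y $ i $ j) y = pderiv_at l (\<lambda>y. G y $ j $ i) y"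
  unfolding pderiv_at_def using frechet_derivative_cong_open[OF open_V, of y "\<lambda>y. G y $ i $ j" "\<lambda>y. G y $ j $ i"] G_sym
  by auto

lemma Ck_christoffel: "Ck_on k V (\<lambda>y. christoffel G y i j l)"
proof -
  have "Ck_on k V (\<lambda>y. matrix_inv (G y) $ a $ b)" for a b
  proof -
    have "Ck_on k V (\<lambda>y. det (\<chi> c d. if d = a then axis b 1 $ c else G y $ c $ d) / det (G y))"
    proof (intro Ck_on_divide Ck_on_det open_V Ck_G)
      show "Ck_on k V (\<lambda>y. (\<chi> c d. if d = a then axis b 1 $ c else G y $ c $ d) $ i $ j)" for i j
        by (cases "j = a") (simp_all add: Ck_G Ck_on_const)
    qed (simp add: invertible_det_nz[symmetric] inv_G)
    then show ?thesis
      by (subst Ck_on_cong[OF open_V, of "\<lambda>y. matrix_inv (G y) $ a $ b"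
         "\<lambda>y. det (\<chi> c d. if d = a then axis b 1 $ c else G y $ c $ d) / det (G y)"])
        (use inv_G in \<open>auto intro!: matrix_inv_nth simp: invertible_det_nz\<close>)
  qed
  then show ?thesis
    unfolding christoffel_def
    by (intro Ck_on_divide Ck_on_sum Ck_on_mult Ck_on_const Ck_on_add Ck_on_diff open_V Ck_pderiv_G) auto
qed

lemma christoffel_sym: "y \<in> V \<Longrightarrow> christoffel G y i j k = christoffel G y i k j"
  unfolding christoffel_def by (simp add: pderiv_G_sym[of y _ j k] add.commute)

lemma christoffel_lowered:
  assumes "y \<in> V"
  shows "(\<Sum>i\<in>UNIV. christoffel G y i j k * G y $ i $ l) =
    (pderiv_at j (\<lambda>x. G x $ k $ l) y + pderiv_at k (\<lambda>x. G x $ j $ l) y - pderiv_at l (\<lambda>x. G x $ j $ k) y) / 2"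
proof -
  let ?c = "\<lambda>l. pderiv_at j (\<lambda>x. G x $ k $ l) y + pderiv_at k (\<lambda>x. G x $ j $ l) y - pderiv_at l (\<lambda>x. G x $ j $ k) y"
  have "(\<Sum>i\<in>UNIV. christoffel G y i j k * G y $ i $ l) =
     (\<Sum>i\<in>UNIV. \<Sum>a\<in>UNIV. G y $ l $ i * matrix_inv (G y) $ i $ a * ?c a / 2)"
    unfolding christoffel_def by (simp add: sum_distrib_left sum_divide_distrib G_sym[OF assms, of l] mult_ac)
  also have "\<dots> = (\<Sum>a\<in>UNIV. (\<Sum>i\<in>UNIV. G y $ l $ i * matrix_inv (G y) $ i $ a) * ?c a / 2)"
    by (subst sum.swap) (simp add: sum_distrib_right sum_divide_distrib)
  also have "\<dots> = (\<Sum>a\<in>UNIV. (G y ** matrix_inv (G y)) $ l $ a * ?c a / 2)"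
    by (simp add: matrix_matrix_mult_def)
  also have "\<dots> = (\<Sum>a\<in>UNIV. (if l = a then ?c a / 2 else 0))"
    unfolding matrix_inv_right[OF inv_G[OF assms]] by (intro sum.cong) (auto simp: mat_def)
  finally show ?thesis by simp
qed

text \<open>The metric is parallel: in the sum of the two lowered symbols the derivatives in the
  directions i and j cancel.\<close>

lemma metric_compatible:
  assumes "y \<in> V"
  shows "pderiv_at k (\<lambda>x. G x $ i $ j) y =
    (\<Sum>l\<in>UNIV. christoffel G y l k i * G y $ l $ j) + (\<Sum>l\<in>UNIV. christoffel G y l k j * G y $ l $ i)"
  unfolding christoffel_lowered[OF assms]
  using pderiv_G_sym[OF assms, of k i j] pderiv_G_sym[OF assms, of i j k] pderiv_G_sym[OF assms, of j i k]
  by (simp add: field_simps)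

text \<open>\<open>Rm y q a b k\<close> is the component with index \<open>q\<close> of \<open>R(\<partial>\<^sub>a, \<partial>\<^sub>b)\<partial>\<^sub>k\<close>.\<close>

definition Rm :: "real^'n \<Rightarrow> 'n \<Rightarrow> 'n \<Rightarrow> 'n \<Rightarrow> 'n \<Rightarrow> real" where
  "Rm y q a b k = pderiv_at a (\<lambda>y. christoffel G y q b k) y - pderiv_at b (\<lambda>y. christoffel G y q a k) y
     + (\<Sum>m\<in>UNIV. christoffel G y q a m * christoffel G y m b k)
     - (\<Sum>m\<in>UNIV. christoffel G y q b m * christoffel G y m a k)"

lemma axis_sum: "(\<Sum>j\<in>UNIV. f j * (axis i (1::real) $ j)) = f i"
proof -
  have "(\<Sum>j\<in>UNIV. f j * (axis i (1::real) $ j)) = (\<Sum>j\<in>UNIV. if j = i then f j else 0)"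
    by (rule sum.cong) (auto simp: axis_def)
  then show ?thesis by simp
qed

lemma nabla_axis: "nabla G (\<lambda>_. axis i 1) Y y = frechet_derivative Y (at y) (axis i 1) +
     (\<chi> q. \<Sum>k\<in>UNIV. christoffel G y q i k * Y y $ k)"
proof -
  have "(\<Sum>j\<in>UNIV. \<Sum>k\<in>UNIV. christoffel G y q j k * axis i 1 $ j * Y y $ k) =
     (\<Sum>k\<in>UNIV. christoffel G y q i k * Y y $ k)" for q
  proof -
    have "(\<Sum>j\<in>UNIV. \<Sum>k\<in>UNIV. christoffel G y q j k * axis i 1 $ j * Y y $ k) =
      (\<Sum>j\<in>UNIV. (\<Sum>k\<in>UNIV. christoffel G y q j k * Y y $ k) * axis i 1 $ j)"
      by (simp add: sum_distrib_left mult_ac)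
    then show ?thesis by (simp add: axis_sum)
  qed
  then show ?thesis by (simp add: nabla_def)
qed

text \<open>Coordinate fields have constant components, so their bracket vanishes and covariant
  derivatives reduce to Christoffel symbols and their derivatives.\<close>

lemma curv_op_axis:
  assumes "y \<in> V"
  shows "curv_op G (\<lambda>_. axis a 1) (\<lambda>_. axis b 1) (\<lambda>_. axis k 1) y $ q = Rm y q a b k"
proof -
  have n1: "nabla G (\<lambda>_. axis b 1) (\<lambda>_. axis k 1) = (\<lambda>y. \<chi> q. christoffel G y q b k)" for b k
    by (rule ext) (simp add: nabla_axis axis_sum frechet_derivative_const)
  have lb: "nabla G (lie_bracket (\<lambda>_. axis a 1) (\<lambda>_. axis b 1)) (\<lambda>_. axis k 1) y = 0"
    by (simp add: lie_bracket_def nabla_def frechet_derivative_const vec_eq_iff)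
  have d: "(\<lambda>y. \<chi> q. christoffel G y q b k) differentiable (at y)" for b k
  proof -
    have "(\<lambda>y. christoffel G y q b k) differentiable (at y)" for q
      using Ck_on_differentiable[OF Ck_christoffel[of 1] _ assms] by simp
    then show ?thesis
      by (subst differentiable_componentwise_within) (auto simp: Basis_vec_def inner_axis)
  qed
  have "frechet_derivative (\<lambda>y. \<chi> q. christoffel G y q b k) (at y) v $ q
      = frechet_derivative (\<lambda>y. christoffel G y q b k) (at y) v" for v b k
    using frechet_derivative_linear_compose[OF bounded_linear_vec_nth d, where v = v] by simp
  then show ?thesis
    unfolding curv_op_def lb n1 nabla_axis Rm_def pderiv_at_def by simp
qed

lemma riem_eq: "y \<in> V \<Longrightarrow> riem G y i j k l = (\<Sum>q\<in>UNIV. Rm y q i j k * G y $ q $ l)"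
  unfolding riem_def inner_vec_def by (simp add: curv_op_axis matrix_vector_mult_basis column_def)

lemma Rm_antisym: "Rm y q a b k = - Rm y q b a k"
  by (simp add: Rm_def)

text \<open>Torsion-freeness: by the symmetry of the Christoffel symbols in the lower indices, both
  the derivative terms and the quadratic terms of the cyclic sum cancel in pairs.\<close>

lemma Rm_bianchi:
  assumes "y \<in> V"
  shows "Rm y q a b k + Rm y q b k a + Rm y q k a b = 0"
proof -
  have s: "christoffel G y q' a b = christoffel G y q' b a" for q' a b using christoffel_sym[OF assms] .
  have p: "pderiv_at c (\<lambda>y. christoffel G y q a b) y = pderiv_at c (\<lambda>y. christoffel G y q b a) y" for a b c
    unfolding pderiv_at_def
    using frechet_derivative_cong_open[OF open_V assms, of "\<lambda>y. christoffel G y q a b" "\<lambda>y. christoffel G y q b a"]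
      christoffel_sym by auto
  show ?thesis unfolding Rm_def s[of _ b k] s[of _ k a] s[of _ a b] p[of _ b k] p[of _ k a] p[of _ a b]
    by simp
qed

end

lemma riem_cplx_diff_antisym:
  assumes "riemannian_coords V G" "y \<in> V"
  shows "riem_cplx G y X Y Z W = - riem_cplx G y Y X Z W"
proof -
  interpret riemannian_coords V G by fact
  have "riem_cplx G y X Y Z W = (\<Sum>j\<in>UNIV. \<Sum>i\<in>UNIV. \<Sum>k\<in>UNIV. \<Sum>l\<in>UNIV.
        of_real (riem G y i j k l) * X $ i * Y $ j * Z $ k * W $ l)"
    unfolding riem_cplx_def by (rule sum.swap)
  also have "\<dots> = - riem_cplx G y Y X Z W"
  proof -
    have r: "riem G y i j k l = - riem G y j i k l" for i j k l
      unfolding riem_eq[OF assms(2)] by (subst Rm_antisym) (simp add: sum_negf)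
    have "complex_of_real (riem G y i j k l) * X $ i * Y $ j * Z $ k * W $ l
      = - (complex_of_real (riem G y j i k l) * Y $ j * X $ i * Z $ k * W $ l)" for i j k l
      by (subst r) (simp add: mult_ac)
    then show ?thesis unfolding riem_cplx_def sum_negf[symmetric] by simp
  qed
  finally show ?thesis .
qed

lemma riem_cplx_bianchi:
  assumes "riemannian_coords V G" "y \<in> V"
  shows "riem_cplx G y X Y Z W + riem_cplx G y Y Z X W + riem_cplx G y Z X Y W = 0"
proof -
  interpret riemannian_coords V G by fact
  have 2: "riem_cplx G y Y Z X W = (\<Sum>i\<in>UNIV. \<Sum>j\<in>UNIV. \<Sum>k\<in>UNIV. \<Sum>l\<in>UNIV.
        of_real (riem G y j k i l) * X $ i * Y $ j * Z $ k * W $ l)"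
    unfolding riem_cplx_def by (subst sum_rot3) (auto intro!: sum.cong simp: algebra_simps)
  have 3: "riem_cplx G y Z X Y W = (\<Sum>i\<in>UNIV. \<Sum>j\<in>UNIV. \<Sum>k\<in>UNIV. \<Sum>l\<in>UNIV.
        of_real (riem G y k i j l) * X $ i * Y $ j * Z $ k * W $ l)"
    unfolding riem_cplx_def by (subst sum_rot3[symmetric]) (auto intro!: sum.cong simp: algebra_simps)
  have "riem G y i j k l + riem G y j k i l + riem G y k i j l = 0" for i j k l
    unfolding riem_eq[OF assms(2)] sum.distrib[symmetric] distrib_right[symmetric] Rm_bianchi[OF assms(2)] by simp
  then have r: "complex_of_real (riem G y i j k l) + of_real (riem G y j k i l) + of_real (riem G y k i j l) = 0" for i j k l
    by (metis of_real_0 of_real_add)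
  show ?thesis unfolding 2 3 unfolding riem_cplx_def sum.distrib[symmetric] distrib_right[symmetric] r by simp
qed

section \<open>The pullback connection and the Bochner identity\<close>

declare Ck_on.simps(2) [simp del]

locale map_coords = riemannian_coords V G
  for V :: "(real^'n) set" and G :: "real^'n \<Rightarrow> real^'n^'n" +
  fixes U :: "(complex^'m) set" and F :: "complex^'m \<Rightarrow> real^'n"
  assumes open_U: "open U" and smooth_F: "smooth_on U F" and F_in: "z \<in> U \<Longrightarrow> F z \<in> V"
begin

definition dF :: "(complex^'m) \<times> (complex^'m) \<Rightarrow> 'n \<Rightarrow> complex^'m \<Rightarrow> complex" where
  "dF p i z = cd p (\<lambda>z. complex_of_real (F z $ i)) z"

definition GG :: "'n \<Rightarrow> 'n \<Rightarrow> complex^'m \<Rightarrow> complex" where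
  "GG i j z = complex_of_real (G (F z) $ i $ j)"

definition Gam :: "'n \<Rightarrow> 'n \<Rightarrow> 'n \<Rightarrow> complex^'m \<Rightarrow> complex" where
  "Gam i j k z = complex_of_real (christoffel G (F z) i j k)"

text \<open>The connection of the complexified pullback of the tangent bundle; a section is given by its components.\<close>

definition cov :: "(complex^'m) \<times> (complex^'m) \<Rightarrow> ('n \<Rightarrow> complex^'m \<Rightarrow> complex) \<Rightarrow> 'n \<Rightarrow> complex^'m \<Rightarrow> complex" where
  "cov p W i z = cd p (W i) z + (\<Sum>j\<in>UNIV. \<Sum>k\<in>UNIV. Gam i j k z * dF p j z * W k z)"

text \<open>Complex bilinear, not sesquilinear: this is the extension of the metric that satisfies a
  product rule along every complexified direction (\<open>cd_ip\<close>). The Hermitian norm is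
  recovered by conjugating the second slot (\<open>ip_cnj_pos\<close>).\<close>

definition ip :: "('n \<Rightarrow> complex^'m \<Rightarrow> complex) \<Rightarrow> ('n \<Rightarrow> complex^'m \<Rightarrow> complex) \<Rightarrow> complex^'m \<Rightarrow> complex" where
  "ip X Y z = (\<Sum>i\<in>UNIV. \<Sum>j\<in>UNIV. GG i j z * X i z * Y j z)"

lemma Ck_F: "Ck_on k U F"
  using smooth_F by (simp add: smooth_on_def)

lemma Ck_comp_F: "Ck_on k V \<phi> \<Longrightarrow> Ck_on k U (\<lambda>z. \<phi> (F z))"
  using Ck_on_compose[OF open_U open_V Ck_F] F_in by blast

lemma Ck_F_nth: "Ck_on k U (\<lambda>z. complex_of_real (F z $ i))"
  by (intro Ck_on_of_real Ck_on_vec_nth open_U Ck_F)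

lemma Ck_dF: "Ck_on k U (dF p i)"
  unfolding dF_def[abs_def] by (rule Ck_on_cd[OF open_U Ck_F_nth])

lemma Ck_GG: "Ck_on k U (GG i j)"
  unfolding GG_def[abs_def] by (intro Ck_on_of_real open_U Ck_comp_F[OF Ck_G])

lemma Ck_Gam: "Ck_on k U (Gam i j l)"
  unfolding Gam_def[abs_def] by (intro Ck_on_of_real open_U Ck_comp_F[OF Ck_christoffel])

lemma Ck_cov: "(\<And>i. Ck_on (Suc k) U (W i)) \<Longrightarrow> Ck_on k U (cov p W i)"
  unfolding cov_def[abs_def]
  by (intro Ck_on_add Ck_on_cd Ck_on_sum Ck_on_mult Ck_Gam Ck_dF open_U) (auto intro: Ck_on_Suc_imp)

lemma Ck_ip: "(\<And>i. Ck_on k U (X i)) \<Longrightarrow> (\<And>i. Ck_on k U (Y i)) \<Longrightarrow> Ck_on k U (ip X Y)"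
  unfolding ip_def[abs_def] by (intro Ck_on_sum Ck_on_mult Ck_GG open_U)

lemma diffI: "Ck_on 1 U W \<Longrightarrow> z \<in> U \<Longrightarrow> W differentiable (at z)"
  by (rule Ck_on_differentiable[of 1]) simp_all

lemma GG_sym: "z \<in> U \<Longrightarrow> GG i j z = GG j i z"
  unfolding GG_def using G_sym[OF F_in] by simp

lemma Gam_sym: "z \<in> U \<Longrightarrow> Gam i j k z = Gam i k j z"
  unfolding Gam_def using christoffel_sym[OF F_in] by simp

lemma cd_GG:
  assumes "z \<in> U"
  shows "cd p (GG i j) z = (\<Sum>k\<in>UNIV. ((\<Sum>l\<in>UNIV. Gam l k i z * GG l j z) + (\<Sum>l\<in>UNIV. Gam l k j z * GG l i z)) * dF p k z)"
proof -
  have "cd p (GG i j) z = (\<Sum>k\<in>UNIV. complex_of_real (pderiv_at k (\<lambda>y. G y $ i $ j) (F z)) * dF p k z)"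
    unfolding GG_def dF_def
    by (rule cd_chain_real[of F z "\<lambda>y. G y $ i $ j"])
       (auto intro: Ck_on_differentiable[OF Ck_F[of 1]] Ck_on_differentiable[OF Ck_G[of 1]] assms F_in)
  then show ?thesis unfolding metric_compatible[OF F_in[OF assms]] by (simp add: Gam_def GG_def)
qed

lemma cd_Gam:
  assumes "z \<in> U"
  shows "cd p (Gam i j k) z = (\<Sum>l\<in>UNIV. complex_of_real (pderiv_at l (\<lambda>y. christoffel G y i j k) (F z)) * dF p l z)"
  unfolding Gam_def dF_def
  by (rule cd_chain_real[of F z "\<lambda>y. christoffel G y i j k"])
     (auto intro: Ck_on_differentiable[OF Ck_F[of 1]] Ck_on_differentiable[OF Ck_christoffel[of 1]] assms F_in)

lemma ip_sym: "z \<in> U \<Longrightarrow> ip X Y z = ip Y X z"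
  unfolding ip_def by (subst sum.swap) (simp add: GG_sym[of z] mult_ac)

text \<open>Metric compatibility of the pullback connection. The auxiliary equations
  \<open>A\<close> and \<open>B\<close> only rename summation indices, so that the Christoffel terms
  of the two covariant derivatives match those coming from \<open>cd_GG\<close>.\<close>

lemma cd_ip:
  assumes "z \<in> U" and X: "\<And>i. Ck_on 1 U (X i)" and Y: "\<And>i. Ck_on 1 U (Y i)"
  shows "cd p (ip X Y) z = ip (cov p X) Y z + ip X (cov p Y) z"
proof -
  have d: "GG i j differentiable (at z)" "X i differentiable (at z)" "Y i differentiable (at z)" for i j
    using diffI[OF Ck_GG assms(1)] diffI[OF X assms(1)] diffI[OF Y assms(1)] by auto
  have 1: "cd p (ip X Y) z = (\<Sum>i\<in>UNIV. \<Sum>j\<in>UNIV. (cd p (GG i j) z * X i z + GG i j z * cd p (X i) z) * Y j z + GG i j z * X i z * cd p (Y j) z)"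
    unfolding ip_def[abs_def]
    by (simp add: cd_sum cd_mult d differentiable_sum differentiable_mult)
  define P where "P k = dF p k z" for k
  have A: "(\<Sum>i\<in>UNIV. \<Sum>j\<in>UNIV. GG i j z * (\<Sum>k\<in>UNIV. \<Sum>l\<in>UNIV. Gam i k l z * P k * X l z) * Y j z)
    = (\<Sum>l\<in>UNIV. \<Sum>j\<in>UNIV. (\<Sum>k\<in>UNIV. (\<Sum>i\<in>UNIV. Gam i k l z * GG i j z) * P k) * X l z * Y j z)"
  proof -
    have "(\<Sum>i\<in>UNIV. \<Sum>j\<in>UNIV. GG i j z * (\<Sum>k\<in>UNIV. \<Sum>l\<in>UNIV. Gam i k l z * P k * X l z) * Y j z)
      = (\<Sum>i\<in>UNIV. \<Sum>j\<in>UNIV. \<Sum>k\<in>UNIV. \<Sum>l\<in>UNIV. GG i j z * Gam i k l z * P k * X l z * Y j z)"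
      by (simp add: sum_distrib_left sum_distrib_right mult_ac)
    also have "\<dots> = (\<Sum>l\<in>UNIV. \<Sum>j\<in>UNIV. \<Sum>k\<in>UNIV. \<Sum>i\<in>UNIV. GG i j z * Gam i k l z * P k * X l z * Y j z)"
      unfolding sum_rot4[where ?f = "\<lambda>i j k l. GG i j z * Gam i k l z * P k * X l z * Y j z"]
      by (rule sum.cong[OF refl]) (rule sum_rot3[symmetric])
    finally show ?thesis by (simp add: sum_distrib_left sum_distrib_right mult_ac)
  qed
  have B: "(\<Sum>i\<in>UNIV. \<Sum>j\<in>UNIV. GG i j z * X i z * (\<Sum>k\<in>UNIV. \<Sum>l\<in>UNIV. Gam j k l z * P k * Y l z))
    = (\<Sum>l\<in>UNIV. \<Sum>j\<in>UNIV. (\<Sum>k\<in>UNIV. (\<Sum>i\<in>UNIV. Gam i k j z * GG i l z) * P k) * X l z * Y j z)"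
  proof -
    have "(\<Sum>i\<in>UNIV. \<Sum>j\<in>UNIV. GG i j z * X i z * (\<Sum>k\<in>UNIV. \<Sum>l\<in>UNIV. Gam j k l z * P k * Y l z))
      = (\<Sum>l\<in>UNIV. \<Sum>i\<in>UNIV. \<Sum>k\<in>UNIV. \<Sum>j\<in>UNIV. GG i l z * X l z * Gam i k j z * P k * Y j z)"
      by (simp add: sum_distrib_left sum_distrib_right mult_ac GG_sym[OF assms(1), of _ "_"])
    also have "\<dots> = (\<Sum>l\<in>UNIV. \<Sum>j\<in>UNIV. \<Sum>k\<in>UNIV. \<Sum>i\<in>UNIV. GG i l z * X l z * Gam i k j z * P k * Y j z)"
      by (rule sum.cong[OF refl], subst sum_rot3) (rule sum.cong[OF refl], rule sum.swap)
    finally show ?thesis by (simp add: sum_distrib_left sum_distrib_right mult_ac)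
  qed
  have 2: "ip (cov p X) Y z + ip X (cov p Y) z =
     (\<Sum>i\<in>UNIV. \<Sum>j\<in>UNIV. GG i j z * cd p (X i) z * Y j z) + (\<Sum>i\<in>UNIV. \<Sum>j\<in>UNIV. GG i j z * X i z * cd p (Y j) z)
     + ((\<Sum>l\<in>UNIV. \<Sum>j\<in>UNIV. (\<Sum>k\<in>UNIV. (\<Sum>i\<in>UNIV. Gam i k l z * GG i j z) * P k) * X l z * Y j z)
     + (\<Sum>l\<in>UNIV. \<Sum>j\<in>UNIV. (\<Sum>k\<in>UNIV. (\<Sum>i\<in>UNIV. Gam i k j z * GG i l z) * P k) * X l z * Y j z))"
    unfolding A[symmetric] B[symmetric] unfolding ip_def cov_def P_def
    by (simp add: distrib_left distrib_right sum.distrib)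
  show ?thesis unfolding 1 2 cd_GG[OF assms(1)] P_def
    by (simp add: distrib_left distrib_right sum.distrib)
qed

text \<open>The second fundamental form of the map is symmetric because derivatives along constant
  directions commute and the connection is torsion-free.\<close>

lemma dF_sym:
  assumes "z \<in> U" shows "cov p (dF q) i z = cov q (dF p) i z"
proof -
  have "cd p (dF q i) z = cd q (dF p i) z"
    unfolding dF_def[abs_def] by (rule cd_commute[OF open_U Ck_F_nth assms])
  moreover have "(\<Sum>j\<in>UNIV. \<Sum>k\<in>UNIV. Gam i j k z * dF p j z * dF q k z) = (\<Sum>j\<in>UNIV. \<Sum>k\<in>UNIV. Gam i j k z * dF q j z * dF p k z)"
    by (subst sum.swap) (simp add: Gam_sym[OF assms, of i] mult_ac)
  ultimately show ?thesis by (simp add: cov_def)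
qed

text \<open>The curvature of the pullback connection is the pullback of the curvature. The
  directions are constant, so no bracket term arises; the terms that differentiate W, and those with
  second derivatives of F, are symmetric in p and q.\<close>

lemma cov_commutator:
  assumes z: "z \<in> U" and W: "\<And>i. Ck_on 2 U (W i)"
  shows "cov p (cov q W) i z - cov q (cov p W) i z =
    (\<Sum>a\<in>UNIV. \<Sum>b\<in>UNIV. \<Sum>k\<in>UNIV. complex_of_real (Rm (F z) i a b k) * dF p a z * dF q b z * W k z)"
proof -
  have W1: "Ck_on 1 U (W i)" for i by (rule Ck_on_mono[OF W]) simp
  have dW: "cd q (W i) differentiable (at z)" for i q
    by (rule diffI[OF _ z], rule Ck_on_cd[OF open_U]) (use W in \<open>simp add: numeral_2_eq_2\<close>)
  have d: "Gam i j k differentiable (at z)" "W i differentiable (at z)" "dF p i differentiable (at z)" for i j k p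
    using diffI[OF Ck_Gam z] diffI[OF W1 z] diffI[OF Ck_dF z] by auto
  define DG where "DG l i j k = complex_of_real (pderiv_at l (\<lambda>y. christoffel G y i j k) (F z))" for l i j k
  have exp: "cov p (cov q W) i z = cd p (cd q (W i)) z
     + (\<Sum>j\<in>UNIV. \<Sum>k\<in>UNIV. (\<Sum>l\<in>UNIV. DG l i j k * dF p l z) * dF q j z * W k z)
     + (\<Sum>j\<in>UNIV. \<Sum>k\<in>UNIV. Gam i j k z * cd p (dF q j) z * W k z)
     + ((\<Sum>j\<in>UNIV. \<Sum>k\<in>UNIV. Gam i j k z * dF q j z * cd p (W k) z)
       + (\<Sum>j\<in>UNIV. \<Sum>k\<in>UNIV. Gam i j k z * dF p j z * cd q (W k) z))
     + (\<Sum>j\<in>UNIV. \<Sum>k\<in>UNIV. Gam i j k z * dF p j z * (\<Sum>b\<in>UNIV. \<Sum>c\<in>UNIV. Gam k b c z * dF q b z * W c z))" for p q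
    unfolding cov_def[abs_def]
    by (simp add: cd_add cd_sum cd_mult d dW differentiable_sum differentiable_mult differentiable_add
       cd_Gam[OF z] DG_def distrib_left distrib_right sum.distrib)
  have c1: "cd p (cd q (W i)) z = cd q (cd p (W i)) z" by (rule cd_commute[OF open_U W z])
  have c2: "cd p (dF q j) z = cd q (dF p j) z" for j
    unfolding dF_def[abs_def] by (rule cd_commute[OF open_U Ck_F_nth z])
  have t1: "(\<Sum>j\<in>UNIV. \<Sum>k\<in>UNIV. (\<Sum>l\<in>UNIV. DG l i j k * dF p l z) * dF q j z * W k z)
    = (\<Sum>a\<in>UNIV. \<Sum>b\<in>UNIV. \<Sum>k\<in>UNIV. DG a i b k * dF p a z * dF q b z * W k z)" 
    unfolding sum_distrib_right by (rule sum_rot3)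
  have t2: "(\<Sum>j\<in>UNIV. \<Sum>k\<in>UNIV. (\<Sum>l\<in>UNIV. DG l i j k * dF q l z) * dF p j z * W k z)
    = (\<Sum>a\<in>UNIV. \<Sum>b\<in>UNIV. \<Sum>k\<in>UNIV. DG b i a k * dF p a z * dF q b z * W k z)"
    unfolding sum_distrib_right by (rule sum.cong[OF refl], subst sum.swap) (simp add: mult_ac)
  have t3: "(\<Sum>j\<in>UNIV. \<Sum>k\<in>UNIV. Gam i j k z * dF p j z * (\<Sum>b\<in>UNIV. \<Sum>c\<in>UNIV. Gam k b c z * dF q b z * W c z))
    = (\<Sum>a\<in>UNIV. \<Sum>b\<in>UNIV. \<Sum>k\<in>UNIV. (\<Sum>m\<in>UNIV. Gam i a m z * Gam m b k z) * dF p a z * dF q b z * W k z)" for p q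
    unfolding sum_distrib_right sum_distrib_left
    by (rule sum.cong[OF refl], subst sum_rot3[symmetric]) (simp add: mult_ac)
  have t4: "(\<Sum>j\<in>UNIV. \<Sum>k\<in>UNIV. Gam i j k z * dF q j z * (\<Sum>b\<in>UNIV. \<Sum>c\<in>UNIV. Gam k b c z * dF p b z * W c z))
    = (\<Sum>a\<in>UNIV. \<Sum>b\<in>UNIV. \<Sum>k\<in>UNIV. (\<Sum>m\<in>UNIV. Gam i b m z * Gam m a k z) * dF p a z * dF q b z * W k z)"
    unfolding t3 by (subst sum.swap) (simp add: mult_ac)
  have R: "complex_of_real (Rm (F z) i a b k) = DG a i b k - DG b i a k
     + (\<Sum>m\<in>UNIV. Gam i a m z * Gam m b k z) - (\<Sum>m\<in>UNIV. Gam i b m z * Gam m a k z)" for a b k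
    unfolding Rm_def DG_def Gam_def by simp
  have "cov p (cov q W) i z - cov q (cov p W) i z =
    (\<Sum>a\<in>UNIV. \<Sum>b\<in>UNIV. \<Sum>k\<in>UNIV. DG a i b k * dF p a z * dF q b z * W k z)
    - (\<Sum>a\<in>UNIV. \<Sum>b\<in>UNIV. \<Sum>k\<in>UNIV. DG b i a k * dF p a z * dF q b z * W k z)
    + (\<Sum>a\<in>UNIV. \<Sum>b\<in>UNIV. \<Sum>k\<in>UNIV. (\<Sum>m\<in>UNIV. Gam i a m z * Gam m b k z) * dF p a z * dF q b z * W k z)
    - (\<Sum>a\<in>UNIV. \<Sum>b\<in>UNIV. \<Sum>k\<in>UNIV. (\<Sum>m\<in>UNIV. Gam i b m z * Gam m a k z) * dF p a z * dF q b z * W k z)"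
    unfolding exp t1 t2 t3[of p q] t4 c1 c2 by simp
  also have "\<dots> = (\<Sum>a\<in>UNIV. \<Sum>b\<in>UNIV. \<Sum>k\<in>UNIV. complex_of_real (Rm (F z) i a b k) * dF p a z * dF q b z * W k z)"
    unfolding R sum_subtractf[symmetric] sum.distrib[symmetric] by (simp add: algebra_simps)
  finally show ?thesis .
qed

lemma ip_cov_commutator:
  assumes z: "z \<in> U" and W: "\<And>i. Ck_on 2 U (W i)"
  shows "ip (cov p (cov q W)) Y z - ip (cov q (cov p W)) Y z =
    riem_cplx G (F z) (\<chi> i. dF p i z) (\<chi> i. dF q i z) (\<chi> i. W i z) (\<chi> i. Y i z)"
proof -
  have "ip (cov p (cov q W)) Y z - ip (cov q (cov p W)) Y z
    = (\<Sum>i\<in>UNIV. \<Sum>j\<in>UNIV. GG i j z * (cov p (cov q W) i z - cov q (cov p W) i z) * Y j z)"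
    unfolding ip_def sum_subtractf[symmetric] by (simp add: algebra_simps)
  also have "\<dots> = (\<Sum>i\<in>UNIV. \<Sum>j\<in>UNIV. \<Sum>a\<in>UNIV. \<Sum>b\<in>UNIV. \<Sum>k\<in>UNIV.
     GG i j z * complex_of_real (Rm (F z) i a b k) * dF p a z * dF q b z * W k z * Y j z)"
    unfolding cov_commutator[OF z W] by (simp add: sum_distrib_left sum_distrib_right mult_ac)
  also have "\<dots> = (\<Sum>j\<in>UNIV. \<Sum>a\<in>UNIV. \<Sum>b\<in>UNIV. \<Sum>k\<in>UNIV. \<Sum>i\<in>UNIV. 
     GG i j z * complex_of_real (Rm (F z) i a b k) * dF p a z * dF q b z * W k z * Y j z)"
    by (subst sum.swap, rule sum.cong[OF refl]) (rule sum_rot4[symmetric])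
  also have "\<dots> = (\<Sum>a\<in>UNIV. \<Sum>b\<in>UNIV. \<Sum>k\<in>UNIV. \<Sum>j\<in>UNIV. \<Sum>i\<in>UNIV. 
     GG i j z * complex_of_real (Rm (F z) i a b k) * dF p a z * dF q b z * W k z * Y j z)"
    by (rule sum_rot4[symmetric])
  also have "\<dots> = riem_cplx G (F z) (\<chi> i. dF p i z) (\<chi> i. dF q i z) (\<chi> i. W i z) (\<chi> i. Y i z)"
    unfolding riem_cplx_def by (simp add: riem_eq[OF F_in[OF z]] GG_def sum_distrib_right sum_distrib_left mult_ac)
  finally show ?thesis .
qed

end

section \<open>The complex Hessian and the Bochner identity\<close>

definition ddb :: "(complex^'m \<Rightarrow> complex^'m^'m) \<Rightarrow> complex^'m \<Rightarrow> complex^'m \<Rightarrow> complex^'m \<Rightarrow> complex^'m \<Rightarrow> complex^'m \<Rightarrow> complex" where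
  "ddb S a x b y z = dl a (db b (\<lambda>w. herm_form (S w) x y)) z"

text \<open>For a \<open>(1,1)\<close>-form \<open>S\<close>, the sum runs over the four terms of \<open>\<partial>\<close>-\<open>\<partial>\<close>-bar of \<open>S\<close> evaluated on \<open>u\<close>, \<open>v\<close>
  and their conjugates, which is why it transforms as a tensor.\<close>

definition ddb_alt :: "(complex^'m \<Rightarrow> complex^'m^'m) \<Rightarrow> complex^'m \<Rightarrow> complex^'m \<Rightarrow> complex^'m \<Rightarrow> complex" where
  "ddb_alt S u v z = ddb S u v u v z - ddb S u v v u z - ddb S v u u v z + ddb S v u v u z"

context map_coords
begin

abbreviation "d10 u \<equiv> dF (dir10 u)"
abbreviation "d01 u \<equiv> dF (dir01 u)"

text \<open>The complex Hessian, that is, the (1,1)-part of the second fundamental form; its trace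
  with respect to h is what the Hermitian harmonic equation sets to zero.\<close>

definition hess :: "complex^'m \<Rightarrow> complex^'m \<Rightarrow> 'n \<Rightarrow> complex^'m \<Rightarrow> complex" where
  "hess x y = cov (dir10 x) (d01 y)"

text \<open>The coefficients of the \<open>(1,1)\<close>-part of the pullback metric.\<close>

definition pullback_mat :: "complex^'m \<Rightarrow> complex^'m^'m" where
  "pullback_mat z = (\<chi> c d. ip (d10 (axis c 1)) (d01 (axis d 1)) z)"

lemma diff_F_nth: "z \<in> U \<Longrightarrow> (\<lambda>z. complex_of_real (F z $ i)) differentiable (at z)"
  by (rule diffI[OF Ck_F_nth])

lemma d10_expansion: "z \<in> U \<Longrightarrow> d10 x i z = (\<Sum>a\<in>UNIV. x $ a * d10 (axis a 1) i z)"
  unfolding dF_def by (rule dl_expansion[OF diff_F_nth])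

lemma d01_expansion: "z \<in> U \<Longrightarrow> d01 x i z = (\<Sum>a\<in>UNIV. cnj (x $ a) * d01 (axis a 1) i z)"
  unfolding dF_def by (rule db_expansion[OF diff_F_nth])

lemma ip_cong: "(\<And>i. X i z = X' i z) \<Longrightarrow> (\<And>i. Y i z = Y' i z) \<Longrightarrow> ip X Y z = ip X' Y' z"
  unfolding ip_def by simp

lemma ip_sum_left: "ip (\<lambda>i z. \<Sum>a\<in>A. c a * X a i z) Y z = (\<Sum>a\<in>A. c a * ip (X a) Y z)"
  unfolding ip_def sum_distrib_left sum_distrib_right
  by (subst sum_rot3) (simp add: mult_ac)

lemma ip_sum_right: "ip X (\<lambda>i z. \<Sum>a\<in>A. c a * Y a i z) z = (\<Sum>a\<in>A. c a * ip X (Y a) z)"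
  unfolding ip_def sum_distrib_left sum_distrib_right
  by (subst sum_rot3) (simp add: mult_ac)

lemma ip_add_left: "ip (\<lambda>i z. X i z + X' i z) Y z = ip X Y z + ip X' Y z"
  unfolding ip_def by (simp add: distrib_left distrib_right sum.distrib)

lemma ip_add_right: "ip X (\<lambda>i z. Y i z + Y' i z) z = ip X Y z + ip X Y' z"
  unfolding ip_def by (simp add: distrib_left distrib_right sum.distrib)

lemma herm_form_pullback_mat:
  assumes "z \<in> U" shows "herm_form (pullback_mat z) x y = ip (d10 x) (d01 y) z"
proof -
  have "ip (d10 x) (d01 y) z = ip (\<lambda>i z. \<Sum>a\<in>UNIV. x $ a * d10 (axis a 1) i z) (\<lambda>i z. \<Sum>a\<in>UNIV. cnj (y $ a) * d01 (axis a 1) i z) z"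
    by (rule ip_cong) (rule d10_expansion[OF assms] d01_expansion[OF assms])+
  also have "\<dots> = herm_form (pullback_mat z) x y"
    unfolding ip_sum_left ip_sum_right herm_form_def pullback_mat_def
    by (simp add: sum_distrib_left mult_ac)
  finally show ?thesis by simp
qed

lemma Ck_pullback_mat: "Ck_on k U (\<lambda>z. pullback_mat z $ c $ d)"
  unfolding pullback_mat_def by (simp add: Ck_ip Ck_dF)

lemma cov_cong: "(\<And>i z. z \<in> U \<Longrightarrow> W i z = W' i z) \<Longrightarrow> z \<in> U \<Longrightarrow> cov p W i z = cov p W' i z"
  unfolding cov_def using cd_cong_open[OF open_U, of z "W i" "W' i"] by simp

lemma cd_T:
  assumes "z \<in> U"
  shows "cd p (\<lambda>w. herm_form (pullback_mat w) x y) z = ip (cov p (d10 x)) (d01 y) z + ip (d10 x) (cov p (d01 y)) z"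
  using cd_cong_open[OF open_U assms, of "\<lambda>w. herm_form (pullback_mat w) x y" "ip (d10 x) (d01 y)"]
    herm_form_pullback_mat cd_ip[OF assms Ck_dF Ck_dF] by simp

lemma cd_cd_T:
  assumes "z \<in> U"
  shows "cd q (cd p (\<lambda>w. herm_form (pullback_mat w) x y)) z =
    ip (cov q (cov p (d10 x))) (d01 y) z + ip (cov p (d10 x)) (cov q (d01 y)) z
    + (ip (cov q (d10 x)) (cov p (d01 y)) z + ip (d10 x) (cov q (cov p (d01 y))) z)"
proof -
  have "cd q (cd p (\<lambda>w. herm_form (pullback_mat w) x y)) z =
     cd q (\<lambda>z. ip (cov p (d10 x)) (d01 y) z + ip (d10 x) (cov p (d01 y)) z) z"
    by (rule cd_cong_open[OF open_U assms cd_T])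
  also have "\<dots> = cd q (ip (cov p (d10 x)) (d01 y)) z + cd q (ip (d10 x) (cov p (d01 y))) z"
    by (intro cd_add diffI[OF _ assms] Ck_ip Ck_cov Ck_dF)
  finally show ?thesis by (simp add: cd_ip[OF assms] Ck_cov Ck_dF)
qed

text \<open>Each \<open>ddb\<close> splits by the product rule into four terms. Those with a
  (2,0)-Hessian, and those where both derivatives fall on the second slot, are symmetric in two
  arguments that the signs alternate, and cancel. Those where both derivatives fall on the first
  slot combine to commutators, that is, curvature; the products of mixed Hessians survive.\<close>

lemma ddb_alt_pullback_mat:
  assumes z: "z \<in> U"
  shows "ddb_alt pullback_mat u v z =
    riem_cplx G (F z) (\<chi> i. d10 u i z) (\<chi> i. d10 v i z) (\<chi> i. d01 u i z) (\<chi> i. d01 v i z)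
    - riem_cplx G (F z) (\<chi> i. d10 u i z) (\<chi> i. d10 v i z) (\<chi> i. d01 v i z) (\<chi> i. d01 u i z)
    + 2 * ip (hess v u) (hess u v) z - 2 * ip (hess u u) (hess v v) z"
proof -
  have 1: "ddb pullback_mat a x b y z = ip (cov (dir10 a) (cov (dir10 x) (d01 b))) (d01 y) z + ip (hess x b) (hess a y) z
    + (ip (cov (dir10 a) (d10 x)) (cov (dir01 b) (d01 y)) z + ip (d10 x) (cov (dir10 a) (cov (dir01 b) (d01 y))) z)" for a x b y
    unfolding ddb_def cd_cd_T[OF z] hess_def
    by (intro arg_cong2[where f="(+)"] ip_cong cov_cong dF_sym z refl)
  have 2: "ip (cov (dir10 u) (d10 v)) (cov (dir01 b) (d01 y)) z = ip (cov (dir10 v) (d10 u)) (cov (dir01 b) (d01 y)) z" for b y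
    by (intro ip_cong dF_sym z refl)
  have 3: "ip (d10 x) (cov (dir10 a) (cov (dir01 u) (d01 v))) z = ip (d10 x) (cov (dir10 a) (cov (dir01 v) (d01 u))) z" for a x
    by (intro ip_cong cov_cong dF_sym z refl)
  have 4: "ip (cov (dir10 u) (cov (dir10 v) (d01 b))) (d01 y) z =
     ip (cov (dir10 v) (cov (dir10 u) (d01 b))) (d01 y) z +
     riem_cplx G (F z) (\<chi> i. d10 u i z) (\<chi> i. d10 v i z) (\<chi> i. d01 b i z) (\<chi> i. d01 y i z)" for b y
    using ip_cov_commutator[OF z Ck_dF, of "dir10 u" "dir10 v"] by (simp add: algebra_simps)
  have 5: "ip (hess u v) (hess v u) z = ip (hess v u) (hess u v) z"  "ip (hess v v) (hess u u) z = ip (hess u u) (hess v v) z"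
    by (rule ip_sym[OF z])+
  show ?thesis unfolding ddb_alt_def 1 2 3 4 5 by simp
qed

lemma cnj_dF: "z \<in> U \<Longrightarrow> cnj (dF p i z) = dF (cnj_dir p) i z"
  unfolding dF_def by (rule cd_of_real_cnj[OF Ck_on_differentiable[OF Ck_on_vec_nth[OF open_U Ck_F]]]) auto

lemma vcnj_d01: "z \<in> U \<Longrightarrow> (\<chi> i. d01 u i z) = vcnj (\<chi> i. d10 u i z)"
  unfolding vcnj_def using cnj_dF[of z "dir10 u"] by (simp add: vec_eq_iff)

lemma cnj_cov:
  assumes z: "z \<in> U" and W: "\<And>i. Ck_on 1 U (W i)"
  shows "cnj (cov p W i z) = cov (cnj_dir p) (\<lambda>i z. cnj (W i z)) i z"
  unfolding cov_def using cd_cnj[OF diffI[OF W z], of "cnj_dir p"] 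
  by (simp add: cnj_dF[OF z] Gam_def)

text \<open>The map is real, so conjugation exchanges the types of the two directions, and
  \<open>dF_sym\<close> restores their order.\<close>

lemma cnj_hess:
  assumes z: "z \<in> U" shows "cnj (hess x y i z) = hess y x i z"
proof -
  have "cnj (hess x y i z) = cov (dir01 x) (\<lambda>i z. cnj (d01 y i z)) i z"
    unfolding hess_def cnj_cov[OF z Ck_dF] by simp
  also have "\<dots> = cov (dir01 x) (d10 y) i z"
    by (rule cov_cong[OF _ z]) (simp add: cnj_dF)
  also have "\<dots> = hess y x i z" unfolding hess_def by (rule dF_sym[OF z])
  finally show ?thesis .
qed

lemma ip_cnj_pos:
  assumes z: "z \<in> U"
  shows "0 \<le> Re (ip X (\<lambda>i z. cnj (X i z)) z)" "Re (ip X (\<lambda>i z. cnj (X i z)) z) = 0 \<Longrightarrow> X i z = 0"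
proof -
  define a where "a = (\<chi> i. Re (X i z))"
  define b where "b = (\<chi> i. Im (X i z))"
  have q: "v \<bullet> (G (F z) *v v) = (\<Sum>i\<in>UNIV. \<Sum>j\<in>UNIV. G (F z) $ i $ j * v $ i * v $ j)" for v
    by (simp add: inner_vec_def matrix_vector_mult_def sum_distrib_left mult_ac)
  have "Re (ip X (\<lambda>i z. cnj (X i z)) z) =
    (\<Sum>i\<in>UNIV. \<Sum>j\<in>UNIV. G (F z) $ i $ j * a $ i * a $ j) + (\<Sum>i\<in>UNIV. \<Sum>j\<in>UNIV. G (F z) $ i $ j * b $ i * b $ j)"
    unfolding ip_def GG_def a_def b_def sum.distrib[symmetric]
    by (simp add: algebra_simps)
  then have e: "Re (ip X (\<lambda>i z. cnj (X i z)) z) = a \<bullet> (G (F z) *v a) + b \<bullet> (G (F z) *v b)"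
    unfolding q .
  have p: "0 \<le> v \<bullet> (G (F z) *v v)" for v using pos_G[OF F_in[OF z], of v] by (cases "v = 0") auto
  show "0 \<le> Re (ip X (\<lambda>i z. cnj (X i z)) z)" unfolding e using p[of a] p[of b] by simp
  assume "Re (ip X (\<lambda>i z. cnj (X i z)) z) = 0"
  then have "a \<bullet> (G (F z) *v a) = 0" "b \<bullet> (G (F z) *v b) = 0" unfolding e using p[of a] p[of b] by auto
  then have "a = 0" "b = 0" using pos_G[OF F_in[OF z]] by (metis less_irrefl)+
  then have "a $ i = 0" "b $ i = 0" by simp_all
  then show "X i z = 0" by (simp add: a_def b_def complex_eq_iff)
qed

lemma ip_hess:
  assumes z: "z \<in> U"
  shows "ip (hess v u) (hess u v) z = ip (hess v u) (\<lambda>i z. cnj (hess v u i z)) z"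
  by (rule ip_cong) (simp_all add: cnj_hess[OF z])

text \<open>For a unitary frame u the hypothesis \<open>harm\<close> is the harmonic map equation.
  By antisymmetry the two curvature terms of \<open>ddb_alt_pullback_mat\<close> contribute equally
  after summation over both indices, and the products of diagonal Hessians sum to the square of the
  trace, which is zero. What remains is twice a sum of nonnegative terms, so a zero total kills each
  Hessian component.\<close>

lemma bochner:
  fixes u :: "'m \<Rightarrow> complex^'m"
  assumes z: "z \<in> U"
    and curv: "\<And>Z W. Re (riem_cplx G (F z) Z (vcnj W) W (vcnj Z)) \<le> 0"
    and harm: "\<And>i. (\<Sum>p\<in>UNIV. hess (u p) (u p) i z) = 0"
  shows "(\<Sum>p\<in>UNIV. \<Sum>s\<in>UNIV. Re (ddb_alt pullback_mat (u p) (u s) z)) \<ge> 0"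
    and "(\<Sum>p\<in>UNIV. \<Sum>s\<in>UNIV. Re (ddb_alt pullback_mat (u p) (u s) z)) = 0 \<Longrightarrow> hess (u p) (u s) i z = 0"
proof -
  define X where "X p = (\<chi> i. d10 (u p) i z)" for p
  define rr where "rr p s = riem_cplx G (F z) (X p) (X s) (vcnj (X s)) (vcnj (X p))" for p s
  define ss where "ss p s = riem_cplx G (F z) (X p) (X s) (vcnj (X p)) (vcnj (X s))" for p s
  define nn where "nn p s = Re (ip (hess (u s) (u p)) (\<lambda>i z. cnj (hess (u s) (u p) i z)) z)" for p s
  have ss: "ss p s = - rr s p" for p s
    unfolding ss_def rr_def by (rule riem_cplx_diff_antisym[OF riemannian_coords_axioms F_in[OF z]])
  have A: "ddb_alt pullback_mat (u p) (u s) z = ss p s - rr p s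
    + 2 * ip (hess (u s) (u p)) (\<lambda>i z. cnj (hess (u s) (u p) i z)) z - 2 * ip (hess (u p) (u p)) (hess (u s) (u s)) z" for p s
    unfolding ddb_alt_pullback_mat[OF z] vcnj_d01[OF z] X_def[symmetric] ip_hess[OF z] ss_def rr_def ..
  have tr: "(\<Sum>p\<in>UNIV. \<Sum>s\<in>UNIV. ip (hess (u p) (u p)) (hess (u s) (u s)) z) = 0"
  proof -
    have "(\<Sum>p\<in>UNIV. \<Sum>s\<in>UNIV. 1 * (1 * ip (hess (u p) (u p)) (hess (u s) (u s)) z)) =
      ip (\<lambda>i z. \<Sum>p\<in>UNIV. 1 * hess (u p) (u p) i z) (\<lambda>i z. \<Sum>s\<in>UNIV. 1 * hess (u s) (u s) i z) z"
      unfolding ip_sum_left ip_sum_right sum_distrib_left ..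
    also have "\<dots> = 0" unfolding ip_def by (simp add: harm)
    finally show ?thesis by simp
  qed
  have "(\<Sum>p\<in>UNIV. \<Sum>s\<in>UNIV. ddb_alt pullback_mat (u p) (u s) z) = - (\<Sum>p\<in>UNIV. \<Sum>s\<in>UNIV. rr s p) - (\<Sum>p\<in>UNIV. \<Sum>s\<in>UNIV. rr p s)
    + 2 * (\<Sum>p\<in>UNIV. \<Sum>s\<in>UNIV. ip (hess (u s) (u p)) (\<lambda>i z. cnj (hess (u s) (u p) i z)) z)
    - 2 * (\<Sum>p\<in>UNIV. \<Sum>s\<in>UNIV. ip (hess (u p) (u p)) (hess (u s) (u s)) z)"
    unfolding A ss by (simp add: sum.distrib sum_subtractf sum_negf sum_distrib_left)
  also have "(\<Sum>p\<in>UNIV. \<Sum>s\<in>UNIV. rr s p) = (\<Sum>p\<in>UNIV. \<Sum>s\<in>UNIV. rr p s)" by (rule sum.swap)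
  finally have S: "(\<Sum>p\<in>UNIV. \<Sum>s\<in>UNIV. Re (ddb_alt pullback_mat (u p) (u s) z)) =
     2 * (\<Sum>p\<in>UNIV. \<Sum>s\<in>UNIV. nn p s - Re (rr p s))"
    unfolding tr nn_def Re_sum[symmetric] sum_subtractf by simp
  \<comment> \<open>The curvature hypothesis with \<open>Z = X p\<close>, and with the conjugate of
    \<open>X s\<close> as W.\<close>
  have rrn: "Re (rr p s) \<le> 0" for p s
    using curv[of "X p" "vcnj (X s)"] unfolding rr_def by (simp add: vcnj_def)
  have nnn: "nn p s \<ge> 0" for p s unfolding nn_def by (rule ip_cnj_pos[OF z])
  have *: "nn p s - Re (rr p s) \<ge> 0" for p s using rrn[of p s] nnn[of p s] by simp
  show "(\<Sum>p\<in>UNIV. \<Sum>s\<in>UNIV. Re (ddb_alt pullback_mat (u p) (u s) z)) \<ge> 0"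
    unfolding S by (intro mult_nonneg_nonneg sum_nonneg *) simp
  assume "(\<Sum>p\<in>UNIV. \<Sum>s\<in>UNIV. Re (ddb_alt pullback_mat (u p) (u s) z)) = 0"
  then have "(\<Sum>p\<in>UNIV. \<Sum>s\<in>UNIV. nn p s - Re (rr p s)) = 0"
    unfolding S by simp
  then have "nn p s - Re (rr p s) = 0" for p s
    using * by (simp add: sum_nonneg_eq_0_iff sum_nonneg)
  then have "nn s p = 0" using rrn[of s p] nnn[of s p] by (smt (verit))
  then show "hess (u p) (u s) i z = 0" unfolding nn_def by (rule ip_cnj_pos(2)[OF z])
qed

lemma hess_expansion:
  assumes z: "z \<in> U"
  shows "hess x y i z = (\<Sum>a\<in>UNIV. \<Sum>b\<in>UNIV. x $ a * cnj (y $ b) * hess (axis a 1) (axis b 1) i z)"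
proof -
  have lin1: "cov (dir10 x) W i z = (\<Sum>a\<in>UNIV. x $ a * cov (dir10 (axis a 1)) W i z)" if W: "\<And>i. Ck_on 1 U (W i)" for x W
  proof -
    have "(\<Sum>j\<in>UNIV. \<Sum>k\<in>UNIV. Gam i j k z * d10 x j z * W k z)
       = (\<Sum>a\<in>UNIV. x $ a * (\<Sum>j\<in>UNIV. \<Sum>k\<in>UNIV. Gam i j k z * d10 (axis a 1) j z * W k z))"
      by (subst d10_expansion[OF z, of x], unfold sum_distrib_left sum_distrib_right, subst sum_rot3) (simp add: mult_ac)
    then show ?thesis
      unfolding cov_def by (subst dl_expansion[OF diffI[OF W z]]) (simp add: distrib_left sum.distrib)
  qed
  have "hess x y i z = cov (dir01 y) (d10 x) i z" unfolding hess_def by (rule dF_sym[OF z])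
  also have "\<dots> = cnj (cov (dir10 y) (d01 x) i z)" using cnj_hess[OF z, of y x] dF_sym[OF z, of "dir01 y" "dir10 x" i] by (simp add: hess_def)
  also have "\<dots> = (\<Sum>b\<in>UNIV. cnj (y $ b) * cnj (hess (axis b 1) x i z))"
    by (subst lin1[OF Ck_dF]) (simp add: hess_def)
  also have "\<dots> = (\<Sum>b\<in>UNIV. cnj (y $ b) * hess x (axis b 1) i z)"
    unfolding cnj_hess[OF z] ..
  also have "\<dots> = (\<Sum>b\<in>UNIV. \<Sum>a\<in>UNIV. x $ a * cnj (y $ b) * hess (axis a 1) (axis b 1) i z)"
    unfolding hess_def by (subst lin1[OF Ck_dF]) (simp add: sum_distrib_left mult_ac)
  finally show ?thesis by (subst sum.swap)
qed

text \<open>The four terms complete a square. Once the mixed Hessian vanishes, the Levi form of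
  T(v,v) is a curvature term plus the squared norm of the covariant derivative of
  \<open>d10 v\<close> along u; the terms with w turn the latter into the squared norm of
  \<open>P\<close>. Hence the bound holds for every w.\<close>

lemma pluriharmonic_hessian_nonneg:
  assumes z: "z \<in> U"
    and curv: "\<And>Z W. Re (riem_cplx G (F z) Z (vcnj W) W (vcnj Z)) \<le> 0"
    and ph: "\<And>x y i w. w \<in> U \<Longrightarrow> hess x y i w = 0"
  shows "0 \<le> Re (dl u (db u (\<lambda>w. herm_form (pullback_mat w) v v)) z + db u (\<lambda>w'. herm_form (pullback_mat w') w v) z
     + dl u (\<lambda>w'. herm_form (pullback_mat w') v w) z + herm_form (pullback_mat z) w w)"
proof -
  have ph': "cov (dir01 y) (d10 x) i w = 0" if "w \<in> U" for x y i w
    using ph[OF that, of x y i] dF_sym[OF that, of "dir10 x"] by (simp add: hess_def)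
  have ph2: "cov p (hess x y) i z = 0" for p x y i
    using cov_cong[of "hess x y" "\<lambda>_ _. 0", OF _ z] ph by (simp add: cov_def)
  have ph2': "cov p (cov (dir01 y) (d10 x)) i z = 0" for p x y i
    using cov_cong[of "cov (dir01 y) (d10 x)" "\<lambda>_ _. 0", OF _ z] ph' by (simp add: cov_def)
  define X where "X = (\<chi> i. d10 u i z)"
  define Y where "Y = (\<chi> i. d10 v i z)"
  have XY: "(\<chi> i. d10 u i z) = X" "(\<chi> i. d10 v i z) = Y" "(\<chi> i. d01 u i z) = vcnj X" "(\<chi> i. d01 v i z) = vcnj Y"
    by (simp_all add: X_def Y_def vcnj_d01[OF z])
  have ip0: "ip X' Y' z = 0" if "\<And>i. X' i z = 0 \<or> Y' i z = 0" "(\<forall>i. X' i z = 0) \<or> (\<forall>i. Y' i z = 0)" for X' Y'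
    using that(2) unfolding ip_def by auto
  \<comment> \<open>Both iterated derivatives of \<open>d01 u\<close> start with a vanishing
    Hessian, so their commutator, this component of the curvature, is zero.\<close>
  have r0: "riem_cplx G (F z) X Y (vcnj X) (vcnj Y) = 0"
    using ip_cov_commutator[OF z, where p = "dir10 u" and q = "dir10 v" and W = "d01 u" and Y = "d01 v", OF Ck_dF] ph2
    unfolding XY hess_def[symmetric] by (simp add: ip0)
  have r1: "ip (cov (dir01 u) (cov (dir10 u) (d10 v))) (d01 v) z = riem_cplx G (F z) (vcnj X) X Y (vcnj Y)"
    using ip_cov_commutator[OF z, where p = "dir01 u" and q = "dir10 u" and W = "d10 v" and Y = "d01 v", OF Ck_dF] ph2'
    unfolding XY by (simp add: ip0)
  \<comment> \<open>The Bianchi identity and \<open>r0\<close> bring the remaining component into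
    the form of the curvature hypothesis with \<open>Z = Y\<close> and \<open>W = X\<close>.\<close>
  have "riem_cplx G (F z) (vcnj X) X Y (vcnj Y) = - riem_cplx G (F z) Y (vcnj X) X (vcnj Y)"
    using riem_cplx_bianchi[OF riemannian_coords_axioms F_in[OF z], of "vcnj X" X Y "vcnj Y"] r0 
    by (simp add: eq_neg_iff_add_eq_0)
  then have r2: "0 \<le> Re (riem_cplx G (F z) (vcnj X) X Y (vcnj Y))"
    using curv[of Y X] by simp
  define P where "P i z = cov (dir10 u) (d10 v) i z + d10 w i z" for i z
  have cP: "cnj (P i z) = cov (dir01 u) (d01 v) i z + d01 w i z" for i
  proof -
    have "cnj (cov (dir10 u) (d10 v) i z) = cov (dir01 u) (\<lambda>i z. cnj (d10 v i z)) i z"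
      unfolding cnj_cov[OF z Ck_dF] by simp
    also have "\<dots> = cov (dir01 u) (d01 v) i z" by (rule cov_cong[OF _ z]) (simp add: cnj_dF)
    finally show ?thesis unfolding P_def by (simp add: cnj_dF[OF z])
  qed
  have "dl u (db u (\<lambda>w. herm_form (pullback_mat w) v v)) z = db u (dl u (\<lambda>w. herm_form (pullback_mat w) v v)) z"
    by (rule cd_commute[OF open_U _ z]) (unfold herm_form_def, intro Ck_on_sum Ck_on_mult Ck_pullback_mat Ck_on_const open_U)
  also have "\<dots> = riem_cplx G (F z) (vcnj X) X Y (vcnj Y) + ip (cov (dir10 u) (d10 v)) (cov (dir01 u) (d01 v)) z"
    unfolding cd_cd_T[OF z] r1
    using ph2[unfolded hess_def] ph[OF z, unfolded hess_def] ph'[OF z] by (simp add: ip0)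
  finally have 1: "dl u (db u (\<lambda>w. herm_form (pullback_mat w) v v)) z = riem_cplx G (F z) (vcnj X) X Y (vcnj Y) + ip (cov (dir10 u) (d10 v)) (cov (dir01 u) (d01 v)) z" .
  have 2: "db u (\<lambda>w'. herm_form (pullback_mat w') w v) z = ip (d10 w) (cov (dir01 u) (d01 v)) z"
    unfolding cd_T[OF z] using ph'[OF z] by (simp add: ip0)
  have 3: "dl u (\<lambda>w'. herm_form (pullback_mat w') v w) z = ip (cov (dir10 u) (d10 v)) (d01 w) z"
    unfolding cd_T[OF z] using ph[OF z, unfolded hess_def] by (simp add: ip0)
  have "ip P (\<lambda>i z. cnj (P i z)) z = ip P (\<lambda>i z. cov (dir01 u) (d01 v) i z + d01 w i z) z"
    by (rule ip_cong) (simp_all add: cP)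
  also have "\<dots> = ip (cov (dir10 u) (d10 v)) (cov (dir01 u) (d01 v)) z + ip (d10 w) (cov (dir01 u) (d01 v)) z
     + ip (cov (dir10 u) (d10 v)) (d01 w) z + ip (d10 w) (d01 w) z"
    unfolding ip_add_right unfolding P_def[abs_def] ip_add_left by simp
  finally have "dl u (db u (\<lambda>w. herm_form (pullback_mat w) v v)) z + db u (\<lambda>w'. herm_form (pullback_mat w') w v) z
     + dl u (\<lambda>w'. herm_form (pullback_mat w') v w) z + herm_form (pullback_mat z) w w
     = riem_cplx G (F z) (vcnj X) X Y (vcnj Y) + ip P (\<lambda>i z. cnj (P i z)) z"
    unfolding 1 2 3 herm_form_pullback_mat[OF z] by simp
  then show ?thesis using r2 ip_cnj_pos(1)[OF z, of P] by simp
qed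

lemma pullback_mat_pos:
  assumes z: "z \<in> U"
  shows "0 \<le> Re (herm_form (pullback_mat z) v v)" "Re (herm_form (pullback_mat z) v v) = 0 \<Longrightarrow> frechet_derivative F (at z) v = 0"
proof -
  have e: "herm_form (pullback_mat z) v v = ip (d10 v) (\<lambda>i z. cnj (d10 v i z)) z"
    unfolding herm_form_pullback_mat[OF z] by (rule ip_cong) (simp_all add: cnj_dF[OF z])
  show "0 \<le> Re (herm_form (pullback_mat z) v v)" unfolding e by (rule ip_cnj_pos[OF z])
  assume "Re (herm_form (pullback_mat z) v v) = 0"
  then have 0: "d10 v i z = 0" for i unfolding e by (rule ip_cnj_pos(2)[OF z])
  have dF: "F differentiable (at z)" using Ck_on_differentiable[OF Ck_F[of 1] _ z] by simp
  have bl: "bounded_linear (\<lambda>v. complex_of_real (v $ i))" for i :: 'n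
    by (rule bounded_linear_compose[OF bounded_linear_of_real bounded_linear_vec_nth])
  have "complex_of_real (frechet_derivative F (at z) v $ i) = d10 v i z + d01 v i z" for i
    unfolding dF_def dl_add_db[OF diff_F_nth[OF z]] frechet_derivative_linear_compose[OF bl dF] ..
  moreover have "d01 v i z = 0" for i using cnj_dF[OF z, of "dir10 v" i] 0[of i] by simp
  ultimately have "complex_of_real (frechet_derivative F (at z) v $ i) = 0" for i using 0[of i] by simp
  then show "frechet_derivative F (at z) v = 0" by (simp add: vec_eq_iff)
qed

end

section \<open>Hermitian forms, unitary frames and holomorphic coordinate changes\<close>

lemma herm_form_add_left: "herm_form H (x + y) z = herm_form H x z + herm_form H y z"
  unfolding herm_form_def by (simp add: distrib_left distrib_right sum.distrib)

lemma herm_form_add_right: "herm_form H z (x + y) = herm_form H z x + herm_form H z y"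
  unfolding herm_form_def by (simp add: distrib_left distrib_right sum.distrib)

lemma herm_form_scale_left: "herm_form H (c *s x) z = c * herm_form H x z"
  unfolding herm_form_def by (simp add: sum_distrib_left mult_ac)

lemma herm_form_scale_right: "herm_form H z (c *s x) = cnj c * herm_form H z x"
  unfolding herm_form_def by (simp add: sum_distrib_left mult_ac)

lemma herm_form_zero_left [simp]: "herm_form H 0 z = 0"
  unfolding herm_form_def by simp

lemma herm_form_zero_right [simp]: "herm_form H z 0 = 0"
  unfolding herm_form_def by simp

lemma herm_form_minus_left: "herm_form H (x - y) z = herm_form H x z - herm_form H y z"
  unfolding herm_form_def by (simp add: left_diff_distrib right_diff_distrib sum_subtractf)

lemma herm_form_sum_left: "herm_form H (\<Sum>i\<in>A. f i) z = (\<Sum>i\<in>A. herm_form H (f i) z)"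
  by (induction A rule: infinite_finite_induct) (auto simp: herm_form_add_left)

lemma herm_form_axis: "herm_form H (axis a 1) (axis b 1) = H $ a $ b"
proof -
  have "herm_form H (axis a 1) (axis b 1) = (\<Sum>c\<in>UNIV. if c = a then (\<Sum>d\<in>UNIV. if d = b then H $ c $ d else 0) else 0)"
    unfolding herm_form_def
    by (intro sum.cong refl) (auto simp: axis_def if_distrib[of cnj] if_distrib[of "(*) _"] cong: if_cong)
  then show ?thesis by simp
qed

lemma herm_form_cnj:
  assumes "\<And>a b. H $ b $ a = cnj (H $ a $ b)"
  shows "cnj (herm_form H x y) = herm_form H y x"
  unfolding herm_form_def
  by (subst sum.swap) (simp add: assms[symmetric] mult_ac)

definition herm_pos :: "complex^'m^'m \<Rightarrow> bool" where
  "herm_pos H \<longleftrightarrow> (\<forall>a b. H $ b $ a = cnj (H $ a $ b)) \<and> (\<forall>v. v \<noteq> 0 \<longrightarrow> 0 < Re (herm_form H v v))"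

definition unitary_frame :: "complex^'m^'m \<Rightarrow> ('m \<Rightarrow> complex^'m) \<Rightarrow> bool" where
  "unitary_frame H u \<longleftrightarrow> (\<forall>p q. herm_form H (u p) (u q) = (if p = q then 1 else 0))"

text \<open>Gram-Schmidt, by induction over the index set. As long as an index is missing, the span
  of the vectors found so far has dimension less than m, which leaves a vector outside it to be
  projected and normalised.\<close>

lemma orthonormal_family_exists:
  fixes H :: "complex^'m^'m" and P :: "'m set"
  assumes H: "herm_pos H" and "finite P"
  shows "\<exists>u. \<forall>p\<in>P. \<forall>q\<in>P. herm_form H (u p) (u q) = (if p = q then 1 else 0)"
  using assms(2)
proof (induction P rule: finite_induct)
  case empty
  then show ?case by simp
next
  case (insert p0 P)
  then obtain u where u: "\<And>p q. p \<in> P \<Longrightarrow> q \<in> P \<Longrightarrow> herm_form H (u p) (u q) = (if p = q then 1 else 0)" by blast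
  have "vec.dim (vec.span (u ` P)) \<le> card (u ` P)"
    by (rule vec.dim_le_card) (auto simp: insert.hyps)
  also have "\<dots> \<le> card P" using card_image_le insert.hyps(1) by blast
  also have "\<dots> < CARD('m)" using insert.hyps by (intro psubset_card_mono) auto
  finally have "vec.dim (vec.span (u ` P)) \<noteq> vec.dim (UNIV :: (complex^'m) set)"
    unfolding vec_dim_card by simp
  then have "vec.span (u ` P) \<noteq> UNIV" by (rule contrapos_nn) simp
  then obtain v where v: "v \<notin> vec.span (u ` P)" by auto
  define v' where "v' = v - (\<Sum>p\<in>P. herm_form H v (u p) *s u p)"
  have "v' \<noteq> 0"
  proof
    assume "v' = 0"
    then have "v = (\<Sum>p\<in>P. herm_form H v (u p) *s u p)" by (simp add: v'_def)
    also have "\<dots> \<in> vec.span (u ` P)" by (intro vec.span_sum vec.span_scale vec.span_base) auto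
    finally show False using v by blast
  qed
  have orth: "herm_form H v' (u q) = 0" if "q \<in> P" for q
  proof -
    have "(\<Sum>p\<in>P. herm_form H v (u p) * herm_form H (u p) (u q)) = (\<Sum>p\<in>P. if p = q then herm_form H v (u p) else 0)"
      using u that by (intro sum.cong) auto
    then show ?thesis unfolding v'_def herm_form_minus_left herm_form_sum_left herm_form_scale_left
      using insert.hyps that by simp
  qed
  have cnjH: "cnj (herm_form H x y) = herm_form H y x" for x y
    using H herm_form_cnj unfolding herm_pos_def by blast
  have orth': "herm_form H (u q) v' = 0" if "q \<in> P" for q
    using orth[OF that] cnjH[of v' "u q"] by simp
  have pos: "0 < Re (herm_form H v' v')" using H \<open>v' \<noteq> 0\<close> unfolding herm_pos_def by blast
  have re: "herm_form H v' v' = of_real (Re (herm_form H v' v'))"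
    using cnjH[of v' v'] by (simp add: complex_eq_iff)
  define c where "c = complex_of_real (1 / sqrt (Re (herm_form H v' v')))"
  have "herm_form H (c *s v') (c *s v') = c * cnj c * of_real (Re (herm_form H v' v'))"
    unfolding herm_form_scale_left herm_form_scale_right by (subst re) simp
  also have "\<dots> = of_real ((1 / sqrt (Re (herm_form H v' v')))\<^sup>2 * Re (herm_form H v' v'))"
    unfolding c_def power2_eq_square by (simp only: complex_cnj_complex_of_real of_real_mult)
  also have "\<dots> = 1" using pos by (simp add: power_divide)
  finally have one: "herm_form H (c *s v') (c *s v') = 1" .
  define w where "w = u(p0 := c *s v')"
  have w: "w p0 = c *s v'" "\<And>p. p \<in> P \<Longrightarrow> w p = u p" using insert.hyps by (auto simp: w_def)
  have "herm_form H (w p) (w q) = (if p = q then 1 else 0)" if "p \<in> insert p0 P" "q \<in> insert p0 P" for p q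
    using that insert.hyps(2)
    using orth orth' one unfolding herm_form_scale_left herm_form_scale_right
    by (elim insertE) (auto simp: w u herm_form_scale_left herm_form_scale_right)
  then show ?case by (intro exI[of _ w]) simp
qed

lemma unitary_frame_exists: "herm_pos H \<Longrightarrow> \<exists>u. unitary_frame H u"
  using orthonormal_family_exists[of H UNIV] by (simp add: unitary_frame_def)

definition frame_mat :: "('m \<Rightarrow> complex^'m) \<Rightarrow> complex^'m^'m" where
  "frame_mat u = (\<chi> a p. u p $ a)"

definition cnj_mat :: "complex^'m^'m \<Rightarrow> complex^'m^'m" where
  "cnj_mat M = (\<chi> a b. cnj (M $ a $ b))"

lemma unitary_frame_matrix:
  "unitary_frame H u \<longleftrightarrow> transpose (frame_mat u) ** (H ** cnj_mat (frame_mat u)) = mat 1"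
proof -
  have "(transpose (frame_mat u) ** (H ** cnj_mat (frame_mat u))) $ p $ q = herm_form H (u p) (u q)" for p q
    unfolding matrix_matrix_mult_def transpose_def frame_mat_def cnj_mat_def herm_form_def
    by (simp add: sum_distrib_left mult_ac)
  then show ?thesis unfolding unitary_frame_def by (simp add: vec_eq_iff mat_def)
qed

lemma matrix_inv_eqI:
  fixes M :: "complex^'m^'m" assumes "M ** N = mat 1" shows "matrix_inv M = N"
proof -
  have NM: "N ** M = mat 1" using assms matrix_left_right_inverse by blast
  have "invertible M" using assms NM invertible_def by blast
  then have "M ** matrix_inv M = mat 1" by (rule matrix_inv_right)
  then have "N ** (M ** matrix_inv M) = N" by (simp add: matrix_mul_rid)
  then show ?thesis by (simp add: matrix_mul_assoc NM matrix_mul_lid)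
qed

text \<open>The inverse metric is the sum of the \<open>u p\<close> tensored with their conjugates,
  so contraction with it becomes a sum over the frame.\<close>

lemma unitary_frame_inv:
  assumes "unitary_frame H u"
  shows "herm_inv H a b = (\<Sum>p\<in>UNIV. u p $ a * cnj (u p $ b))" and "invertible H" and "invertible (frame_mat u)"
proof -
  have 1: "transpose (frame_mat u) ** (H ** cnj_mat (frame_mat u)) = mat 1"
    using assms unitary_frame_matrix by blast
  then have "(H ** cnj_mat (frame_mat u)) ** transpose (frame_mat u) = mat 1"
    using matrix_left_right_inverse by blast
  then have 2: "H ** (cnj_mat (frame_mat u) ** transpose (frame_mat u)) = mat 1"
    by (simp add: matrix_mul_assoc)
  show "herm_inv H a b = (\<Sum>p\<in>UNIV. u p $ a * cnj (u p $ b))"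
    unfolding herm_inv_def matrix_inv_eqI[OF 2]
    by (simp add: matrix_matrix_mult_def transpose_def frame_mat_def cnj_mat_def mult_ac)
  show "invertible H" using 2 matrix_left_right_inverse unfolding invertible_def by blast
  have "invertible (transpose (frame_mat u))" using 1 matrix_left_right_inverse unfolding invertible_def by blast
  then show "invertible (frame_mat u)" by (simp add: invertible_det_nz det_transpose)
qed

text \<open>The rows of W are the dual coframe. It diagonalises H, and through it the coordinate
  forms are expressed by coframe elements.\<close>

lemma unitary_frame_coframe:
  assumes "unitary_frame H u" and W: "W ** frame_mat u = mat 1"
  shows "H $ a $ b = (\<Sum>r\<in>UNIV. W $ r $ a * cnj (W $ r $ b))"
    and "(\<Sum>p\<in>UNIV. u p $ a * (W *v x) $ p) = x $ a"
proof -
  let ?U = "frame_mat u"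
  have UW: "?U ** W = mat 1" using W matrix_left_right_inverse by blast
  have tUW: "transpose W ** transpose ?U = mat 1"
    by (metis UW matrix_transpose_mul transpose_mat)
  have cUW: "cnj_mat ?U ** cnj_mat W = mat 1"
  proof -
    have "cnj_mat ?U ** cnj_mat W = cnj_mat (?U ** W)"
      by (simp add: cnj_mat_def matrix_matrix_mult_def vec_eq_iff)
    then show ?thesis unfolding UW by (simp add: cnj_mat_def mat_def vec_eq_iff)
  qed
  have 1: "transpose ?U ** (H ** cnj_mat ?U) = mat 1" using assms unitary_frame_matrix by blast
  have "transpose W ** (transpose ?U ** (H ** cnj_mat ?U)) ** cnj_mat W = transpose W ** cnj_mat W"
    unfolding 1 by (simp add: matrix_mul_rid)
  also have "transpose W ** (transpose ?U ** (H ** cnj_mat ?U)) ** cnj_mat W = (transpose W ** transpose ?U) ** H ** (cnj_mat ?U ** cnj_mat W)"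
    by (simp only: matrix_mul_assoc)
  finally have "H = transpose W ** cnj_mat W" unfolding tUW cUW by (simp add: matrix_mul_lid matrix_mul_rid)
  then show "H $ a $ b = (\<Sum>r\<in>UNIV. W $ r $ a * cnj (W $ r $ b))"
    by (simp add: matrix_matrix_mult_def transpose_def cnj_mat_def)
  have "?U *v (W *v x) = x" by (simp add: matrix_vector_mul_assoc UW matrix_vector_mul_lid)
  then have "(?U *v (W *v x)) $ a = x $ a" by simp
  then show "(\<Sum>p\<in>UNIV. u p $ a * (W *v x) $ p) = x $ a"
    by (simp add: matrix_vector_mult_def frame_mat_def)
qed

lemma hermitian_metricD:
  assumes "hermitian_metric A h" "c \<in> A"
  shows "smooth_on (img c) (h c)" "z \<in> img c \<Longrightarrow> herm_pos (h c z)"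
    "c' \<in> A \<Longrightarrow> z \<in> overlap c c' \<Longrightarrow> herm_form (h c z) u v =
        herm_form (h c' (transition c c' z)) (frechet_derivative (transition c c') (at z) u)
          (frechet_derivative (transition c c') (at z) v)"
  using assms unfolding hermitian_metric_def herm_pos_def Let_def by blast+

lemma ddb_expand:
  assumes "open W" "z \<in> W" and S: "\<And>c d. Ck_on 2 W (\<lambda>w. S w $ c $ d)"
  shows "ddb S a x b y z = (\<Sum>c\<in>UNIV. \<Sum>d\<in>UNIV. x $ c * cnj (y $ d) * dl a (db b (\<lambda>w. S w $ c $ d)) z)"
proof -
  have S1: "(\<lambda>w. S w $ c $ d) differentiable (at w)" if "w \<in> W" for c d w
    using Ck_on_differentiable[OF S _ that] by simp
  have S2: "db b (\<lambda>w. S w $ c $ d) differentiable (at z)" for c d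
    using Ck_on_differentiable[OF Ck_on_cd[OF assms(1), of 1] _ assms(2)] S by (simp add: numeral_2_eq_2)
  have 1: "db b (\<lambda>w. herm_form (S w) x y) w = (\<Sum>c\<in>UNIV. \<Sum>d\<in>UNIV. x $ c * cnj (y $ d) * db b (\<lambda>w. S w $ c $ d) w)"
    if "w \<in> W" for w
  proof -
    have "herm_form (S w) x y = (\<Sum>c\<in>UNIV. \<Sum>d\<in>UNIV. x $ c * cnj (y $ d) * S w $ c $ d)" for w
      unfolding herm_form_def by (simp add: mult_ac)
    then show ?thesis using S1[OF that] by (simp add: cd_sum cd_cmult differentiable_sum differentiable_mult)
  qed
  have "ddb S a x b y z = dl a (\<lambda>w. \<Sum>c\<in>UNIV. \<Sum>d\<in>UNIV. x $ c * cnj (y $ d) * db b (\<lambda>w. S w $ c $ d) w) z"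
    unfolding ddb_def by (rule cd_cong_open[OF assms(1,2) 1])
  then show ?thesis
    using S2 by (simp add: cd_sum cd_cmult differentiable_sum differentiable_mult)
qed

section \<open>Holomorphic changes of coordinates\<close>

locale holo_change =
  fixes W W' :: "(complex^'m) set" and \<tau> :: "complex^'m \<Rightarrow> complex^'m"
  assumes open_W: "open W" and open_W': "open W'" and \<tau>: "holo_map_on W \<tau>" and \<tau>_in: "z \<in> W \<Longrightarrow> \<tau> z \<in> W'"
begin

definition J :: "complex^'m \<Rightarrow> 'm \<Rightarrow> complex^'m \<Rightarrow> complex" where
  "J x c = dl x (\<lambda>z. \<tau> z $ c)"

lemma Ck_\<tau>: "Ck_on k W \<tau>"
  using \<tau> by (simp add: holo_map_on_def smooth_on_def)

lemma Ck_\<tau>_nth: "Ck_on k W (\<lambda>z. \<tau> z $ c)"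
  by (rule Ck_on_vec_nth[OF open_W Ck_\<tau>])

lemma Ck_J: "Ck_on k W (J x c)"
  unfolding J_def by (rule Ck_on_cd[OF open_W Ck_\<tau>_nth])

lemma diff_W: "Ck_on 1 W g \<Longrightarrow> z \<in> W \<Longrightarrow> g differentiable (at z)"
  by (rule Ck_on_differentiable[of 1]) simp_all

lemma D_\<tau>_nth:
  "z \<in> W \<Longrightarrow> frechet_derivative (\<lambda>z. \<tau> z $ c) (at z) x = frechet_derivative \<tau> (at z) x $ c"
  by (rule frechet_derivative_linear_compose[OF bounded_linear_vec_nth diff_W[OF Ck_\<tau>]])

lemma D_\<tau>_i: "z \<in> W \<Longrightarrow> frechet_derivative \<tau> (at z) (\<i> *s x) = \<i> *s frechet_derivative \<tau> (at z) x"
  using \<tau> by (simp add: holo_map_on_def)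

lemma J_eq: "z \<in> W \<Longrightarrow> J x c z = frechet_derivative \<tau> (at z) x $ c"
  unfolding J_def dl_alt[OF diff_W[OF Ck_\<tau>_nth]] by (simp add: D_\<tau>_nth D_\<tau>_i)

lemma db_\<tau>: "z \<in> W \<Longrightarrow> db x (\<lambda>z. \<tau> z $ c) z = 0"
  unfolding db_alt[OF diff_W[OF Ck_\<tau>_nth]] by (simp add: D_\<tau>_nth D_\<tau>_i)

lemma db_J: assumes "z \<in> W" shows "db b (J x c) z = 0"
proof -
  have "db b (J x c) z = dl x (db b (\<lambda>z. \<tau> z $ c)) z"
    unfolding J_def by (rule cd_commute[OF open_W Ck_\<tau>_nth assms])
  then show ?thesis using cd_cong_open[OF open_W assms, of "db b (\<lambda>z. \<tau> z $ c)" "\<lambda>_. 0"] db_\<tau> by simp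
qed

lemma dl_J_sym: "z \<in> W \<Longrightarrow> dl b (J x c) z = dl x (J b c) z"
  unfolding J_def by (rule cd_commute[OF open_W Ck_\<tau>_nth])

lemma dl_cnj_J: assumes "z \<in> W" shows "dl b (\<lambda>z. cnj (J x c z)) z = 0"
  unfolding cd_cnj[OF diff_W[OF Ck_J assms]] by (simp add: db_J[OF assms])

lemma db_cnj_J: assumes "z \<in> W" shows "db b (\<lambda>z. cnj (J x c z)) z = cnj (dl b (J x c) z)"
  unfolding cd_cnj[OF diff_W[OF Ck_J assms]] by simp

lemma Ck_comp_\<tau>: "Ck_on k W' \<phi> \<Longrightarrow> Ck_on k W (\<lambda>z. \<phi> (\<tau> z))"
  using Ck_on_compose[OF open_W open_W' Ck_\<tau>] \<tau>_in by blast

lemma D_comp_\<tau>: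
  fixes \<phi> :: "complex^'m \<Rightarrow> complex"
  assumes "z \<in> W" "Ck_on 1 W' \<phi>"
  shows "dl x (\<lambda>z. \<phi> (\<tau> z)) z = dl (frechet_derivative \<tau> (at z) x) \<phi> (\<tau> z)"
    "db x (\<lambda>z. \<phi> (\<tau> z)) z = db (frechet_derivative \<tau> (at z) x) \<phi> (\<tau> z)"
proof -
  have d: "\<phi> differentiable (at (\<tau> z))" using Ck_on_differentiable[OF assms(2) _ \<tau>_in[OF assms(1)]] by simp
  have c: "frechet_derivative (\<lambda>z. \<phi> (\<tau> z)) (at z) v = frechet_derivative \<phi> (at (\<tau> z)) (frechet_derivative \<tau> (at z) v)" for v
    by (rule frechet_derivative_comp_apply[OF diff_W[OF Ck_\<tau> assms(1)] d])
  show "dl x (\<lambda>z. \<phi> (\<tau> z)) z = dl (frechet_derivative \<tau> (at z) x) \<phi> (\<tau> z)"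
    "db x (\<lambda>z. \<phi> (\<tau> z)) z = db (frechet_derivative \<tau> (at z) x) \<phi> (\<tau> z)"
    unfolding dl_alt[OF diff_W[OF Ck_comp_\<tau>[OF assms(2)] assms(1)]] dl_alt[OF d]
      db_alt[OF diff_W[OF Ck_comp_\<tau>[OF assms(2)] assms(1)]] db_alt[OF d] c
    by (simp_all add: D_\<tau>_i[OF assms(1)])
qed

text \<open>Mixed second derivatives of a function behave as a tensor under holomorphic maps: in the
  product rule a second derivative of \<tau> could enter only as \<open>dl\<close> of a conjugated
  Jacobian entry, which vanishes.\<close>

lemma dl_db_comp_\<tau>:
  fixes \<phi> :: "complex^'m \<Rightarrow> complex"
  assumes z: "z \<in> W" and \<phi>: "Ck_on 2 W' \<phi>"
  shows "dl a (db b (\<lambda>z. \<phi> (\<tau> z))) z = dl (frechet_derivative \<tau> (at z) a) (db (frechet_derivative \<tau> (at z) b) \<phi>) (\<tau> z)"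
proof -
  have \<phi>1: "Ck_on 1 W' \<phi>" using Ck_on_mono[OF \<phi>, of 1] by simp
  have d\<phi>: "\<phi> differentiable (at w)" if "w \<in> W'" for w using Ck_on_differentiable[OF \<phi> _ that] by simp
  have db\<phi>: "Ck_on 1 W' (db e \<phi>)" for e by (rule Ck_on_cd[OF open_W']) (use \<phi> in \<open>simp add: numeral_2_eq_2\<close>)
  have d2: "db e \<phi> differentiable (at (\<tau> z))" for e using Ck_on_differentiable[OF db\<phi> _ \<tau>_in[OF z]] by simp
  have 1: "db b (\<lambda>z. \<phi> (\<tau> z)) w = (\<Sum>e\<in>UNIV. cnj (J b e w) * db (axis e 1) \<phi> (\<tau> w))" if w: "w \<in> W" for w
    unfolding D_comp_\<tau>(2)[OF w \<phi>1] J_eq[OF w] by (rule db_expansion[OF d\<phi>[OF \<tau>_in[OF w]]])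
  have "dl a (db b (\<lambda>z. \<phi> (\<tau> z))) z = dl a (\<lambda>w. \<Sum>e\<in>UNIV. cnj (J b e w) * db (axis e 1) \<phi> (\<tau> w)) z"
    by (rule cd_cong_open[OF open_W z 1])
  also have "\<dots> = (\<Sum>e\<in>UNIV. cnj (J b e z) * dl a (\<lambda>w. db (axis e 1) \<phi> (\<tau> w)) z)"
  proof -
    have d: "(\<lambda>w. cnj (J b e w)) differentiable (at z)" "(\<lambda>w. db (axis e 1) \<phi> (\<tau> w)) differentiable (at z)" for e
      by (intro differentiable_cnj diff_W[OF Ck_J z]) (rule diff_W[OF Ck_comp_\<tau>[OF db\<phi>] z])
    then show ?thesis by (simp add: cd_sum cd_mult differentiable_mult dl_cnj_J[OF z])
  qed
  also have "\<dots> = (\<Sum>e\<in>UNIV. cnj (J b e z) * dl (frechet_derivative \<tau> (at z) a) (db (axis e 1) \<phi>) (\<tau> z))"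
    unfolding D_comp_\<tau>(1)[OF z db\<phi>] ..
  also have "\<dots> = dl (frechet_derivative \<tau> (at z) a) (\<lambda>w. \<Sum>e\<in>UNIV. cnj (J b e z) * db (axis e 1) \<phi> w) (\<tau> z)"
    using d2 by (simp add: cd_sum cd_cmult differentiable_mult)
  also have "\<dots> = dl (frechet_derivative \<tau> (at z) a) (db (frechet_derivative \<tau> (at z) b) \<phi>) (\<tau> z)"
  proof (rule cd_cong_open[OF open_W' \<tau>_in[OF z]])
    fix w assume w: "w \<in> W'"
    show "(\<Sum>e\<in>UNIV. cnj (J b e z) * db (axis e 1) \<phi> w) = db (frechet_derivative \<tau> (at z) b) \<phi> w"
      unfolding J_eq[OF z] using db_expansion[OF d\<phi>[OF w], of "frechet_derivative \<tau> (at z) b"] by simp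
  qed
  finally show ?thesis .
qed

text \<open>Besides the tensorial part, the derivative along a can hit the Jacobian of x
  (\<open>K\<close>, symmetric in a and x), and the one along the conjugate of b can hit the
  conjugated Jacobian of y (\<open>Q\<close>, symmetric in b and y). The symmetries are those of the
  second derivatives of \<tau>; the signs of \<open>ddb_alt\<close> make these contributions
  cancel.\<close>

lemma ddb_alt_pullback:
  assumes z: "z \<in> W" and S': "\<And>c d. Ck_on 2 W' (\<lambda>w. S' w $ c $ d)"
    and S: "\<And>z x y. z \<in> W \<Longrightarrow> herm_form (S z) x y =
        herm_form (S' (\<tau> z)) (frechet_derivative \<tau> (at z) x) (frechet_derivative \<tau> (at z) y)"
  shows "ddb_alt S u v z = ddb_alt S' (frechet_derivative \<tau> (at z) u) (frechet_derivative \<tau> (at z) v) (\<tau> z)"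
proof -
  define \<sigma> where "\<sigma> c d z = S' (\<tau> z) $ c $ d" for c d z
  have \<sigma>2: "Ck_on 2 W (\<sigma> c d)" for c d unfolding \<sigma>_def[abs_def] by (rule Ck_comp_\<tau>[OF S'])
  have db\<sigma>: "Ck_on 1 W (db b (\<sigma> c d))" for b c d by (rule Ck_on_cd[OF open_W]) (use \<sigma>2 in \<open>simp add: numeral_2_eq_2\<close>)
  have \<sigma>1: "Ck_on 1 W (\<sigma> c d)" for c d by (rule Ck_on_mono[OF \<sigma>2]) simp
  have d: "\<sigma> c d differentiable (at w)" "db b (\<sigma> c d) differentiable (at w)" "J x c differentiable (at w)"
     "(\<lambda>w. cnj (J x c w)) differentiable (at w)" "dl a (J x c) differentiable (at w)"
     "(\<lambda>w. cnj (dl a (J x c) w)) differentiable (at w)" if "w \<in> W" for a b c d x w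
    by (rule diff_W[OF \<sigma>1 that] diff_W[OF db\<sigma> that] diff_W[OF Ck_J that]
      diff_W[OF Ck_on_cd[OF open_W Ck_J] that]
      differentiable_cnj[OF diff_W[OF Ck_J that]] differentiable_cnj[OF diff_W[OF Ck_on_cd[OF open_W Ck_J] that]])+
  define P where "P x b y z = (\<Sum>c\<in>UNIV. \<Sum>d\<in>UNIV. db b (\<sigma> c d) z * J x c z * cnj (J y d z))" for x b y z
  define Q where "Q x b y z = (\<Sum>c\<in>UNIV. \<Sum>d\<in>UNIV. \<sigma> c d z * J x c z * cnj (dl b (J y d) z))" for x b y z
  have dP: "P x b y differentiable (at z)" for x b y
    unfolding P_def[abs_def] using d[OF z] by (intro differentiable_sum differentiable_mult) auto
  have dQ: "Q x b y differentiable (at z)" for x b y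
    unfolding Q_def[abs_def] using d[OF z] by (intro differentiable_sum differentiable_mult) auto
  have 1: "db b (\<lambda>w. herm_form (S w) x y) w = P x b y w + Q x b y w" if w: "w \<in> W" for x b y w
  proof -
    have "db b (\<lambda>w. herm_form (S w) x y) w = db b (\<lambda>w. \<Sum>c\<in>UNIV. \<Sum>d\<in>UNIV. \<sigma> c d w * J x c w * cnj (J y d w)) w"
      by (rule cd_cong_open[OF open_W w]) (simp add: S[unfolded herm_form_def] herm_form_def \<sigma>_def J_eq)
    also have "\<dots> = P x b y w + Q x b y w"
      unfolding P_def Q_def using d[OF w]
      by (simp add: cd_sum cd_mult differentiable_sum differentiable_mult db_J[OF w] db_cnj_J[OF w] sum.distrib)
    finally show ?thesis .
  qed
  have 2: "ddb S a x b y z = dl a (P x b y) z + dl a (Q x b y) z" for a x b y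
  proof -
    have "ddb S a x b y z = dl a (\<lambda>w. P x b y w + Q x b y w) z"
      unfolding ddb_def by (rule cd_cong_open[OF open_W z 1])
    then show ?thesis by (simp add: cd_add[OF dP dQ])
  qed
  have Qs: "dl a (Q x b y) z = dl a (Q x y b) z" for a x b y
    by (rule cd_cong_open[OF open_W z]) (simp add: Q_def dl_J_sym[of _ b y])
  define K where "K a x b y = (\<Sum>c\<in>UNIV. \<Sum>d\<in>UNIV. db b (\<sigma> c d) z * dl a (J x c) z * cnj (J y d z))" for a x b y
  have Ks: "K a x b y = K x a b y" for a x b y unfolding K_def dl_J_sym[OF z, of a x] ..
  have 3: "dl a (P x b y) z = (\<Sum>c\<in>UNIV. \<Sum>d\<in>UNIV. dl a (db b (\<sigma> c d)) z * J x c z * cnj (J y d z)) + K a x b y" for a x b y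
    unfolding P_def[abs_def] K_def using d[OF z]
    by (simp add: cd_sum cd_mult differentiable_sum differentiable_mult dl_cnj_J[OF z] sum.distrib distrib_right)
  have 4: "(\<Sum>c\<in>UNIV. \<Sum>d\<in>UNIV. dl a (db b (\<sigma> c d)) z * J x c z * cnj (J y d z)) =
      ddb S' (frechet_derivative \<tau> (at z) a) (frechet_derivative \<tau> (at z) x)
        (frechet_derivative \<tau> (at z) b) (frechet_derivative \<tau> (at z) y) (\<tau> z)" for a x b y
    unfolding ddb_expand[OF open_W' \<tau>_in[OF z] S'] \<sigma>_def[abs_def] dl_db_comp_\<tau>[OF z S'] J_eq[OF z]
    by (simp add: mult_ac)
  show ?thesis
    unfolding ddb_alt_def 2 3 4 Ks[of v u] Qs[of _ _ v u] by simp
qed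

end

section \<open>Alternation and the astheno-Kaehler condition\<close>

text \<open>Wedge products are handled through the unnormalised alternation \<open>alt\<close> of products of one-forms; the
  constants that this introduces are collected in \<open>coef\<close>.\<close>

definition alt :: "nat \<Rightarrow> ((nat \<Rightarrow> 'v) \<Rightarrow> complex) \<Rightarrow> (nat \<Rightarrow> 'v) \<Rightarrow> complex" where
  "alt n F v = (\<Sum>p\<in>{p. p permutes {..<n}}. of_int (sign p) * F (\<lambda>i. v (p i)))"

lemma sign_mult_sign: "of_int (sign p) * of_int (sign p) = (1 :: complex)"
  by (simp add: of_int_mult[symmetric] del: of_int_mult)

lemma alt_permute:
  assumes q: "q permutes {..<n}"
  shows "alt n (\<lambda>v. F (\<lambda>i. v (q i))) v = of_int (sign q) * alt n F v"
proof -
  let ?f = "\<lambda>p. of_int (sign p) * of_int (sign q) * F (\<lambda>i. v (p i)) :: complex"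
  have "alt n (\<lambda>v. F (\<lambda>i. v (q i))) v = (\<Sum>p\<in>{p. p permutes {..<n}}. ?f (p \<circ> q))"
    unfolding alt_def
  proof (intro sum.cong refl)
    fix p assume "p \<in> {p. p permutes {..<n}}"
    then have "sign (p \<circ> q) = sign p * sign q"
      using q by (intro sign_compose) (auto intro: permutation_permutes[THEN iffD2])
    then show "of_int (sign p) * F (\<lambda>i. v (p (q i))) = ?f (p \<circ> q)"
      using sign_mult_sign[of q] by (simp add: mult.assoc)
  qed
  also have "\<dots> = sum ?f {p. p permutes {..<n}}"
    by (rule sum_permutations_compose_right[OF q, symmetric])
  finally show ?thesis by (simp add: alt_def sum_distrib_left mult_ac)
qed

lemma alt_transpose:
  assumes "a < n" "b < n" "a \<noteq> b"
  shows "alt n (\<lambda>v. F (\<lambda>i. v (Transposition.transpose a b i))) v = - alt n F v"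
  using alt_permute[of "Transposition.transpose a b" n F v] assms permutes_swap_id[of a "{..<n}" b]
  by (simp add: sign_swap_id)

lemma alt_cong:
  "(\<And>p. p permutes {..<n} \<Longrightarrow> F (\<lambda>i. v (p i)) = G (\<lambda>i. v (p i))) \<Longrightarrow> alt n F v = alt n G v"
  unfolding alt_def by (intro sum.cong) auto

lemma alt_sum: "alt n (\<lambda>v. \<Sum>i\<in>I. F i v) v = (\<Sum>i\<in>I. alt n (F i) v)"
  unfolding alt_def sum_distrib_left by (rule sum.swap)

lemma alt_cmult: "alt n (\<lambda>v. c * F v) v = c * alt n F v"
  unfolding alt_def sum_distrib_left by (simp add: mult_ac)

lemma alt_add: "alt n (\<lambda>v. F v + G v) v = alt n F v + alt n G v"
  unfolding alt_def by (simp add: distrib_left sum.distrib)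

text \<open>A permutation of the last k arguments extends to all arguments with the same sign and
  leaves G alone. Its sign therefore occurs squared, and each of the \<open>fact k\<close> inner
  permutations contributes the same value.\<close>

lemma alt_nested:
  assumes G: "\<And>v w. (\<And>i. i < j \<Longrightarrow> v i = w i) \<Longrightarrow> G v = G w"
  shows "alt (j + k) (\<lambda>v. G v * alt k F (\<lambda>i. v (j + i))) v = fact k * alt (j + k) (\<lambda>v. G v * F (\<lambda>i. v (j + i))) v"
proof -
  let ?P = "{q. q permutes {..<k}}"
  have 1: "alt (j + k) (\<lambda>v. G v * F (\<lambda>i. v (j + q i))) v
     = of_int (sign q) * alt (j + k) (\<lambda>v. G v * F (\<lambda>i. v (j + i))) v" if q: "q permutes {..<k}" for q
  proof -
    define Q where "Q = map_permutation {..<k} (\<lambda>i. j + i) q"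
    have Qp: "Q permutes (\<lambda>i. j + i) ` {..<k}"
      unfolding Q_def by (rule map_permutation_permutes[OF _ q]) (auto simp: bij_betw_def inj_on_def)
    have "Q permutes {..<j + k}" by (rule permutes_subset[OF Qp]) auto
    moreover have "sign Q = sign q"
      unfolding Q_def by (rule sign_map_permutation) (use q in \<open>auto simp: inj_on_def\<close>)
    moreover have "Q i = i" if "i < j" for i using permutes_not_in[OF Qp, of i] that by auto
    moreover have "Q (j + i) = j + q i" for i
    proof (cases "i < k")
      case True
      then show ?thesis unfolding Q_def by (intro map_permutation_apply) (auto simp: inj_on_def)
    next
      case False
      then have "j + i \<notin> (\<lambda>i. j + i) ` {..<k}" by auto
      then show ?thesis using permutes_not_in[OF Qp] permutes_not_in[OF q, of i] False by auto
    qed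
    moreover have "G (\<lambda>i. v (Q i)) = G v" for v by (rule G) (simp add: calculation)
    ultimately show ?thesis using alt_permute[of Q "j + k" "\<lambda>v. G v * F (\<lambda>i. v (j + i))" v] by simp
  qed
  have "alt (j + k) (\<lambda>v. G v * alt k F (\<lambda>i. v (j + i))) v =
     alt (j + k) (\<lambda>v. \<Sum>q\<in>?P. of_int (sign q) * (G v * F (\<lambda>i. v (j + q i)))) v"
    by (rule alt_cong) (simp add: alt_def sum_distrib_left mult_ac)
  also have "\<dots> = (\<Sum>q\<in>?P. of_int (sign q) * (of_int (sign q) * alt (j + k) (\<lambda>v. G v * F (\<lambda>i. v (j + i))) v))"
    unfolding alt_sum alt_cmult by (intro sum.cong refl) (simp add: 1)
  also have "\<dots> = (\<Sum>q\<in>?P. alt (j + k) (\<lambda>v. G v * F (\<lambda>i. v (j + i))) v)"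
    unfolding mult.assoc[symmetric] sign_mult_sign by simp
  also have "\<dots> = fact k * alt (j + k) (\<lambda>v. G v * F (\<lambda>i. v (j + i))) v"
    by (simp add: card_permutations)
  finally show ?thesis .
qed

lemma fund_form_power_Suc_alt:
  "fund_form_power H (Suc k) v =
     alt (2 + 2 * k) (\<lambda>v. fund_form H v * fund_form_power H k (\<lambda>i. v (2 + i))) v / (fact 2 * fact (2 * k))"
  by (simp add: wedge_def alt_def mult.assoc)

lemma fund_form_coframe:
  assumes H: "\<And>a b. H $ a $ b = (\<Sum>r\<in>UNIV. W $ r $ a * cnj (W $ r $ b))"
  shows "fund_form H v = \<i> * (\<Sum>r\<in>UNIV. (W *v v 0) $ r * cnj ((W *v v 1) $ r) - (W *v v 1) $ r * cnj ((W *v v 0) $ r))"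
proof -
  have "(\<Sum>a\<in>UNIV. \<Sum>b\<in>UNIV. H $ a $ b * (x $ a * cnj (y $ b))) = (\<Sum>r\<in>UNIV. (W *v x) $ r * cnj ((W *v y) $ r))" for x y
  proof -
    have "(\<Sum>a\<in>UNIV. \<Sum>b\<in>UNIV. H $ a $ b * (x $ a * cnj (y $ b)))
      = (\<Sum>a\<in>UNIV. \<Sum>b\<in>UNIV. \<Sum>r\<in>UNIV. (W $ r $ a * x $ a) * cnj (W $ r $ b * y $ b))"
      unfolding H by (simp add: sum_distrib_right sum_distrib_left mult_ac)
    also have "\<dots> = (\<Sum>r\<in>UNIV. \<Sum>a\<in>UNIV. \<Sum>b\<in>UNIV. (W $ r $ a * x $ a) * cnj (W $ r $ b * y $ b))"
      by (rule sum_rot3)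
    finally show ?thesis by (simp add: matrix_vector_mult_def sum_product)
  qed
  then show ?thesis unfolding fund_form_def right_diff_distrib sum_subtractf by simp
qed

text \<open>Splits one factor off the power. In the coframe the fundamental form is \<i> times a sum
  of wedge products of a one-form with its conjugate; the two terms of such a product differ by a
  sign and a transposition of arguments, so under alternation they agree and give the factor 2. The
  factorials come from \<open>wedge\<close> and from \<open>alt_nested\<close>.\<close>

lemma alt_fund_form_step:
  fixes H :: "complex^'m^'m"
  assumes H: "\<And>a b. H $ a $ b = (\<Sum>r\<in>UNIV. W $ r $ a * cnj (W $ r $ b))"
    and G: "\<And>v w. (\<And>i. i < j \<Longrightarrow> v i = w i) \<Longrightarrow> G v = G w"
  shows "alt (j + 2 * Suc k) (\<lambda>v. G v * fund_form_power H (Suc k) (\<lambda>i. v (j + i))) v =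
    (2 * \<i> * fact (2 + 2 * k) / (fact 2 * fact (2 * k))) *
    (\<Sum>r\<in>UNIV. alt (j + 2 + 2 * k) (\<lambda>v. (G v * ((W *v v j) $ r * cnj ((W *v v (j + 1)) $ r)))
       * fund_form_power H k (\<lambda>i. v (j + 2 + i))) v)"
proof -
  let ?n = "j + (2 + 2 * k)"
  let ?c = "fact 2 * fact (2 * k) :: complex"
  define \<theta> where "\<theta> r x = (W *v x) $ r" for r x
  define P where "P r v = G v * (\<theta> r (v j) * cnj (\<theta> r (v (j + 1)))) * fund_form_power H k (\<lambda>i. v (j + 2 + i))" for r v
  have "alt (j + 2 * Suc k) (\<lambda>v. G v * fund_form_power H (Suc k) (\<lambda>i. v (j + i))) v =
    alt ?n (\<lambda>v. (1 / ?c) * (G v * alt (2 + 2 * k) (\<lambda>v. fund_form H v * fund_form_power H k (\<lambda>i. v (2 + i))) (\<lambda>i. v (j + i)))) v"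
    unfolding fund_form_power_Suc_alt by simp
  also have "\<dots> = (fact (2 + 2 * k) / ?c) * alt ?n (\<lambda>v. G v * (fund_form H (\<lambda>i. v (j + i)) * fund_form_power H k (\<lambda>i. v (j + (2 + i))))) v"
    unfolding alt_cmult by (subst alt_nested[where j = j and k = "2 + 2 * k", OF G]) auto
  also have "(\<lambda>v. G v * (fund_form H (\<lambda>i. v (j + i)) * fund_form_power H k (\<lambda>i. v (j + (2 + i))))) =
     (\<lambda>v. \<i> * ((\<Sum>r\<in>UNIV. P r v) + - 1 * (\<Sum>r\<in>UNIV. P r (\<lambda>i. v (Transposition.transpose j (j + 1) i)))))"
  proof
    fix v :: "nat \<Rightarrow> complex^'m"
    have t: "Transposition.transpose j (j + 1) i = i" if "i < j \<or> i \<ge> j + 2" for i using that by (auto simp: Transposition.transpose_def)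
    have Gt: "G (\<lambda>i. v (Transposition.transpose j (j + 1) i)) = G v" by (rule G) (simp add: t)
    have Pt: "P r (\<lambda>i. v (Transposition.transpose j (j + 1) i)) =
       G v * (\<theta> r (v (j + 1)) * cnj (\<theta> r (v j))) * fund_form_power H k (\<lambda>i. v (j + 2 + i))" for r
      unfolding P_def Gt by (simp add: t)
    show "G v * (fund_form H (\<lambda>i. v (j + i)) * fund_form_power H k (\<lambda>i. v (j + (2 + i)))) =
      \<i> * ((\<Sum>r\<in>UNIV. P r v) + - 1 * (\<Sum>r\<in>UNIV. P r (\<lambda>i. v (Transposition.transpose j (j + 1) i))))"
      unfolding fund_form_coframe[OF H] Pt unfolding P_def \<theta>_def[symmetric]
      by (simp add: sum_subtractf sum_distrib_left sum_distrib_right algebra_simps sum_negf)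
  qed
  also have "alt ?n \<dots> v = \<i> * ((\<Sum>r\<in>UNIV. alt ?n (P r) v) - (\<Sum>r\<in>UNIV. alt ?n (\<lambda>v. P r (\<lambda>i. v (Transposition.transpose j (j + 1) i))) v))"
    unfolding alt_cmult alt_add alt_sum by simp
  also have "\<dots> = 2 * \<i> * (\<Sum>r\<in>UNIV. alt ?n (P r) v)"
    by (subst alt_transpose) (auto simp: sum_negf)
  finally show ?thesis unfolding P_def[abs_def] \<theta>_def by (simp add: add.assoc)
qed

section \<open>Powers of the fundamental form in a unitary coframe\<close>

lemma sum_lists_Suc:
  "(\<Sum>rs | length rs = Suc k. f rs) = (\<Sum>r\<in>(UNIV :: 'm::finite set). \<Sum>rs | length rs = k. f (r # rs))"
proof -
  have "{rs :: 'm list. length rs = Suc k} = (\<lambda>(r, rs). r # rs) ` (UNIV \<times> {rs. length rs = k})"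
    by (auto simp: length_Suc_conv image_iff)
  then have "(\<Sum>rs | length rs = Suc k. f rs) = (\<Sum>(r, rs)\<in>(UNIV :: 'm set) \<times> {rs. length rs = k}. f (r # rs))"
    by (simp add: sum.reindex inj_on_def case_prod_unfold o_def)
  then show ?thesis by (simp add: sum.cartesian_product)
qed

definition pairs :: "complex^'m^'m \<Rightarrow> nat \<Rightarrow> (nat \<Rightarrow> 'm) \<Rightarrow> (nat \<Rightarrow> 'm) \<Rightarrow> (nat \<Rightarrow> complex^'m) \<Rightarrow> complex" where
  "pairs W j x y v = (\<Prod>i<j. (W *v v (2 * i)) $ x i * cnj ((W *v v (2 * i + 1)) $ y i))"

text \<open>The factor with index i is the constant of \<open>alt_fund_form_step\<close>. The
  product enters \<open>dens\<close> and \<open>wt\<close> alike and cancels in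
  \<open>Lam\<close>.\<close>

definition coef :: "nat \<Rightarrow> complex" where
  "coef k = (\<Prod>i<k. 2 * \<i> * fact (2 + 2 * i) / (fact 2 * fact (2 * i)))"

lemma coef_nz: "coef k \<noteq> 0"
proof -
  have "2 * \<i> * fact a / (fact b * fact c) \<noteq> (0::complex)" for a b c by simp
  then show ?thesis unfolding coef_def prod_zero_iff[OF finite_lessThan] by blast
qed

text \<open>All factors are split off in turn. The fundamental form is diagonal in the coframe, so
  the same list rs is appended to the holomorphic and to the antiholomorphic indices.\<close>

lemma alt_pairs_fund_form_power:
  fixes H :: "complex^'m^'m"
  assumes H: "\<And>a b. H $ a $ b = (\<Sum>r\<in>UNIV. W $ r $ a * cnj (W $ r $ b))"
    and "length xs = length ys"
  shows "alt (2 * length xs + 2 * k) (\<lambda>v. pairs W (length xs) ((!) xs) ((!) ys) v * fund_form_power H k (\<lambda>i. v (2 * length xs + i))) v =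
    coef k * (\<Sum>rs | length rs = k. alt (2 * (length xs + k)) (pairs W (length xs + k) ((!) (xs @ rs)) ((!) (ys @ rs))) v)"
  using assms(2)
proof (induction k arbitrary: xs ys)
  case 0
  then show ?case by (simp add: coef_def)
next
  case (Suc k)
  let ?j = "length xs"
  have zero_ext: "pairs W ?j ((!) xs) ((!) ys) v * ((W *v v (2 * ?j)) $ r * cnj ((W *v v (2 * ?j + 1)) $ r)) =
    pairs W (Suc ?j) ((!) (xs @ [r])) ((!) (ys @ [r])) v" for r v
    using Suc.prems unfolding pairs_def by (simp add: nth_append)
  have "alt (2 * ?j + 2 * Suc k) (\<lambda>v. pairs W ?j ((!) xs) ((!) ys) v * fund_form_power H (Suc k) (\<lambda>i. v (2 * ?j + i))) v =
   (2 * \<i> * fact (2 + 2 * k) / (fact 2 * fact (2 * k))) *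
    (\<Sum>r\<in>UNIV. alt (2 * ?j + 2 + 2 * k) (\<lambda>v. (pairs W ?j ((!) xs) ((!) ys) v * ((W *v v (2 * ?j)) $ r * cnj ((W *v v (2 * ?j + 1)) $ r)))
       * fund_form_power H k (\<lambda>i. v (2 * ?j + 2 + i))) v)"
    by (rule alt_fund_form_step[OF H]) (auto simp: pairs_def intro!: prod.cong)
  also have "\<dots> = (2 * \<i> * fact (2 + 2 * k) / (fact 2 * fact (2 * k))) *
    (\<Sum>r\<in>UNIV. alt (2 * length (xs @ [r]) + 2 * k) (\<lambda>v. pairs W (length (xs @ [r])) ((!) (xs @ [r])) ((!) (ys @ [r])) v
       * fund_form_power H k (\<lambda>i. v (2 * length (xs @ [r]) + i))) v)"
    unfolding zero_ext by simp
  also have "\<dots> = (2 * \<i> * fact (2 + 2 * k) / (fact 2 * fact (2 * k))) * (\<Sum>r\<in>UNIV. coef k *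
     (\<Sum>rs | length rs = k. alt (2 * (length (xs @ [r]) + k)) (pairs W (length (xs @ [r]) + k) ((!) ((xs @ [r]) @ rs)) ((!) ((ys @ [r]) @ rs))) v))"
    using Suc.prems by (subst Suc.IH) auto
  also have "\<dots> = coef (Suc k) * (\<Sum>r\<in>UNIV. \<Sum>rs | length rs = k. alt (2 * (?j + Suc k)) (pairs W (?j + Suc k) ((!) (xs @ r # rs)) ((!) (ys @ r # rs))) v)"
    unfolding coef_def by (simp add: sum_distrib_left mult_ac)
  finally show ?case unfolding sum_lists_Suc .
qed

lemma pairs_transpose:
  assumes "a < m" "b < m"
  shows "pairs W m (x \<circ> Transposition.transpose a b) y v = pairs W m x y (\<lambda>i. v (Transposition.transpose (2 * a) (2 * b) i))"
    and "pairs W m x (y \<circ> Transposition.transpose a b) v = pairs W m x y (\<lambda>i. v (Transposition.transpose (2 * a + 1) (2 * b + 1) i))"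
proof -
  have bij: "bij_betw (Transposition.transpose a b) {..<m} {..<m}"
    using assms by (intro permutes_imp_bij permutes_swap_id) auto
  have e: "Transposition.transpose (2 * a) (2 * b) (2 * i) = 2 * Transposition.transpose a b i" "Transposition.transpose (2 * a) (2 * b) (2 * i + 1) = 2 * i + 1"
     "Transposition.transpose (2 * a + 1) (2 * b + 1) (2 * i + 1) = 2 * Transposition.transpose a b i + 1" "Transposition.transpose (2 * a + 1) (2 * b + 1) (2 * i) = 2 * i" for i
    by (auto simp: Transposition.transpose_def) presburger+
  have 1: "(\<Prod>i<m. f (Transposition.transpose a b i)) = (\<Prod>i<m. f i)" for f :: "nat \<Rightarrow> complex"
    by (rule prod.reindex_bij_betw[OF bij])
  show "pairs W m (x \<circ> Transposition.transpose a b) y v = pairs W m x y (\<lambda>i. v (Transposition.transpose (2 * a) (2 * b) i))"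
    unfolding pairs_def e prod.distrib
    using 1[of "\<lambda>i. (W *v v (2 * i)) $ (x \<circ> Transposition.transpose a b) i"] by simp
  show "pairs W m x (y \<circ> Transposition.transpose a b) v = pairs W m x y (\<lambda>i. v (Transposition.transpose (2 * a + 1) (2 * b + 1) i))"
    unfolding pairs_def e prod.distrib
    using 1[of "\<lambda>i. cnj ((W *v v (2 * i + 1)) $ (y \<circ> Transposition.transpose a b) i)"] by simp
qed

lemma alt_pairs_transpose:
  assumes "a < m" "b < m" "a \<noteq> b"
  shows "alt (2 * m) (pairs W m (x \<circ> Transposition.transpose a b) y) v = - alt (2 * m) (pairs W m x y) v"
    and "alt (2 * m) (pairs W m x (y \<circ> Transposition.transpose a b)) v = - alt (2 * m) (pairs W m x y) v"
proof -
  have "alt (2 * m) (pairs W m (x \<circ> Transposition.transpose a b) y) v = alt (2 * m) (\<lambda>v. pairs W m x y (\<lambda>i. v (Transposition.transpose (2 * a) (2 * b) i))) v"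
    by (rule alt_cong) (rule pairs_transpose[OF assms(1,2)])
  then show "alt (2 * m) (pairs W m (x \<circ> Transposition.transpose a b) y) v = - alt (2 * m) (pairs W m x y) v"
    using assms by (subst (asm) alt_transpose) auto
  have "alt (2 * m) (pairs W m x (y \<circ> Transposition.transpose a b)) v = alt (2 * m) (\<lambda>v. pairs W m x y (\<lambda>i. v (Transposition.transpose (2 * a + 1) (2 * b + 1) i))) v"
    by (rule alt_cong) (rule pairs_transpose[OF assms(1,2)])
  then show "alt (2 * m) (pairs W m x (y \<circ> Transposition.transpose a b)) v = - alt (2 * m) (pairs W m x y) v"
    using assms by (subst (asm) alt_transpose) auto
qed

lemma alt_pairs_repeat:
  assumes "\<not> inj_on x {..<m} \<or> \<not> inj_on y {..<m}"
  shows "alt (2 * m) (pairs W m x y) v = 0"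
proof -
  have tr: "z \<circ> Transposition.transpose a b = z" if "z a = z b" for z :: "nat \<Rightarrow> 'm" and a b
    using that by (auto simp: fun_eq_iff Transposition.transpose_def)
  have eq0: "(c::complex) = - c \<Longrightarrow> c = 0" for c by simp
  from assms show ?thesis
  proof
    assume "\<not> inj_on x {..<m}"
    then obtain a b where "a < m" "b < m" "a \<noteq> b" "x a = x b" by (auto simp: inj_on_def)
    then show ?thesis using alt_pairs_transpose(1)[of a m b W x y v] tr[of x a b] eq0 by simp
  next
    assume "\<not> inj_on y {..<m}"
    then obtain a b where "a < m" "b < m" "a \<noteq> b" "y a = y b" by (auto simp: inj_on_def)
    then show ?thesis using alt_pairs_transpose(2)[of a m b W x y v] tr[of y a b] eq0 by simp
  qed
qed

text \<open>Permuting both index sequences in the same way produces the sign twice.\<close>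

lemma alt_pairs_permute:
  assumes "\<pi> permutes {..<m}"
  shows "alt (2 * m) (pairs W m (x \<circ> \<pi>) (x \<circ> \<pi>)) v = alt (2 * m) (pairs W m x x) v"
  using assms finite_lessThan
proof (induction arbitrary: x rule: permutes_induct)
  case id
  then show ?case by simp
next
  case (swap a b p)
  have "alt (2 * m) (pairs W m (x \<circ> (Transposition.transpose a b \<circ> p)) (x \<circ> (Transposition.transpose a b \<circ> p))) v =
     alt (2 * m) (pairs W m (x \<circ> Transposition.transpose a b) (x \<circ> Transposition.transpose a b)) v"
    unfolding o_assoc by (rule swap.IH)
  also have "\<dots> = alt (2 * m) (pairs W m x x) v"
    using swap.hyps alt_pairs_transpose[of a m b W] by simp
  finally show ?case .
qed

lemma pairs_cong: "(\<And>i. i < m \<Longrightarrow> x i = x' i) \<Longrightarrow> (\<And>i. i < m \<Longrightarrow> y i = y' i) \<Longrightarrow> pairs W m x y v = pairs W m x' y' v"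
  unfolding pairs_def by (intro prod.cong) auto

lemma alt_pairs_bij:
  assumes "bij_betw x {..<m} S" "bij_betw x0 {..<m} S"
  shows "alt (2 * m) (pairs W m x x) v = alt (2 * m) (pairs W m x0 x0) v"
proof -
  define \<pi> where "\<pi> i = (if i < m then inv_into {..<m} x0 (x i) else i)" for i
  have "bij_betw (inv_into {..<m} x0 \<circ> x) {..<m} {..<m}"
    using bij_betw_trans[OF assms(1) bij_betw_inv_into[OF assms(2)]] .
  then have "bij_betw \<pi> {..<m} {..<m}"
    by (subst bij_betw_cong[of _ _ "inv_into {..<m} x0 \<circ> x"]) (auto simp: \<pi>_def)
  then have p: "\<pi> permutes {..<m}" by (rule bij_imp_permutes) (simp add: \<pi>_def)
  have e: "(x0 \<circ> \<pi>) i = x i" if "i < m" for i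
    using that assms bij_betwE[OF assms(1)] by (auto simp: \<pi>_def bij_betw_def intro: f_inv_into_f)
  have "alt (2 * m) (pairs W m x x) v = alt (2 * m) (pairs W m (x0 \<circ> \<pi>) (x0 \<circ> \<pi>)) v"
    by (rule alt_cong) (rule pairs_cong; simp only: e)
  then show ?thesis by (simp add: alt_pairs_permute[OF p])
qed

text \<open>The list rs uses up m - 2 of the m indices. If nothing is repeated, p, s and q, t are
  both the two missing indices and agree up to order; the exchange costs a sign. A repeated index
  gives zero.\<close>

lemma alt_pairs_four:
  fixes rs :: "'m::finite list" and x0 :: "nat \<Rightarrow> 'm"
  defines "m \<equiv> CARD('m)"
  assumes m: "2 \<le> m" and rs: "length rs = m - 2" and x0: "bij_betw x0 {..<m} UNIV"
  shows "alt (2 * m) (pairs W m ((!) (p # s # rs)) ((!) (q # t # rs))) v =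
    (if distinct (p # s # rs) then ((if p = q \<and> s = t then 1 else 0) - (if p = t \<and> s = q then 1 else 0))
       * alt (2 * m) (pairs W m x0 x0) v else 0)"
proof -
  let ?D = "\<lambda>xs ys. alt (2 * m) (pairs W m ((!) xs) ((!) ys)) v"
  have rep: "?D xs ys = 0" if "length xs = m" "length ys = m" "\<not> distinct xs \<or> \<not> distinct ys" for xs ys
    by (rule alt_pairs_repeat) (use that in \<open>auto simp: distinct_conv_nth inj_on_def\<close>)
  have full: "set xs = UNIV" if "length xs = m" "distinct xs" for xs :: "'m list"
    using that by (intro card_subset_eq) (auto simp: distinct_card m_def)
  have diag: "?D xs xs = alt (2 * m) (pairs W m x0 x0) v" if "length xs = m" "distinct xs" for xs
    by (rule alt_pairs_bij[OF bij_betw_nth x0]) (use that full in auto)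
  have len: "length (a # b # rs) = m" for a b using m rs by simp
  show ?thesis
  proof (cases "distinct (p # s # rs)")
    case False
    then have "?D (p # s # rs) (q # t # rs) = 0" using rep[OF len len] by blast
    then show ?thesis using False by (simp only: if_False)
  next
    case dp: True
    show ?thesis
    proof (cases "distinct (q # t # rs)")
      case False
      then have "\<not> (p = q \<and> s = t)" "\<not> (p = t \<and> s = q)" using dp by auto
      moreover have "?D (p # s # rs) (q # t # rs) = 0" using False rep[OF len len] by blast
      ultimately show ?thesis by (simp only: if_False if_cancel diff_self mult_zero_left)
    next
      case dq: True
      have "{p, s} \<union> set rs = UNIV" "{q, t} \<union> set rs = UNIV"
        using full[OF len dp] full[OF len dq] by auto
      then have "{p, s} = UNIV - set rs" "{q, t} = UNIV - set rs" using dp dq by auto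
      then have "{p, s} = {q, t}" by simp
      then consider "p = q" "s = t" | "p = t" "s = q" by (auto simp: doubleton_eq_iff)
      then show ?thesis
      proof cases
        case 1
        moreover have "\<not> (p = t \<and> s = q)" using 1 dp by auto
        moreover have "p = q \<and> s = t" using 1 by simp
        ultimately show ?thesis using diag[OF len dp] dp by (simp only: if_True if_False diff_zero mult_1 simp_thms)
      next
        case 2
        have "(!) (s # p # rs) = (!) (p # s # rs) \<circ> Transposition.transpose 0 1"
        proof
          fix k
          consider "k = 0" | "k = 1" | j where "k = Suc (Suc j)" by (metis One_nat_def not0_implies_Suc)
          then show "(!) (s # p # rs) k = ((!) (p # s # rs) \<circ> Transposition.transpose 0 1) k"
            by cases (simp_all add: Transposition.transpose_def)
        qed
        then have "?D (p # s # rs) (s # p # rs) = - ?D (p # s # rs) (p # s # rs)"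
          using alt_pairs_transpose(2)[of 0 m 1] m by (simp only:) simp
        moreover have "\<not> (p = q \<and> s = t)" using 2 dp by auto
        moreover have "p = t \<and> s = q" using 2 by simp
        ultimately show ?thesis using diag[OF len dp] dp 2
          by (simp only: if_True if_False diff_0 mult_minus1 simp_thms)
      qed
    qed
  qed
qed

lemma card_distinct_extensions:
  assumes "p \<noteq> (s :: 'm::finite)"
  shows "card {rs. length rs = CARD('m) - 2 \<and> distinct (p # s # rs)} = fact (CARD('m) - 2)"
proof -
  have c: "card (UNIV - {p, s}) = CARD('m) - 2"
    using assms by (simp add: card_Diff_subset)
  have "{rs. length rs = CARD('m) - 2 \<and> distinct (p # s # rs)} =
     {rs. length rs = CARD('m) - 2 \<and> distinct rs \<and> set rs \<subseteq> UNIV - {p, s}}"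
    using assms by auto
  also have "card \<dots> = \<Prod>{1..CARD('m) - 2}"
    by (subst card_lists_distinct_length_eq) (simp_all add: c)
  finally show ?thesis by (simp add: fact_prod)
qed

lemma sum_alt_pairs_four:
  fixes x0 :: "nat \<Rightarrow> 'm::finite"
  defines "m \<equiv> CARD('m)"
  assumes m: "2 \<le> m" and x0: "bij_betw x0 {..<m} UNIV"
  shows "(\<Sum>rs | length rs = m - 2. alt (2 * m) (pairs W m ((!) (p # s # rs)) ((!) (q # t # rs))) v) =
     fact (m - 2) * ((if p = q \<and> s = t then 1 else 0) - (if p = t \<and> s = q then 1 else 0)) * alt (2 * m) (pairs W m x0 x0) v"
proof -
  let ?c = "((if p = q \<and> s = t then 1 else 0) - (if p = t \<and> s = q then 1 else 0)) * alt (2 * m) (pairs W m x0 x0) v"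
  have fin: "finite {rs :: 'm list. length rs = m - 2}"
    using finite_lists_length_eq[of "UNIV :: 'm set"] by simp
  have "(\<Sum>rs | length rs = m - 2. alt (2 * m) (pairs W m ((!) (p # s # rs)) ((!) (q # t # rs))) v) =
    (\<Sum>rs | length rs = m - 2. if distinct (p # s # rs) then ?c else 0)"
    using m x0 unfolding m_def by (intro sum.cong refl alt_pairs_four) auto
  also have "\<dots> = (\<Sum>rs | length rs = m - 2 \<and> distinct (p # s # rs). ?c)"
    using fin by (simp add: sum.inter_filter[symmetric] Collect_conj_eq[symmetric])
  also have "\<dots> = of_nat (card {rs. length rs = m - 2 \<and> distinct (p # s # rs)}) * ?c" by simp
  also have "\<dots> = of_nat (fact (m - 2)) * ?c"
  proof (cases "p = s")
    case False
    then show ?thesis unfolding m_def by (subst card_distinct_extensions) auto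
  qed auto
  finally show ?thesis by (simp add: mult.assoc)
qed

section \<open>Values of top degree forms on a real basis\<close>

definition real_frame :: "nat \<Rightarrow> complex^'m" where
  "real_frame = (SOME v. bij_betw v {..<2 * CARD('m)} Basis)"

lemma real_frame: "bij_betw (real_frame :: nat \<Rightarrow> complex^'m) {..<2 * CARD('m)} Basis"
proof -
  have "card (Basis :: (complex^'m) set) = 2 * CARD('m)" by simp
  then have "\<exists>v. bij_betw v {..<2 * CARD('m)} (Basis :: (complex^'m) set)"
    by (metis bij_betw_iff_card card_lessThan finite_Basis finite_lessThan)
  then show ?thesis unfolding real_frame_def by (rule someI_ex)
qed

text \<open>The value on \<open>real_frame\<close> of the top degree form built from the coframe W
  and its conjugate. By \<open>alt_pairs_bij\<close> it does not depend on the enumeration of the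
  indices.\<close>

definition vol :: "complex^'m^'m \<Rightarrow> complex" where
  "vol W = (let x = (SOME x. bij_betw x {..<CARD('m)} (UNIV :: 'm set)) in
     alt (2 * CARD('m)) (pairs W CARD('m) x x) real_frame)"

text \<open>A multiple of the coefficient of the real volume form in the wedge product of
  \<open>dz\<^sup>a\<close>, the conjugate of \<open>dz\<^sup>b\<close>, \<open>dz\<^sup>c\<close>, the conjugate of \<open>dz\<^sup>d\<close> and the power \<open>m - 2\<close> of the fundamental form.\<close>

definition Ecoef :: "complex^'m^'m \<Rightarrow> 'm \<Rightarrow> 'm \<Rightarrow> 'm \<Rightarrow> 'm \<Rightarrow> complex" where
  "Ecoef H a b c d = alt (2 * CARD('m)) (\<lambda>v. v 0 $ a * cnj (v 1 $ b) * (v 2 $ c * cnj (v 3 $ d)) *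
      fund_form_power H (CARD('m) - 2) (\<lambda>i. v (4 + i))) real_frame"

lemma sum_delta2:
  fixes f :: "'a::finite \<Rightarrow> 'a \<Rightarrow> complex"
  shows "(\<Sum>q\<in>UNIV. \<Sum>t\<in>UNIV. f q t * (if p = q \<and> s = t then 1 else 0)) = f p s"
proof -
  have "(\<Sum>q\<in>UNIV. \<Sum>t\<in>UNIV. f q t * (if p = q \<and> s = t then 1 else 0)) = (\<Sum>q\<in>UNIV. if p = q then (\<Sum>t\<in>UNIV. if s = t then f q t else 0) else 0)"
  proof (rule sum.cong[OF refl])
    fix q
    show "(\<Sum>t\<in>UNIV. f q t * (if p = q \<and> s = t then 1 else 0)) = (if p = q then (\<Sum>t\<in>UNIV. if s = t then f q t else 0) else 0)"
      by (cases "p = q") (simp_all add: if_distrib[of "(*) _"] cong: if_cong)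
  qed
  then show ?thesis by simp
qed

text \<open>The coordinate forms are expanded in the coframe dual to u, with the components of u as
  coefficients. Wedging with the power of the fundamental form then leaves only the two index
  patterns of \<open>sum_alt_pairs_four\<close>, which collapse the sum over four indices to one
  over p and s.\<close>

lemma Ecoef_frame:
  fixes H :: "complex^'m^'m"
  assumes m: "2 \<le> CARD('m)" and u: "unitary_frame H u" and W: "W ** frame_mat u = mat 1"
  shows "Ecoef H a b c d = coef (CARD('m) - 2) * fact (CARD('m) - 2) * vol W *
    (\<Sum>p\<in>UNIV. \<Sum>s\<in>UNIV. u p $ a * cnj (u p $ b) * (u s $ c * cnj (u s $ d)) - u p $ a * cnj (u s $ b) * (u s $ c * cnj (u p $ d)))"
proof -
  let ?m = "CARD('m)"
  define x0 where "x0 = (SOME x. bij_betw x {..<?m} (UNIV :: 'm set))"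
  have "\<exists>x. bij_betw x {..<?m} (UNIV :: 'm set)"
    using ex_bij_betw_nat_finite[of "UNIV :: 'm set"] by (auto simp: atLeast0LessThan)
  then have x0: "bij_betw x0 {..<?m} UNIV" unfolding x0_def by (rule someI_ex)
  have vol: "alt (2 * ?m) (pairs W ?m x0 x0) real_frame = vol W" by (simp add: vol_def x0_def Let_def)
  note co = unitary_frame_coframe[OF u W]
  define U where "U p q s t = u p $ a * cnj (u q $ b) * (u s $ c * cnj (u t $ d))" for p q s t
  have p2: "pairs W 2 ((!) [p, s]) ((!) [q, t]) v =
     (W *v v 0) $ p * cnj ((W *v v 1) $ q) * ((W *v v 2) $ s * cnj ((W *v v 3) $ t))" for p q s t v
    by (simp add: pairs_def numeral_2_eq_2 numeral_3_eq_3)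
  have 1: "v 0 $ a * cnj (v 1 $ b) * (v 2 $ c * cnj (v 3 $ d)) =
    (\<Sum>p\<in>UNIV. \<Sum>q\<in>UNIV. \<Sum>s\<in>UNIV. \<Sum>t\<in>UNIV. U p q s t * pairs W 2 ((!) [p, s]) ((!) [q, t]) v)" for v
  proof -
    have "v 0 $ a * cnj (v 1 $ b) * (v 2 $ c * cnj (v 3 $ d)) =
      (\<Sum>p\<in>UNIV. u p $ a * (W *v v 0) $ p) * (\<Sum>q\<in>UNIV. cnj (u q $ b * (W *v v 1) $ q)) *
      ((\<Sum>s\<in>UNIV. u s $ c * (W *v v 2) $ s) * (\<Sum>t\<in>UNIV. cnj (u t $ d * (W *v v 3) $ t)))"
      by (simp only: cnj_sum[symmetric] co(2))
    also have "\<dots> = (\<Sum>p\<in>UNIV. \<Sum>q\<in>UNIV. \<Sum>s\<in>UNIV. \<Sum>t\<in>UNIV. U p q s t * pairs W 2 ((!) [p, s]) ((!) [q, t]) v)"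
      unfolding sum_product unfolding p2 U_def sum_distrib_left sum_distrib_right
      by (rule sum.cong[OF refl], subst sum.swap) (simp add: mult_ac)
    finally show ?thesis .
  qed
  have 2: "alt (2 * ?m) (\<lambda>v. pairs W 2 ((!) [p, s]) ((!) [q, t]) v * fund_form_power H (?m - 2) (\<lambda>i. v (4 + i))) real_frame
     = coef (?m - 2) * (fact (?m - 2) * ((if p = q \<and> s = t then 1 else 0) - (if p = t \<and> s = q then 1 else 0)) * vol W)" for p q s t
  proof -
    have e: "length [p, s] = 2" "length [p, s] = length [q, t]" "2 * (2::nat) = 4" "4 + 2 * (?m - 2) = 2 * ?m" "2 + (?m - 2) = ?m" using m by auto
    have l: "[a, b] @ rs = a # b # rs" for a b and rs :: "'m list" by simp
    show ?thesis
      using alt_pairs_fund_form_power[OF co(1) e(2), of "?m - 2" real_frame]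
      unfolding e(1,3-5) l sum_alt_pairs_four[OF m x0] vol .
  qed
  have "Ecoef H a b c d = alt (2 * ?m) (\<lambda>v. \<Sum>p\<in>UNIV. \<Sum>q\<in>UNIV. \<Sum>s\<in>UNIV. \<Sum>t\<in>UNIV. U p q s t *
      (pairs W 2 ((!) [p, s]) ((!) [q, t]) v * fund_form_power H (?m - 2) (\<lambda>i. v (4 + i)))) real_frame"
    unfolding Ecoef_def 1 by (simp add: sum_distrib_right mult.assoc)
  also have "\<dots> = (\<Sum>p\<in>UNIV. \<Sum>q\<in>UNIV. \<Sum>s\<in>UNIV. \<Sum>t\<in>UNIV. U p q s t * (coef (?m - 2) * (fact (?m - 2) * ((if p = q \<and> s = t then 1 else 0) - (if p = t \<and> s = q then 1 else 0)) * vol W)))"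
    unfolding alt_sum alt_cmult 2 ..
  also have "\<dots> = coef (?m - 2) * fact (?m - 2) * vol W * (\<Sum>p\<in>UNIV. \<Sum>q\<in>UNIV. \<Sum>s\<in>UNIV. \<Sum>t\<in>UNIV.
     U p q s t * (if p = q \<and> s = t then 1 else 0) - U p q s t * (if p = t \<and> s = q then 1 else 0))"
    by (simp add: sum_distrib_left algebra_simps)
  also have "(\<Sum>p\<in>UNIV. \<Sum>q\<in>UNIV. \<Sum>s\<in>UNIV. \<Sum>t\<in>UNIV.
     U p q s t * (if p = q \<and> s = t then 1 else 0) - U p q s t * (if p = t \<and> s = q then 1 else 0)) =
     (\<Sum>p\<in>UNIV. \<Sum>s\<in>UNIV. \<Sum>q\<in>UNIV. \<Sum>t\<in>UNIV.
     U p q s t * (if p = q \<and> s = t then 1 else 0) - U p q s t * (if s = q \<and> p = t then 1 else 0))"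
    by (rule sum.cong[OF refl], subst sum.swap) (intro sum.cong refl arg_cong2[where f = minus] arg_cong2[where f = times] if_cong conj_commute)
  also have "\<dots> = (\<Sum>p\<in>UNIV. \<Sum>s\<in>UNIV. U p p s s - U p s s p)"
    unfolding sum_subtractf sum_delta2 ..
  finally show ?thesis unfolding U_def .
qed

text \<open>The Leibniz formula. The bijection \<beta> transports permutations of an initial segment
  of the naturals to permutations of the finite index type over which \<open>det\<close> is
  defined.\<close>

lemma alt_prod_det:
  fixes \<beta> :: "nat \<Rightarrow> 'k::finite"
  assumes \<beta>: "bij_betw \<beta> {..<n} UNIV"
  shows "alt n (\<lambda>v. \<Prod>i<n. l i (v i)) v =
    det (\<chi> i j. l (inv_into {..<n} \<beta> i) (v (inv_into {..<n} \<beta> j)))"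
proof -
  let ?M = "\<chi> i j. l (inv_into {..<n} \<beta> i) (v (inv_into {..<n} \<beta> j))"
  let ?\<Phi> = "map_permutation {..<n} \<beta>"
  have inj: "inj_on \<beta> {..<n}" using \<beta> by (simp add: bij_betw_def)
  have inv: "inv_into {..<n} \<beta> (\<beta> i) = i" if "i < n" for i using inj that by (intro inv_into_f_f) auto
  have inv': "\<beta> (inv_into {..<n} \<beta> j) = j" "inv_into {..<n} \<beta> j < n" for j
    using f_inv_into_f[of j \<beta> "{..<n}"] inv_into_into[of j \<beta> "{..<n}"] \<beta> by (auto simp: bij_betw_def)
  have "det ?M = (\<Sum>p\<in>{p. p permutes UNIV}. of_int (sign p) * (\<Prod>i\<in>UNIV. ?M $ i $ p i))"
    by (simp add: det_def)
  also have "\<dots> = (\<Sum>p\<in>{p. p permutes {..<n}}. of_int (sign p) * (\<Prod>i<n. l i (v (p i))))"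
  proof (rule sum.reindex_bij_witness[where j = "map_permutation UNIV (inv_into {..<n} \<beta>)" and i = ?\<Phi>])
    have b': "bij_betw (inv_into {..<n} \<beta>) UNIV {..<n}" by (rule bij_betw_inv_into[OF \<beta>])
    fix p assume p: "p \<in> {p. p permutes (UNIV :: 'k set)}"
    show "?\<Phi> (map_permutation UNIV (inv_into {..<n} \<beta>) p) = p"
      by (rule map_permutation_compose_inv[OF b']) (use p inv' in auto)
    show q: "map_permutation UNIV (inv_into {..<n} \<beta>) p \<in> {p. p permutes {..<n}}"
      using map_permutation_permutes[OF b'] p by auto
    have "(\<Prod>i<n. l i (v (map_permutation UNIV (inv_into {..<n} \<beta>) p i))) =
       (\<Prod>i\<in>UNIV. l (inv_into {..<n} \<beta> i) (v (map_permutation UNIV (inv_into {..<n} \<beta>) p (inv_into {..<n} \<beta> i))))"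
      by (rule prod.reindex_bij_betw[OF b', symmetric])
    also have "\<dots> = (\<Prod>i\<in>UNIV. ?M $ i $ p i)"
      by (subst map_permutation_apply) (use b' in \<open>auto simp: bij_betw_def\<close>)
    finally show "of_int (sign (map_permutation UNIV (inv_into {..<n} \<beta>) p)) * (\<Prod>i<n. l i (v (map_permutation UNIV (inv_into {..<n} \<beta>) p i)))
      = of_int (sign p) * (\<Prod>i\<in>UNIV. ?M $ i $ p i)"
      using sign_map_permutation[of "inv_into {..<n} \<beta>" UNIV p] b' p by (simp add: bij_betw_def)
  next
    fix q assume q: "q \<in> {p. p permutes {..<n}}"
    show "map_permutation UNIV (inv_into {..<n} \<beta>) (?\<Phi> q) = q"
      by (rule map_permutation_compose_inv[OF \<beta>]) (use q inv in auto)
    show "?\<Phi> q \<in> {p. p permutes UNIV}"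
      using map_permutation_permutes[OF \<beta>] q by auto
  qed
  finally show ?thesis by (simp add: alt_def)
qed

text \<open>The index type \<open>'m bit0\<close> has \<open>2 m\<close> elements, so that determinants and the change of variables formula for
  \<open>real^'m bit0\<close> become available on \<open>complex^'m\<close>.\<close>

definition enum_bit0 :: "nat \<Rightarrow> 'm::finite bit0" where
  "enum_bit0 = (SOME f. bij_betw f {..<2 * CARD('m)} UNIV)"

lemma enum_bit0: "bij_betw (enum_bit0 :: nat \<Rightarrow> 'm::finite bit0) {..<2 * CARD('m)} UNIV"
proof -
  have "\<exists>f :: nat \<Rightarrow> 'm bit0. bij_betw f {..<2 * CARD('m)} UNIV"
    using ex_bij_betw_nat_finite[of "UNIV :: 'm bit0 set"] by (simp add: atLeast0LessThan)
  then show ?thesis unfolding enum_bit0_def by (rule someI_ex)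
qed

definition real_basis :: "'m::finite bit0 \<Rightarrow> complex^'m" where
  "real_basis = real_frame \<circ> inv_into {..<2 * CARD('m)} enum_bit0"

lemma real_basis: "bij_betw (real_basis :: 'm::finite bit0 \<Rightarrow> complex^'m) UNIV Basis"
  unfolding real_basis_def by (rule bij_betw_trans[OF bij_betw_inv_into[OF enum_bit0] real_frame])

lemma real_basis_Basis [simp]: "real_basis i \<in> Basis"
  using real_basis by (auto simp: bij_betw_def)

lemma real_basis_inner: "real_basis i \<bullet> real_basis j = (if i = j then 1 else 0)"
  using inner_Basis[of "real_basis i" "real_basis j"] bij_betw_imp_inj_on[OF real_basis] by (auto dest: injD)

lemma real_basis_expansion: "x = (\<Sum>k\<in>UNIV. (real_basis k \<bullet> x) *\<^sub>R real_basis k)"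
proof -
  have "x = (\<Sum>b\<in>Basis. (x \<bullet> b) *\<^sub>R b)" by (simp add: euclidean_representation)
  also have "\<dots> = (\<Sum>k\<in>UNIV. (x \<bullet> real_basis k) *\<^sub>R real_basis k)"
    by (rule sum.reindex_bij_betw[OF real_basis, symmetric])
  finally show ?thesis by (simp add: inner_commute)
qed

definition rdet :: "(complex^'m \<Rightarrow> complex^'m) \<Rightarrow> real" where
  "rdet L = det (\<chi> i j. real_basis i \<bullet> L (real_basis j))"

lemma alt_real_frame_det:
  "alt (2 * CARD('m::finite)) (\<lambda>v. \<Prod>i<2 * CARD('m). l i (v i)) (\<lambda>i. L (real_frame i)) =
    det (\<chi> i j. l (inv_into {..<2 * CARD('m)} enum_bit0 i) (L (real_basis j :: complex^'m)))"
  unfolding alt_prod_det[OF enum_bit0] by (simp add: real_basis_def)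

lemma det_of_real: "det (\<chi> i j. complex_of_real (M $ i $ j)) = complex_of_real (det M)"
  unfolding det_def by simp

text \<open>A top degree form pulled back by a real linear map is multiplied by its determinant: the
  matrix of values on the image basis is the old one times the real matrix of L.\<close>

lemma alt_linear_image:
  fixes L :: "complex^'m \<Rightarrow> complex^'m" and l :: "nat \<Rightarrow> complex^'m \<Rightarrow> complex"
  assumes l: "\<And>i. linear (l i)"
  shows "alt (2 * CARD('m)) (\<lambda>v. \<Prod>i<2 * CARD('m). l i (v i)) (\<lambda>i. L (real_frame i)) =
    of_real (rdet L) * alt (2 * CARD('m)) (\<lambda>v. \<Prod>i<2 * CARD('m). l i (v i)) real_frame"
proof -
  let ?inv = "inv_into {..<2 * CARD('m)} (enum_bit0 :: nat \<Rightarrow> 'm bit0)"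
  define A where "A = (\<chi> i j. l (?inv i) (real_basis j))"
  define M where "M = (\<chi> i j. complex_of_real (real_basis i \<bullet> L (real_basis j)))"
  have "(\<chi> i j. l (?inv i) (L (real_basis j))) = A ** M"
  proof (subst vec_eq_iff, intro allI, subst vec_eq_iff, intro allI)
    fix i j
    have "l (?inv i) (L (real_basis j)) = l (?inv i) (\<Sum>k\<in>UNIV. (real_basis k \<bullet> L (real_basis j)) *\<^sub>R real_basis k)"
      using real_basis_expansion[of "L (real_basis j)"] by simp
    also have "\<dots> = (\<Sum>k\<in>UNIV. l (?inv i) (real_basis k) * complex_of_real (real_basis k \<bullet> L (real_basis j)))"
      unfolding linear_sum[OF l] linear_scale[OF l] by (simp add: scaleR_conv_of_real mult.commute)
    finally show "(\<chi> i j. l (?inv i) (L (real_basis j))) $ i $ j = (A ** M) $ i $ j"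
      by (simp add: A_def M_def matrix_matrix_mult_def)
  qed
  moreover have "det M = of_real (rdet L)"
    unfolding M_def rdet_def using det_of_real[of "\<chi> i j. real_basis i \<bullet> L (real_basis j)"] by simp
  ultimately show ?thesis
    unfolding alt_real_frame_det[of l L] alt_real_frame_det[of l "\<lambda>x. x"] A_def[symmetric]
    by (simp add: det_mul)
qed

lemma pairs_eq_prod:
  "pairs W m x y v = (\<Prod>i<2 * m. (\<lambda>z. if even i then (W *v z) $ x (i div 2) else cnj ((W *v z) $ y (i div 2))) (v i))"
  by (induction m) (auto simp: pairs_def mult.assoc)

lemma vol_eq_rdet: "vol (W :: complex^'m^'m) = of_real (rdet ((*v) W)) * vol (mat 1 :: complex^'m^'m)"
proof -
  define x where "x = (SOME x. bij_betw x {..<CARD('m)} (UNIV :: 'm set))"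
  define l where "l i z = (if even i then (mat 1 *v z) $ x (i div 2) else cnj ((mat 1 *v z) $ x (i div 2)))"
    for i and z :: "complex^'m"
  have lin: "linear (l i)" for i
    by (rule linearI) (auto simp: l_def)
  have 1: "pairs (mat 1) CARD('m) x x = (\<lambda>v. \<Prod>i<2 * CARD('m). l i (v i))"
    by (rule ext) (simp add: pairs_eq_prod l_def)
  have "pairs W CARD('m) x x v = pairs (mat 1) CARD('m) x x (\<lambda>i. W *v v i)" for v
    by (simp add: pairs_def matrix_vector_mul_lid)
  then have "alt (2 * CARD('m)) (pairs W CARD('m) x x) real_frame
    = alt (2 * CARD('m)) (pairs (mat 1) CARD('m) x x) (\<lambda>i. W *v real_frame i)"
    unfolding alt_def by simp
  also have "\<dots> = of_real (rdet ((*v) W)) * alt (2 * CARD('m)) (pairs (mat 1) CARD('m) x x) real_frame"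
    unfolding 1 by (rule alt_linear_image[OF lin])
  finally show ?thesis unfolding vol_def Let_def x_def .
qed

text \<open>The forms dz and their conjugates are linearly independent over the complex numbers. A
  kernel vector c of \<open>A\<close> satisfies a linear relation between basis vectors and, by
  conjugation, so does the conjugate of c; half the sum and the difference over 2\<i> are real
  relations for the real and imaginary parts of c, which must vanish.\<close>

lemma vol_mat_1: "vol (mat 1 :: complex^'m^'m) \<noteq> 0"
proof -
  let ?inv = "inv_into {..<2 * CARD('m)} (enum_bit0 :: nat \<Rightarrow> 'm bit0)"
  define x where "x = (SOME x. bij_betw x {..<CARD('m)} (UNIV :: 'm set))"
  have "\<exists>x. bij_betw x {..<CARD('m)} (UNIV :: 'm set)"
    using ex_bij_betw_nat_finite[of "UNIV :: 'm set"] by (auto simp: atLeast0LessThan)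
  then have x: "bij_betw x {..<CARD('m)} UNIV" unfolding x_def by (rule someI_ex)
  define l where "l i z = (if even i then z $ x (i div 2) else cnj (z $ x (i div 2)))"
    for i and z :: "complex^'m"
  define A where "A = (\<chi> i j. l (?inv i) (real_basis j))"
  have "vol (mat 1 :: complex^'m^'m) = alt (2 * CARD('m)) (\<lambda>v. \<Prod>i<2 * CARD('m). l i (v i)) real_frame"
    unfolding vol_def Let_def x_def[symmetric] pairs_eq_prod[abs_def] l_def matrix_vector_mul_lid ..
  also have "\<dots> = det A"
    using alt_real_frame_det[of l "\<lambda>x. x"] by (simp add: A_def)
  finally have v: "vol (mat 1 :: complex^'m^'m) = det A" .
  have "c = 0" if c: "A *v c = 0" for c
  proof -
    have li: "(\<Sum>j\<in>UNIV. l i (real_basis j) * c $ j) = 0" if "i < 2 * CARD('m)" for i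
    proof -
      have "?inv (enum_bit0 i) = i"
        using that enum_bit0[where 'm='m] by (intro inv_into_f_f) (auto simp: bij_betw_def)
      moreover have "(A *v c) $ enum_bit0 i = 0" using c by simp
      ultimately show ?thesis by (simp add: A_def matrix_vector_mult_def)
    qed
    have r: "(\<Sum>j\<in>UNIV. real_basis j $ r * c $ j) = 0" "(\<Sum>j\<in>UNIV. real_basis j $ r * cnj (c $ j)) = 0" for r
    proof -
      obtain k where k: "k < CARD('m)" "x k = r" using x by (metis UNIV_I bij_betw_def imageE lessThan_iff)
      show "(\<Sum>j\<in>UNIV. real_basis j $ r * c $ j) = 0" using li[of "2 * k"] k by (simp add: l_def)
      have "(\<Sum>j\<in>UNIV. cnj (real_basis j $ r) * c $ j) = 0" using li[of "2 * k + 1"] k by (simp add: l_def)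
      then have "cnj (\<Sum>j\<in>UNIV. cnj (real_basis j $ r) * c $ j) = 0" by simp
      then show "(\<Sum>j\<in>UNIV. real_basis j $ r * cnj (c $ j)) = 0" by simp
    qed
    have z: "d i = 0" if "(\<Sum>j\<in>UNIV. d j *\<^sub>R (real_basis j :: complex^'m)) = 0" for d i
    proof -
      have "0 = real_basis i \<bullet> (\<Sum>j\<in>UNIV. d j *\<^sub>R (real_basis j :: complex^'m))" using that by simp
      also have "\<dots> = (\<Sum>j\<in>UNIV. if i = j then d j else 0)"
        unfolding inner_sum_right by (intro sum.cong) (auto simp: real_basis_inner)
      finally show ?thesis by simp
    qed
    have "(\<Sum>j\<in>UNIV. Re (c $ j) *\<^sub>R (real_basis j :: complex^'m)) $ r = 0" for r
    proof -
      have "(\<Sum>j\<in>UNIV. Re (c $ j) *\<^sub>R (real_basis j :: complex^'m)) $ r = ((\<Sum>j\<in>UNIV. real_basis j $ r * c $ j) + (\<Sum>j\<in>UNIV. real_basis j $ r * cnj (c $ j))) / 2"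
        unfolding sum.distrib[symmetric] distrib_left[symmetric] complex_add_cnj
        by (simp add: sum_divide_distrib scaleR_conv_of_real[where 'a = complex] mult_ac)
      then show ?thesis by (simp add: r)
    qed
    then have "(\<Sum>j\<in>UNIV. Re (c $ j) *\<^sub>R (real_basis j :: complex^'m)) = 0" by (simp add: vec_eq_iff)
    from z[OF this] have re: "Re (c $ j) = 0" for j .
    have "(\<Sum>j\<in>UNIV. Im (c $ j) *\<^sub>R (real_basis j :: complex^'m)) $ r = 0" for r
    proof -
      have "(\<Sum>j\<in>UNIV. Im (c $ j) *\<^sub>R (real_basis j :: complex^'m)) $ r = ((\<Sum>j\<in>UNIV. real_basis j $ r * c $ j) - (\<Sum>j\<in>UNIV. real_basis j $ r * cnj (c $ j))) / (2 * \<i>)"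
        unfolding sum_subtractf[symmetric] right_diff_distrib[symmetric] complex_diff_cnj
        by (simp add: sum_divide_distrib scaleR_conv_of_real[where 'a = complex] mult_ac)
      then show ?thesis by (simp add: r)
    qed
    then have "(\<Sum>j\<in>UNIV. Im (c $ j) *\<^sub>R (real_basis j :: complex^'m)) = 0" by (simp add: vec_eq_iff)
    from z[OF this] have "Im (c $ j) = 0" for j .
    with re show "c = 0" by (simp add: vec_eq_iff complex_eq_iff)
  qed
  then have "invertible A" using matrix_left_invertible_ker[of A] invertible_left_inverse[of A] by blast
  then show ?thesis unfolding v by (simp add: invertible_det_nz)
qed

text \<open>In the alternating sums that define \<open>del\<close> and \<open>delbar\<close>, term i
  arises from term 0 by moving one argument past i others. Under \<open>alt\<close> the resulting
  sign cancels the explicit one, so all \<open>Suc k\<close> terms coincide.\<close>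

lemma alt_derivation:
  assumes G: "\<And>v w. (\<And>i. i < j \<Longrightarrow> v i = w i) \<Longrightarrow> G v = G w" and n: "j + k < n"
  shows "alt n (\<lambda>v. G v * (\<Sum>i\<le>k. (-1) ^ i * Y (v (j + i)) (omit i (\<lambda>l. v (j + l))))) v =
    of_nat (Suc k) * alt n (\<lambda>v. G v * Y (v j) (\<lambda>l. v (Suc j + l))) v"
proof -
  define P where "P i v = G v * Y (v (j + i)) (omit i (\<lambda>l. v (j + l)))" for i v
  have step: "P (Suc i) v = P i (\<lambda>l. v (Transposition.transpose (j + i) (j + Suc i) l))" for i v
  proof -
    have "G (\<lambda>l. v (Transposition.transpose (j + i) (j + Suc i) l)) = G v"
      by (rule G) (auto simp: Transposition.transpose_def)
    moreover have "omit i (\<lambda>l. v (Transposition.transpose (j + i) (j + Suc i) (j + l))) = omit (Suc i) (\<lambda>l. v (j + l))"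
    proof
      fix l
      consider "l < i" | "l = i" | "l > i" by linarith
      then show "omit i (\<lambda>l. v (Transposition.transpose (j + i) (j + Suc i) (j + l))) l = omit (Suc i) (\<lambda>l. v (j + l)) l"
        by cases (simp_all add: omit_def Transposition.transpose_def)
    qed
    ultimately show ?thesis unfolding P_def by simp
  qed
  have Pi: "alt n (P i) v = (-1) ^ i * alt n (P 0) v" if "i \<le> k" for i
    using that
  proof (induction i)
    case (Suc i)
    have "alt n (P (Suc i)) v = - alt n (P i) v"
    proof -
      have "alt n (P (Suc i)) v = alt n (\<lambda>v. P i (\<lambda>l. v (Transposition.transpose (j + i) (j + Suc i) l))) v"
        by (rule alt_cong) (rule step)
      also have "\<dots> = - alt n (P i) v" by (rule alt_transpose) (use Suc.prems n in linarith)+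
      finally show ?thesis .
    qed
    then show ?case using Suc by simp
  qed simp
  have 1: "(\<Sum>i\<le>k. (-1) ^ i * alt n (P i) v) = (\<Sum>i\<le>k. alt n (P 0) v)"
    by (rule sum.cong[OF refl], subst Pi) auto
  have "alt n (\<lambda>v. G v * (\<Sum>i\<le>k. (-1) ^ i * Y (v (j + i)) (omit i (\<lambda>l. v (j + l))))) v = alt n (\<lambda>v. \<Sum>i\<le>k. (-1) ^ i * P i v) v"
    unfolding P_def by (simp add: sum_distrib_left mult_ac)
  also have "\<dots> = (\<Sum>i\<le>k. alt n (P 0) v)" unfolding alt_sum alt_cmult 1 ..
  also have "\<dots> = of_nat (Suc k) * alt n (P 0) v" by simp
  also have "P 0 = (\<lambda>v. G v * Y (v j) (\<lambda>l. v (Suc j + l)))"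
    by (simp add: P_def omit_def fun_eq_iff)
  finally show ?thesis .
qed

lemma Ck_fund_form_power:
  assumes "open D" "\<And>a b. Ck_on k D (\<lambda>w. H w $ a $ b)"
  shows "Ck_on k D (\<lambda>w. fund_form_power (H w) l v)"
proof (induction l arbitrary: v)
  case 0
  then show ?case by (simp add: Ck_on_const)
next
  case (Suc l)
  have "Ck_on k D (\<lambda>w. fund_form (H w) v)" for v
    unfolding fund_form_def by (intro Ck_on_mult Ck_on_sum Ck_on_const assms)
  then show ?case
    unfolding fund_form_power.simps wedge_def divide_inverse
    by (intro Ck_on_mult Ck_on_sum Ck_on_const assms(1) Suc.IH)
qed

lemma dz_dzbar:
  assumes "open D" "Ck_on 2 D F" "z \<in> D"
  shows "dz a (dzbar b F) z = dl (axis a 1) (db (axis b 1) F) z" "dzbar b F differentiable (at z)"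
proof -
  have F1: "F differentiable (at w)" if "w \<in> D" for w using Ck_on_differentiable[OF assms(2) _ that] by simp
  have C1: "Ck_on 1 D (db (axis b 1) F)" by (rule Ck_on_cd[OF assms(1)]) (use assms(2) in \<open>simp add: numeral_2_eq_2\<close>)
  have d: "db (axis b 1) F differentiable (at z)" using Ck_on_differentiable[OF C1 _ assms(3)] by simp
  show *: "dzbar b F differentiable (at z)"
    using differentiable_cong_open[OF assms(1,3), of "dzbar b F" "db (axis b 1) F"] dzbar_eq_db[OF F1] d by blast
  show "dz a (dzbar b F) z = dl (axis a 1) (db (axis b 1) F) z"
    unfolding dz_eq_dl[OF *] by (rule cd_cong_open[OF assms(1,3)]) (rule dzbar_eq_db[OF F1])
qed

lemma cd_alt:
  assumes "\<And>v. F v differentiable (at z)"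
  shows "cd p (\<lambda>w. alt n (\<lambda>v. c v * F v w) v0) z = alt n (\<lambda>v. c v * cd p (F v) z) v0"
  unfolding alt_def mult.assoc[symmetric] using assms by (simp add: cd_sum cd_cmult differentiable_mult)

text \<open>The condition is wedged with dz of index c and the conjugate of dz of index d. These
  have constant coefficients, so the result is an equation between second derivatives of the
  functions \<open>Ecoef\<close>. The alternating sums in \<open>del\<close> and
  \<open>delbar\<close> are contracted one after the other by \<open>alt_derivation\<close>, and
  their nonzero factors are divided out.\<close>

lemma astheno_Ecoef:
  fixes Hf :: "complex^'m \<Rightarrow> complex^'m^'m"
  assumes m: "2 < CARD('m)" and D: "open D" and H: "\<And>a b. Ck_on 2 D (\<lambda>w. Hf w $ a $ b)" and z: "z \<in> D"
    and ast: "\<And>v. del (2 * (CARD('m) - 2) + 1) (delbar (2 * (CARD('m) - 2)) (\<lambda>w. fund_form_power (Hf w) (CARD('m) - 2))) z v = 0"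
  shows "(\<Sum>a\<in>UNIV. \<Sum>b\<in>UNIV. dl (axis a 1) (db (axis b 1) (\<lambda>w. Ecoef (Hf w) c d a b)) z) = 0"
proof -
  let ?n = "2 * CARD('m)"
  define k where "k = 2 * (CARD('m) - 2)"
  \<comment> \<open>Room for \<open>alt_derivation\<close>: the total degree is k + 4, namely 2 for
    the extra one-forms and k + 2 for the twice differentiated power.\<close>
  have n: "2 + Suc k < ?n" "3 + k < ?n" unfolding k_def using m by linarith+
  define \<eta> where "\<eta> w v = fund_form_power (Hf w) (CARD('m) - 2) v" for w v
  have \<eta>2: "Ck_on 2 D (\<lambda>w. \<eta> w v)" for v unfolding \<eta>_def by (rule Ck_fund_form_power[OF D H])
  define DD where "DD a b v = dz a (dzbar b (\<lambda>w. \<eta> w v)) z" for a b v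
  have DD: "DD a b v = dl (axis a 1) (db (axis b 1) (\<lambda>w. \<eta> w v)) z" for a b v
    unfolding DD_def by (rule dz_dzbar[OF D \<eta>2 z])
  have dd: "dzbar b (\<lambda>w. \<eta> w v) differentiable (at z)" for b v by (rule dz_dzbar(2)[OF D \<eta>2 z])
  define Y where "Y a y v = (\<Sum>b\<in>UNIV. cnj (y $ b) * DD a b v)" for a and y :: "complex^'m" and v
  define Y1 where "Y1 x v = (\<Sum>a\<in>UNIV. x $ a * (\<Sum>i\<le>k. (-1) ^ i * Y a (v i) (omit i v)))" for x :: "complex^'m" and v
  have s: "Suc 2 = 3" "Suc 3 = 4" by simp_all
  have nz: "0 = x" if "0 = of_nat (Suc i) * x" for i and x :: complex
    using that of_nat_neq_0[where 'a = complex, of i] by (metis mult_eq_0_iff)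
  have del: "del (Suc k) (delbar k \<eta>) z v = (\<Sum>i\<le>Suc k. (-1) ^ i * Y1 (v i) (omit i v))" for v
  proof -
    have "dz a (\<lambda>w. delbar k \<eta> w v) z = (\<Sum>i\<le>k. (-1) ^ i * Y a (v i) (omit i v))" for a v
    proof -
      have t: "(\<lambda>w. (-1) ^ i * (\<Sum>b\<in>UNIV. cnj (v i $ b) * dzbar b (\<lambda>w. \<eta> w (omit i v)) w)) differentiable (at z)" for i
        using dd by (intro differentiable_mult differentiable_sum) auto
      have "delbar k \<eta> = (\<lambda>w v. \<Sum>i\<le>k. (-1) ^ i * (\<Sum>b\<in>UNIV. cnj (v i $ b) * dzbar b (\<lambda>w. \<eta> w (omit i v)) w))"
        by (simp add: delbar_def fun_eq_iff)
      then have "dz a (\<lambda>w. delbar k \<eta> w v) z = dl (axis a 1) (\<lambda>w. \<Sum>i\<le>k. (-1) ^ i * (\<Sum>b\<in>UNIV. cnj (v i $ b) * dzbar b (\<lambda>w. \<eta> w (omit i v)) w)) z"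
        using t by (simp add: dz_eq_dl differentiable_sum)
      also have "\<dots> = (\<Sum>i\<le>k. (-1) ^ i * (\<Sum>b\<in>UNIV. cnj (v i $ b) * dl (axis a 1) (dzbar b (\<lambda>w. \<eta> w (omit i v))) z))"
        using t dd by (simp add: cd_sum cd_cmult differentiable_sum differentiable_mult)
      finally show ?thesis unfolding Y_def DD_def dz_eq_dl[OF dd] .
    qed
    then show ?thesis unfolding del_def Y1_def by simp
  qed
  have "0 = alt ?n (\<lambda>v. (v 0 $ c * cnj (v 1 $ d)) * (\<Sum>i\<le>Suc k. (-1) ^ i * Y1 (v (2 + i)) (omit i (\<lambda>l. v (2 + l))))) real_frame"
  proof -
    have "(\<Sum>i\<le>Suc k. (-1) ^ i * Y1 (v i) (omit i v)) = 0" for v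
      using ast[of v] del[of v] unfolding \<eta>_def[abs_def] k_def Suc_eq_plus1 by argo
    from this[of "\<lambda>l. _ (2 + l)"]
    have Z: "(v 0 $ c * cnj (v 1 $ d)) * (\<Sum>i\<le>Suc k. (-1) ^ i * Y1 (v (2 + i)) (omit i (\<lambda>l. v (2 + l)))) = 0" for v
      by (simp only: mult_zero_right)
    have "alt ?n (\<lambda>v. (v 0 $ c * cnj (v 1 $ d)) * (\<Sum>i\<le>Suc k. (-1) ^ i * Y1 (v (2 + i)) (omit i (\<lambda>l. v (2 + l))))) real_frame
      = alt ?n (\<lambda>v. 0) (real_frame :: nat \<Rightarrow> complex^'m)" by (rule alt_cong) (rule Z)
    then show ?thesis by (simp add: alt_def)
  qed
  also have "\<dots> = of_nat (Suc (Suc k)) * alt ?n (\<lambda>v. (v 0 $ c * cnj (v 1 $ d)) * Y1 (v 2) (\<lambda>l. v (Suc 2 + l))) real_frame"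
    by (rule alt_derivation[where j = 2]) (use n in auto)
  finally have "0 = alt ?n (\<lambda>v. (v 0 $ c * cnj (v 1 $ d)) * Y1 (v 2) (\<lambda>l. v (3 + l))) real_frame"
    unfolding s by (rule nz)
  also have "\<dots> = (\<Sum>a\<in>UNIV. alt ?n (\<lambda>v. (v 0 $ c * cnj (v 1 $ d) * v 2 $ a) * (\<Sum>i\<le>k. (-1) ^ i * Y a (v (3 + i)) (omit i (\<lambda>l. v (3 + l))))) real_frame)"
    unfolding Y1_def alt_sum[symmetric] by (simp add: sum_distrib_left mult_ac)
  also have "\<dots> = (\<Sum>a\<in>UNIV. of_nat (Suc k) * alt ?n (\<lambda>v. (v 0 $ c * cnj (v 1 $ d) * v 2 $ a) * Y a (v 3) (\<lambda>l. v (Suc 3 + l))) real_frame)"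
    by (intro sum.cong refl alt_derivation[where j = 3]) (use n in auto)
  finally have 0: "0 = (\<Sum>a\<in>UNIV. alt ?n (\<lambda>v. (v 0 $ c * cnj (v 1 $ d) * v 2 $ a) * Y a (v 3) (\<lambda>l. v (4 + l))) real_frame)"
    unfolding sum_distrib_left[symmetric] s by (rule nz)
  have E: "dl (axis a 1) (db (axis b 1) (\<lambda>w. Ecoef (Hf w) c d a b)) z =
     alt ?n (\<lambda>v. (v 0 $ c * cnj (v 1 $ d) * (v 2 $ a * cnj (v 3 $ b))) * DD a b (\<lambda>l. v (4 + l))) real_frame" for a b
  proof -
    have d1: "(\<lambda>w. \<eta> w v) differentiable (at w)" if "w \<in> D" for w v
      using Ck_on_differentiable[OF \<eta>2 _ that] by simp
    have d2: "db (axis b 1) (\<lambda>w. \<eta> w v) differentiable (at z)" for v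
      by (rule Ck_on_differentiable[OF Ck_on_cd[OF D, of 1] _ z]) (use \<eta>2 in \<open>simp_all add: numeral_2_eq_2\<close>)
    have "db (axis b 1) (\<lambda>w. Ecoef (Hf w) c d a b) w =
      alt ?n (\<lambda>v. (v 0 $ c * cnj (v 1 $ d) * (v 2 $ a * cnj (v 3 $ b))) * db (axis b 1) (\<lambda>w. \<eta> w (\<lambda>l. v (4 + l))) w) real_frame" if "w \<in> D" for w
      unfolding Ecoef_def \<eta>_def[symmetric] by (rule cd_alt) (rule d1[OF that])
    then have "dl (axis a 1) (db (axis b 1) (\<lambda>w. Ecoef (Hf w) c d a b)) z = dl (axis a 1) (\<lambda>w.
      alt ?n (\<lambda>v. (v 0 $ c * cnj (v 1 $ d) * (v 2 $ a * cnj (v 3 $ b))) * db (axis b 1) (\<lambda>w. \<eta> w (\<lambda>l. v (4 + l))) w) real_frame) z"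
      by (rule cd_cong_open[OF D z])
    also have "\<dots> = alt ?n (\<lambda>v. (v 0 $ c * cnj (v 1 $ d) * (v 2 $ a * cnj (v 3 $ b))) * DD a b (\<lambda>l. v (4 + l))) real_frame"
      unfolding DD by (rule cd_alt) (rule d2)
    finally show ?thesis .
  qed
  show ?thesis unfolding E 0[symmetric] Y_def alt_sum[symmetric] unfolding 0 Y_def
    unfolding alt_sum[symmetric] by (simp add: sum_distrib_left mult_ac)
qed

section \<open>Integration by parts and change of coordinates\<close>

lemma sum_rot5: "(\<Sum>a\<in>A. \<Sum>b\<in>B. \<Sum>c\<in>C. \<Sum>d\<in>D. \<Sum>e\<in>E. f a b c d e)
   = (\<Sum>e\<in>E. \<Sum>a\<in>A. \<Sum>b\<in>B. \<Sum>c\<in>C. \<Sum>d\<in>D. f a b c d e)"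
proof -
  have "(\<Sum>a\<in>A. \<Sum>b\<in>B. \<Sum>c\<in>C. \<Sum>d\<in>D. \<Sum>e\<in>E. f a b c d e)
    = (\<Sum>a\<in>A. \<Sum>e\<in>E. \<Sum>b\<in>B. \<Sum>c\<in>C. \<Sum>d\<in>D. f a b c d e)"
    by (rule sum.cong[OF refl]) (rule sum_rot4)
  also have "\<dots> = (\<Sum>e\<in>E. \<Sum>a\<in>A. \<Sum>b\<in>B. \<Sum>c\<in>C. \<Sum>d\<in>D. f a b c d e)"
    by (rule sum.swap)
  finally show ?thesis .
qed

lemma sum_rot42: "(\<Sum>a\<in>A. \<Sum>b\<in>B. \<Sum>c\<in>C. \<Sum>d\<in>D. \<Sum>p\<in>P. \<Sum>s\<in>S. f a b c d p s)
   = (\<Sum>p\<in>P. \<Sum>s\<in>S. \<Sum>a\<in>A. \<Sum>b\<in>B. \<Sum>c\<in>C. \<Sum>d\<in>D. f a b c d p s)"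
proof -
  have "(\<Sum>a\<in>A. \<Sum>b\<in>B. \<Sum>c\<in>C. \<Sum>d\<in>D. \<Sum>p\<in>P. \<Sum>s\<in>S. f a b c d p s)
    = (\<Sum>p\<in>P. \<Sum>a\<in>A. \<Sum>b\<in>B. \<Sum>c\<in>C. \<Sum>d\<in>D. \<Sum>s\<in>S. f a b c d p s)"
    by (rule sum_rot5[where f = "\<lambda>a b c d p. \<Sum>s\<in>S. f a b c d p s"])
  also have "\<dots> = (\<Sum>p\<in>P. \<Sum>s\<in>S. \<Sum>a\<in>A. \<Sum>b\<in>B. \<Sum>c\<in>C. \<Sum>d\<in>D. f a b c d p s)"
    by (rule sum.cong[OF refl]) (rule sum_rot5)
  finally show ?thesis .
qed

lemma dl_db_expansion:
  assumes D: "open D" "z \<in> D" and \<phi>: "Ck_on 2 D \<phi>"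
  shows "dl a (db b \<phi>) z = (\<Sum>\<alpha>\<in>UNIV. \<Sum>\<beta>\<in>UNIV. a $ \<alpha> * cnj (b $ \<beta>) * dl (axis \<alpha> 1) (db (axis \<beta> 1) \<phi>) z)"
proof -
  have d1: "\<phi> differentiable (at w)" if "w \<in> D" for w using Ck_on_differentiable[OF \<phi> _ that] by simp
  have C: "Ck_on 1 D (db b \<phi>)" for b by (rule Ck_on_cd[OF D(1)]) (use \<phi> in \<open>simp add: numeral_2_eq_2\<close>)
  have d2: "db b \<phi> differentiable (at z)" for b using Ck_on_differentiable[OF C _ D(2)] by simp
  have "dl a (db b \<phi>) z = dl a (\<lambda>w. \<Sum>\<beta>\<in>UNIV. cnj (b $ \<beta>) * db (axis \<beta> 1) \<phi> w) z"
    by (rule cd_cong_open[OF D]) (rule db_expansion[OF d1])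
  also have "\<dots> = (\<Sum>\<beta>\<in>UNIV. cnj (b $ \<beta>) * dl a (db (axis \<beta> 1) \<phi>) z)"
    using d2 by (simp add: cd_sum cd_cmult differentiable_mult)
  also have "\<dots> = (\<Sum>\<beta>\<in>UNIV. \<Sum>\<alpha>\<in>UNIV. a $ \<alpha> * cnj (b $ \<beta>) * dl (axis \<alpha> 1) (db (axis \<beta> 1) \<phi>) z)"
    by (subst dl_expansion[OF d2]) (simp add: sum_distrib_left mult_ac)
  finally show ?thesis by (subst sum.swap)
qed

text \<open>Up to a constant, the volume coefficient of the mixed second derivative of the form S
  wedged with the power m - 2 of the fundamental form. Written out as a sum of products it can be
  integrated by parts term by term.\<close>

definition dens :: "complex^'m^'m \<Rightarrow> (complex^'m \<Rightarrow> complex^'m^'m) \<Rightarrow> complex^'m \<Rightarrow> complex" where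
  "dens H S z = (\<Sum>c\<in>UNIV. \<Sum>d\<in>UNIV. \<Sum>a\<in>UNIV. \<Sum>b\<in>UNIV.
     Ecoef H c d a b * dl (axis a 1) (db (axis b 1) (\<lambda>w. S w $ c $ d)) z)"

text \<open>By the frame formula below, \<open>wt H\<close> is a constant multiple of the volume density of \<open>H\<close>, so
  that \<open>dens H S / wt H\<close> is a scalar.\<close>

definition wt :: "complex^'m^'m \<Rightarrow> complex" where
  "wt H = (\<Sum>a\<in>UNIV. \<Sum>b\<in>UNIV. \<Sum>c\<in>UNIV. \<Sum>d\<in>UNIV. Ecoef H a b c d * (H $ a $ b * H $ c $ d))"

lemma sum_herm_form: "(\<Sum>a\<in>UNIV. \<Sum>b\<in>UNIV. x $ a * cnj (y $ b) * H $ a $ b) = herm_form H x y"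
  unfolding herm_form_def by (simp add: mult_ac)

text \<open>In the frame H is the identity, so the two patterns of \<open>Ecoef_frame\<close> leave
  the number of ordered pairs of distinct indices. For m = 1 this number is zero, which keeps that
  case out of the integral argument.\<close>

lemma wt_frame:
  fixes H :: "complex^'m^'m"
  assumes m: "2 \<le> CARD('m)" and u: "unitary_frame H u" and W: "W ** frame_mat u = mat 1"
  shows "wt H = coef (CARD('m) - 2) * fact (CARD('m) - 2) * (of_nat CARD('m) * of_nat (CARD('m) - 1)) * vol W"
proof -
  let ?K = "coef (CARD('m) - 2) * fact (CARD('m) - 2) * vol W"
  have uu: "herm_form H (u p) (u q) = (if p = q then 1 else 0)" for p q using u by (simp add: unitary_frame_def)
  have prod: "(\<Sum>a\<in>UNIV. \<Sum>b\<in>UNIV. \<Sum>c\<in>UNIV. \<Sum>d\<in>UNIV. (x $ a * cnj (y $ b) * (x' $ c * cnj (y' $ d))) * (H $ a $ b * H $ c $ d))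
    = herm_form H x y * herm_form H x' y'" for x y x' y' :: "complex^'m"
    unfolding sum_herm_form[symmetric] sum_distrib_left sum_distrib_right
    by (subst sum_rot4, subst sum_rot4) (simp add: mult_ac)
  have "wt H = (\<Sum>a\<in>UNIV. \<Sum>b\<in>UNIV. \<Sum>c\<in>UNIV. \<Sum>d\<in>UNIV. \<Sum>p\<in>UNIV. \<Sum>s\<in>UNIV. ?K * ((u p $ a * cnj (u p $ b) * (u s $ c * cnj (u s $ d))) * (H $ a $ b * H $ c $ d)
     - (u p $ a * cnj (u s $ b) * (u s $ c * cnj (u p $ d))) * (H $ a $ b * H $ c $ d)))"
    unfolding wt_def Ecoef_frame[OF m u W] sum_distrib_left sum_distrib_right by (simp only: left_diff_distrib mult.assoc)
  also have "\<dots> = (\<Sum>p\<in>UNIV. \<Sum>s\<in>UNIV. ?K * (\<Sum>a\<in>UNIV. \<Sum>b\<in>UNIV. \<Sum>c\<in>UNIV. \<Sum>d\<in>UNIV. ((u p $ a * cnj (u p $ b) * (u s $ c * cnj (u s $ d))) * (H $ a $ b * H $ c $ d)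
     - (u p $ a * cnj (u s $ b) * (u s $ c * cnj (u p $ d))) * (H $ a $ b * H $ c $ d))))"
    unfolding sum_distrib_left
    by (rule sum_rot42)
  also have "\<dots> = (\<Sum>p\<in>(UNIV :: 'm set). \<Sum>s\<in>UNIV. ?K * (1 - (if p = s then 1 else 0)))"
    unfolding sum_subtractf prod uu by (intro sum.cong refl) simp
  also have "\<dots> = ?K * (\<Sum>p\<in>(UNIV :: 'm set). (of_nat CARD('m) - 1))"
    unfolding sum_distrib_left[symmetric] sum_subtractf by simp
  also have "\<dots> = ?K * (of_nat CARD('m) * of_nat (CARD('m) - 1))"
    using m by (simp add: of_nat_diff)
  finally show ?thesis by (simp add: mult_ac)
qed

text \<open>A single \<open>dens\<close> yields two of the four terms of \<open>ddb_alt\<close>. The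
  other two come from the same sum with p and s exchanged; hence the factor 2.\<close>

lemma dens_frame:
  fixes H :: "complex^'m^'m"
  assumes m: "2 \<le> CARD('m)" and u: "unitary_frame H u" and W: "W ** frame_mat u = mat 1"
    and D: "open D" "z \<in> D" and S: "\<And>c d. Ck_on 2 D (\<lambda>w. S w $ c $ d)"
  shows "2 * dens H S z = coef (CARD('m) - 2) * fact (CARD('m) - 2) * vol W * (\<Sum>p\<in>UNIV. \<Sum>s\<in>UNIV. ddb_alt S (u p) (u s) z)"
proof -
  let ?K = "coef (CARD('m) - 2) * fact (CARD('m) - 2) * vol W"
  define DD where "DD a b c d = dl (axis a 1) (db (axis b 1) (\<lambda>w. S w $ c $ d)) z" for a b c d
  have ddb: "ddb S a x b y z = (\<Sum>c\<in>UNIV. \<Sum>d\<in>UNIV. \<Sum>\<alpha>\<in>UNIV. \<Sum>\<beta>\<in>UNIV. (x $ c * cnj (y $ d) * (a $ \<alpha> * cnj (b $ \<beta>))) * DD \<alpha> \<beta> c d)" for a x b y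
    unfolding ddb_expand[OF D S] DD_def
    by (subst dl_db_expansion[OF D S]) (simp only: sum_distrib_left mult.assoc)
  have "dens H S z = (\<Sum>c\<in>UNIV. \<Sum>d\<in>UNIV. \<Sum>a\<in>UNIV. \<Sum>b\<in>UNIV. \<Sum>p\<in>UNIV. \<Sum>s\<in>UNIV. ?K * ((u p $ c * cnj (u p $ d) * (u s $ a * cnj (u s $ b))) * DD a b c d
     - (u p $ c * cnj (u s $ d) * (u s $ a * cnj (u p $ b))) * DD a b c d))"
    unfolding dens_def Ecoef_frame[OF m u W] sum_distrib_left sum_distrib_right DD_def[symmetric] by (simp only: left_diff_distrib mult.assoc)
  also have "\<dots> = (\<Sum>p\<in>UNIV. \<Sum>s\<in>UNIV. ?K * (\<Sum>c\<in>UNIV. \<Sum>d\<in>UNIV. \<Sum>a\<in>UNIV. \<Sum>b\<in>UNIV. ((u p $ c * cnj (u p $ d) * (u s $ a * cnj (u s $ b))) * DD a b c d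
     - (u p $ c * cnj (u s $ d) * (u s $ a * cnj (u p $ b))) * DD a b c d)))"
    unfolding sum_distrib_left
    by (rule sum_rot42)
  also have "\<dots> = ?K * (\<Sum>p\<in>UNIV. \<Sum>s\<in>UNIV. ddb S (u s) (u p) (u s) (u p) z - ddb S (u s) (u p) (u p) (u s) z)"
    unfolding sum_subtractf ddb[symmetric] by (simp add: sum_distrib_left[symmetric] sum_subtractf)
  finally have 1: "dens H S z = ?K * (\<Sum>p\<in>UNIV. \<Sum>s\<in>UNIV. ddb S (u s) (u p) (u s) (u p) z - ddb S (u s) (u p) (u p) (u s) z)" .
  also have "(\<Sum>p\<in>UNIV. \<Sum>s\<in>UNIV. ddb S (u s) (u p) (u s) (u p) z - ddb S (u s) (u p) (u p) (u s) z) =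
     (\<Sum>p\<in>UNIV. \<Sum>s\<in>UNIV. ddb S (u p) (u s) (u p) (u s) z - ddb S (u p) (u s) (u s) (u p) z)"
    by (rule sum.swap)
  finally have 2: "dens H S z = ?K * (\<Sum>p\<in>UNIV. \<Sum>s\<in>UNIV. ddb S (u p) (u s) (u p) (u s) z - ddb S (u p) (u s) (u s) (u p) z)" .
  have "2 * dens H S z = ?K * ((\<Sum>p\<in>UNIV. \<Sum>s\<in>UNIV. ddb S (u s) (u p) (u s) (u p) z - ddb S (u s) (u p) (u p) (u s) z)
    + (\<Sum>p\<in>UNIV. \<Sum>s\<in>UNIV. ddb S (u p) (u s) (u p) (u s) z - ddb S (u p) (u s) (u s) (u p) z))"
    using 1 2 by (simp only: distrib_left mult_2)
  also have "\<dots> = ?K * (\<Sum>p\<in>UNIV. \<Sum>s\<in>UNIV. ddb_alt S (u p) (u s) z)"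
    unfolding sum.distrib[symmetric] ddb_alt_def by (simp add: algebra_simps)
  finally show ?thesis .
qed

section \<open>The volume density and its transformation\<close>

lemma frame_inverse:
  assumes "unitary_frame H u" shows "matrix_inv (frame_mat u) ** frame_mat u = mat 1"
  using matrix_inv_right[OF unitary_frame_inv(3)[OF assms]] matrix_left_right_inverse by blast

text \<open>The value of \<open>wt\<close> at the standard Hermitian metric
  \<open>mat 1\<close>.\<close>

definition wt_const :: "'m::finite itself \<Rightarrow> complex" where
  "wt_const _ = coef (CARD('m) - 2) * fact (CARD('m) - 2) * (of_nat CARD('m) * of_nat (CARD('m) - 1)) * vol (mat 1 :: complex^'m^'m)"

lemma wt_const_nz: "2 \<le> CARD('m::finite) \<Longrightarrow> wt_const TYPE('m) \<noteq> 0"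
  by (simp add: wt_const_def coef_nz vol_mat_1)

lemma wt_rdet:
  fixes H :: "complex^'m^'m"
  assumes m: "2 \<le> CARD('m)" and u: "unitary_frame H u"
  shows "wt H = wt_const TYPE('m) * of_real (rdet ((*v) (matrix_inv (frame_mat u))))"
  unfolding wt_frame[OF m u frame_inverse[OF u]] wt_const_def vol_eq_rdet[of "matrix_inv (frame_mat u)"] by simp

lemma linear_matrix_vector: "linear ((*v) (M :: complex^'m^'m))"
proof (rule linearI)
  show "M *v (r *\<^sub>R x) = r *\<^sub>R (M *v x)" for r x
    by (simp add: matrix_vector_mult_def vec_eq_iff scaleR_sum_right)
qed (rule matrix_vector_right_distrib)

lemma rdet_compose:
  fixes K L :: "complex^'m \<Rightarrow> complex^'m"
  assumes K: "linear K"
  shows "rdet (\<lambda>x. K (L x)) = rdet K * rdet L"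
proof -
  have "(\<chi> i j. real_basis i \<bullet> K (L (real_basis j))) = (\<chi> i j. real_basis i \<bullet> K (real_basis j)) ** (\<chi> i j. real_basis i \<bullet> L (real_basis j))"
  proof (subst vec_eq_iff, intro allI, subst vec_eq_iff, intro allI)
    fix i j :: "'m bit0"
    have "real_basis i \<bullet> K (L (real_basis j)) = real_basis i \<bullet> K (\<Sum>k\<in>UNIV. (real_basis k \<bullet> L (real_basis j)) *\<^sub>R real_basis k)"
      using real_basis_expansion[of "L (real_basis j)"] by simp
    also have "\<dots> = (\<Sum>k\<in>UNIV. (real_basis i \<bullet> K (real_basis k)) * (real_basis k \<bullet> L (real_basis j)))"
      unfolding linear_sum[OF K] linear_scale[OF K] by (simp add: inner_sum_right mult.commute)
    finally show "(\<chi> i j. real_basis i \<bullet> K (L (real_basis j))) $ i $ j = ((\<chi> i j. real_basis i \<bullet> K (real_basis j)) ** (\<chi> i j. real_basis i \<bullet> L (real_basis j))) $ i $ j"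
      by (simp add: matrix_matrix_mult_def)
  qed
  then show ?thesis unfolding rdet_def by (simp add: det_mul)
qed

lemma rdet_id: "rdet (\<lambda>x :: complex^'m. x) = 1"
proof -
  have "(\<chi> i j. real_basis i \<bullet> real_basis j) = (mat 1 :: real^('m bit0)^('m bit0))"
    by (simp add: vec_eq_iff mat_def real_basis_inner)
  then show ?thesis by (simp add: rdet_def)
qed

text \<open>The value of \<open>wt\<close> is \<open>wt_const\<close> times a determinant that
  cannot vanish. Reality of the quotient allows it to have a sign, which
  \<open>integral_cut_Lam_zero\<close> needs to be constant on a ball.\<close>

lemma wt_nz:
  fixes H :: "complex^'m^'m"
  assumes m: "2 \<le> CARD('m)" and H: "herm_pos H"
  shows "wt H \<noteq> 0" "wt H / wt_const TYPE('m) \<in> \<real>"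
proof -
  obtain u where u: "unitary_frame H u" using unitary_frame_exists[OF H] by blast
  let ?W = "matrix_inv (frame_mat u)"
  have "(\<lambda>x. ?W *v (frame_mat u *v x)) = (\<lambda>x. x)"
    by (simp add: matrix_vector_mul_assoc frame_inverse[OF u])
  then have "rdet ((*v) ?W) * rdet ((*v) (frame_mat u)) = 1"
    using rdet_compose[OF linear_matrix_vector[of ?W], of "(*v) (frame_mat u)"] by (simp add: rdet_id)
  then have "rdet ((*v) ?W) \<noteq> 0" by auto
  then show "wt H \<noteq> 0" unfolding wt_rdet[OF m u] using wt_const_nz[OF m] by simp
  show "wt H / wt_const TYPE('m) \<in> \<real>" unfolding wt_rdet[OF m u] using wt_const_nz[OF m] by simp
qed

definition clinear :: "(complex^'m \<Rightarrow> complex^'m) \<Rightarrow> bool" where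
  "clinear L \<longleftrightarrow> linear L \<and> (\<forall>c x. L (c *s x) = c *s L x)"

lemma clinear_matrix:
  fixes L :: "complex^'m \<Rightarrow> complex^'m"
  assumes "clinear L"
  shows "\<exists>M. \<forall>x. L x = M *v x"
proof -
  have "L x = (\<chi> i j. L (axis j 1) $ i) *v x" for x
  proof -
    have "L x = L (\<Sum>j\<in>UNIV. x $ j *s axis j 1)" by (simp add: basis_expansion)
    also have "\<dots> = (\<Sum>j\<in>UNIV. x $ j *s L (axis j 1))"
      using assms by (simp add: clinear_def linear_sum)
    finally show ?thesis by (simp add: matrix_vector_mult_def vec_eq_iff sum_component mult.commute)
  qed
  then show ?thesis by blast
qed

text \<open>L maps a unitary frame of H to one of \<open>H'\<close>, and \<open>wt\<close> is a
  constant times the determinant of the dual coframe. After taking norms it transforms as a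
  density.\<close>

lemma wt_transform:
  fixes H H' :: "complex^'m^'m"
  assumes m: "2 \<le> CARD('m)" and H: "herm_pos H" and H': "herm_pos H'" and L: "clinear L"
    and HL: "\<And>x y. herm_form H x y = herm_form H' (L x) (L y)"
  shows "norm (wt H) = \<bar>rdet L\<bar> * norm (wt H')"
proof -
  obtain u where u: "unitary_frame H u" using unitary_frame_exists[OF H] by blast
  define u' where "u' = (\<lambda>p. L (u p))"
  have u': "unitary_frame H' u'" using u by (simp add: unitary_frame_def u'_def HL)
  obtain M where M: "\<And>x. L x = M *v x" using clinear_matrix[OF L] by blast
  have f: "frame_mat u' = M ** frame_mat u"
    by (simp add: frame_mat_def u'_def M matrix_matrix_mult_def matrix_vector_mult_def vec_eq_iff)
  let ?W = "matrix_inv (frame_mat u)" and ?W' = "matrix_inv (frame_mat u')"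
  have "(?W' ** M) ** frame_mat u = mat 1"
    using frame_inverse[OF u'] unfolding f by (simp add: matrix_mul_assoc)
  then have "wt H = coef (CARD('m) - 2) * fact (CARD('m) - 2) * (of_nat CARD('m) * of_nat (CARD('m) - 1)) * vol (?W' ** M)"
    by (rule wt_frame[OF m u])
  also have "\<dots> = wt_const TYPE('m) * of_real (rdet ((*v) (?W' ** M)))"
    unfolding wt_const_def vol_eq_rdet[of "?W' ** M"] by simp
  also have "(*v) (?W' ** M) = (\<lambda>x. ?W' *v (L x))" by (simp add: M matrix_vector_mul_assoc fun_eq_iff)
  also have "rdet \<dots> = rdet ((*v) ?W') * rdet L" by (rule rdet_compose[OF linear_matrix_vector])
  finally have "wt H = wt H' * of_real (rdet L)" unfolding wt_rdet[OF m u'] by simp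
  then show ?thesis by (simp add: norm_mult)
qed

definition Lam :: "complex^'m^'m \<Rightarrow> (complex^'m \<Rightarrow> complex^'m^'m) \<Rightarrow> complex^'m \<Rightarrow> real" where
  "Lam H S z = Re (dens H S z / wt H)"

text \<open>The volume coefficient and \<open>coef\<close> are common to \<open>dens\<close> and
  \<open>wt\<close> and cancel. The 2 in the denominator comes from \<open>dens_frame\<close>, the
  product m (m - 1) from \<open>wt_frame\<close>.\<close>

lemma Lam_frame:
  fixes H :: "complex^'m^'m"
  assumes m: "2 \<le> CARD('m)" and u: "unitary_frame H u"
    and D: "open D" "z \<in> D" and S: "\<And>c d. Ck_on 2 D (\<lambda>w. S w $ c $ d)"
  shows "Lam H S z = (\<Sum>p\<in>UNIV. \<Sum>s\<in>UNIV. Re (ddb_alt S (u p) (u s) z)) / (2 * real CARD('m) * real (CARD('m) - 1))"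
proof -
  let ?W = "matrix_inv (frame_mat u)"
  let ?k = "coef (CARD('m) - 2) * fact (CARD('m) - 2) * vol ?W"
  let ?n = "of_nat CARD('m) * of_nat (CARD('m) - 1) :: complex"
  have wt: "wt H = ?k * ?n" unfolding wt_frame[OF m u frame_inverse[OF u]] by simp
  have hp: "wt H \<noteq> 0"
  proof -
    have "(\<lambda>x. ?W *v (frame_mat u *v x)) = (\<lambda>x. x)"
      by (simp add: matrix_vector_mul_assoc frame_inverse[OF u])
    then have "rdet ((*v) ?W) * rdet ((*v) (frame_mat u)) = 1"
      using rdet_compose[OF linear_matrix_vector[of ?W], of "(*v) (frame_mat u)"] by (simp add: rdet_id)
    then have "rdet ((*v) ?W) \<noteq> 0" by auto
    then show "wt H \<noteq> 0" unfolding wt_rdet[OF m u] using wt_const_nz[OF m] by simp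
  qed
  then have k: "?k \<noteq> 0" "?n \<noteq> 0" unfolding wt by auto
  have "dens H S z = ?k * (\<Sum>p\<in>UNIV. \<Sum>s\<in>UNIV. ddb_alt S (u p) (u s) z) / 2"
    using dens_frame[OF m u frame_inverse[OF u] D S] by (simp add: field_simps)
  then have "dens H S z / wt H = (\<Sum>p\<in>UNIV. \<Sum>s\<in>UNIV. ddb_alt S (u p) (u s) z) / (2 * ?n)"
    unfolding wt using k by (simp add: field_simps)
  also have "\<dots> = (\<Sum>p\<in>UNIV. \<Sum>s\<in>UNIV. ddb_alt S (u p) (u s) z) / of_real (2 * real CARD('m) * real (CARD('m) - 1))"
    by simp
  finally show ?thesis unfolding Lam_def by (simp add: Re_divide_of_real del: of_real_mult)
qed

section \<open>Integrals of compactly supported functions\<close>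

definition zero_ext :: "'a set \<Rightarrow> ('a \<Rightarrow> 'b::zero) \<Rightarrow> 'a \<Rightarrow> 'b" where
  "zero_ext U g z = (if z \<in> U then g z else 0)"

lemma Ck_zero_ext:
  fixes g :: "'a::real_normed_vector \<Rightarrow> 'b::real_normed_vector"
  assumes "open U" "Ck_on k U g" "compact K" "K \<subseteq> U" "\<And>z. z \<in> U - K \<Longrightarrow> g z = 0"
  shows "Ck_on k UNIV (zero_ext U g)"
proof (rule Ck_on_local)
  fix x :: 'a
  show "\<exists>T. open T \<and> x \<in> T \<and> Ck_on k T (zero_ext U g)"
  proof (cases "x \<in> U")
    case True
    then show ?thesis using assms(1,2) Ck_on_cong[OF assms(1), of "zero_ext U g" g] by (auto simp: zero_ext_def)
  next
    case False
    have o: "open (- K)" using assms(3) by (simp add: compact_imp_closed open_Compl)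
    have "Ck_on k (- K) (zero_ext U g) = Ck_on k (- K) (\<lambda>_. 0 :: 'b)"
      by (rule Ck_on_cong[OF o]) (use assms(5) in \<open>auto simp: zero_ext_def\<close>)
    then show ?thesis using o False assms(4) Ck_on_const by blast
  qed
qed

lemma integrable_compact_support:
  fixes F :: "'a::euclidean_space \<Rightarrow> 'b::{banach, second_countable_topology}"
  assumes "continuous_on UNIV F" "compact K" "\<And>z. z \<notin> K \<Longrightarrow> F z = 0"
  shows "integrable lborel F"
proof -
  have "(\<lambda>z. indicator K z *\<^sub>R F z) = F"
    using assms(3) by (auto simp: fun_eq_iff indicator_def)
  then show ?thesis
    using borel_integrable_compact[of K F] assms continuous_on_subset by (metis subset_UNIV)
qed

lemma integral_translate:
  fixes F :: "'a::euclidean_space \<Rightarrow> 'b::{banach, second_countable_topology}"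
  assumes "F \<in> borel_measurable borel"
  shows "(\<integral>z. F (h + z) \<partial>lborel) = (\<integral>z. F z \<partial>lborel)"
proof -
  have "(\<integral>z. F z \<partial>lborel) = (\<integral>z. F z \<partial>distr lborel borel ((+) h))" by (simp add: lborel_distr_plus)
  also have "\<dots> = (\<integral>z. F (h + z) \<partial>lborel)" by (rule integral_distr) (use assms in auto)
  finally show ?thesis by simp
qed

text \<open>Translation invariance makes the integral of every difference quotient vanish, and
  dominated convergence passes to the derivative. The dominating function is a bound of the
  derivative times the indicator of a compact set.\<close>

lemma integral_directional_derivative:
  fixes F :: "'a::euclidean_space \<Rightarrow> complex"
  assumes F: "Ck_on 1 UNIV F" and K: "compact K" and F0: "\<And>z. z \<notin> K \<Longrightarrow> F z = 0"
  shows "integrable lborel (\<lambda>z. frechet_derivative F (at z) v)"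
    and "(\<integral>z. frechet_derivative F (at z) v \<partial>lborel) = 0"
proof -
  define D where "D z = frechet_derivative F (at z) v" for z
  have contF: "continuous_on UNIV F" using F Ck_on_imp_continuous_on by blast
  have contD: "continuous_on UNIV D" unfolding D_def[abs_def] using Ck_on_frechet[of 0 UNIV F] F by simp
  have D0: "D z = 0" if "z \<notin> K" for z
  proof -
    have "D z = frechet_derivative (\<lambda>_. 0) (at z) v"
      unfolding D_def using frechet_derivative_cong_open[of "- K" z F "\<lambda>_. 0"] that F0 K
      by (simp add: compact_imp_closed open_Compl)
    then show ?thesis by (simp add: frechet_derivative_const)
  qed
  show iD: "integrable lborel (\<lambda>z. frechet_derivative F (at z) v)"
    using integrable_compact_support[OF contD K D0] by (simp add: D_def[abs_def])
  have iF: "integrable lborel F" by (rule integrable_compact_support[OF contF K F0])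
  have mF: "F \<in> borel_measurable borel" using contF by (rule borel_measurable_continuous_onI)
  have mD: "D \<in> borel_measurable borel" using contD by (rule borel_measurable_continuous_onI)
  have "compact (D ` K)" using contD K compact_continuous_image continuous_on_subset by blast
  then obtain B where B: "\<And>z. z \<in> K \<Longrightarrow> norm (D z) \<le> B" using compact_imp_bounded bounded_iff by (metis imageI)
  define B' where "B' = max B 0"
  have B': "norm (D z) \<le> B'" "0 \<le> B'" for z using B[of z] D0[of z] by (cases "z \<in> K"; force simp: B'_def)+
  \<comment> \<open>Contains the supports of all difference quotients, whose steps are at most
    1.\<close>
  define K' where "K' = (\<lambda>(x, t). x - t *\<^sub>R v) ` (K \<times> {0..1})"
  have cK': "compact K'" unfolding K'_def
    by (intro compact_continuous_image compact_Times K compact_Icc) (auto intro!: continuous_intros simp: case_prod_unfold)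
  define g where "g n z = real (Suc n) *\<^sub>R (F ((1 / real (Suc n)) *\<^sub>R v + z) - F z)" for n z
  have d1: "((\<lambda>s. F (z + s *\<^sub>R v)) has_derivative (\<lambda>h. h *\<^sub>R D (z + s *\<^sub>R v))) (at s within X)" for z s X
  proof -
    have dF: "(F has_derivative frechet_derivative F (at (z + s *\<^sub>R v))) (at (z + s *\<^sub>R v))"
      by (rule Ck_on_has_derivative[OF F]) auto
    have "((\<lambda>s. F (z + s *\<^sub>R v)) has_derivative (\<lambda>h. frechet_derivative F (at (z + s *\<^sub>R v)) (h *\<^sub>R v))) (at s within X)"
      by (rule has_derivative_compose[where f = "\<lambda>s. z + s *\<^sub>R v" and g = F, OF _ dF]) (auto intro!: derivative_eq_intros)
    then show ?thesis
      by (simp add: D_def linear_scale[OF has_derivative_linear[OF dF]])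
  qed
  have bnd: "norm (F (z + s *\<^sub>R v) - F z) \<le> B' * s" if "0 \<le> s" for z s
  proof -
    have "norm (F (z + s *\<^sub>R v) - F (z + 0 *\<^sub>R v)) \<le> B' * norm (s - 0)"
    proof (rule differentiable_bound[where S = "{0..s}"])
      show "onorm (\<lambda>h. h *\<^sub>R D (z + t *\<^sub>R v)) \<le> B'" for t
        by (rule onorm_bound) (use B' in \<open>auto simp: mult.commute[of _ "norm (D _)"] intro!: mult_right_mono\<close>)
    qed (use that d1 in auto)
    then show ?thesis using that by simp
  qed
  have gb: "norm (g n z) \<le> B' * indicator K' z" for n z
  proof (cases "z \<in> K'")
    case True
    have "norm (g n z) = real (Suc n) * norm (F (z + (1 / real (Suc n)) *\<^sub>R v) - F z)"
      by (simp add: g_def add.commute)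
    also have "\<dots> \<le> real (Suc n) * (B' * (1 / real (Suc n)))"
      by (intro mult_left_mono bnd) auto
    finally show ?thesis using True by simp
  next
    case False
    have "z \<in> K'" if "z \<in> K" unfolding K'_def by (rule image_eqI[of _ _ "(z, 0)"]) (use that in auto)
    then have "z \<notin> K" using False by blast
    moreover have "(1 / real (Suc n)) *\<^sub>R v + z \<notin> K"
    proof
      assume "(1 / real (Suc n)) *\<^sub>R v + z \<in> K"
      then have "z \<in> K'" unfolding K'_def
        by (intro image_eqI[of _ _ "((1 / real (Suc n)) *\<^sub>R v + z, 1 / real (Suc n))"]) auto
      then show False using False by blast
    qed
    ultimately show ?thesis by (simp add: g_def F0 False)
  qed
  have lim: "(\<lambda>n. g n z) \<longlonglongrightarrow> D z" for z
  proof -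
    have "(\<lambda>h. norm (F (z + h *\<^sub>R v) - F z - h *\<^sub>R D z) / norm h) \<midarrow>0\<rightarrow> 0"
      using d1[of z 0 UNIV] by (simp add: has_derivative_at)
    then have "(\<lambda>n. norm (F (z + (1 / real (Suc n)) *\<^sub>R v) - F z - (1 / real (Suc n)) *\<^sub>R D z) / norm (1 / real (Suc n))) \<longlonglongrightarrow> 0"
      by (rule filterlim_compose)
         (use LIMSEQ_Suc[OF lim_1_over_n[where 'a = real]] in \<open>simp add: filterlim_at\<close>)
    moreover have "norm (F (z + (1 / real (Suc n)) *\<^sub>R v) - F z - (1 / real (Suc n)) *\<^sub>R D z) / norm (1 / real (Suc n)) = norm (g n z - D z)" for n
    proof -
      have "g n z - D z = real (Suc n) *\<^sub>R (F (z + (1 / real (Suc n)) *\<^sub>R v) - F z - (1 / real (Suc n)) *\<^sub>R D z)"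
        by (simp add: g_def scaleR_diff_right add.commute del: of_nat_Suc)
      then have "norm (g n z - D z) = real (Suc n) * norm (F (z + (1 / real (Suc n)) *\<^sub>R v) - F z - (1 / real (Suc n)) *\<^sub>R D z)"
        by (simp only: norm_scaleR abs_of_nat)
      then show ?thesis by (simp add: mult.commute)
    qed
    ultimately have "(\<lambda>n. norm (g n z - D z)) \<longlonglongrightarrow> 0" by simp
    then show ?thesis by (rule LIM_zero_cancel[OF tendsto_norm_zero_cancel])
  qed
  have "(\<lambda>n. \<integral>z. g n z \<partial>lborel) \<longlonglongrightarrow> (\<integral>z. D z \<partial>lborel)"
  proof (rule integral_dominated_convergence[where w = "\<lambda>z. B' * indicator K' z"])
    show "integrable lborel (\<lambda>z. B' * indicator K' z)"
      using borel_integrable_compact[OF cK', of "\<lambda>_. B'"] by (simp add: mult.commute)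
    show "g n \<in> borel_measurable lborel" for n
      unfolding g_def[abs_def] using mF by measurable
    show "D \<in> borel_measurable lborel" using mD by simp
  qed (use lim gb in auto)
  moreover have "(\<integral>z. g n z \<partial>lborel) = 0" for n
  proof -
    have "integrable lborel (\<lambda>z. F ((1 / real (Suc n)) *\<^sub>R v + z))"
    proof (rule integrable_compact_support)
      show "continuous_on UNIV (\<lambda>z. F ((1 / real (Suc n)) *\<^sub>R v + z))"
        by (rule continuous_on_compose2[OF contF]) (auto intro!: continuous_intros)
      show "compact ((+) (- ((1 / real (Suc n)) *\<^sub>R v)) ` K)" using K by (rule compact_translation)
      show "F ((1 / real (Suc n)) *\<^sub>R v + z) = 0" if "z \<notin> (+) (- ((1 / real (Suc n)) *\<^sub>R v)) ` K" for z
        using that by (intro F0) (auto simp: image_iff)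
    qed
    then have "(\<integral>z. g n z \<partial>lborel) = real (Suc n) *\<^sub>R ((\<integral>z. F ((1 / real (Suc n)) *\<^sub>R v + z) \<partial>lborel) - (\<integral>z. F z \<partial>lborel))"
      unfolding g_def using iF by simp
    then show ?thesis by (simp add: integral_translate[OF mF])
  qed
  ultimately show "(\<integral>z. frechet_derivative F (at z) v \<partial>lborel) = 0"
    unfolding D_def[symmetric] by (simp add: LIMSEQ_const_iff)
qed

lemma integral_zero_ext_cd:
  fixes G :: "complex^'m \<Rightarrow> complex"
  assumes "open U" "Ck_on 1 U G" "compact K" "K \<subseteq> U" "\<And>z. z \<in> U - K \<Longrightarrow> G z = 0"
  shows "integrable lborel (zero_ext U (cd p G))" "(\<integral>z. zero_ext U (cd p G) z \<partial>lborel) = 0"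
proof -
  have C: "Ck_on 1 UNIV (zero_ext U G)" by (rule Ck_zero_ext[OF assms])
  have z: "zero_ext U G z = 0" if "z \<notin> K" for z using assms(5) that by (auto simp: zero_ext_def)
  have e: "zero_ext U (cd p G) = cd p (zero_ext U G)"
  proof
    fix z
    show "zero_ext U (cd p G) z = cd p (zero_ext U G) z"
    proof (cases "z \<in> U")
      case True
      then show ?thesis using cd_cong_open[OF assms(1) True, of "zero_ext U G" G] by (auto simp: zero_ext_def)
    next
      case False
      have "cd p (zero_ext U G) z = cd p (\<lambda>_. 0) z"
        by (rule cd_cong_open[of "- K"]) (use assms(3,4) False z in \<open>auto simp: compact_imp_closed open_Compl\<close>)
      then show ?thesis using False by (simp add: zero_ext_def)
    qed
  qed
  note I = integral_directional_derivative[OF C assms(3) z]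
  show "integrable lborel (zero_ext U (cd p G))" unfolding e cd_def using I(1) by simp
  show "(\<integral>z. zero_ext U (cd p G) z \<partial>lborel) = 0" unfolding e cd_def using I by simp
qed

lemma support_cd:
  assumes "open U" "compact K" "\<And>z. z \<in> U - K \<Longrightarrow> g z = 0" "z \<in> U - K"
  shows "cd p g z = 0"
  using cd_cong_open[of "U - K" z g "\<lambda>_. 0"] assms by (simp add: compact_imp_closed open_Diff)

lemma integral_by_parts:
  fixes E s :: "complex^'m \<Rightarrow> complex"
  assumes U: "open U" and E: "Ck_on 1 U E" and s: "Ck_on 1 U s" and K: "compact K" "K \<subseteq> U"
    and s0: "\<And>z. z \<in> U - K \<Longrightarrow> s z = 0"
  shows "(\<integral>z. zero_ext U (\<lambda>z. E z * cd p s z) z \<partial>lborel) = - (\<integral>z. zero_ext U (\<lambda>z. cd p E z * s z) z \<partial>lborel)"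
proof -
  have Es: "Ck_on 1 U (\<lambda>z. E z * s z)" by (rule Ck_on_mult[OF U E s])
  have c: "Ck_on 0 U (cd p E)" "Ck_on 0 U (cd p s)"
    using Ck_on_cd[OF U, of 0] E s by simp_all
  have i1: "integrable lborel (zero_ext U (\<lambda>z. cd p E z * s z))"
  proof (rule integrable_compact_support[OF _ K(1)])
    have "Ck_on 0 UNIV (zero_ext U (\<lambda>z. cd p E z * s z))"
      by (rule Ck_zero_ext[OF U _ K]) (use s0 Ck_on_mult[OF U c(1) Ck_on_mono[OF s]] in auto)
    then show "continuous_on UNIV (zero_ext U (\<lambda>z. cd p E z * s z))" by simp
  qed (use s0 in \<open>auto simp: zero_ext_def\<close>)
  have i2: "integrable lborel (zero_ext U (\<lambda>z. E z * cd p s z))"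
  proof (rule integrable_compact_support[OF _ K(1)])
    have "Ck_on 0 UNIV (zero_ext U (\<lambda>z. E z * cd p s z))"
      by (rule Ck_zero_ext[OF U _ K]) (use support_cd[OF U K(1) s0] Ck_on_mult[OF U Ck_on_mono[OF E] c(2)] in auto)
    then show "continuous_on UNIV (zero_ext U (\<lambda>z. E z * cd p s z))" by simp
  qed (use support_cd[OF U K(1) s0] in \<open>auto simp: zero_ext_def\<close>)
  have "zero_ext U (cd p (\<lambda>z. E z * s z)) = (\<lambda>z. zero_ext U (\<lambda>z. cd p E z * s z) z + zero_ext U (\<lambda>z. E z * cd p s z) z)"
    using Ck_on_differentiable[OF E] Ck_on_differentiable[OF s] by (auto simp: zero_ext_def fun_eq_iff cd_mult)
  then have "0 = (\<integral>z. zero_ext U (\<lambda>z. cd p E z * s z) z + zero_ext U (\<lambda>z. E z * cd p s z) z \<partial>lborel)"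
    using integral_zero_ext_cd(2)[OF U Es K, of p] s0 by simp
  also have "\<dots> = (\<integral>z. zero_ext U (\<lambda>z. cd p E z * s z) z \<partial>lborel) + (\<integral>z. zero_ext U (\<lambda>z. E z * cd p s z) z \<partial>lborel)"
    by (rule Bochner_Integration.integral_add[OF i1 i2])
  finally show ?thesis by (simp add: eq_neg_iff_add_eq_0 add.commute)
qed

text \<open>Both derivatives are moved from S to the coefficients. They arrive there in reverse
  order, and \<open>cd_commute\<close> restores the order in which the astheno-Kaehler equation
  \<open>E0\<close> is stated.\<close>

lemma integral_dens_zero:
  fixes Hf :: "complex^'m \<Rightarrow> complex^'m^'m"
  assumes U: "open U" and H: "\<And>a b c d. Ck_on 2 U (\<lambda>w. Ecoef (Hf w) a b c d)"
    and E0: "\<And>c d z. z \<in> U \<Longrightarrow> (\<Sum>a\<in>UNIV. \<Sum>b\<in>UNIV. dl (axis a 1) (db (axis b 1) (\<lambda>w. Ecoef (Hf w) c d a b)) z) = 0"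
    and S: "\<And>c d. Ck_on 2 U (\<lambda>w. S w $ c $ d)" and K: "compact K" "K \<subseteq> U"
    and S0: "\<And>z. z \<in> U - K \<Longrightarrow> S z = 0"
  shows "(\<integral>z. zero_ext U (\<lambda>z. dens (Hf z) S z) z \<partial>lborel) = 0"
proof -
  define E where "E c d a b z = Ecoef (Hf z) c d a b" for c d a b z
  define s where "s c d z = S z $ c $ d" for c d z
  have E2: "Ck_on 2 U (E c d a b)" for a b c d unfolding E_def[abs_def] by (rule H)
  have s2: "Ck_on 2 U (s c d)" for c d unfolding s_def[abs_def] by (rule S)
  have E1: "Ck_on 1 U (E c d a b)" for a b c d by (rule Ck_on_mono[OF E2]) simp
  have s1: "Ck_on 1 U (s c d)" for c d by (rule Ck_on_mono[OF s2]) simp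
  have cE: "Ck_on 1 U (cd p (E c d a b))" for p a b c d by (rule Ck_on_cd[OF U]) (use E2 in \<open>simp add: numeral_2_eq_2\<close>)
  have cs: "Ck_on 1 U (cd p (s c d))" for p c d by (rule Ck_on_cd[OF U]) (use s2 in \<open>simp add: numeral_2_eq_2\<close>)
  have ccE: "Ck_on 0 U (cd q (cd p (E c d a b)))" for p q a b c d using Ck_on_cd[OF U, of 0] cE by simp
  have ccs: "Ck_on 0 U (cd q (cd p (s c d)))" for p q c d using Ck_on_cd[OF U, of 0] cs by simp
  have s0: "s c d z = 0" if "z \<in> U - K" for c d z using S0[OF that] by (simp add: s_def)
  have cs0: "cd p (s c d) z = 0" if "z \<in> U - K" for p c d z by (rule support_cd[OF U K(1) s0 that])
  have ccs0: "cd q (cd p (s c d)) z = 0" if "z \<in> U - K" for p q c d z by (rule support_cd[OF U K(1) cs0 that])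
  have int: "integrable lborel (zero_ext U g)" if "Ck_on 0 U g" "\<And>z. z \<in> U - K \<Longrightarrow> g z = 0" for g :: "complex^'m \<Rightarrow> complex"
  proof (rule integrable_compact_support[OF _ K(1)])
    show "continuous_on UNIV (zero_ext U g)" using Ck_zero_ext[OF U that(1) K that(2)] by simp
  qed (use that(2) in \<open>auto simp: zero_ext_def\<close>)
  have parts: "(\<integral>z. zero_ext U (\<lambda>z. E c d a b z * dl (axis a 1) (db (axis b 1) (s c d)) z) z \<partial>lborel)
    = (\<integral>z. zero_ext U (\<lambda>z. dl (axis a 1) (db (axis b 1) (E c d a b)) z * s c d z) z \<partial>lborel)" for a b c d
  proof -
    have "(\<integral>z. zero_ext U (\<lambda>z. E c d a b z * dl (axis a 1) (db (axis b 1) (s c d)) z) z \<partial>lborel)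
      = - (\<integral>z. zero_ext U (\<lambda>z. dl (axis a 1) (E c d a b) z * db (axis b 1) (s c d) z) z \<partial>lborel)"
      by (rule integral_by_parts[OF U E1 cs K cs0])
    also have "(\<integral>z. zero_ext U (\<lambda>z. dl (axis a 1) (E c d a b) z * db (axis b 1) (s c d) z) z \<partial>lborel)
      = - (\<integral>z. zero_ext U (\<lambda>z. db (axis b 1) (dl (axis a 1) (E c d a b)) z * s c d z) z \<partial>lborel)"
      by (rule integral_by_parts[OF U cE s1 K s0])
    also have "zero_ext U (\<lambda>z. db (axis b 1) (dl (axis a 1) (E c d a b)) z * s c d z) = zero_ext U (\<lambda>z. dl (axis a 1) (db (axis b 1) (E c d a b)) z * s c d z)"
      using cd_commute[OF U E2] by (auto simp: zero_ext_def fun_eq_iff)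
    finally show ?thesis by simp
  qed
  have i1: "integrable lborel (zero_ext U (\<lambda>z. E c d a b z * dl (axis a 1) (db (axis b 1) (s c d)) z))" for a b c d
    by (rule int) (use Ck_on_mult[OF U Ck_on_mono[OF E1] ccs] ccs0 in auto)
  have i2: "integrable lborel (zero_ext U (\<lambda>z. dl (axis a 1) (db (axis b 1) (E c d a b)) z * s c d z))" for a b c d
    by (rule int) (use Ck_on_mult[OF U ccE Ck_on_mono[OF s1]] s0 in auto)
  have "zero_ext U (\<lambda>z. dens (Hf z) S z) = (\<lambda>z. \<Sum>c\<in>UNIV. \<Sum>d\<in>UNIV. \<Sum>a\<in>UNIV. \<Sum>b\<in>UNIV. zero_ext U (\<lambda>z. E c d a b z * dl (axis a 1) (db (axis b 1) (s c d)) z) z)"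
    by (auto simp: zero_ext_def fun_eq_iff dens_def E_def s_def[abs_def])
  then have "(\<integral>z. zero_ext U (\<lambda>z. dens (Hf z) S z) z \<partial>lborel) =
    (\<Sum>c\<in>UNIV. \<Sum>d\<in>UNIV. \<Sum>a\<in>UNIV. \<Sum>b\<in>UNIV. (\<integral>z. zero_ext U (\<lambda>z. E c d a b z * dl (axis a 1) (db (axis b 1) (s c d)) z) z \<partial>lborel))"
    using i1 by simp
  also have "\<dots> = (\<integral>z. (\<Sum>c\<in>UNIV. \<Sum>d\<in>UNIV. \<Sum>a\<in>UNIV. \<Sum>b\<in>UNIV. zero_ext U (\<lambda>z. dl (axis a 1) (db (axis b 1) (E c d a b)) z * s c d z) z) \<partial>lborel)"
    unfolding parts using i2 by simp
  also have "(\<lambda>z. \<Sum>c\<in>UNIV. \<Sum>d\<in>UNIV. \<Sum>a\<in>UNIV. \<Sum>b\<in>UNIV. zero_ext U (\<lambda>z. dl (axis a 1) (db (axis b 1) (E c d a b)) z * s c d z) z) = (\<lambda>z. 0)"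
  proof
    fix z
    show "(\<Sum>c\<in>UNIV. \<Sum>d\<in>UNIV. \<Sum>a\<in>UNIV. \<Sum>b\<in>UNIV. zero_ext U (\<lambda>z. dl (axis a 1) (db (axis b 1) (E c d a b)) z * s c d z) z) = 0"
    proof (cases "z \<in> U")
      case True
      have "(\<Sum>a\<in>UNIV. \<Sum>b\<in>UNIV. dl (axis a 1) (db (axis b 1) (E c d a b)) z * s c d z) = 0" for c d
        unfolding sum_distrib_right[symmetric] E_def[abs_def] E0[OF True] by simp
      then show ?thesis using True by (simp add: zero_ext_def)
    qed (simp add: zero_ext_def)
  qed
  finally show ?thesis by simp
qed

section \<open>Change of variables on the complex coordinate space\<close>

definition of_coords :: "real^('m::finite bit0) \<Rightarrow> complex^'m" where
  "of_coords x = (\<Sum>i\<in>UNIV. x $ i *\<^sub>R real_basis i)"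

definition to_coords :: "complex^'m \<Rightarrow> real^('m::finite bit0)" where
  "to_coords z = (\<chi> i. real_basis i \<bullet> z)"

lemma real_basis_of_coords: "real_basis i \<bullet> of_coords x = x $ i"
proof -
  have "real_basis i \<bullet> of_coords x = (\<Sum>j\<in>UNIV. if i = j then x $ j else 0)"
    unfolding of_coords_def inner_sum_right by (intro sum.cong refl) (simp add: real_basis_inner)
  then show ?thesis by simp
qed

lemma to_coords_of_coords [simp]: "to_coords (of_coords x) = x"
  by (simp add: to_coords_def real_basis_of_coords vec_eq_iff)

lemma of_coords_to_coords [simp]: "of_coords (to_coords z) = z"
  unfolding of_coords_def to_coords_def using real_basis_expansion[of z] by simp

lemma linear_of_coords: "linear of_coords"
  by (rule linearI) (simp_all add: of_coords_def scaleR_left_distrib sum.distrib scaleR_sum_right)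

lemma linear_to_coords: "linear to_coords"
  by (rule linearI) (simp_all add: to_coords_def vec_eq_iff inner_right_distrib)

lemma continuous_of_coords: "continuous_on S of_coords"
  using linear_of_coords by (auto intro: linear_continuous_on simp: linear_conv_bounded_linear)

lemma of_coords_axis: "of_coords (axis j 1) = real_basis j"
proof -
  have "of_coords (axis j 1) = (\<Sum>i\<in>UNIV. if i = j then real_basis i else 0)"
    unfolding of_coords_def by (intro sum.cong refl) (simp add: axis_def)
  then show ?thesis by simp
qed

text \<open>Coordinates with respect to an orthonormal basis take boxes to boxes of the same volume,
  and this characterises the measure.\<close>

lemma distr_of_coords: "distr lborel borel (of_coords :: real^('m::finite bit0) \<Rightarrow> complex^'m) = lborel"
proof (rule lborel_eqI[symmetric])
  have m: "of_coords \<in> borel_measurable (lborel :: (real^('m bit0)) measure)"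
    using borel_measurable_continuous_onI[OF continuous_of_coords] by simp
  fix l u :: "complex^'m" assume lu: "\<And>b. b \<in> Basis \<Longrightarrow> l \<bullet> b \<le> u \<bullet> b"
  have pre: "of_coords -` box l u \<inter> space lborel = box (to_coords l) (to_coords u)"
  proof -
    have B: "(\<forall>b\<in>Basis. P b) \<longleftrightarrow> (\<forall>i. P (real_basis i))" for P :: "complex^'m \<Rightarrow> bool"
      using real_basis by (auto simp: bij_betw_def) (metis imageE UNIV_I)
    have "of_coords x \<in> box l u \<longleftrightarrow> x \<in> box (to_coords l) (to_coords u)" for x
    proof -
      have "of_coords x \<in> box l u \<longleftrightarrow> (\<forall>i. real_basis i \<bullet> l < x $ i \<and> x $ i < real_basis i \<bullet> u)"
        unfolding mem_box B by (simp add: inner_commute[of _ "real_basis _"] real_basis_of_coords)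
      then show ?thesis unfolding mem_box_cart by (simp add: to_coords_def)
    qed
    then show ?thesis by auto
  qed
  have le: "(to_coords l) \<bullet> b \<le> (to_coords u) \<bullet> b" if bB: "b \<in> Basis" for b
  proof -
    obtain i where "b = axis i 1" using bB by (auto simp: Basis_vec_def)
    then show ?thesis using lu[OF real_basis_Basis[of i]] by (simp add: inner_axis to_coords_def inner_commute[of "real_basis _"])
  qed
  have "emeasure (distr lborel borel of_coords) (box l u) = emeasure lborel (box (to_coords l) (to_coords u))"
    using m pre by (subst emeasure_distr) auto
  also have "\<dots> = ennreal (\<Prod>b\<in>Basis. (to_coords u - to_coords l) \<bullet> b)"
    by (rule emeasure_lborel_box[OF le])
  also have "(\<Prod>b\<in>Basis. (to_coords u - to_coords l) \<bullet> b) = (\<Prod>i\<in>UNIV. (u - l) \<bullet> real_basis i)"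
  proof -
    have "(\<Prod>b\<in>Basis. (to_coords u - to_coords l) \<bullet> b) = (\<Prod>i\<in>UNIV. (to_coords u - to_coords l) $ i)"
      unfolding Basis_vec_def by (subst prod.UNION_disjoint) (auto simp: inner_axis axis_eq_axis)
    then show ?thesis by (simp add: to_coords_def inner_diff_right inner_diff_left inner_commute)
  qed
  also have "\<dots> = (\<Prod>b\<in>Basis. (u - l) \<bullet> b)"
    by (rule prod.reindex_bij_betw[OF real_basis])
  finally show "emeasure (distr lborel borel of_coords) (box l u) = ennreal (\<Prod>b\<in>Basis. (u - l) \<bullet> b)" .
qed simp

lemma integral_of_coords:
  fixes f :: "complex^'m \<Rightarrow> real"
  assumes "integrable lborel f"
  shows "integrable lborel (\<lambda>x. f (of_coords x))" "(\<integral>x. f (of_coords x) \<partial>lborel) = (\<integral>z. f z \<partial>lborel)"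
proof -
  have m: "of_coords \<in> borel_measurable (lborel :: (real^('m bit0)) measure)"
    using borel_measurable_continuous_onI[OF continuous_of_coords] by simp
  have fm: "f \<in> borel_measurable borel" using assms by simp
  have d: "integrable (distr lborel borel (of_coords :: real^('m bit0) \<Rightarrow> complex^'m)) f" unfolding distr_of_coords by (rule assms)
  show "integrable lborel (\<lambda>x. f (of_coords x))" by (rule integrable_distr[OF _ d]) (use m in simp)
  have "(\<integral>z. f z \<partial>lborel) = (\<integral>z. f z \<partial>distr lborel borel (of_coords :: real^('m bit0) \<Rightarrow> complex^'m))" by (simp only: distr_of_coords)
  also have "\<dots> = (\<integral>x. f (of_coords x) \<partial>lborel)" by (rule integral_distr) (use m fm in simp_all)
  finally show "(\<integral>x. f (of_coords x) \<partial>lborel) = (\<integral>z. f z \<partial>lborel)" by simp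
qed

text \<open>The change of variables theorem on real coordinate vectors is conjugated with
  \<open>of_coords\<close>; the matrix of the conjugated derivative has determinant
  \<open>rdet (D z)\<close>.\<close>

lemma integral_change_coords:
  fixes \<tau> :: "complex^'m \<Rightarrow> complex^'m" and f :: "complex^'m \<Rightarrow> real"
  assumes W: "open W" "inj_on \<tau> W" and D: "\<And>z. z \<in> W \<Longrightarrow> (\<tau> has_derivative D z) (at z)"
    and f: "integrable lborel f" "\<And>z. z \<notin> \<tau> ` W \<Longrightarrow> f z = 0"
    and k: "integrable lborel (zero_ext W (\<lambda>z. \<bar>rdet (D z)\<bar> * f (\<tau> z)))"
  shows "(\<integral>z. f z \<partial>lborel) = (\<integral>z. zero_ext W (\<lambda>z. \<bar>rdet (D z)\<bar> * f (\<tau> z)) z \<partial>lborel)"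
proof -
  let ?k = "zero_ext W (\<lambda>z. \<bar>rdet (D z)\<bar> * f (\<tau> z))"
  define S where "S = of_coords -` W"
  define G where "G x = to_coords (\<tau> (of_coords x))" for x :: "real^('m bit0)"
  define G' where "G' x v = to_coords (D (of_coords x) (of_coords v))" for x v :: "real^('m bit0)"
  \<comment> \<open>The change of variables theorem concerns vector valued functions;
    \<open>fv\<close> is f with values in \<open>real^1\<close>.\<close>
  define fv where "fv x = (vec (f (of_coords x)) :: real^1)" for x :: "real^('m bit0)"
  have oS: "open S" unfolding S_def by (rule open_vimage[OF W(1) continuous_of_coords])
  have S: "S \<in> sets lebesgue" using oS by (simp add: borel_open sets_completionI_sets)
  have der: "(G has_derivative G' x) (at x within S)" if "x \<in> S" for x
  proof -
    have "((\<lambda>x. \<tau> (of_coords x)) has_derivative (\<lambda>v. D (of_coords x) (of_coords v))) (at x within S)"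
      by (rule has_derivative_compose[where f = of_coords and g = \<tau>, OF linear_imp_has_derivative[OF linear_of_coords] D])
        (use that in \<open>simp add: S_def\<close>)
    then show ?thesis unfolding G_def[abs_def] G'_def[abs_def]
      by (rule has_derivative_compose[where g = to_coords, OF _ linear_imp_has_derivative[OF linear_to_coords]])
  qed
  have inj: "inj_on G S"
    by (rule inj_onI) (metis G_def S_def of_coords_to_coords to_coords_of_coords W(2) inj_onD vimageD)
  have det: "det (matrix (G' x)) = rdet (D (of_coords x))" for x
    unfolding rdet_def matrix_def G'_def by (simp add: of_coords_axis to_coords_def)
  have GS: "x \<in> G ` S \<longleftrightarrow> of_coords x \<in> \<tau> ` W" for x
  proof
    assume "of_coords x \<in> \<tau> ` W"
    then obtain z where "z \<in> W" "of_coords x = \<tau> z" by blast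
    then have "to_coords z \<in> S" "x = G (to_coords z)" by (auto simp: S_def G_def) (metis to_coords_of_coords)
    then show "x \<in> G ` S" by blast
  qed (auto simp: G_def S_def)
  have fi: "integrable lborel (\<lambda>x. f (of_coords x))" by (rule integral_of_coords[OF f(1)])
  have fa: "(\<lambda>x. f (of_coords x)) absolutely_integrable_on UNIV"
    using fi by (simp add: set_integrable_def integrable_completion)
  have "(\<lambda>x. if x \<in> G ` S then f (of_coords x) else 0) = (\<lambda>x. f (of_coords x))"
    using f(2) GS by (auto simp: fun_eq_iff)
  then have faS: "(\<lambda>x. f (of_coords x)) absolutely_integrable_on (G ` S)"
    using fa absolutely_integrable_restrict_UNIV[of "G ` S" "\<lambda>x. f (of_coords x)"] by simp
  have fvS: "fv absolutely_integrable_on (G ` S)"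
    unfolding absolutely_integrable_on_1_iff fv_def using faS by simp
  have "integral (G ` S) fv = integral S (\<lambda>x. \<bar>det (matrix (G' x))\<bar> *\<^sub>R fv (G x))"
    using has_absolute_integral_change_of_variables[OF S der inj, of fv "integral (G ` S) fv"] fvS by simp
  then have "integral (G ` S) fv $ 1 = integral S (\<lambda>x. \<bar>det (matrix (G' x))\<bar> *\<^sub>R fv (G x)) $ 1" by simp
  then have "integral (G ` S) (\<lambda>x. f (of_coords x)) = integral S (\<lambda>x. \<bar>rdet (D (of_coords x))\<bar> * f (\<tau> (of_coords x)))"
    unfolding integral_on_1_eq by (simp add: fv_def det G_def)
  moreover have "integral (G ` S) (\<lambda>x. f (of_coords x)) = (\<integral>z. f z \<partial>lborel)"
  proof -
    have "integral (G ` S) (\<lambda>x. f (of_coords x)) = integral UNIV (\<lambda>x. if x \<in> G ` S then f (of_coords x) else 0)"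
      by (rule integral_restrict_UNIV[symmetric])
    also have "\<dots> = (\<integral>x. f (of_coords x) \<partial>lborel)"
      unfolding \<open>(\<lambda>x. if x \<in> G ` S then f (of_coords x) else 0) = (\<lambda>x. f (of_coords x))\<close> by (rule integral_lborel[OF fi])
    finally show ?thesis using integral_of_coords[OF f(1)] by simp
  qed
  moreover have "integral S (\<lambda>x. \<bar>rdet (D (of_coords x))\<bar> * f (\<tau> (of_coords x))) = (\<integral>z. ?k z \<partial>lborel)"
  proof -
    have "integral S (\<lambda>x. \<bar>rdet (D (of_coords x))\<bar> * f (\<tau> (of_coords x))) = integral UNIV (\<lambda>x. if x \<in> S then \<bar>rdet (D (of_coords x))\<bar> * f (\<tau> (of_coords x)) else 0)"
      by (rule integral_restrict_UNIV[symmetric])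
    also have "\<dots> = integral UNIV (\<lambda>x. ?k (of_coords x))" by (simp add: zero_ext_def S_def)
    also have "\<dots> = (\<integral>x. ?k (of_coords x) \<partial>lborel)" by (rule integral_lborel[OF integral_of_coords(1)[OF k]])
    finally show ?thesis using integral_of_coords[OF k] by simp
  qed
  ultimately show ?thesis by simp
qed

section \<open>Charts, the global form and cut-off functions\<close>

lemma chartD:
  assumes "is_chart c"
  shows "open (fst c)" "open (img c)" "continuous_on (fst c) (snd c)" "continuous_on (img c) (param c)"
    "q \<in> fst c \<Longrightarrow> snd c q \<in> img c" "q \<in> fst c \<Longrightarrow> param c (snd c q) = q"
    "z \<in> img c \<Longrightarrow> param c z \<in> fst c" "z \<in> img c \<Longrightarrow> snd c (param c z) = z"
  using assms unfolding is_chart_def homeomorphism_def by auto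

lemma overlap_iff:
  assumes "is_chart c"
  shows "z \<in> overlap c c' \<longleftrightarrow> z \<in> img c \<and> param c z \<in> fst c'"
  using chartD[OF assms] unfolding overlap_def by (auto simp: image_iff) (metis IntI)

lemma local_dom_iff:
  assumes "is_chart c"
  shows "z \<in> local_dom c d f \<longleftrightarrow> z \<in> img c \<and> f (param c z) \<in> fst d"
  using chartD[OF assms] unfolding local_dom_def by (auto simp: image_iff) (metis IntI vimageI)

lemma open_chart_preimage:
  assumes "is_chart c" "open X" shows "open {z \<in> img c. param c z \<in> X}"
proof -
  have "open (img c \<inter> param c -` X)"
    by (rule continuous_open_preimage[OF chartD(4,2)[OF assms(1)] assms(2)])
  also have "img c \<inter> param c -` X = {z \<in> img c. param c z \<in> X}" by auto
  finally show ?thesis .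
qed

lemma open_overlap:
  assumes "is_chart c" "is_chart c'" shows "open (overlap c c')"
proof -
  have "overlap c c' = {z \<in> img c. param c z \<in> fst c'}" by (simp add: set_eq_iff overlap_iff[OF assms(1)])
  then show ?thesis using open_chart_preimage[OF assms(1) chartD(1)[OF assms(2)]] by simp
qed

lemma open_local_dom:
  assumes "is_chart c" "is_chart d" "continuous_on UNIV f" shows "open (local_dom c d f)"
proof -
  have "open (f -` fst d)" by (rule open_vimage[OF chartD(1)[OF assms(2)] assms(3)])
  then have "open {z \<in> img c. param c z \<in> f -` fst d}" by (rule open_chart_preimage[OF assms(1)])
  moreover have "local_dom c d f = {z \<in> img c. param c z \<in> f -` fst d}"
    by (simp add: set_eq_iff local_dom_iff[OF assms(1)])
  ultimately show ?thesis by simp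
qed

lemma transition_overlap:
  assumes "is_chart c" "is_chart c'" "z \<in> overlap c c'"
  shows "transition c c' z \<in> overlap c' c" "param c' (transition c c' z) = param c z"
    "transition c' c (transition c c' z) = z" "transition c c' z \<in> img c'"
proof -
  have z: "z \<in> img c" "param c z \<in> fst c'" using overlap_iff[OF assms(1)] assms(3) by auto
  show p: "param c' (transition c c' z) = param c z"
    using z chartD(6)[OF assms(2)] by (simp add: transition_def)
  show t: "transition c c' z \<in> img c'" using z chartD(5)[OF assms(2)] by (simp add: transition_def)
  show "transition c c' z \<in> overlap c' c"
    using overlap_iff[OF assms(2)] t p z chartD(7)[OF assms(1)] by simp
  show "transition c' c (transition c c' z) = z"
    using p z chartD(8)[OF assms(1)] unfolding transition_def[of c' c] by simp
qed

text \<open>Expresses the complex pairing through the real differential and the real metric, whose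
  behaviour under a change of target chart is part of \<open>riemannian_metric\<close>.\<close>

lemma (in map_coords) ip_dF:
  assumes z: "z \<in> U"
  shows "ip (dF p) (dF q) z =
     complex_of_real (frechet_derivative F (at z) (fst p) \<bullet> (G (F z) *v frechet_derivative F (at z) (fst q))
       - frechet_derivative F (at z) (snd p) \<bullet> (G (F z) *v frechet_derivative F (at z) (snd q)))
     + \<i> * complex_of_real (frechet_derivative F (at z) (fst p) \<bullet> (G (F z) *v frechet_derivative F (at z) (snd q))
       + frechet_derivative F (at z) (snd p) \<bullet> (G (F z) *v frechet_derivative F (at z) (fst q)))"
proof -
  have bl: "bounded_linear (\<lambda>v. complex_of_real (v $ i))" for i :: 'n
    by (rule bounded_linear_compose[OF bounded_linear_of_real bounded_linear_vec_nth])
  have d: "F differentiable (at z)" by (rule Ck_on_differentiable[OF Ck_F[of 1] _ z]) simp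
  have e: "dF p i z = complex_of_real (frechet_derivative F (at z) (fst p) $ i) + \<i> * complex_of_real (frechet_derivative F (at z) (snd p) $ i)" for p i
    unfolding dF_def cd_def frechet_derivative_linear_compose[OF bl d] ..
  have q: "x \<bullet> (G (F z) *v y) = (\<Sum>i\<in>UNIV. \<Sum>j\<in>UNIV. G (F z) $ i $ j * x $ i * y $ j)" for x y
    by (simp add: inner_vec_def matrix_vector_mult_def sum_distrib_left mult_ac)
  show ?thesis unfolding ip_def e GG_def q
    by (simp add: sum_distrib_left sum.distrib sum_subtractf algebra_simps complex_eq_iff)
qed

section \<open>The pullback form on the manifold\<close>

locale manifold_map =
  fixes A :: "('a::{t2_space,second_countable_topology}, complex^'m) chart set"
    and B :: "('b::{t2_space,second_countable_topology}, real^'n) chart set"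
    and g :: "('b, 'n) real_metric" and f :: "'a \<Rightarrow> 'b"
  assumes cm: "complex_manifold A" and cpt: "compact (UNIV :: 'a set)"
    and sm: "smooth_manifold B" and rm: "riemannian_metric B g" and smf: "smooth_map A B f"
begin

lemma chartA: "c \<in> A \<Longrightarrow> is_chart c"
  using cm unfolding complex_manifold_def by blast

lemma coverA: "\<exists>c\<in>A. q \<in> fst c"
  using cm unfolding complex_manifold_def by blast

lemma chartB: "d \<in> B \<Longrightarrow> is_chart d"
  using sm unfolding smooth_manifold_def by blast

lemma coverB: "\<exists>d\<in>B. q \<in> fst d"
  using sm unfolding smooth_manifold_def by blast

lemma cont_f: "continuous_on UNIV f"
  using smf by (simp add: smooth_map_def)

lemma map_coords_chart:
  assumes "c \<in> A" "d \<in> B"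
  shows "map_coords (img d) (g d) (local_dom c d f) (local_rep c d f)"
proof unfold_locales
  show "open (img d)" by (rule chartD(2)[OF chartB[OF assms(2)]])
  show "smooth_on (img d) (g d)" "\<And>y. y \<in> img d \<Longrightarrow> Finite_Cartesian_Product.transpose (g d y) = g d y"
    "\<And>y v. y \<in> img d \<Longrightarrow> v \<noteq> 0 \<Longrightarrow> 0 < v \<bullet> (g d y *v v)"
    using rm assms(2) by (auto simp: riemannian_metric_def)
  show "open (local_dom c d f)" by (rule open_local_dom[OF chartA[OF assms(1)] chartB[OF assms(2)] cont_f])
  show "smooth_on (local_dom c d f) (local_rep c d f)" using smf assms by (simp add: smooth_map_def)
  show "local_rep c d f z \<in> img d" if "z \<in> local_dom c d f" for z
    using that chartD(5)[OF chartB[OF assms(2)]] by (simp add: local_rep_def local_dom_iff[OF chartA[OF assms(1)]])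
qed

lemma holo_change_chart:
  assumes "c \<in> A" "c' \<in> A"
  shows "holo_change (overlap c c') (img c') (transition c c')"
proof unfold_locales
  show "holo_map_on (overlap c c') (transition c c')" using cm assms by (simp add: complex_manifold_def)
qed (use open_overlap transition_overlap(4) chartD(2) chartA assms in blast)+

definition pull :: "('b, real^'n) chart \<Rightarrow> ('a, complex^'m) chart \<Rightarrow> complex^'m \<Rightarrow> complex^'m \<Rightarrow> complex^'m \<Rightarrow> real" where
  "pull d c z x y = frechet_derivative (local_rep c d f) (at z) x \<bullet>
     (g d (local_rep c d f z) *v frechet_derivative (local_rep c d f) (at z) y)"

lemma local_rep_diff:
  assumes "c \<in> A" "d \<in> B" "z \<in> local_dom c d f"
  shows "local_rep c d f differentiable (at z)"
proof -
  interpret map_coords "img d" "g d" "local_dom c d f" "local_rep c d f" by (rule map_coords_chart[OF assms(1,2)])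
  show ?thesis by (rule Ck_on_differentiable[OF Ck_F[of 1] _ assms(3)]) simp
qed

lemma pull_target_change:
  assumes c: "c \<in> A" and d: "d \<in> B" "d' \<in> B" and z: "z \<in> local_dom c d f" "z \<in> local_dom c d' f"
  shows "pull d c z x y = pull d' c z x y"
proof -
  let ?F = "local_rep c d f" and ?\<tau> = "transition d d'"
  note cd = chartA[OF c] chartB[OF d(1)] chartB[OF d(2)]
  have zz: "z \<in> img c" "f (param c z) \<in> fst d" "f (param c z) \<in> fst d'" using z by (simp_all add: local_dom_iff[OF cd(1)])
  have Fz: "?F z \<in> overlap d d'"
    using zz by (simp add: local_rep_def overlap_def)
  have sm': "smooth_on (overlap d d') ?\<tau>" using sm d by (simp add: smooth_manifold_def)
  have d\<tau>: "?\<tau> differentiable (at (?F z))"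
    using sm' Ck_on_differentiable[of 1 "overlap d d'" ?\<tau>] Fz by (simp add: smooth_on_def)
  have o: "open (local_dom c d f \<inter> local_dom c d' f)" using open_local_dom cd cont_f by blast
  have eq: "local_rep c d' f w = ?\<tau> (?F w)" if "w \<in> local_dom c d f \<inter> local_dom c d' f" for w
    using that chartD(6)[OF cd(2)] by (simp add: local_rep_def transition_def local_dom_iff[OF cd(1)])
  have D: "frechet_derivative (local_rep c d' f) (at z) v = frechet_derivative ?\<tau> (at (?F z)) (frechet_derivative ?F (at z) v)" for v
    using frechet_derivative_cong_open[OF o _ eq, of z] z
      frechet_derivative_comp_apply[OF local_rep_diff[OF c d(1) z(1)] d\<tau>] by simp
  have "u \<bullet> (g d (?F z) *v v) = frechet_derivative ?\<tau> (at (?F z)) u \<bullet> (g d' (?\<tau> (?F z)) *v frechet_derivative ?\<tau> (at (?F z)) v)" for u v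
    using rm d Fz by (simp add: riemannian_metric_def Let_def)
  then show ?thesis unfolding pull_def D using eq[of z] z by simp
qed

lemma pull_source_change:
  assumes c: "c \<in> A" "c' \<in> A" and d: "d \<in> B" and z: "z \<in> overlap c c'" "z \<in> local_dom c d f"
  shows "pull d c z x y = pull d c' (transition c c' z)
     (frechet_derivative (transition c c') (at z) x) (frechet_derivative (transition c c') (at z) y)"
    and "transition c c' z \<in> local_dom c' d f"
proof -
  let ?F = "local_rep c' d f" and ?\<tau> = "transition c c'"
  note cd = chartA[OF c(1)] chartA[OF c(2)] chartB[OF d]
  interpret holo_change "overlap c c'" "img c'" ?\<tau> by (rule holo_change_chart[OF c])
  note t = transition_overlap[OF cd(1,2)]
  show tz: "?\<tau> z \<in> local_dom c' d f" using z t[OF z(1)] local_dom_iff cd by metis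
  have o: "open (overlap c c' \<inter> local_dom c d f)" using open_local_dom open_overlap cd cont_f by blast
  have eq: "local_rep c d f w = ?F (?\<tau> w)" if "w \<in> overlap c c' \<inter> local_dom c d f" for w
    using that t by (simp add: local_rep_def)
  have D: "frechet_derivative (local_rep c d f) (at z) v = frechet_derivative ?F (at (?\<tau> z)) (frechet_derivative ?\<tau> (at z) v)" for v
    using frechet_derivative_cong_open[OF o _ eq, of z] z
      frechet_derivative_comp_apply[OF diff_W[OF Ck_\<tau> z(1)] local_rep_diff[OF c(2) d tz]] by simp
  show "pull d c z x y = pull d c' (?\<tau> z) (frechet_derivative ?\<tau> (at z) x) (frechet_derivative ?\<tau> (at z) y)"
    unfolding pull_def D using eq[of z] z by simp
qed

definition chart_at :: "'a \<Rightarrow> ('b, real^'n) chart" where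
  "chart_at q = (SOME d. d \<in> B \<and> f q \<in> fst d)"

lemma chart_at: "chart_at q \<in> B" "f q \<in> fst (chart_at q)"
  using someI_ex[of "\<lambda>d. d \<in> B \<and> f q \<in> fst d"] coverB[of "f q"] unfolding chart_at_def by blast+

text \<open>The image of a chart domain under f need not lie in one target chart, so a target chart
  is chosen at every point. By \<open>pullback11_eq\<close> the choice does not affect the value,
  and smoothness can be checked with one target chart near each point.\<close>

definition pullback11 :: "('a, complex^'m) chart \<Rightarrow> complex^'m \<Rightarrow> complex^'m^'m" where
  "pullback11 c z = map_coords.pullback_mat (g (chart_at (param c z))) (local_rep c (chart_at (param c z)) f) z"

lemma chart_at_local_dom: "c \<in> A \<Longrightarrow> z \<in> img c \<Longrightarrow> z \<in> local_dom c (chart_at (param c z)) f"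
  using local_dom_iff[OF chartA] chart_at by blast

lemma herm_form_pullback_mat_pull:
  assumes "c \<in> A" "d \<in> B" "z \<in> local_dom c d f"
  shows "herm_form (map_coords.pullback_mat (g d) (local_rep c d f) z) x y =
     complex_of_real (pull d c z (fst (dir10 x)) (fst (dir01 y)) - pull d c z (snd (dir10 x)) (snd (dir01 y)))
     + \<i> * complex_of_real (pull d c z (fst (dir10 x)) (snd (dir01 y)) + pull d c z (snd (dir10 x)) (fst (dir01 y)))"
proof -
  interpret map_coords "img d" "g d" "local_dom c d f" "local_rep c d f" by (rule map_coords_chart[OF assms(1,2)])
  show ?thesis unfolding herm_form_pullback_mat[OF assms(3)] ip_dF[OF assms(3)] pull_def ..
qed

lemma pullback11_eq:
  assumes c: "c \<in> A" and d: "d \<in> B" and z: "z \<in> local_dom c d f"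
  shows "pullback11 c z = map_coords.pullback_mat (g d) (local_rep c d f) z"
proof -
  have zi: "z \<in> img c" using z local_dom_iff[OF chartA[OF c]] by blast
  let ?d = "chart_at (param c z)"
  have "herm_form (pullback11 c z) x y = herm_form (map_coords.pullback_mat (g d) (local_rep c d f) z) x y" for x y
    unfolding pullback11_def herm_form_pullback_mat_pull[OF c d z] herm_form_pullback_mat_pull[OF c chart_at(1) chart_at_local_dom[OF c zi]]
    using pull_target_change[OF c chart_at(1) d chart_at_local_dom[OF c zi] z] by simp
  then have "pullback11 c z $ a $ b = map_coords.pullback_mat (g d) (local_rep c d f) z $ a $ b" for a b
    using herm_form_axis by metis
  then show ?thesis by (simp add: vec_eq_iff)
qed

lemma Ck_pullback11:
  assumes c: "c \<in> A" shows "Ck_on k (img c) (\<lambda>z. pullback11 c z $ a $ b)"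
proof (rule Ck_on_local)
  fix z assume z: "z \<in> img c"
  let ?d = "chart_at (param c z)"
  interpret map_coords "img ?d" "g ?d" "local_dom c ?d f" "local_rep c ?d f"
    by (rule map_coords_chart[OF c chart_at(1)])
  have "Ck_on k (local_dom c ?d f) (\<lambda>z. pullback11 c z $ a $ b)"
    using Ck_on_cong[OF open_U, of "\<lambda>z. pullback11 c z $ a $ b" "\<lambda>z. pullback_mat z $ a $ b"] Ck_pullback_mat pullback11_eq[OF c chart_at(1)] by simp
  then show "\<exists>T. open T \<and> z \<in> T \<and> Ck_on k T (\<lambda>z. pullback11 c z $ a $ b)"
    using open_U chart_at_local_dom[OF c z] by blast
qed

lemma pullback11_change:
  assumes c: "c \<in> A" "c' \<in> A" and z: "z \<in> overlap c c'"
  shows "herm_form (pullback11 c z) x y = herm_form (pullback11 c' (transition c c' z))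
     (frechet_derivative (transition c c') (at z) x) (frechet_derivative (transition c c') (at z) y)"
proof -
  let ?d = "chart_at (param c z)" and ?D = "frechet_derivative (transition c c') (at z)"
  interpret holo_change "overlap c c'" "img c'" "transition c c'" by (rule holo_change_chart[OF c])
  have zi: "z \<in> local_dom c ?d f" using chart_at_local_dom[OF c(1)] overlap_iff[OF chartA[OF c(1)]] z by blast
  note p = pull_source_change[OF c chart_at(1) z zi]
  have lin: "linear ?D" by (rule linear_frechet_derivative[OF diff_W[OF Ck_\<tau> z]])
  have D: "?D (fst (dir10 x)) = fst (dir10 (?D x))" "?D (snd (dir10 x)) = snd (dir10 (?D x))"
    "?D (fst (dir01 x)) = fst (dir01 (?D x))" "?D (snd (dir01 x)) = snd (dir01 (?D x))" for x
    by (simp_all add: dir10_def dir01_def linear_scale[OF lin] linear_neg[OF lin] D_\<tau>_i[OF z])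
  show ?thesis
    unfolding pullback11_eq[OF c(1) chart_at(1) zi] pullback11_eq[OF c(2) chart_at(1) p(2)]
      herm_form_pullback_mat_pull[OF c(1) chart_at(1) zi] herm_form_pullback_mat_pull[OF c(2) chart_at(1) p(2)] p(1) D ..
qed

end

section \<open>Cut-off functions and partitions of unity\<close>

lemma has_real_derivative_max_power:
  "((\<lambda>t::real. (max 0 t) ^ Suc (Suc n)) has_real_derivative real (Suc (Suc n)) * (max 0 t) ^ Suc n) (at t)"
proof -
  consider "t > 0" | "t < 0" | "t = 0" by linarith
  then show ?thesis
  proof cases
    case 1
    have "((\<lambda>t::real. t ^ Suc (Suc n)) has_real_derivative real (Suc (Suc n)) * t ^ Suc n) (at t)"
      using DERIV_pow[of "Suc (Suc n)" t UNIV] by simp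
    then have "((\<lambda>t::real. (max 0 t) ^ Suc (Suc n)) has_real_derivative real (Suc (Suc n)) * t ^ Suc n) (at t)"
      by (rule DERIV_cong_ev[OF refl _ refl, THEN iffD1, rotated])
        (use 1 in \<open>auto intro!: eventually_mono[OF order_tendstoD(1)[OF tendsto_ident_at, of 0]] simp: eventually_nhds_conv_at max_def\<close>)
    then show ?thesis using 1 by (simp add: max_def)
  next
    case 2
    have "((\<lambda>t::real. 0) has_real_derivative 0) (at t)" by simp
    then have "((\<lambda>t::real. (max 0 t) ^ Suc (Suc n)) has_real_derivative 0) (at t)"
      by (rule DERIV_cong_ev[OF refl _ refl, THEN iffD1, rotated])
        (use 2 in \<open>auto intro!: eventually_mono[OF order_tendstoD(2)[OF tendsto_ident_at, of _ 0]] simp: eventually_nhds_conv_at max_def\<close>)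
    then show ?thesis using 2 by (simp add: max_def)
  next
    case 3
    have "((\<lambda>h::real. (max 0 h) ^ Suc n * (if h \<ge> 0 then 1 else 0)) \<longlongrightarrow> 0) (at 0)"
    proof (rule Lim_null_comparison)
      show "\<forall>\<^sub>F h::real in at 0. norm ((max 0 h) ^ Suc n * (if h \<ge> 0 then 1 else 0)) \<le> (max 0 h) ^ Suc n" by simp
      have "((\<lambda>h::real. (max 0 h) ^ Suc n) \<longlongrightarrow> (max 0 0) ^ Suc n) (at 0)" by (intro tendsto_intros)
      then show "((\<lambda>h::real. (max 0 h) ^ Suc n) \<longlongrightarrow> 0) (at 0)" by simp
    qed
    moreover have "(max 0 (0 + h)) ^ Suc (Suc n) / h = (max 0 h) ^ Suc n * (if h \<ge> 0 then 1 else 0)" if "h \<noteq> 0" for h :: real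
      using that by (auto simp: max_def)
    ultimately have "((\<lambda>h::real. ((max 0 (0 + h)) ^ Suc (Suc n) - (max 0 0) ^ Suc (Suc n)) / h) \<longlongrightarrow> 0) (at 0)"
      by (subst LIM_equal[of 0 _ "\<lambda>h. (max 0 h) ^ Suc n * (if h \<ge> 0 then 1 else 0)"]) auto
    then show ?thesis unfolding 3 DERIV_def by simp
  qed
qed

lemma Ck_on_cube: "Ck_on 2 UNIV (\<lambda>t::real. (max 0 t) ^ 3)"
proof -
  have 0: "Ck_on 0 UNIV (\<lambda>t::real. max 0 t)" by (auto intro!: continuous_intros)
  have 1: "Ck_on 1 UNIV (\<lambda>t::real. (max 0 t) ^ 2)"
    unfolding One_nat_def
  proof (rule Ck_on_SucI)
    show "((\<lambda>t. (max 0 t) ^ 2) has_derivative (\<lambda>v. (2 * max 0 t) * v)) (at t)" for t :: real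
      using has_real_derivative_max_power[of 0 t] by (simp add: has_field_derivative_def numeral_2_eq_2)
    show "Ck_on 0 UNIV (\<lambda>t. 2 * max 0 t * v)" for v :: real
      by (intro Ck_on_mult Ck_on_const 0) auto
  qed simp
  show ?thesis
    unfolding numeral_2_eq_2
  proof (rule Ck_on_SucI)
    show "((\<lambda>t. (max 0 t) ^ 3) has_derivative (\<lambda>v. (3 * (max 0 t)\<^sup>2) * v)) (at t)" for t :: real
      using has_real_derivative_max_power[of 1 t] by (simp add: has_field_derivative_def numeral_2_eq_2 numeral_3_eq_3)
    show "Ck_on (Suc 0) UNIV (\<lambda>t. 3 * (max 0 t)\<^sup>2 * v)" for v :: real
      by (intro Ck_on_mult Ck_on_const 1[unfolded One_nat_def]) auto
  qed simp
qed

context manifold_map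
begin

text \<open>The cube makes the cut-off twice continuously differentiable, which is all that the integrations by parts need.\<close>

definition bump :: "('a, complex^'m) chart \<times> (complex^'m) \<times> real \<Rightarrow> 'a \<Rightarrow> real" where
  "bump i q = (case i of (c, x, r) \<Rightarrow>
     if q \<in> fst c then (max 0 (r\<^sup>2 - (snd c q - x) \<bullet> (snd c q - x))) ^ 3 else 0)"

text \<open>A closed set outside which \<open>bump\<close> vanishes; the open \<open>cell\<close>
  below is where it is positive.\<close>

definition bcell :: "('a, complex^'m) chart \<times> (complex^'m) \<times> real \<Rightarrow> 'a set" where
  "bcell i = (case i of (c, x, r) \<Rightarrow> param c ` cball x r)"

definition good :: "('a, complex^'m) chart \<times> (complex^'m) \<times> real \<Rightarrow> bool" where
  "good i \<longleftrightarrow> (case i of (c, x, r) \<Rightarrow> c \<in> A \<and> 0 < r \<and> cball x r \<subseteq> img c)"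

definition cell :: "('a, complex^'m) chart \<times> (complex^'m) \<times> real \<Rightarrow> 'a set" where
  "cell i = (case i of (c, x, r) \<Rightarrow> {q \<in> fst c. snd c q \<in> ball x r})"

lemma good_cover: "\<exists>I. finite I \<and> (\<forall>i\<in>I. good i) \<and> (\<forall>q. \<exists>i\<in>I. q \<in> cell i)"
proof -
  have "open (cell i)" if i: "good i" for i
  proof -
    obtain c x r where ie: "i = (c, x, r)" by (cases i)
    have c: "is_chart c" using i chartA by (simp add: good_def ie)
    have "open (fst c \<inter> snd c -` ball x r)"
      by (rule continuous_open_preimage[OF chartD(3,1)[OF c]]) simp
    moreover have "cell i = fst c \<inter> snd c -` ball x r" by (simp add: cell_def ie set_eq_iff)
    ultimately show ?thesis by simp
  qed
  moreover have "UNIV \<subseteq> (\<Union>i\<in>{i. good i}. cell i)"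
  proof
    fix q :: 'a
    obtain c where c: "c \<in> A" "q \<in> fst c" using coverA by blast
    obtain r where r: "r > 0" "cball (snd c q) r \<subseteq> img c"
      using open_contains_cball_eq[OF chartD(2)[OF chartA[OF c(1)]]] chartD(5)[OF chartA[OF c(1)] c(2)] by metis
    have "good (c, snd c q, r)" "q \<in> cell (c, snd c q, r)" using c r by (simp_all add: good_def cell_def)
    then show "q \<in> (\<Union>i\<in>{i. good i}. cell i)" by blast
  qed
  ultimately obtain I where I: "I \<subseteq> {i. good i}" "finite I" "UNIV \<subseteq> (\<Union>i\<in>I. cell i)"
    by (rule compactE_image[OF cpt, of "{i. good i}" cell]) auto
  show ?thesis by (rule exI[of _ I]) (use I in blast)
qed

lemma bcell_closed: assumes "good i" shows "closed (bcell i)"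
proof -
  obtain c x r where i: "i = (c, x, r)" by (cases i)
  have c: "is_chart c" "cball x r \<subseteq> img c" using assms chartA by (simp_all add: good_def i)
  have "compact (param c ` cball x r)"
    by (rule compact_continuous_image[OF continuous_on_subset[OF chartD(4)[OF c(1)] c(2)]]) simp
  then show ?thesis by (simp add: bcell_def i compact_imp_closed)
qed

lemma bump_outside:
  assumes "good i" "q \<notin> bcell i" shows "bump i q = 0"
proof -
  obtain c x r where i: "i = (c, x, r)" by (cases i)
  have c: "is_chart c" "0 < r" using assms chartA by (simp_all add: good_def i)
  show ?thesis
  proof (cases "q \<in> fst c")
    case True
    have "snd c q \<notin> cball x r"
      using assms(2) chartD(6)[OF c(1) True] by (auto simp: bcell_def i) (metis imageI mem_cball)
    then have "r < norm (snd c q - x)" by (simp add: dist_norm norm_minus_commute)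
    then have "r\<^sup>2 \<le> (snd c q - x) \<bullet> (snd c q - x)"
      unfolding power2_norm_eq_inner[symmetric] using c(2) by (simp add: power_mono)
    then show ?thesis using True by (simp add: bump_def i)
  qed (simp add: bump_def i)
qed

text \<open>The chart domain of the ball and the complement of its closed cell cover M. On the first
  the bump is the truncated cube of a smooth function of the coordinates, on the second it is
  zero.\<close>

lemma Ck_bump:
  assumes i: "good i" and c': "c' \<in> A"
  shows "Ck_on 2 (img c') (\<lambda>z. bump i (param c' z))"
proof (rule Ck_on_local)
  fix z assume z: "z \<in> img c'"
  obtain c x r where ie: "i = (c, x, r)" by (cases i)
  have c: "c \<in> A" using i by (simp add: good_def ie)
  note cc = chartA[OF c] chartA[OF c']
  show "\<exists>T. open T \<and> z \<in> T \<and> Ck_on 2 T (\<lambda>z. bump i (param c' z))"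
  proof (cases "param c' z \<in> fst c")
    case True
    interpret holo_change "overlap c' c" "img c" "transition c' c" by (rule holo_change_chart[OF c' c])
    have "Ck_on 2 (overlap c' c) (\<lambda>z. r\<^sup>2 - (transition c' c z - x) \<bullet> (transition c' c z - x))"
      by (intro Ck_on_diff Ck_on_inner Ck_on_const Ck_\<tau> open_W)
    then have "Ck_on 2 (overlap c' c) (\<lambda>z. (max 0 (r\<^sup>2 - (transition c' c z - x) \<bullet> (transition c' c z - x))) ^ 3)"
      by (rule Ck_on_compose[OF open_W open_UNIV _ Ck_on_cube]) simp
    moreover have "bump i (param c' z) = (max 0 (r\<^sup>2 - (transition c' c z - x) \<bullet> (transition c' c z - x))) ^ 3" if "z \<in> overlap c' c" for z
      using that by (simp add: bump_def ie transition_def overlap_iff[OF cc(2)])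
    ultimately have "Ck_on 2 (overlap c' c) (\<lambda>z. bump i (param c' z))"
      by (subst Ck_on_cong[OF open_W]) auto
    moreover have "z \<in> overlap c' c" using True z by (simp add: overlap_iff[OF cc(2)])
    ultimately show ?thesis using open_W by blast
  next
    case False
    let ?T = "{z \<in> img c'. param c' z \<in> - bcell i}"
    have o: "open ?T" by (rule open_chart_preimage[OF cc(2)]) (use bcell_closed[OF i] in auto)
    have "param c' z \<notin> bcell i"
    proof
      assume "param c' z \<in> bcell i"
      then obtain w where "w \<in> cball x r" "param c' z = param c w" unfolding bcell_def ie by auto
      moreover have "cball x r \<subseteq> img c" using i by (simp add: good_def ie)
      ultimately show False using False chartD(7)[OF cc(1)] by auto
    qed
    moreover have "Ck_on 2 ?T (\<lambda>z. bump i (param c' z))"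
    proof -
      have "Ck_on 2 ?T (\<lambda>z. bump i (param c' z)) = Ck_on 2 ?T (\<lambda>_. 0 :: real)"
        by (rule Ck_on_cong[OF o], rule bump_outside[OF i]) simp
      then show ?thesis by (simp add: Ck_on_const)
    qed
    ultimately show ?thesis using o z by blast
  qed
qed

definition C2_map :: "('a \<Rightarrow> real) \<Rightarrow> bool" where
  "C2_map \<rho> \<longleftrightarrow> (\<forall>c\<in>A. Ck_on 2 (img c) (\<lambda>z. \<rho> (param c z)))"

lemma partition_of_unity:
  "\<exists>I \<rho>. finite I \<and> (\<forall>i\<in>I. good i) \<and> (\<forall>i\<in>I. C2_map (\<rho> i)) \<and> (\<forall>i\<in>I. \<forall>q. 0 \<le> \<rho> i q) \<and>
     (\<forall>i\<in>I. \<forall>q. q \<notin> bcell i \<longrightarrow> \<rho> i q = 0) \<and> (\<forall>q. (\<Sum>i\<in>I. \<rho> i q) = 1)"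
proof -
  obtain I where I: "finite I" "\<And>i. i \<in> I \<Longrightarrow> good i" "\<And>q. \<exists>i\<in>I. q \<in> cell i"
    using good_cover by blast
  have nn: "0 \<le> bump i q" for i q by (auto simp: bump_def split: prod.split)
  have pos: "0 < (\<Sum>i\<in>I. bump i q)" for q
  proof -
    obtain i where iI: "i \<in> I" "q \<in> cell i" using I(3) by blast
    obtain c x r where ie: "i = (c, x, r)" by (cases i)
    have i: "(c, x, r) \<in> I" "q \<in> fst c" "snd c q \<in> ball x r" using iI by (simp_all add: ie cell_def)
    have "norm (snd c q - x) < r" using i(3) by (simp add: dist_norm norm_minus_commute)
    then have "(snd c q - x) \<bullet> (snd c q - x) < r\<^sup>2"
      unfolding power2_norm_eq_inner[symmetric] by (simp add: power_strict_mono)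
    then have "0 < bump (c, x, r) q" using i by (simp add: bump_def)
    then show ?thesis using sum_pos2[OF I(1) i(1), of "\<lambda>i. bump i q"] nn by simp
  qed
  define \<rho> where "\<rho> i q = bump i q / (\<Sum>i\<in>I. bump i q)" for i q
  have "C2_map (\<rho> i)" if "i \<in> I" for i
    unfolding C2_map_def \<rho>_def
  proof
    fix c assume c: "c \<in> A"
    note o = chartD(2)[OF chartA[OF c]]
    show "Ck_on 2 (img c) (\<lambda>z. bump i (param c z) / (\<Sum>i\<in>I. bump i (param c z)))"
    proof (intro Ck_on_divide Ck_on_sum o)
      show "Ck_on 2 (img c) (\<lambda>z. bump i (param c z))" if "i \<in> I" for i by (rule Ck_bump[OF I(2)[OF that] c])
      then show "Ck_on 2 (img c) (\<lambda>z. bump i (param c z))" using that .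
      show "(\<Sum>i\<in>I. bump i (param c z)) \<noteq> 0" for z using pos[of "param c z"] by simp
    qed
  qed
  moreover have "(\<Sum>i\<in>I. \<rho> i q) = 1" for q
    unfolding \<rho>_def sum_divide_distrib[symmetric] using pos[of q] by simp
  moreover have "0 \<le> \<rho> i q" for i q unfolding \<rho>_def using nn pos[of q] by (simp add: less_imp_le)
  moreover have "\<rho> i q = 0" if "i \<in> I" "q \<notin> bcell i" for i q
    unfolding \<rho>_def using bump_outside[OF I(2)] that by simp
  ultimately show ?thesis using I(1,2) by (intro exI[of _ I] exI[of _ \<rho>]) blast
qed

end

section \<open>Hermitian harmonic maps are pluriharmonic\<close>

lemma integral_zero_imp_zero:
  fixes k :: "'a::euclidean_space \<Rightarrow> real"
  assumes k: "continuous_on UNIV k" "integrable lborel k" "\<And>z. 0 \<le> k z" "(\<integral>z. k z \<partial>lborel) = 0"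
  shows "k z = 0"
proof -
  have "AE z in lborel. k z = 0"
    using integral_nonneg_eq_0_iff_AE[OF k(2)] k(3,4) by simp
  then have "{z. k z \<noteq> 0} \<in> null_sets lborel"
    using k(2) by (subst (asm) AE_iff_null) (auto simp: borel_measurable_integrable)
  then have "negligible {z. k z \<noteq> 0}"
    by (simp add: negligible_iff_null_sets null_sets_completionI)
  moreover have "open {z. k z \<noteq> 0}"
    using open_vimage[of "- {0}" k] k(1) by (simp add: vimage_def open_Compl)
  ultimately have "{z. k z \<noteq> 0} = {}" using open_not_negligible by blast
  then show ?thesis by blast
qed

lemma constant_sign_on_connected:
  fixes s :: "'a::topological_space \<Rightarrow> real"
  assumes "connected X" "continuous_on X s" "\<And>z. z \<in> X \<Longrightarrow> s z \<noteq> 0"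
  shows "\<exists>\<sigma>. \<forall>z\<in>X. \<bar>s z\<bar> = \<sigma> * s z"
proof -
  have c: "connected (s ` X)" by (rule connected_continuous_image[OF assms(2,1)])
  show ?thesis
  proof (cases "\<exists>z\<in>X. s z > 0")
    case True
    then obtain a where a: "a \<in> X" "s a > 0" by blast
    have "s z > 0" if z: "z \<in> X" for z
    proof (rule ccontr)
      assume "\<not> 0 < s z"
      then have "0 \<in> s ` X" using connectedD_interval[OF c, of "s z" "s a" 0] a z by auto
      then show False using assms(3) by auto
    qed
    then show ?thesis by (intro exI[of _ 1]) (simp add: less_imp_le)
  next
    case False
    then have "s z \<le> 0" if "z \<in> X" for z using that by force
    then show ?thesis by (intro exI[of _ "-1"]) auto
  qed
qed

lemma Ck_Ecoef:
  assumes "open D" "\<And>a b. Ck_on k D (\<lambda>w. H w $ a $ b)"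
  shows "Ck_on k D (\<lambda>w. Ecoef (H w) a b c d)"
  unfolding Ecoef_def alt_def
  by (intro Ck_on_sum Ck_on_mult Ck_on_const Ck_fund_form_power assms)

locale harmonic_map = manifold_map A B g f
  for A :: "('a::{t2_space,second_countable_topology}, complex^'m) chart set"
    and B :: "('b::{t2_space,second_countable_topology}, real^'n) chart set"
    and g :: "('b, 'n) real_metric" and f :: "'a \<Rightarrow> 'b" +
  fixes h :: "('a, 'm) herm_metric"
  assumes hm: "hermitian_metric A h" and ast: "astheno_kaehler A h"
    and curv: "nonpos_complex_sectional_curvature B g" and harm: "hermitian_harmonic A h B g f"
begin

lemma curv_at:
  assumes "c \<in> A" "d \<in> B" "z \<in> local_dom c d f"
  shows "Re (riem_cplx (g d) (local_rep c d f z) Z (vcnj W) W (vcnj Z)) \<le> 0"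
proof -
  interpret map_coords "img d" "g d" "local_dom c d f" "local_rep c d f" by (rule map_coords_chart[OF assms(1,2)])
  show ?thesis using curv assms(2) F_in[OF assms(3)] by (simp add: nonpos_complex_sectional_curvature_def)
qed

lemma herm_pos_h: "c \<in> A \<Longrightarrow> z \<in> img c \<Longrightarrow> herm_pos (h c z)"
  using hermitian_metricD(2)[OF hm] .

lemma Ck_h: assumes "c \<in> A" shows "Ck_on k (img c) (\<lambda>z. h c z $ a $ b)"
  using hermitian_metricD(1)[OF hm assms] chartD(2)[OF chartA[OF assms]]
  by (intro Ck_on_vec_nth) (auto simp: smooth_on_def)

text \<open>By \<open>unitary_frame_inv\<close> the sum over the frame is the contraction with the
  inverse metric. The first derivatives in the harmonic map equation stand in the other order than
  in \<open>hess\<close>, which the symmetry of the Christoffel symbols repairs.\<close>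

lemma harm_frame:
  assumes c: "c \<in> A" "d \<in> B" "z \<in> local_dom c d f" and u: "unitary_frame (h c z) u"
  shows "(\<Sum>p\<in>UNIV. map_coords.hess (g d) (local_rep c d f) (u p) (u p) i z) = 0"
proof -
  interpret map_coords "img d" "g d" "local_dom c d f" "local_rep c d f" by (rule map_coords_chart[OF c(1,2)])
  let ?F = "local_rep c d f"
  have hess: "hess (axis a 1) (axis b 1) i z = dz a (dzbar b (\<lambda>w. complex_of_real (?F w $ i))) z +
       (\<Sum>j\<in>UNIV. \<Sum>k\<in>UNIV. of_real (christoffel (g d) (?F z) i j k) *
          dzbar b (\<lambda>w. complex_of_real (?F w $ j)) z * dz a (\<lambda>w. complex_of_real (?F w $ k)) z)" for a b
  proof -
    have 1: "dz a (dzbar b (\<lambda>w. complex_of_real (?F w $ i))) z = dl (axis a 1) (d01 (axis b 1) i) z"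
      unfolding dF_def[abs_def] by (rule dz_dzbar(1)[OF open_U Ck_F_nth c(3)])
    have 2: "dzbar b (\<lambda>w. complex_of_real (?F w $ j)) z = d01 (axis b 1) j z"
      "dz a (\<lambda>w. complex_of_real (?F w $ j)) z = d10 (axis a 1) j z" for a b j
      unfolding dF_def by (rule dzbar_eq_db[OF diff_F_nth[OF c(3)]] dz_eq_dl[OF diff_F_nth[OF c(3)]])+
    have "(\<Sum>j\<in>UNIV. \<Sum>k\<in>UNIV. Gam i j k z * d10 (axis a 1) j z * d01 (axis b 1) k z)
      = (\<Sum>j\<in>UNIV. \<Sum>k\<in>UNIV. Gam i j k z * d01 (axis b 1) j z * d10 (axis a 1) k z)"
      by (subst sum.swap) (simp add: Gam_sym[OF c(3), of i] mult_ac)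
    then show ?thesis unfolding hess_def cov_def 1 2 Gam_def by simp
  qed
  have "(\<Sum>p\<in>UNIV. hess (u p) (u p) i z) = (\<Sum>p\<in>UNIV. \<Sum>a\<in>UNIV. \<Sum>b\<in>UNIV. u p $ a * cnj (u p $ b) * hess (axis a 1) (axis b 1) i z)"
    by (rule sum.cong[OF refl]) (rule hess_expansion[OF c(3)])
  also have "\<dots> = (\<Sum>a\<in>UNIV. \<Sum>b\<in>UNIV. herm_inv (h c z) a b * hess (axis a 1) (axis b 1) i z)"
    unfolding unitary_frame_inv(1)[OF u] sum_distrib_right by (rule sum_rot3[symmetric])
  also have "\<dots> = 0"
    using harm c unfolding hess hermitian_harmonic_def Let_def by blast
  finally show ?thesis .
qed

section \<open>The cut off pullback form and its scalar\<close>

definition cut_pullback :: "('a \<Rightarrow> real) \<Rightarrow> ('a, complex^'m) chart \<Rightarrow> complex^'m \<Rightarrow> complex^'m^'m" where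
  "cut_pullback \<rho> c z = (\<chi> a b. complex_of_real (\<rho> (param c z)) * pullback11 c z $ a $ b)"

definition cut_Lam :: "('a \<Rightarrow> real) \<Rightarrow> ('a, complex^'m) chart \<Rightarrow> complex^'m \<Rightarrow> real" where
  "cut_Lam \<rho> c z = Lam (h c z) (cut_pullback \<rho> c) z"

lemma Ck_cut_pullback: "C2_map \<rho> \<Longrightarrow> c \<in> A \<Longrightarrow> Ck_on 2 (img c) (\<lambda>z. cut_pullback \<rho> c z $ a $ b)"
  unfolding cut_pullback_def C2_map_def using chartD(2)[OF chartA]
  by (simp, intro Ck_on_mult Ck_on_of_real Ck_pullback11) auto

lemma herm_form_cut_pullback: "herm_form (cut_pullback \<rho> c z) x y = complex_of_real (\<rho> (param c z)) * herm_form (pullback11 c z) x y"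
  unfolding herm_form_def cut_pullback_def by (simp add: sum_distrib_left mult_ac)

lemma cut_pullback_one: "cut_pullback (\<lambda>_. 1) = pullback11"
  by (intro ext) (simp add: cut_pullback_def vec_eq_iff)

lemma C2_map_one: "C2_map (\<lambda>_. 1)"
  by (simp add: C2_map_def Ck_on_const)

lemma frame_change:
  assumes c: "c \<in> A" "c' \<in> A" "z \<in> overlap c c'" and u: "unitary_frame (h c z) u"
  shows "unitary_frame (h c' (transition c c' z)) (\<lambda>p. frechet_derivative (transition c c') (at z) (u p))"
  using u hermitian_metricD(3)[OF hm c] unfolding unitary_frame_def by simp

text \<open>The differential of the transition carries unitary frames to unitary frames, and
  \<open>ddb_alt\<close> is tensorial.\<close>

lemma cut_Lam_change:
  assumes m: "2 \<le> CARD('m)" and \<rho>: "C2_map \<rho>" and c: "c \<in> A" "c' \<in> A" "z \<in> overlap c c'"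
  shows "cut_Lam \<rho> c z = cut_Lam \<rho> c' (transition c c' z)"
proof -
  interpret holo_change "overlap c c'" "img c'" "transition c c'" by (rule holo_change_chart[OF c(1,2)])
  let ?\<tau> = "transition c c'" and ?D = "frechet_derivative (transition c c') (at z)"
  have z: "z \<in> img c" using c overlap_iff[OF chartA[OF c(1)]] by blast
  note t = transition_overlap[OF chartA[OF c(1)] chartA[OF c(2)]]
  obtain u where u: "unitary_frame (h c z) u" using unitary_frame_exists[OF herm_pos_h[OF c(1) z]] by blast
  have "ddb_alt (cut_pullback \<rho> c) (u p) (u s) z = ddb_alt (cut_pullback \<rho> c') (?D (u p)) (?D (u s)) (?\<tau> z)" for p s
    by (rule ddb_alt_pullback[OF c(3) Ck_cut_pullback[OF \<rho> c(2)]])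
      (simp add: herm_form_cut_pullback pullback11_change[OF c(1,2)] t(2))
  then show ?thesis
    unfolding cut_Lam_def Lam_frame[OF m u chartD(2)[OF chartA[OF c(1)]] z Ck_cut_pullback[OF \<rho> c(1)]]
      Lam_frame[OF m frame_change[OF c u] chartD(2)[OF chartA[OF c(2)]] t(4)[OF c(3)] Ck_cut_pullback[OF \<rho> c(2)]] by simp
qed

lemma cont_wt: "c \<in> A \<Longrightarrow> continuous_on (img c) (\<lambda>z. wt (h c z))"
proof -
  assume c: "c \<in> A"
  have "Ck_on 0 (img c) (\<lambda>z. wt (h c z))"
    unfolding wt_def by (intro Ck_on_sum Ck_on_mult Ck_Ecoef Ck_h c chartD(2)[OF chartA])
  then show ?thesis by simp
qed

lemma cont_dens:
  assumes "C2_map \<rho>" "c \<in> A" shows "continuous_on (img c) (\<lambda>z. dens (h c z) (cut_pullback \<rho> c) z)"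
proof -
  note o = chartD(2)[OF chartA[OF assms(2)]]
  have "Ck_on 0 (img c) (dl (axis a 1) (db (axis b 1) (\<lambda>w. cut_pullback \<rho> c w $ e $ d)))" for a b e d
    by (rule Ck_on_cd[OF o], rule Ck_on_cd[OF o]) (use Ck_cut_pullback[OF assms] in \<open>simp add: numeral_2_eq_2\<close>)
  then have "Ck_on 0 (img c) (\<lambda>z. dens (h c z) (cut_pullback \<rho> c) z)"
    unfolding dens_def by (intro Ck_on_sum Ck_on_mult Ck_Ecoef Ck_h assms o)
  then show ?thesis by simp
qed

lemma cont_cut_Lam:
  assumes "2 \<le> CARD('m)" "C2_map \<rho>" "c \<in> A" shows "continuous_on (img c) (cut_Lam \<rho> c)"
  unfolding cut_Lam_def[abs_def] Lam_def
  by (intro continuous_intros cont_dens cont_wt assms) (use wt_nz(1)[OF assms(1) herm_pos_h[OF assms(3)]] in auto)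

lemma dens_zero:
  assumes c: "c \<in> A" "z \<in> img c" and K: "closed K" "\<And>q. q \<notin> K \<Longrightarrow> \<rho> q = 0" "param c z \<notin> K"
  shows "dens (h c z) (cut_pullback \<rho> c) z = 0"
proof -
  let ?T = "{w \<in> img c. param c w \<in> - K}"
  have o: "open ?T" by (rule open_chart_preimage[OF chartA[OF c(1)]]) (use K(1) in auto)
  have S0: "cut_pullback \<rho> c w $ e $ d = 0" if "w \<in> ?T" for w e d using that K(2) by (simp add: cut_pullback_def)
  have z: "z \<in> ?T" using c K(3) by simp
  have "db (axis b 1) (\<lambda>w. cut_pullback \<rho> c w $ e $ d) w = 0" if "w \<in> ?T" for w b e d
    using cd_cong_open[OF o that, of "\<lambda>w. cut_pullback \<rho> c w $ e $ d" "\<lambda>_. 0"] S0 by simp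
  then have "dl (axis a 1) (db (axis b 1) (\<lambda>w. cut_pullback \<rho> c w $ e $ d)) z = 0" for a b e d
    using cd_cong_open[OF o z, of "db (axis b 1) (\<lambda>w. cut_pullback \<rho> c w $ e $ d)" "\<lambda>_. 0"] by simp
  then show ?thesis by (simp add: dens_def)
qed

lemma cut_Lam_zero:
  assumes "c \<in> A" "z \<in> img c" "closed K" "\<And>q. q \<notin> K \<Longrightarrow> \<rho> q = 0" "param c z \<notin> K"
  shows "cut_Lam \<rho> c z = 0"
  using dens_zero[of c z K \<rho>] assms by (simp add: cut_Lam_def Lam_def)

lemma cut_Lam_sum:
  assumes I: "finite I" "\<And>i. i \<in> I \<Longrightarrow> C2_map (\<rho> i)" "\<And>q. (\<Sum>i\<in>I. \<rho> i q) = 1" and c: "c \<in> A" "z \<in> img c"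
  shows "(\<Sum>i\<in>I. cut_Lam (\<rho> i) c z) = cut_Lam (\<lambda>_. 1) c z"
proof -
  note o = chartD(2)[OF chartA[OF c(1)]]
  have S: "cut_pullback (\<lambda>_. 1) c w $ e $ d = (\<Sum>i\<in>I. cut_pullback (\<rho> i) c w $ e $ d)" for w e d
    unfolding cut_pullback_def by (simp add: sum_distrib_right[symmetric] of_real_sum[symmetric] I(3) del: of_real_sum)
  have 1: "(\<lambda>w. cut_pullback (\<rho> i) c w $ e $ d) differentiable (at w)" if "i \<in> I" "w \<in> img c" for i e d w
    using Ck_on_differentiable[OF Ck_cut_pullback[OF I(2)[OF that(1)] c(1)] _ that(2)] by simp
  have 2: "db (axis b 1) (\<lambda>w. cut_pullback (\<rho> i) c w $ e $ d) differentiable (at z)" if "i \<in> I" for i b e d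
    by (rule Ck_on_differentiable[OF Ck_on_cd[OF o, of 1] _ c(2)])
      (use Ck_cut_pullback[OF I(2)[OF that] c(1)] in \<open>simp_all add: numeral_2_eq_2\<close>)
  have "dl (axis a 1) (db (axis b 1) (\<lambda>w. cut_pullback (\<lambda>_. 1) c w $ e $ d)) z =
     (\<Sum>i\<in>I. dl (axis a 1) (db (axis b 1) (\<lambda>w. cut_pullback (\<rho> i) c w $ e $ d)) z)" for a b e d
  proof -
    have "dl (axis a 1) (db (axis b 1) (\<lambda>w. cut_pullback (\<lambda>_. 1) c w $ e $ d)) z =
      dl (axis a 1) (\<lambda>w. \<Sum>i\<in>I. db (axis b 1) (\<lambda>w. cut_pullback (\<rho> i) c w $ e $ d) w) z"
      unfolding S by (rule cd_cong_open[OF o c(2)]) (rule cd_sum[OF 1])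
    then show ?thesis by (simp add: cd_sum[OF 2])
  qed
  then have "dens (h c z) (cut_pullback (\<lambda>_. 1) c) z = (\<Sum>e\<in>UNIV. \<Sum>d\<in>UNIV. \<Sum>a\<in>UNIV. \<Sum>b\<in>UNIV. \<Sum>i\<in>I.
      Ecoef (h c z) e d a b * dl (axis a 1) (db (axis b 1) (\<lambda>w. cut_pullback (\<rho> i) c w $ e $ d)) z)"
    unfolding dens_def by (simp add: sum_distrib_left)
  also have "\<dots> = (\<Sum>i\<in>I. dens (h c z) (cut_pullback (\<rho> i) c) z)" unfolding dens_def by (rule sum_rot5)
  finally show ?thesis unfolding cut_Lam_def Lam_def by (simp add: sum_divide_distrib)
qed

lemma cut_Lam_pullback11:
  assumes m: "2 \<le> CARD('m)" and c: "c \<in> A" "d \<in> B" "z \<in> local_dom c d f"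
  shows "0 \<le> cut_Lam (\<lambda>_. 1) c z"
    and "cut_Lam (\<lambda>_. 1) c z = 0 \<Longrightarrow> unitary_frame (h c z) u \<Longrightarrow> map_coords.hess (g d) (local_rep c d f) (u p) (u s) i z = 0"
proof -
  interpret map_coords "img d" "g d" "local_dom c d f" "local_rep c d f" by (rule map_coords_chart[OF c(1,2)])
  have z: "z \<in> img c" using c local_dom_iff[OF chartA[OF c(1)]] by blast
  have e: "cut_Lam (\<lambda>_. 1) c z = (\<Sum>p\<in>UNIV. \<Sum>s\<in>UNIV. Re (ddb_alt pullback_mat (u p) (u s) z)) / (2 * real CARD('m) * real (CARD('m) - 1))"
    if u: "unitary_frame (h c z) u" for u
  proof -
    have "ddb (pullback11 c) a x b y z = ddb pullback_mat a x b y z" for a x b y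
    proof -
      have "db b (\<lambda>w. herm_form (pullback11 c w) x y) w = db b (\<lambda>w. herm_form (pullback_mat w) x y) w" if "w \<in> local_dom c d f" for w
        by (rule cd_cong_open[OF open_U that]) (simp add: pullback11_eq[OF c(1,2)])
      then show ?thesis unfolding ddb_def by (rule cd_cong_open[OF open_U c(3)])
    qed
    then show ?thesis
      unfolding cut_Lam_def Lam_frame[OF m u chartD(2)[OF chartA[OF c(1)]] z Ck_cut_pullback[OF C2_map_one c(1)]]
      unfolding cut_pullback_one ddb_alt_def by simp
  qed
  have n: "0 < 2 * real CARD('m) * real (CARD('m) - 1)" using m by simp
  note b = bochner[OF c(3) curv_at[OF c] harm_frame[OF c]]
  obtain u0 where u0: "unitary_frame (h c z) u0" using unitary_frame_exists[OF herm_pos_h[OF c(1) z]] by blast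
  show "0 \<le> cut_Lam (\<lambda>_. 1) c z" unfolding e[OF u0] using b(1)[OF u0] n by simp
  assume L: "cut_Lam (\<lambda>_. 1) c z = 0" and u: "unitary_frame (h c z) u"
  have "(\<Sum>p\<in>UNIV. \<Sum>s\<in>UNIV. Re (ddb_alt pullback_mat (u p) (u s) z)) = 0"
    using L n m unfolding e[OF u] by auto
  then show "hess (u p) (u s) i z = 0" by (rule b(2)[OF u])
qed

lemma astheno_chart:
  assumes m: "2 \<le> CARD('m)" and c: "c \<in> A" "z \<in> img c"
  shows "(\<Sum>a\<in>UNIV. \<Sum>b\<in>UNIV. dl (axis a 1) (db (axis b 1) (\<lambda>w. Ecoef (h c w) e d a b)) z) = 0"
proof (cases "CARD('m) = 2")
  \<comment> \<open>For m = 2 the power of the fundamental form is 1, so the coefficients do not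
    depend on the metric and all their derivatives vanish.\<close>
  case True
  define k where "k a b = Ecoef (h c z) e d a b" for a b
  have K: "(\<lambda>w. Ecoef (h c w) e d a b) = (\<lambda>_. k a b)" for a b
    by (simp add: Ecoef_def True k_def)
  have K2: "cd p (\<lambda>_. k a b) = (\<lambda>_. 0)" for p :: "(complex^'m) \<times> (complex^'m)" and a b by (rule ext) simp
  show ?thesis by (simp only: K K2 cd_const sum.neutral_const)
next
  case False
  show ?thesis
    by (rule astheno_Ecoef[OF _ chartD(2)[OF chartA[OF c(1)]] Ck_h[OF c(1)] c(2)])
      (use m False ast c in \<open>auto simp: astheno_kaehler_def Let_def\<close>)
qed

text \<open>\<open>integral_dens_zero\<close> concerns \<open>dens\<close>, which is
  \<open>Lam\<close> times \<open>wt\<close>, while the density here is the norm of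
  \<open>wt\<close>. On the ball that carries the cut-off the real quotient of \<open>wt\<close> by
  \<open>wt_const\<close> has no zero, hence a constant sign, so norm and value differ by a constant
  factor.\<close>

lemma integral_cut_Lam_zero:
  assumes m: "2 \<le> CARD('m)" and i: "good (c, x, r)" and \<rho>: "C2_map \<rho>" "\<And>q. q \<notin> bcell (c, x, r) \<Longrightarrow> \<rho> q = 0"
  shows "(\<integral>z. zero_ext (img c) (\<lambda>z. norm (wt (h c z)) * cut_Lam \<rho> c z) z \<partial>lborel) = 0"
proof -
  have c: "c \<in> A" "0 < r" "cball x r \<subseteq> img c" using i by (simp_all add: good_def)
  note ch = chartA[OF c(1)]
  let ?s = "\<lambda>z. Re (wt (h c z) / wt_const TYPE('m))"
  have s: "wt (h c z) = wt_const TYPE('m) * of_real (?s z)" if "z \<in> img c" for z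
  proof -
    have "wt (h c z) / wt_const TYPE('m) = of_real (?s z)"
      using wt_nz(2)[OF m herm_pos_h[OF c(1) that]] by (simp only: of_real_Re)
    then show ?thesis using wt_const_nz[OF m] by (simp only: divide_eq_eq mult.commute if_True not_False_eq_True)
  qed
  have "continuous_on (cball x r) ?s"
    by (intro continuous_intros continuous_on_subset[OF cont_wt[OF c(1)] c(3)]) (use wt_const_nz[OF m] in auto)
  moreover have "?s z \<noteq> 0" if "z \<in> cball x r" for z
  proof
    assume "?s z = 0"
    then have "wt (h c z) = 0" using s[of z] that c(3) by auto
    then show False using wt_nz(1)[OF m herm_pos_h[OF c(1)]] that c(3) by blast
  qed
  ultimately obtain \<sigma> where \<sigma>: "\<And>z. z \<in> cball x r \<Longrightarrow> \<bar>?s z\<bar> = \<sigma> * ?s z"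
    using constant_sign_on_connected[of "cball x r" ?s] convex_connected[OF convex_cball] by blast
  \<comment> \<open>The constant with \<open>norm (wt (h c z))\<close> equal to \<kappa> times
    \<open>wt (h c z)\<close> on the ball.\<close>
  define \<kappa> where "\<kappa> = of_real (norm (wt_const TYPE('m)) * \<sigma>) / wt_const TYPE('m)"
  have out: "dens (h c z) (cut_pullback \<rho> c) z = 0" if "z \<in> img c - cball x r" for z
  proof (rule dens_zero[OF c(1) _ bcell_closed[OF i] \<rho>(2)])
    show "z \<in> img c" using that by simp
    show "param c z \<notin> bcell (c, x, r)"
    proof
      assume "param c z \<in> bcell (c, x, r)"
      then obtain w where "w \<in> cball x r" "param c z = param c w" by (auto simp: bcell_def)
      then have "z = w" using chartD(8)[OF ch] that c(3) by (metis DiffD1 subsetD)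
      then show False using that \<open>w \<in> cball x r\<close> by simp
    qed
  qed
  have "norm (wt (h c z)) * cut_Lam \<rho> c z = Re (\<kappa> * dens (h c z) (cut_pullback \<rho> c) z)" if z: "z \<in> img c" for z
  proof (cases "z \<in> cball x r")
    case True
    have "of_real (norm (wt (h c z))) = \<kappa> * wt (h c z)"
    proof -
      have "norm (wt (h c z)) = norm (wt_const TYPE('m)) * (\<sigma> * ?s z)"
        by (subst s[OF z]) (simp only: norm_mult norm_of_real \<sigma>[OF True])
      then have "complex_of_real (norm (wt (h c z))) = of_real (norm (wt_const TYPE('m)) * \<sigma>) * of_real (?s z)" by simp
      also have "\<dots> = \<kappa> * (wt_const TYPE('m) * of_real (?s z))" using wt_const_nz[OF m] by (simp add: \<kappa>_def)
      finally show ?thesis using s[OF z] by simp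
    qed
    then have "of_real (norm (wt (h c z))) * (dens (h c z) (cut_pullback \<rho> c) z / wt (h c z)) = \<kappa> * dens (h c z) (cut_pullback \<rho> c) z"
      using wt_nz(1)[OF m herm_pos_h[OF c(1) z]] by simp
    then have "Re (of_real (norm (wt (h c z))) * (dens (h c z) (cut_pullback \<rho> c) z / wt (h c z))) = Re (\<kappa> * dens (h c z) (cut_pullback \<rho> c) z)" by simp
    moreover have "Re (of_real a * w) = a * Re w" for a w by simp
    ultimately show ?thesis by (simp only: cut_Lam_def Lam_def)
  next
    case False
    then show ?thesis using out[of z] z by (simp add: cut_Lam_def Lam_def)
  qed
  then have e: "zero_ext (img c) (\<lambda>z. norm (wt (h c z)) * cut_Lam \<rho> c z) = (\<lambda>z. Re (\<kappa> * zero_ext (img c) (\<lambda>z. dens (h c z) (cut_pullback \<rho> c) z) z))"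
    by (auto simp: zero_ext_def fun_eq_iff)
  have S0: "cut_pullback \<rho> c z = 0" if "z \<in> img c - cball x r" for z
  proof -
    have "param c z \<notin> bcell (c, x, r)"
    proof
      assume "param c z \<in> bcell (c, x, r)"
      then obtain w where "w \<in> cball x r" "param c z = param c w" by (auto simp: bcell_def)
      then have "z = w" using chartD(8)[OF ch] that c(3) by (metis DiffD1 subsetD)
      then show False using that \<open>w \<in> cball x r\<close> by simp
    qed
    then show ?thesis using \<rho>(2) by (simp add: cut_pullback_def vec_eq_iff)
  qed
  have d0: "(\<integral>z. zero_ext (img c) (\<lambda>z. dens (h c z) (cut_pullback \<rho> c) z) z \<partial>lborel) = 0"
    by (rule integral_dens_zero[OF chartD(2)[OF ch] Ck_Ecoef[OF chartD(2)[OF ch] Ck_h[OF c(1)]] astheno_chart[OF m c(1)] Ck_cut_pullback[OF \<rho>(1) c(1)] compact_cball c(3) S0])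
  have cont: "Ck_on 0 UNIV (zero_ext (img c) (\<lambda>z. dens (h c z) (cut_pullback \<rho> c) z))"
    by (rule Ck_zero_ext[OF chartD(2)[OF ch] _ compact_cball c(3) out]) (simp add: cont_dens[OF \<rho>(1) c(1)])
  have int: "integrable lborel (zero_ext (img c) (\<lambda>z. dens (h c z) (cut_pullback \<rho> c) z))"
    by (rule integrable_compact_support[OF _ compact_cball, of _ x r]) (use cont out in \<open>auto simp: zero_ext_def\<close>)
  have "(\<integral>z. Re (\<kappa> * zero_ext (img c) (\<lambda>z. dens (h c z) (cut_pullback \<rho> c) z) z) \<partial>lborel)
     = Re (\<integral>z. \<kappa> * zero_ext (img c) (\<lambda>z. dens (h c z) (cut_pullback \<rho> c) z) z \<partial>lborel)"
    by (rule integral_bounded_linear[OF bounded_linear_Re]) (use int in simp)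
  also have "\<dots> = 0" using d0 by simp
  finally show ?thesis unfolding e .
qed

section \<open>Comparison of integrals in two charts\<close>

lemma bcell_param:
  assumes "good (c, x, r)" "z \<in> img c" "param c z \<in> bcell (c, x, r)" shows "z \<in> cball x r"
proof -
  obtain w where w: "w \<in> cball x r" "param c z = param c w" using assms(3) unfolding bcell_def by auto
  have c: "c \<in> A" "cball x r \<subseteq> img c" using assms(1) by (simp_all add: good_def)
  have "z = w" using chartD(8)[OF chartA[OF c(1)]] assms(2) w c(2) by (metis subsetD)
  then show ?thesis using w(1) by simp
qed

lemma bcell_chart:
  assumes "good (c, x, r)" "q \<in> bcell (c, x, r)" shows "q \<in> fst c"
proof -
  obtain w where w: "w \<in> cball x r" "q = param c w" using assms(2) unfolding bcell_def by auto
  have c: "c \<in> A" "cball x r \<subseteq> img c" using assms(1) by (simp_all add: good_def)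
  show ?thesis unfolding w(2) by (rule chartD(7)[OF chartA[OF c(1)]]) (use c(2) w(1) in blast)
qed

lemma zero_ext_integrable:
  fixes \<phi> :: "complex^'m \<Rightarrow> real"
  assumes "good (c, x, r)" "continuous_on (img c) \<phi>" "\<And>z. z \<in> img c - cball x r \<Longrightarrow> \<phi> z = 0"
  shows "continuous_on UNIV (zero_ext (img c) \<phi>)" "integrable lborel (zero_ext (img c) \<phi>)"
proof -
  have c: "c \<in> A" "cball x r \<subseteq> img c" using assms(1) by (simp_all add: good_def)
  have "Ck_on 0 UNIV (zero_ext (img c) \<phi>)"
    by (rule Ck_zero_ext[OF chartD(2)[OF chartA[OF c(1)]] _ compact_cball c(2) assms(3)]) (simp add: assms(2))
  then show k: "continuous_on UNIV (zero_ext (img c) \<phi>)" by simp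
  show "integrable lborel (zero_ext (img c) \<phi>)"
    by (rule integrable_compact_support[OF k compact_cball, of x r]) (use assms(3) in \<open>auto simp: zero_ext_def\<close>)
qed

text \<open>The two cut-offs play different parts: \<rho> stands under the derivatives, as part of
  the differentiated form, while \<sigma> only multiplies the resulting scalar. Both can be summed
  over a partition of unity.\<close>

definition wdens :: "('a \<Rightarrow> real) \<Rightarrow> ('a \<Rightarrow> real) \<Rightarrow> ('a, complex^'m) chart \<Rightarrow> complex^'m \<Rightarrow> real" where
  "wdens \<sigma> \<rho> c = zero_ext (img c) (\<lambda>z. norm (wt (h c z)) * (\<sigma> (param c z) * cut_Lam \<rho> c z))"

lemma wdens_integrable:
  assumes m: "2 \<le> CARD('m)" and i: "good (c, x, r)" and \<rho>: "C2_map \<rho>" "C2_map \<sigma>"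
    and supp: "(\<forall>q. q \<notin> bcell (c, x, r) \<longrightarrow> \<rho> q = 0) \<or> (\<forall>q. q \<notin> bcell (c, x, r) \<longrightarrow> \<sigma> q = 0)"
  shows "continuous_on UNIV (wdens \<sigma> \<rho> c)" "integrable lborel (wdens \<sigma> \<rho> c)"
proof -
  have c: "c \<in> A" using i by (simp add: good_def)
  have co: "continuous_on (img c) (\<lambda>z. norm (wt (h c z)) * (\<sigma> (param c z) * cut_Lam \<rho> c z))"
  proof (intro continuous_intros cont_wt cont_cut_Lam m \<rho>(1) c)
    show "continuous_on (img c) (\<lambda>z. \<sigma> (param c z))" using \<rho>(2) c Ck_on_imp_continuous_on by (auto simp: C2_map_def)
  qed
  have z: "norm (wt (h c z)) * (\<sigma> (param c z) * cut_Lam \<rho> c z) = 0" if "z \<in> img c - cball x r" for z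
  proof -
    have n: "param c z \<notin> bcell (c, x, r)" using bcell_param[OF i] that by blast
    from supp show ?thesis
    proof
      assume "\<forall>q. q \<notin> bcell (c, x, r) \<longrightarrow> \<rho> q = 0"
      then have "cut_Lam \<rho> c z = 0" by (intro cut_Lam_zero[OF c _ bcell_closed[OF i] _ n]) (use that in auto)
      then show ?thesis by simp
    next
      assume "\<forall>q. q \<notin> bcell (c, x, r) \<longrightarrow> \<sigma> q = 0"
      then show ?thesis using n by simp
    qed
  qed
  show "continuous_on UNIV (wdens \<sigma> \<rho> c)" unfolding wdens_def by (rule zero_ext_integrable(1)[OF i co z])
  show "integrable lborel (wdens \<sigma> \<rho> c)" unfolding wdens_def by (rule zero_ext_integrable(2)[OF i co z])
qed

text \<open>One cut-off is supported in either cell, so both integrands vanish off the overlap.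
  There the scalar is the same in both charts, and the factor \<open>norm (wt H)\<close> compensates
  the Jacobian.\<close>

lemma wdens_change:
  assumes m: "2 \<le> CARD('m)" and i: "good (c, x, r)" and j: "good (c', x', r')" and \<rho>: "C2_map \<rho>" "C2_map \<sigma>"
    and \<rho>0: "\<And>q. q \<notin> bcell (c, x, r) \<Longrightarrow> \<rho> q = 0" and \<sigma>0: "\<And>q. q \<notin> bcell (c', x', r') \<Longrightarrow> \<sigma> q = 0"
  shows "(\<integral>z. wdens \<sigma> \<rho> c z \<partial>lborel) = (\<integral>z. wdens \<sigma> \<rho> c' z \<partial>lborel)"
proof -
  have c: "c \<in> A" "c' \<in> A" using i j by (simp_all add: good_def)
  note ch = chartA[OF c(1)] chartA[OF c(2)]
  interpret holo_change "overlap c c'" "img c'" "transition c c'" by (rule holo_change_chart[OF c])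
  let ?W = "overlap c c'" and ?\<tau> = "transition c c'"
  define D where "D z = frechet_derivative ?\<tau> (at z)" for z
  note t = transition_overlap[OF ch] and t' = transition_overlap[OF ch(2,1)]
  have i1: "integrable lborel (wdens \<sigma> \<rho> c)" by (rule wdens_integrable(2)[OF m i \<rho>]) (use \<rho>0 in auto)
  have i2: "integrable lborel (wdens \<sigma> \<rho> c')" by (rule wdens_integrable(2)[OF m j \<rho>]) (use \<sigma>0 in auto)
  have k: "zero_ext ?W (\<lambda>z. \<bar>rdet (D z)\<bar> * wdens \<sigma> \<rho> c' (?\<tau> z)) = wdens \<sigma> \<rho> c"
  proof
    fix z
    show "zero_ext ?W (\<lambda>z. \<bar>rdet (D z)\<bar> * wdens \<sigma> \<rho> c' (?\<tau> z)) z = wdens \<sigma> \<rho> c z"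
    proof (cases "z \<in> ?W")
      case True
      have z: "z \<in> img c" using True by (simp add: overlap_iff[OF ch(1)])
      have L: "clinear (D z)"
        unfolding clinear_def D_def using \<tau> True linear_frechet_derivative[OF diff_W[OF Ck_\<tau> True]]
        by (simp add: holo_map_on_def)
      have "norm (wt (h c z)) = \<bar>rdet (D z)\<bar> * norm (wt (h c' (?\<tau> z)))"
        by (rule wt_transform[OF m herm_pos_h[OF c(1) z] herm_pos_h[OF c(2) t(4)[OF True]] L])
          (use hermitian_metricD(3)[OF hm c True] in \<open>simp add: D_def\<close>)
      then show ?thesis
        using True z t[OF True] cut_Lam_change[OF m \<rho>(1) c True] by (simp add: zero_ext_def wdens_def)
    next
      case False
      have "\<sigma> (param c z) = 0" if "z \<in> img c"
      proof (rule \<sigma>0)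
        show "param c z \<notin> bcell (c', x', r')" using False that bcell_chart[OF j] by (auto simp: overlap_iff[OF ch(1)])
      qed
      then show ?thesis using False by (auto simp: zero_ext_def wdens_def)
    qed
  qed
  have zero: "wdens \<sigma> \<rho> c' z = 0" if "z \<notin> ?\<tau> ` ?W" for z
  proof (cases "z \<in> img c'")
    case True
    have "param c' z \<notin> bcell (c, x, r)"
    proof
      assume "param c' z \<in> bcell (c, x, r)"
      then have "z \<in> overlap c' c" using True bcell_chart[OF i] by (simp add: overlap_iff[OF ch(2)])
      then have "z = ?\<tau> (transition c' c z)" "transition c' c z \<in> ?W" using t' by auto
      then show False using that by blast
    qed
    then have "cut_Lam \<rho> c' z = 0" using \<rho>0 by (intro cut_Lam_zero[OF c(2) True bcell_closed[OF i]])
    then show ?thesis by (simp add: wdens_def zero_ext_def)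
  qed (simp add: wdens_def zero_ext_def)
  have inj: "inj_on ?\<tau> ?W" by (rule inj_on_inverseI[of _ "transition c' c"]) (rule t(3))
  have der: "(?\<tau> has_derivative D z) (at z)" if "z \<in> ?W" for z
    unfolding D_def by (rule has_derivative_frechetI[OF diff_W[OF Ck_\<tau> that]])
  have "(\<integral>z. wdens \<sigma> \<rho> c' z \<partial>lborel) = (\<integral>z. zero_ext ?W (\<lambda>z. \<bar>rdet (D z)\<bar> * wdens \<sigma> \<rho> c' (?\<tau> z)) z \<partial>lborel)"
    by (rule integral_change_coords[OF open_W inj der i2 zero]) (use i1 in \<open>simp_all add: k\<close>)
  then show ?thesis by (simp only: k)
qed

text \<open>Each \<open>\<rho> i\<close> supports an integral over its own cell; inserting \<open>\<Sum>j. \<rho> j = 1\<close> as a second cut-off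
  moves the integrals to the cells of the \<open>\<rho> j\<close>, where the sum over \<open>i\<close> restores the full form. This
  replaces an integral over \<open>M\<close>.\<close>

lemma cut_Lam_one_zero:
  assumes m: "2 \<le> CARD('m)" and c: "c \<in> A" "z \<in> img c"
  shows "cut_Lam (\<lambda>_. 1) c z = 0"
proof -
  obtain I \<rho> where P: "finite I \<and> (\<forall>i\<in>I. good i) \<and> (\<forall>i\<in>I. C2_map (\<rho> i)) \<and> (\<forall>i\<in>I. \<forall>q. 0 \<le> \<rho> i q) \<and> (\<forall>i\<in>I. \<forall>q. q \<notin> bcell i \<longrightarrow> \<rho> i q = 0) \<and> (\<forall>q. (\<Sum>i\<in>I. \<rho> i q) = 1)"
    using partition_of_unity by (elim exE) (rule that)
  then have I: "finite I" "\<And>i. i \<in> I \<Longrightarrow> good i" "\<And>i. i \<in> I \<Longrightarrow> C2_map (\<rho> i)" "\<And>i q. i \<in> I \<Longrightarrow> 0 \<le> \<rho> i q"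
    "\<And>i q. i \<in> I \<Longrightarrow> q \<notin> bcell i \<Longrightarrow> \<rho> i q = 0" "\<And>q. (\<Sum>i\<in>I. \<rho> i q) = 1"
    by simp_all
  have rep: "(fst i, fst (snd i), snd (snd i)) = i" for i :: "('a, complex^'m) chart \<times> (complex^'m) \<times> real" by simp
  have gi: "good (fst i, fst (snd i), snd (snd i))" if "i \<in> I" for i using I(2)[OF that] by simp
  have bi: "\<rho> i q = 0" if "i \<in> I" "q \<notin> bcell (fst i, fst (snd i), snd (snd i))" for i q using I(5) that by simp
  have ci: "fst i \<in> A" if "i \<in> I" for i using gi[OF that, unfolded good_def prod.case] by blast
  have int1: "integrable lborel (wdens (\<rho> j) (\<rho> i) (fst i))" if "i \<in> I" "j \<in> I" for i j
    by (rule wdens_integrable(2)[OF m gi[OF that(1)] I(3)[OF that(1)] I(3)[OF that(2)]]) (use bi that in blast)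
  have int2: "integrable lborel (wdens (\<rho> j) (\<rho> i) (fst j))" if "i \<in> I" "j \<in> I" for i j
    by (rule wdens_integrable(2)[OF m gi[OF that(2)] I(3)[OF that(1)] I(3)[OF that(2)]]) (use bi that in blast)
  have int3: "integrable lborel (wdens (\<rho> j) (\<lambda>_. 1) (fst j))" "continuous_on UNIV (wdens (\<rho> j) (\<lambda>_. 1) (fst j))" if "j \<in> I" for j
    by (rule wdens_integrable[OF m gi[OF that] C2_map_one I(3)[OF that]]; use bi that in blast)+
  have A0: "(\<Sum>j\<in>I. \<integral>z. wdens (\<rho> j) (\<rho> i) (fst i) z \<partial>lborel) = 0" if i: "i \<in> I" for i
  proof -
    have "(\<Sum>j\<in>I. wdens (\<rho> j) (\<rho> i) (fst i) z) = zero_ext (img (fst i)) (\<lambda>z. norm (wt (h (fst i) z)) * cut_Lam (\<rho> i) (fst i) z) z" for z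
      unfolding wdens_def zero_ext_def using I(6) by (simp add: sum_distrib_left[symmetric] sum_distrib_right[symmetric])
    then have "(\<integral>z. (\<Sum>j\<in>I. wdens (\<rho> j) (\<rho> i) (fst i) z) \<partial>lborel) = 0"
      using integral_cut_Lam_zero[OF m gi[OF i] I(3)[OF i] bi[OF i]] by simp
    then show ?thesis using int1[OF i] by simp
  qed
  have B0: "(\<Sum>i\<in>I. \<integral>z. wdens (\<rho> j) (\<rho> i) (fst j) z \<partial>lborel) = (\<integral>z. wdens (\<rho> j) (\<lambda>_. 1) (fst j) z \<partial>lborel)" if j: "j \<in> I" for j
  proof -
    have "(\<Sum>i\<in>I. wdens (\<rho> j) (\<rho> i) (fst j) z) = wdens (\<rho> j) (\<lambda>_. 1) (fst j) z" for z
    proof (cases "z \<in> img (fst j)")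
      case True
      have "(\<Sum>i\<in>I. wdens (\<rho> j) (\<rho> i) (fst j) z) = norm (wt (h (fst j) z)) * (\<rho> j (param (fst j) z) * (\<Sum>i\<in>I. cut_Lam (\<rho> i) (fst j) z))"
        using True unfolding wdens_def zero_ext_def by (simp add: sum_distrib_left)
      then show ?thesis using True cut_Lam_sum[OF I(1,3,6) ci[OF j] True] by (simp add: wdens_def zero_ext_def)
    qed (simp add: wdens_def zero_ext_def)
    then have "(\<integral>z. (\<Sum>i\<in>I. wdens (\<rho> j) (\<rho> i) (fst j) z) \<partial>lborel) = (\<integral>z. wdens (\<rho> j) (\<lambda>_. 1) (fst j) z \<partial>lborel)" by simp
    then show ?thesis using int2[OF _ j] by simp
  qed
  have "0 = (\<Sum>i\<in>I. \<Sum>j\<in>I. \<integral>z. wdens (\<rho> j) (\<rho> i) (fst i) z \<partial>lborel)" using A0 by simp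
  also have "\<dots> = (\<Sum>i\<in>I. \<Sum>j\<in>I. \<integral>z. wdens (\<rho> j) (\<rho> i) (fst j) z \<partial>lborel)"
    by (intro sum.cong refl wdens_change[OF m gi gi]) (use I(3) bi in auto)
  also have "\<dots> = (\<Sum>j\<in>I. \<Sum>i\<in>I. \<integral>z. wdens (\<rho> j) (\<rho> i) (fst j) z \<partial>lborel)" by (rule sum.swap)
  also have "\<dots> = (\<Sum>j\<in>I. \<integral>z. wdens (\<rho> j) (\<lambda>_. 1) (fst j) z \<partial>lborel)" using B0 by simp
  finally have S: "(\<Sum>j\<in>I. \<integral>z. wdens (\<rho> j) (\<lambda>_. 1) (fst j) z \<partial>lborel) = 0" by simp
  have LLnn: "0 \<le> cut_Lam (\<lambda>_. 1) c z" if "c \<in> A" "z \<in> img c" for c z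
    using cut_Lam_pullback11(1)[OF m that(1) chart_at(1) chart_at_local_dom[OF that]] .
  have nn: "0 \<le> wdens (\<rho> j) (\<lambda>_. 1) (fst j) z" if "j \<in> I" for j z
    unfolding wdens_def zero_ext_def using LLnn[OF ci[OF that]] I(4)[OF that] by simp
  have wz: "wdens (\<rho> j) (\<lambda>_. 1) (fst j) z = 0" if j: "j \<in> I" for j z
  proof -
    have "(\<integral>z. wdens (\<rho> j) (\<lambda>_. 1) (fst j) z \<partial>lborel) = 0"
      using S I(1) j nn by (subst (asm) sum_nonneg_eq_0_iff) (auto intro!: integral_nonneg_AE)
    then show ?thesis using integral_zero_imp_zero[OF int3(2)[OF j] int3(1)[OF j] nn[OF j]] by blast
  qed
  \<comment> \<open>Some cut-off is nonzero at the given point. It yields the vanishing in its own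
    chart, and invariance of the scalar carries this back to c.\<close>
  obtain j where j: "j \<in> I" "\<rho> j (param c z) \<noteq> 0"
    using I(6)[of "param c z"] by (metis sum.neutral zero_neq_one)
  let ?c = "fst j"
  have "param c z \<in> fst ?c" using bcell_chart[OF gi[OF j(1)]] bi[OF j(1)] j(2) by blast
  then have o: "z \<in> overlap c ?c" using c(2) by (simp add: overlap_iff[OF chartA[OF c(1)]])
  note t = transition_overlap[OF chartA[OF c(1)] chartA[OF ci[OF j(1)]] o]
  have "norm (wt (h ?c (transition c ?c z))) * (\<rho> j (param c z) * cut_Lam (\<lambda>_. 1) ?c (transition c ?c z)) = 0"
    using wz[OF j(1), of "transition c ?c z"] t by (simp add: wdens_def zero_ext_def)
  then have "cut_Lam (\<lambda>_. 1) ?c (transition c ?c z) = 0"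
    using j(2) wt_nz(1)[OF m herm_pos_h[OF ci[OF j(1)] t(4)]] by simp
  then show ?thesis using cut_Lam_change[OF m C2_map_one c(1) ci[OF j(1)] o] by simp
qed

text \<open>The Hessian is linear in the first and conjugate linear in the second argument, hence
  determined by its values on a frame.\<close>

lemma hess_frames:
  assumes c: "c \<in> A" "d \<in> B" "z \<in> local_dom c d f" and u: "unitary_frame H u"
    and z: "\<And>p s i. map_coords.hess (g d) (local_rep c d f) (u p) (u s) i z = 0"
  shows "map_coords.hess (g d) (local_rep c d f) x y i z = 0"
proof -
  interpret map_coords "img d" "g d" "local_dom c d f" "local_rep c d f" by (rule map_coords_chart[OF c(1,2)])
  define k where "k a b = hess (axis a 1) (axis b 1) i z" for a b
  have hk: "hess x y i z = (\<Sum>a\<in>UNIV. \<Sum>b\<in>UNIV. x $ a * cnj (y $ b) * k a b)" for x y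
    unfolding k_def by (rule hess_expansion[OF c(3)])
  define W where "W = matrix_inv (frame_mat u)"
  note co = unitary_frame_coframe(2)[OF u frame_inverse[OF u], folded W_def]
  have "hess x y i z = (\<Sum>a\<in>UNIV. \<Sum>b\<in>UNIV. (\<Sum>p\<in>UNIV. u p $ a * (W *v x) $ p) * (\<Sum>s\<in>UNIV. cnj (u s $ b * (W *v y) $ s)) * k a b)"
    unfolding hk by (simp only: cnj_sum[symmetric] co)
  also have "\<dots> = (\<Sum>a\<in>UNIV. \<Sum>b\<in>UNIV. \<Sum>p\<in>UNIV. \<Sum>s\<in>UNIV. (W *v x) $ p * cnj ((W *v y) $ s) * (u p $ a * cnj (u s $ b) * k a b))"
    unfolding sum_product sum_distrib_right by (simp add: mult_ac sum_distrib_left)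
  also have "\<dots> = (\<Sum>p\<in>UNIV. \<Sum>s\<in>UNIV. \<Sum>a\<in>UNIV. \<Sum>b\<in>UNIV. (W *v x) $ p * cnj ((W *v y) $ s) * (u p $ a * cnj (u s $ b) * k a b))"
    by (subst sum_rot4, subst sum_rot4) (rule refl)
  also have "\<dots> = (\<Sum>p\<in>UNIV. \<Sum>s\<in>UNIV. (W *v x) $ p * cnj ((W *v y) $ s) * hess (u p) (u s) i z)"
    unfolding hk sum_distrib_left ..
  finally show ?thesis by (simp add: z)
qed

theorem pluriharmonic:
  assumes c: "c \<in> A" "d \<in> B" "z \<in> local_dom c d f"
  shows "map_coords.hess (g d) (local_rep c d f) x y i z = 0"
proof -
  have z: "z \<in> img c" using c local_dom_iff[OF chartA[OF c(1)]] by blast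
  obtain u where u: "unitary_frame (h c z) u" using unitary_frame_exists[OF herm_pos_h[OF c(1) z]] by blast
  have "map_coords.hess (g d) (local_rep c d f) (u p) (u s) i z = 0" for p s i
  proof (cases "2 \<le> CARD('m)")
    case True
    show ?thesis by (rule cut_Lam_pullback11(2)[OF True c cut_Lam_one_zero[OF True c(1) z] u])
  next
    case False
    then have "card (UNIV :: 'm set) = 1" using zero_less_card_finite[where 'a='m] by linarith
    then obtain a where a: "(UNIV :: 'm set) = {a}" using card_1_singletonE by blast
    then have "p = a" "s = a" by auto
    then show ?thesis using harm_frame[OF c u, of i] unfolding a by simp
  qed
  then show ?thesis by (rule hess_frames[OF c u])
qed

end

section \<open>The maximum principle\<close>

text \<open>If the second derivative were positive at x it would be so nearby, and the mean value
  formula with directions a and \<open>- a\<close> would make the symmetric second difference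
  positive, against maximality.\<close>

lemma second_derivative_at_max:
  fixes \<phi> :: "'a::real_normed_vector \<Rightarrow> real"
  assumes S: "open S" "x \<in> S" "Ck_on 2 S \<phi>" and mx: "\<And>y. y \<in> S \<Longrightarrow> \<phi> y \<le> \<phi> x"
  shows "frechet_derivative (\<lambda>z. frechet_derivative \<phi> (at z) a) (at x) a \<le> 0"
proof (rule ccontr)
  define d2 where "d2 y = frechet_derivative (\<lambda>z. frechet_derivative \<phi> (at z) a) (at y) a" for y
  assume "\<not> ?thesis"
  then have pos: "0 < d2 x" by (simp add: d2_def)
  have "Ck_on (Suc (Suc 0)) S \<phi>" using S(3) by (simp only: numeral_2_eq_2)
  then have "continuous_on S d2" unfolding d2_def by (simp add: Ck_on.simps(2))
  then have "open (S \<inter> d2 -` {0<..})" by (intro continuous_open_preimage S(1) open_greaterThan)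
  then obtain r where r: "0 < r" "ball x r \<subseteq> S \<inter> d2 -` {0<..}"
    using S(2) pos by (meson IntI greaterThan_iff openE vimageI)
  \<comment> \<open>The summand 2 keeps the quotient defined for \<open>a = 0\<close>; the step is
    small enough for both points to stay in the ball.\<close>
  define h where "h = r / (2 * (norm a + norm a) + 2)"
  have h: "0 < h" "h * (norm a + norm (- a)) < r"
    using r(1) by (auto simp: h_def field_simps add_pos_nonneg intro!: add_pos_nonneg)
  have "Ck_on 2 (ball x r) \<phi>" using Ck_on_subset[OF S(3)] r(2) by blast
  from second_difference_mvt[OF this h] obtain y where y: "norm (y - x) \<le> h * (norm a + norm (- a))"
    "\<phi> (x + h *\<^sub>R a + h *\<^sub>R (- a)) - \<phi> (x + h *\<^sub>R a) - \<phi> (x + h *\<^sub>R (- a)) + \<phi> x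
     = h * h * frechet_derivative (\<lambda>z. frechet_derivative \<phi> (at z) a) (at y) (- a)" by blast
  have yb: "y \<in> ball x r" using y(1) h(2) by (simp add: dist_norm norm_minus_commute)
  have "0 \<le> h * norm a" using h(1) by simp
  then have hr: "h * norm a < r" using h(2) unfolding norm_minus_cancel ring_distribs by linarith
  have b: "x + h *\<^sub>R a \<in> ball x r" "x + h *\<^sub>R (- a) \<in> ball x r"
    using h(1) hr by (simp_all add: dist_norm)
  have "(\<lambda>z. frechet_derivative \<phi> (at z) a) differentiable (at y)"
    using S(3) yb r(2) by (auto simp: numeral_2_eq_2 Ck_on.simps(2))
  from linear_frechet_derivative[OF this]
  have "frechet_derivative (\<lambda>z. frechet_derivative \<phi> (at z) a) (at y) (- a) = - d2 y"
    unfolding d2_def by (rule linear_neg)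
  moreover have "0 < d2 y" using yb r(2) by auto
  ultimately have "\<phi> x - \<phi> (x + h *\<^sub>R a) - \<phi> (x + h *\<^sub>R (- a)) + \<phi> x < 0"
    using y(2) h(1) by (simp add: mult_pos_neg)
  moreover have "x + h *\<^sub>R a \<in> S" "x + h *\<^sub>R (- a) \<in> S" using b r(2) by blast+
  ultimately show False using mx[of "x + h *\<^sub>R a"] mx[of "x + h *\<^sub>R (- a)"] by linarith
qed

text \<open>A quarter of the Laplacian on the complex line through u; the mixed terms cancel by the
  symmetry of second derivatives.\<close>

lemma dl_db_real_form:
  fixes \<psi> :: "complex^'m \<Rightarrow> complex"
  assumes S: "open S" "z \<in> S" "Ck_on 2 S \<psi>"
  shows "dl u (db u \<psi>) z =
    frechet_derivative (\<lambda>w. frechet_derivative \<psi> (at w) ((1/2) *\<^sub>R u)) (at z) ((1/2) *\<^sub>R u)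
    + frechet_derivative (\<lambda>w. frechet_derivative \<psi> (at w) ((1/2) *\<^sub>R (\<i> *s u))) (at z) ((1/2) *\<^sub>R (\<i> *s u))"
proof -
  define a b where "a = (1/2) *\<^sub>R u" "b = (1/2) *\<^sub>R (\<i> *s u)"
  define D where "D x w = frechet_derivative \<psi> (at w) x" for x w
  have df: "D x differentiable (at z)" for x
    using S(2,3) unfolding D_def by (simp add: numeral_2_eq_2 Ck_on.simps(2))
  have db: "db u \<psi> = (\<lambda>w. D a w + \<i> * D b w)" by (simp add: fun_eq_iff cd_def dir01_def D_def a_b_def)
  have "frechet_derivative (\<lambda>w. D a w + \<i> * D b w) (at z)
      = (\<lambda>x. frechet_derivative (D a) (at z) x + \<i> * frechet_derivative (D b) (at z) x)"
    by (intro frechet_derivative_eqI has_derivative_add has_derivative_mult_right has_derivative_frechetI df)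
  moreover have "frechet_derivative (D b) (at z) (- b) = - frechet_derivative (D b) (at z) b"
    "frechet_derivative (D a) (at z) (- b) = - frechet_derivative (D a) (at z) b"
    by (rule linear_neg[OF linear_frechet_derivative[OF df]])+
  moreover have "frechet_derivative (D a) (at z) b = frechet_derivative (D b) (at z) a"
    unfolding D_def by (rule frechet_derivative_commute[OF S(1,3,2)])
  ultimately have "dl u (db u \<psi>) z = frechet_derivative (D a) (at z) a + frechet_derivative (D b) (at z) b"
    unfolding db by (simp add: cd_def dir10_def a_b_def[symmetric] algebra_simps)
  then show ?thesis unfolding D_def a_b_def .
qed

lemma Levi_form_at_max:
  fixes \<psi> :: "complex^'m \<Rightarrow> complex"
  assumes S: "open S" "z \<in> S" "Ck_on 2 S \<psi>" and mx: "\<And>y. y \<in> S \<Longrightarrow> Re (\<psi> y) \<le> Re (\<psi> z)"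
  shows "Re (dl u (db u \<psi>) z) \<le> 0"
proof -
  have "Re (frechet_derivative (\<lambda>w. frechet_derivative \<psi> (at w) a) (at z) a) \<le> 0" for a
  proof -
    have d: "\<psi> differentiable (at w)" if "w \<in> S" for w
      using Ck_on_differentiable[OF S(3) _ that] by simp
    have d': "(\<lambda>w. frechet_derivative \<psi> (at w) a) differentiable (at z)"
      using S(2,3) by (simp add: numeral_2_eq_2 Ck_on.simps(2))
    have "Re (frechet_derivative (\<lambda>w. frechet_derivative \<psi> (at w) a) (at z) a)
        = frechet_derivative (\<lambda>w. Re (frechet_derivative \<psi> (at w) a)) (at z) a"
      by (rule frechet_derivative_linear_compose[OF bounded_linear_Re d', symmetric])
    also have "\<dots> = frechet_derivative (\<lambda>w. frechet_derivative (\<lambda>z. Re (\<psi> z)) (at w) a) (at z) a"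
      by (subst frechet_derivative_cong_open[OF S(1,2)])
        (simp_all add: frechet_derivative_linear_compose[OF bounded_linear_Re d])
    also have "\<dots> \<le> 0" by (rule second_derivative_at_max[OF S(1,2) Ck_on_Re[OF S(1,3)] mx])
    finally show ?thesis .
  qed
  then show ?thesis unfolding dl_db_real_form[OF S] by (simp add: add_nonpos_nonpos)
qed

text \<open>The value at \<open>q\<close> of the Levi form in direction \<open>u\<close> of \<open>S(V,V)\<close>, for \<open>V z = v + l z w\<close> with a holomorphic
  function \<open>l\<close> such that \<open>l q = 0\<close> and \<open>\<partial>\<^sub>u l = 1\<close>.\<close>

definition Levi_twist :: "(complex^'m \<Rightarrow> complex^'m^'m) \<Rightarrow> complex^'m \<Rightarrow> complex^'m \<Rightarrow> complex^'m \<Rightarrow> complex^'m \<Rightarrow> complex" where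
  "Levi_twist S u v w q = dl u (db u (\<lambda>z. herm_form (S z) v v)) q + db u (\<lambda>z. herm_form (S z) w v) q
     + dl u (\<lambda>z. herm_form (S z) v w) q + herm_form (S q) w w"

lemma Ck_herm_form:
  assumes "open W" "\<And>c d. Ck_on k W (\<lambda>z. S z $ c $ d)"
  shows "Ck_on k W (\<lambda>z. herm_form (S z) x y)"
  unfolding herm_form_def by (intro Ck_on_sum Ck_on_mult Ck_on_const assms)

text \<open>Leibniz rule for S(V,V) expanded in powers of l and its conjugate. Dividing a coordinate
  by \<open>u $ a\<close> makes l a holomorphic affine function with derivative 1 along u, and
  \<open>l q = 0\<close> leaves only terms in which every factor l or its conjugate has been
  differentiated.\<close>

lemma dl_db_twist:
  fixes \<alpha> \<beta> \<gamma> \<delta> :: "complex^'m \<Rightarrow> complex"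
  assumes W: "open W" "q \<in> W" and C: "Ck_on 2 W \<alpha>" "Ck_on 2 W \<beta>" "Ck_on 2 W \<gamma>" "Ck_on 2 W \<delta>"
    and a: "u $ a \<noteq> 0" and l: "l = (\<lambda>z. (z $ a - q $ a) / u $ a)"
  shows "dl u (db u (\<lambda>z. \<alpha> z + l z * \<beta> z + cnj (l z) * \<gamma> z + l z * cnj (l z) * \<delta> z)) q
      = dl u (db u \<alpha>) q + db u \<beta> q + dl u \<gamma> q + \<delta> q"
    and "Ck_on 2 W (\<lambda>z. \<alpha> z + l z * \<beta> z + cnj (l z) * \<gamma> z + l z * cnj (l z) * \<delta> z)"
proof -
  have bl: "bounded_linear (\<lambda>x. x $ a / u $ a)"
    using bounded_linear_divide[of "u $ a"] bounded_linear_vec_nth[of a] by (rule bounded_linear_compose)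
  have ld: "(l has_derivative (\<lambda>x. x $ a / u $ a)) (at z)" for z
    unfolding l diff_divide_distrib
    using has_derivative_diff[OF bounded_linear_imp_has_derivative[OF bl] has_derivative_const] by simp
  have ldf: "l differentiable (at z)" for z using ld by (rule differentiableI)
  have ll: "dl u l z = 1" "db u l z = 0" for z
    unfolding dl_alt[OF ldf] db_alt[OF ldf] frechet_derivative_eqI[OF ld] using a by simp_all
  have lc: "dl u (\<lambda>z. cnj (l z)) z = 0" "db u (\<lambda>z. cnj (l z)) z = 1" for z
    unfolding cd_cnj[OF ldf] by (simp_all add: ll)
  have Cl: "Ck_on k W l" for k
    unfolding l diff_divide_distrib by (intro Ck_on_diff W Ck_on_const Ck_on_linear[OF bl] Ck_on_ident)
  have Clc: "Ck_on k W (\<lambda>z. cnj (l z))" for k by (rule Ck_on_cnj[OF W(1) Cl])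
  note I = Ck_on_add[OF W(1)] Ck_on_mult[OF W(1)]
  show "Ck_on 2 W (\<lambda>z. \<alpha> z + l z * \<beta> z + cnj (l z) * \<gamma> z + l z * cnj (l z) * \<delta> z)"
    by (intro I C Cl Clc)
  have C1: "Ck_on 1 W \<phi>" "Ck_on 1 W (cd p \<phi>)" if "Ck_on 2 W \<phi>" for \<phi> p
    using Ck_on_mono[OF that, of 1] Ck_on_cd[OF W(1), of 1 \<phi> p] that by (simp_all add: numeral_2_eq_2)
  have D: "\<phi> differentiable (at z)" if "Ck_on 1 W \<phi>" "z \<in> W" for \<phi> :: "complex^'m \<Rightarrow> complex" and z
    using Ck_on_differentiable[OF that(1) _ that(2)] by simp
  have "db u (\<lambda>z. \<alpha> z + l z * \<beta> z + cnj (l z) * \<gamma> z + l z * cnj (l z) * \<delta> z) z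
      = db u \<alpha> z + l z * db u \<beta> z + (\<gamma> z + cnj (l z) * db u \<gamma> z) + (l z * \<delta> z + l z * cnj (l z) * db u \<delta> z)"
    if z: "z \<in> W" for z
  proof -
    note d = D[OF _ z]
    note e = d[OF C1(1)[OF C(1)]] d[OF C1(1)[OF C(2)]] d[OF C1(1)[OF C(3)]] d[OF C1(1)[OF C(4)]] d[OF Cl] d[OF Clc]
    have "db u (\<lambda>z. l z * cnj (l z)) z = l z" by (subst cd_mult) (use ll lc d Cl Clc in auto)
    then show ?thesis
      by (simp add: cd_add cd_mult e differentiable_add differentiable_mult ll lc)
  qed
  then have "dl u (db u (\<lambda>z. \<alpha> z + l z * \<beta> z + cnj (l z) * \<gamma> z + l z * cnj (l z) * \<delta> z)) q
      = dl u (\<lambda>z. db u \<alpha> z + l z * db u \<beta> z + (\<gamma> z + cnj (l z) * db u \<gamma> z) + (l z * \<delta> z + l z * cnj (l z) * db u \<delta> z)) q"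
    by (rule cd_cong_open[OF W])
  also have "\<dots> = dl u (db u \<alpha>) q + db u \<beta> q + dl u \<gamma> q + \<delta> q"
  proof -
    note d = D[OF _ W(2)]
    note e = d[OF C1(2)[OF C(1)]] d[OF C1(2)[OF C(2)]] d[OF C1(2)[OF C(3)]] d[OF C1(2)[OF C(4)]]
      d[OF C1(1)[OF C(3)]] d[OF C1(1)[OF C(4)]] d[OF Cl] d[OF Clc]
    have "l q = 0" by (simp add: l)
    then show ?thesis
      by (simp add: cd_add cd_mult e differentiable_add differentiable_mult ll lc)
  qed
  finally show "dl u (db u (\<lambda>z. \<alpha> z + l z * \<beta> z + cnj (l z) * \<gamma> z + l z * cnj (l z) * \<delta> z)) q
      = dl u (db u \<alpha>) q + db u \<beta> q + dl u \<gamma> q + \<delta> q" .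
qed

text \<open>The same field V is inserted into both forms. The difference T(V,V) - \<kappa> H(V,V) is
  nonpositive and vanishes at q because V equals v there, so its Levi form at q is
  nonpositive.\<close>

lemma Levi_twist_le:
  fixes T H :: "complex^'m \<Rightarrow> complex^'m^'m"
  assumes W: "open W" "q \<in> W" and C: "\<And>c d. Ck_on 2 W (\<lambda>z. T z $ c $ d)" "\<And>c d. Ck_on 2 W (\<lambda>z. H z $ c $ d)"
    and le: "\<And>z V. z \<in> W \<Longrightarrow> Re (herm_form (T z) V V) \<le> \<kappa> * Re (herm_form (H z) V V)"
    and eq: "Re (herm_form (T q) v v) = \<kappa> * Re (herm_form (H q) v v)" and u: "u \<noteq> 0"
  shows "Re (Levi_twist T u v w q) \<le> \<kappa> * Re (Levi_twist H u v w q)"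
proof -
  obtain a where a: "u $ a \<noteq> 0" using u by (auto simp: vec_eq_iff)
  define l where "l z = (z $ a - q $ a) / u $ a" for z
  define \<psi> where "\<psi> S z = herm_form (S z) v v + l z * herm_form (S z) w v + cnj (l z) * herm_form (S z) v w
     + l z * cnj (l z) * herm_form (S z) w w" for S z
  have \<psi>: "\<psi> S z = herm_form (S z) (v + l z *s w) (v + l z *s w)" for S z
    by (simp add: \<psi>_def herm_form_add_left herm_form_add_right herm_form_scale_left herm_form_scale_right algebra_simps)
  have tw: "dl u (db u (\<psi> S)) q = Levi_twist S u v w q" "Ck_on 2 W (\<psi> S)"
    if "\<And>c d. Ck_on 2 W (\<lambda>z. S z $ c $ d)" for S
  proof -
    note h = Ck_herm_form[OF W(1) that]
    note t = dl_db_twist[OF W h[of v v] h[of w v] h[of v w] h[of w w] a, of l]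
    have "l = (\<lambda>z. (z $ a - q $ a) / u $ a)" by (simp add: l_def fun_eq_iff)
    note t = t[OF this]
    show "dl u (db u (\<psi> S)) q = Levi_twist S u v w q" unfolding \<psi>_def Levi_twist_def by (rule t(1))
    show "Ck_on 2 W (\<psi> S)" unfolding \<psi>_def by (rule t(2))
  qed
  define \<phi> where "\<phi> z = \<psi> T z - complex_of_real \<kappa> * \<psi> H z" for z
  have c1: "Ck_on 1 W f" "Ck_on 1 W (cd p f)" if "Ck_on 2 W f" for f :: "complex^'m \<Rightarrow> complex" and p
    using Ck_on_mono[OF that, of 1] Ck_on_cd[OF W(1), of 1 f p] that by (simp_all add: numeral_2_eq_2)
  have D: "f differentiable (at z)" if "Ck_on 1 W f" "z \<in> W" for f :: "complex^'m \<Rightarrow> complex" and z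
    using Ck_on_differentiable[OF that(1) _ that(2)] by simp
  note CT = tw(2)[of T, OF C(1)] and CH = tw(2)[of H, OF C(2)]
  have C\<phi>: "Ck_on 2 W \<phi>" unfolding \<phi>_def by (intro Ck_on_diff Ck_on_mult Ck_on_const W CT CH)
  have d\<psi>: "\<psi> H differentiable (at z)" if "z \<in> W" for z by (rule D[OF c1(1)[OF CH] that])
  have "dl u (db u \<phi>) q = dl u (\<lambda>z. db u (\<psi> T) z - complex_of_real \<kappa> * db u (\<psi> H) z) q"
    unfolding \<phi>_def
    by (rule cd_cong_open[OF W], subst cd_diff) (auto intro!: D c1 CT CH Ck_on_mult Ck_on_const W simp: cd_cmult d\<psi>)
  also have "\<dots> = Levi_twist T u v w q - complex_of_real \<kappa> * Levi_twist H u v w q"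
    by (subst cd_diff) (auto intro!: D c1 CT CH Ck_on_mult Ck_on_const W simp: cd_cmult D[OF c1(2)[OF CH] W(2)] tw C)
  finally have e: "dl u (db u \<phi>) q = Levi_twist T u v w q - complex_of_real \<kappa> * Levi_twist H u v w q" .
  have "l q = 0" by (simp add: l_def)
  then have "Re (\<phi> q) = 0" using eq by (simp add: \<phi>_def \<psi>)
  moreover have "Re (\<phi> z) \<le> 0" if "z \<in> W" for z using le[OF that, of "v + l z *s w"] by (simp add: \<phi>_def \<psi>)
  ultimately have "Re (dl u (db u \<phi>) q) \<le> 0" by (intro Levi_form_at_max[OF W C\<phi>]) simp
  then show ?thesis by (simp add: e)
qed

text \<open>For the chosen w both first order terms equal minus h(w,w). With the last term of
  \<open>Levi_twist\<close> this leaves one copy of minus h(w,w), which is minus the quadratic part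
  of the curvature form; the second derivatives of the metric give the rest.\<close>

lemma Levi_twist_chern_form:
  fixes H :: "complex^'m \<Rightarrow> complex^'m^'m"
  assumes W: "open W" "q \<in> W" and C: "\<And>c d. Ck_on 2 W (\<lambda>z. H z $ c $ d)"
    and pos: "\<And>z. z \<in> W \<Longrightarrow> herm_pos (H z)"
  shows "\<exists>w. Levi_twist H u v w q = - chern_form H q u v"
proof -
  define X where "X a c n = dz a (\<lambda>w. H w $ c $ n) q" for a c n
  define Y where "Y b m d = dzbar b (\<lambda>w. H w $ m $ d) q" for b m d
  define P where "P n = (\<Sum>a\<in>UNIV. \<Sum>c\<in>UNIV. u $ a * v $ c * X a c n)" for n
  define Q where "Q m = (\<Sum>b\<in>UNIV. \<Sum>d\<in>UNIV. cnj (u $ b) * cnj (v $ d) * Y b m d)" for m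
  have inv: "invertible (H q)"
    using unitary_frame_exists[OF pos[OF W(2)]] unitary_frame_inv(2) by blast
  have hs: "H z $ b $ a = cnj (H z $ a $ b)" if "z \<in> W" for z a b using pos[OF that] unfolding herm_pos_def by blast
  have dH: "(\<lambda>w. H w $ c $ d) differentiable (at q)" for c d
    using Ck_on_differentiable[OF C _ W(2)] by simp
  have i1: "(\<Sum>\<mu>\<in>UNIV. herm_inv (H q) \<mu> n * H q $ \<mu> $ k) = (if n = k then 1 else 0)" for n k
  proof -
    have "(matrix_inv (H q) ** H q) $ n $ k = mat 1 $ n $ k" using matrix_inv_right[OF inv] matrix_left_right_inverse[of "H q"] by simp
    then show ?thesis by (simp add: matrix_matrix_mult_def mat_def herm_inv_def)
  qed
  have i2: "(\<Sum>n\<in>UNIV. herm_inv (H q) \<mu> n * H q $ k $ n) = (if k = \<mu> then 1 else 0)" for \<mu> k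
  proof -
    have "(H q ** matrix_inv (H q)) $ k $ \<mu> = mat 1 $ k $ \<mu>" using matrix_inv_right[OF inv] by simp
    then show ?thesis by (simp add: matrix_matrix_mult_def mat_def herm_inv_def mult.commute)
  qed
  \<comment> \<open>Minus the Chern connection form in direction u applied to v, so that the Chern
    derivative of V along u vanishes at q.\<close>
  define w where "w = (\<chi> \<mu>. - (\<Sum>n\<in>UNIV. herm_inv (H q) \<mu> n * P n))"
  have wP: "(\<Sum>\<mu>\<in>UNIV. w $ \<mu> * H q $ \<mu> $ k) = - P k" for k
  proof -
    have "(\<Sum>\<mu>\<in>UNIV. w $ \<mu> * H q $ \<mu> $ k) = - (\<Sum>\<mu>\<in>UNIV. \<Sum>n\<in>UNIV. P n * (herm_inv (H q) \<mu> n * H q $ \<mu> $ k))"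
      unfolding w_def by (simp add: sum_distrib_left sum_distrib_right sum_negf mult_ac)
    also have "\<dots> = - (\<Sum>n\<in>UNIV. \<Sum>\<mu>\<in>UNIV. P n * (herm_inv (H q) \<mu> n * H q $ \<mu> $ k))"
      by (subst sum.swap) (rule refl)
    also have "\<dots> = - P k" unfolding sum_distrib_left[symmetric] i1 by (simp add: if_distrib cong: if_cong)
    finally show ?thesis .
  qed
  have lP: "dl u (\<lambda>z. herm_form (H z) v x) q = (\<Sum>n\<in>UNIV. cnj (x $ n) * P n)" for x
  proof -
    have "dl u (\<lambda>z. herm_form (H z) v x) q = (\<Sum>c\<in>UNIV. \<Sum>n\<in>UNIV. v $ c * cnj (x $ n) * dl u (\<lambda>z. H z $ c $ n) q)"
      unfolding herm_form_def
      by (simp add: cd_sum cd_mult cd_cmult dH differentiable_sum differentiable_mult mult_ac)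
    also have "\<dots> = (\<Sum>c\<in>UNIV. \<Sum>n\<in>UNIV. \<Sum>a\<in>UNIV. cnj (x $ n) * (u $ a * v $ c * X a c n))"
      unfolding X_def dl_expansion[OF dH, of u] dz_eq_dl[OF dH] by (simp add: sum_distrib_left mult_ac)
    also have "\<dots> = (\<Sum>n\<in>UNIV. \<Sum>a\<in>UNIV. \<Sum>c\<in>UNIV. cnj (x $ n) * (u $ a * v $ c * X a c n))"
      by (subst sum.swap) (rule sum.cong[OF refl], rule sum.swap)
    finally show ?thesis by (simp add: P_def sum_distrib_left)
  qed
  have PQ: "Q m = cnj (P m)" for m
  proof -
    have "Y b m d = cnj (X b d m)" for b d
    proof -
      have "db (axis b 1) (\<lambda>w. H w $ m $ d) q = db (axis b 1) (\<lambda>w. cnj (H w $ d $ m)) q"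
        by (rule cd_cong_open[OF W]) (rule hs)
      then show ?thesis unfolding Y_def X_def dzbar_eq_db[OF dH] dz_eq_dl[OF dH] by (simp add: cd_cnj[OF dH])
    qed
    then show ?thesis by (simp add: P_def Q_def)
  qed
  have HwP: "herm_form (H q) w x = - (\<Sum>n\<in>UNIV. cnj (x $ n) * P n)" for x
  proof -
    have "herm_form (H q) w x = (\<Sum>n\<in>UNIV. cnj (x $ n) * (\<Sum>\<mu>\<in>UNIV. w $ \<mu> * H q $ \<mu> $ n))"
      unfolding herm_form_def by (subst sum.swap) (simp add: sum_distrib_left mult_ac)
    then show ?thesis unfolding wP by (simp add: sum_negf)
  qed
  have 1: "dl u (\<lambda>z. herm_form (H z) v w) q = - herm_form (H q) w w" unfolding lP HwP by simp
  have 2: "db u (\<lambda>z. herm_form (H z) w v) q = - herm_form (H q) w w"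
  proof -
    have d: "(\<lambda>z. herm_form (H z) v w) differentiable (at q)"
      using Ck_on_differentiable[OF Ck_herm_form[OF W(1) C] _ W(2)] by simp
    have "db u (\<lambda>z. herm_form (H z) w v) q = db u (\<lambda>z. cnj (herm_form (H z) v w)) q"
      by (rule cd_cong_open[OF W]) (rule herm_form_cnj[symmetric], rule hs)
    also have "\<dots> = cnj (- herm_form (H q) w w)" unfolding cd_cnj[OF d] by (simp add: 1)
    also have "\<dots> = - herm_form (H q) w w" unfolding complex_cnj_minus by (subst herm_form_cnj[OF hs[OF W(2)]]) (rule refl)
    finally show ?thesis .
  qed
  have R: "(\<Sum>a\<in>UNIV. \<Sum>b\<in>UNIV. \<Sum>c\<in>UNIV. \<Sum>d\<in>UNIV. dz a (dzbar b (\<lambda>w. H w $ c $ d)) q * u $ a * cnj (u $ b) * v $ c * cnj (v $ d))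
      = dl u (db u (\<lambda>z. herm_form (H z) v v)) q"
  proof -
    have "dl u (db u (\<lambda>z. herm_form (H z) v v)) q
       = (\<Sum>c\<in>UNIV. \<Sum>d\<in>UNIV. v $ c * cnj (v $ d) * (\<Sum>a\<in>UNIV. \<Sum>b\<in>UNIV. u $ a * cnj (u $ b) * dl (axis a 1) (db (axis b 1) (\<lambda>w. H w $ c $ d)) q))"
      using ddb_expand[OF W C, of u v u v] unfolding ddb_def dl_db_expansion[OF W C, of u u] .
    also have "\<dots> = (\<Sum>c\<in>UNIV. \<Sum>d\<in>UNIV. \<Sum>a\<in>UNIV. \<Sum>b\<in>UNIV. dz a (dzbar b (\<lambda>w. H w $ c $ d)) q * u $ a * cnj (u $ b) * v $ c * cnj (v $ d))"
      unfolding dz_dzbar(1)[OF W(1) C W(2)] by (simp add: sum_distrib_left mult_ac)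
    also have "\<dots> = (\<Sum>a\<in>UNIV. \<Sum>b\<in>UNIV. \<Sum>c\<in>UNIV. \<Sum>d\<in>UNIV. dz a (dzbar b (\<lambda>w. H w $ c $ d)) q * u $ a * cnj (u $ b) * v $ c * cnj (v $ d))"
      by (subst (2) sum_rot4, subst (2) sum_rot4) (rule refl)
    finally show ?thesis by simp
  qed
  have prod: "P \<nu> * Q \<mu> = (\<Sum>a\<in>UNIV. \<Sum>b\<in>UNIV. \<Sum>c\<in>UNIV. \<Sum>d\<in>UNIV. (u $ a * v $ c * X a c \<nu>) * (cnj (u $ b) * cnj (v $ d) * Y b \<mu> d))" for \<nu> \<mu>
    unfolding P_def Q_def by (simp only: sum_product)
  \<comment> \<open>The quadratic part of the curvature factors through \<open>P\<close> and its
    conjugate \<open>Q\<close>; contraction with the inverse metric turns it into h(w,w).\<close>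
  have "(\<Sum>a\<in>UNIV. \<Sum>b\<in>UNIV. \<Sum>c\<in>UNIV. \<Sum>d\<in>UNIV. (\<Sum>\<mu>\<in>UNIV. \<Sum>\<nu>\<in>UNIV. herm_inv (H q) \<mu> \<nu> * X a c \<nu> * Y b \<mu> d) * u $ a * cnj (u $ b) * v $ c * cnj (v $ d))
     = (\<Sum>a\<in>UNIV. \<Sum>b\<in>UNIV. \<Sum>c\<in>UNIV. \<Sum>d\<in>UNIV. \<Sum>\<mu>\<in>UNIV. \<Sum>\<nu>\<in>UNIV. herm_inv (H q) \<mu> \<nu> * ((u $ a * v $ c * X a c \<nu>) * (cnj (u $ b) * cnj (v $ d) * Y b \<mu> d)))"
    by (simp add: sum_distrib_left sum_distrib_right mult_ac)
  also have "\<dots> = (\<Sum>\<mu>\<in>UNIV. \<Sum>\<nu>\<in>UNIV. \<Sum>a\<in>UNIV. \<Sum>b\<in>UNIV. \<Sum>c\<in>UNIV. \<Sum>d\<in>UNIV. herm_inv (H q) \<mu> \<nu> * ((u $ a * v $ c * X a c \<nu>) * (cnj (u $ b) * cnj (v $ d) * Y b \<mu> d)))"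
    by (rule sum_rot42)
  also have "\<dots> = (\<Sum>\<mu>\<in>UNIV. \<Sum>\<nu>\<in>UNIV. herm_inv (H q) \<mu> \<nu> * (P \<nu> * Q \<mu>))"
    unfolding prod sum_distrib_left by (rule refl)
  also have "\<dots> = (\<Sum>\<mu>\<in>UNIV. - w $ \<mu> * cnj (P \<mu>))"
    unfolding w_def PQ by (simp add: sum_distrib_left sum_distrib_right mult_ac)
  also have "\<dots> = herm_form (H q) w w"
  proof -
    have "herm_form (H q) w w = cnj (herm_form (H q) w w)" by (rule herm_form_cnj[OF hs[OF W(2)], symmetric])
    also have "\<dots> = (\<Sum>\<mu>\<in>UNIV. - w $ \<mu> * cnj (P \<mu>))" by (simp add: HwP sum_negf)
    finally show ?thesis by simp
  qed
  finally have E: "(\<Sum>a\<in>UNIV. \<Sum>b\<in>UNIV. \<Sum>c\<in>UNIV. \<Sum>d\<in>UNIV. (\<Sum>\<mu>\<in>UNIV. \<Sum>\<nu>\<in>UNIV. herm_inv (H q) \<mu> \<nu> * X a c \<nu> * Y b \<mu> d) * u $ a * cnj (u $ b) * v $ c * cnj (v $ d))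
     = herm_form (H q) w w" .
  have "chern_form H q u v = - dl u (db u (\<lambda>z. herm_form (H z) v v)) q + herm_form (H q) w w"
    unfolding E[symmetric] R[symmetric] chern_form_def chern_curv_def X_def Y_def
    by (simp only: distrib_right sum.distrib mult_minus_left sum_negf)
  then have "Levi_twist H u v w q = - chern_form H q u v" unfolding Levi_twist_def 1 2 by simp
  then show ?thesis by blast
qed

lemma herm_form_scaleR: "herm_form H (c *\<^sub>R x) (c *\<^sub>R x) = c\<^sup>2 *\<^sub>R herm_form H x x"
  unfolding herm_form_def vector_scaleR_component
  by (simp add: scaleR_conv_of_real[where 'a=complex] sum_distrib_left power2_eq_square mult_ac)

lemma continuous_on_Re_herm_form:
  fixes S :: "complex^'m \<Rightarrow> complex^'m^'m"
  assumes "\<And>a b. continuous_on X (\<lambda>z. S z $ a $ b)"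
  shows "continuous_on (X \<times> Y) (\<lambda>p. Re (herm_form (S (fst p)) (snd p) (snd p)))"
proof -
  have "continuous_on (X \<times> Y) (\<lambda>p. S (fst p) $ a $ b)" for a b
    by (rule continuous_on_compose2[OF assms]) (auto intro: continuous_on_fst continuous_on_id)
  then show ?thesis
    unfolding herm_form_def
    by (intro continuous_on_Re continuous_on_sum continuous_on_mult) (auto intro!: continuous_intros)
qed

section \<open>The maximal ratio of the two forms and constancy of the map\<close>

context manifold_map
begin

text \<open>The quotient is homogeneous of degree zero in the vector, so over each closed coordinate
  ball the Euclidean unit sphere of that chart suffices and no unit sphere bundle has to be built.
  Finitely many balls cover M, and points in other charts are carried to them by
  transitions.\<close>

lemma max_ratio:
  assumes h0: "hermitian_metric A h0"
  shows "\<exists>\<kappa> c q v. c \<in> A \<and> q \<in> img c \<and> v \<noteq> 0 \<and> Re (herm_form (pullback11 c q) v v) = \<kappa> * Re (herm_form (h0 c q) v v)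
     \<and> (\<forall>c'\<in>A. \<forall>z\<in>img c'. \<forall>V. Re (herm_form (pullback11 c' z) V V) \<le> \<kappa> * Re (herm_form (h0 c' z) V V))"
proof -
  let ?S = "sphere 0 1 :: (complex^'m) set"
  define t where "t c p = Re (herm_form (pullback11 c (fst p)) (snd p) (snd p))" for c p
  define s where "s c p = Re (herm_form (h0 c (fst p)) (snd p) (snd p))" for c p
  define K where "K i = cball (fst (snd i)) (snd (snd i)) \<times> ?S" for i :: "('a, complex^'m) chart \<times> (complex^'m) \<times> real"
  obtain I where I: "finite I \<and> (\<forall>i\<in>I. good i) \<and> (\<forall>q. \<exists>i\<in>I. q \<in> cell i)"
    using good_cover by (elim exE) (rule that)
  have g: "fst i \<in> A" "0 < snd (snd i)" "cball (fst (snd i)) (snd (snd i)) \<subseteq> img (fst i)" if "i \<in> I" for i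
    using I that unfolding good_def by (auto simp: case_prod_beta)
  have pos: "0 < s c p" if "c \<in> A" "fst p \<in> img c" "snd p \<noteq> 0" for c p
    using hermitian_metricD(2)[OF h0 that(1,2)] that(3) unfolding herm_pos_def s_def by blast
  have Kp: "fst p \<in> img (fst i)" "snd p \<noteq> 0" if "i \<in> I" "p \<in> K i" for i p
    using g(3)[OF that(1)] that(2) unfolding K_def by auto
  have "\<exists>p\<in>K i. \<forall>p'\<in>K i. t (fst i) p' / s (fst i) p' \<le> t (fst i) p / s (fst i) p" if i: "i \<in> I" for i
  proof (rule continuous_attains_sup)
    show "compact (K i)" unfolding K_def by (intro compact_Times compact_cball compact_sphere)
    show "K i \<noteq> {}" using g(2)[OF i] unfolding K_def by (auto simp: sphere_eq_empty)
    have c: "fst i \<in> A" by (rule g(1)[OF i])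
    have "continuous_on (img (fst i)) (\<lambda>z. pullback11 (fst i) z $ a $ b)" for a b
      using Ck_pullback11[OF c, of 0] by simp
    then have "continuous_on (img (fst i) \<times> ?S) (t (fst i))" unfolding t_def by (rule continuous_on_Re_herm_form)
    moreover have "continuous_on (img (fst i)) (\<lambda>z. h0 (fst i) z $ a $ b)" for a b
      using hermitian_metricD(1)[OF h0 c] Ck_on_imp_continuous_on[of 0 "img (fst i)" "h0 (fst i)"]
      by (intro continuous_intros) (simp add: smooth_on_def)
    then have "continuous_on (img (fst i) \<times> ?S) (s (fst i))" unfolding s_def by (rule continuous_on_Re_herm_form)
    moreover have "K i \<subseteq> img (fst i) \<times> ?S" using g(3)[OF i] unfolding K_def by auto
    ultimately show "continuous_on (K i) (\<lambda>p. t (fst i) p / s (fst i) p)"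
      using pos[OF c Kp[OF i]] by (intro continuous_on_divide) (auto intro: continuous_on_subset simp: less_le)
  qed
  then obtain p where p: "\<And>i. i \<in> I \<Longrightarrow> p i \<in> K i"
    "\<And>i p'. i \<in> I \<Longrightarrow> p' \<in> K i \<Longrightarrow> t (fst i) p' / s (fst i) p' \<le> t (fst i) (p i) / s (fst i) (p i)"
    by metis
  define R where "R i = t (fst i) (p i) / s (fst i) (p i)" for i
  have "I \<noteq> {}" using I by blast
  then have "Max (R ` I) \<in> R ` I" using I by (intro Max_in) auto
  then obtain i where i: "i \<in> I" "R i = Max (R ` I)" by (metis imageE)
  have Rle: "R j \<le> R i" if "j \<in> I" for j using I that i(2) by simp
  have "Re (herm_form (pullback11 c' z) V V) \<le> R i * Re (herm_form (h0 c' z) V V)" if c': "c' \<in> A" "z \<in> img c'" for c' z V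
  proof (cases "V = 0")
    case False
    obtain j where j: "j \<in> I" "param c' z \<in> cell j" using I by blast
    let ?c = "fst j"
    have c: "?c \<in> A" by (rule g(1)[OF j(1)])
    have cell: "param c' z \<in> fst ?c" "snd ?c (param c' z) \<in> cball (fst (snd j)) (snd (snd j))"
      using j(2) unfolding cell_def by (auto simp: case_prod_beta)
    have o: "z \<in> overlap c' ?c" using c'(2) cell(1) by (simp add: overlap_iff[OF chartA[OF c'(1)]])
    let ?w = "transition c' ?c z"
    define V' where "V' = frechet_derivative (transition c' ?c) (at z) V"
    have e: "herm_form (pullback11 c' z) V V = herm_form (pullback11 ?c ?w) V' V'" "herm_form (h0 c' z) V V = herm_form (h0 ?c ?w) V' V'"
      unfolding V'_def by (rule pullback11_change[OF c'(1) c o], rule hermitian_metricD(3)[OF h0 c'(1) c o])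
    have "0 < s c' (z, V)" using pos[OF c'(1)] c'(2) False by simp
    then have "V' \<noteq> 0" using e(2) by (auto simp: s_def)
    \<comment> \<open>Euclidean normalisation in the chart of the ball; the factor is undone below
      because both sides are quadratic in the vector.\<close>
    define V1 where "V1 = (1 / norm V') *\<^sub>R V'"
    have V1: "V' = norm V' *\<^sub>R V1" "norm V1 = 1" using \<open>V' \<noteq> 0\<close> by (simp_all add: V1_def)
    have w: "?w \<in> cball (fst (snd j)) (snd (snd j))" using cell(2) by (simp add: transition_def)
    then have K: "(?w, V1) \<in> K j" using V1(2) unfolding K_def by simp
    have sp: "0 < s ?c (?w, V1)" using pos[OF c] Kp[OF j(1) K] by simp
    have "t ?c (?w, V1) / s ?c (?w, V1) \<le> R i" using p(2)[OF j(1) K] Rle[OF j(1)] unfolding R_def by simp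
    then have "t ?c (?w, V1) \<le> R i * s ?c (?w, V1)" using sp by (simp add: pos_divide_le_eq)
    then have "(norm V')\<^sup>2 * t ?c (?w, V1) \<le> (norm V')\<^sup>2 * (R i * s ?c (?w, V1))" by (rule mult_left_mono) simp
    moreover have "Re (herm_form H V' V') = (norm V')\<^sup>2 * Re (herm_form H V1 V1)" for H
      using arg_cong[OF herm_form_scaleR[of H "norm V'" V1], of Re] unfolding V1(1)[symmetric] by simp
    ultimately show ?thesis unfolding e by (simp add: t_def s_def mult_ac)
  qed simp
  moreover have "Re (herm_form (pullback11 (fst i) (fst (p i))) (snd (p i)) (snd (p i))) = R i * Re (herm_form (h0 (fst i) (fst (p i))) (snd (p i)) (snd (p i)))"
    using pos[OF g(1)[OF i(1)] Kp[OF i(1) p(1)[OF i(1)]]] by (simp add: R_def t_def s_def)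
  ultimately show ?thesis using g(1)[OF i(1)] Kp[OF i(1) p(1)[OF i(1)]] by blast
qed

lemma constant_of_derivative_zero:
  assumes z: "\<And>c d z v. c \<in> A \<Longrightarrow> d \<in> B \<Longrightarrow> z \<in> local_dom c d f \<Longrightarrow> frechet_derivative (local_rep c d f) (at z) v = 0"
  shows "f constant_on UNIV"
proof -
  have loc: "\<forall>\<^sub>F p in at q. f q = f p" for q
  proof -
    obtain c where c: "c \<in> A" "q \<in> fst c" using coverA by blast
    obtain d where d: "d \<in> B" "f q \<in> fst d" using coverB by blast
    note ch = chartA[OF c(1)] chartB[OF d(1)]
    have "snd c q \<in> local_dom c d f" using c(2) d(2) chartD(5,6)[OF ch(1) c(2)] by (simp add: local_dom_iff[OF ch(1)])
    then obtain r where r: "0 < r" "ball (snd c q) r \<subseteq> local_dom c d f"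
      using open_local_dom[OF ch cont_f] by (meson openE)
    have eq: "local_rep c d f w = local_rep c d f (snd c q)" if w: "w \<in> ball (snd c q) r" for w
    proof (rule has_derivative_zero_unique[OF convex_ball _ w])
      fix x assume "x \<in> ball (snd c q) r"
      then have x: "x \<in> local_dom c d f" using r(2) by blast
      have "frechet_derivative (local_rep c d f) (at x) = (\<lambda>_. 0)" using z[OF c(1) d(1) x] by (simp add: fun_eq_iff)
      then show "(local_rep c d f has_derivative (\<lambda>_. 0)) (at x within ball (snd c q) r)"
        using has_derivative_frechetI[OF local_rep_diff[OF c(1) d(1) x]] has_derivative_at_withinI by metis
    qed (simp add: r(1))
    have fp: "f p = param d (local_rep c d f (snd c p))" if "p \<in> fst c" "snd c p \<in> ball (snd c q) r" for p
    proof -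
      have "f p \<in> fst d" using that r(2) local_dom_iff[OF ch(1), of "snd c p" d f] chartD(6)[OF ch(1) that(1)] by auto
      then show ?thesis using chartD(6)[OF ch(1) that(1)] chartD(6)[OF ch(2)] by (simp add: local_rep_def)
    qed
    have "open (fst c \<inter> snd c -` ball (snd c q) r)"
      by (rule continuous_open_preimage[OF chartD(3,1)[OF ch(1)]]) simp
    moreover have "q \<in> fst c \<inter> snd c -` ball (snd c q) r" using c(2) r(1) by simp
    moreover have "f q = f p" if "p \<in> fst c \<inter> snd c -` ball (snd c q) r" for p
    proof -
      have p: "p \<in> fst c" "snd c p \<in> ball (snd c q) r" using that by auto
      have q: "snd c q \<in> ball (snd c q) r" using r(1) by simp
      show ?thesis unfolding fp[OF p] fp[OF c(2) q] eq[OF p(2)] ..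
    qed
    ultimately show ?thesis unfolding eventually_at_topological by blast
  qed
  have "connected (UNIV :: 'a set)" using cm unfolding complex_manifold_def by blast
  then have "f a = f b" for a b using connected_local_const[of UNIV a b f] loc by simp
  then show ?thesis unfolding constant_on_def by blast
qed

end

context harmonic_map
begin

text \<open>\<open>Levi_twist_le\<close> compares the two forms for one and the same w.
  Pluriharmonicity bounds the side of T for every w, so the w that produces the Chern curvature of
  \<open>h0\<close> may be taken.\<close>

lemma constant_if_RC_positive:
  assumes h0: "hermitian_metric A h0" and rc: "uniformly_RC_positive A h0"
  shows "f constant_on UNIV"
proof -
  obtain \<kappa> c q v where m: "c \<in> A \<and> q \<in> img c \<and> v \<noteq> 0 \<and> Re (herm_form (pullback11 c q) v v) = \<kappa> * Re (herm_form (h0 c q) v v)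
     \<and> (\<forall>c'\<in>A. \<forall>z\<in>img c'. \<forall>V. Re (herm_form (pullback11 c' z) V V) \<le> \<kappa> * Re (herm_form (h0 c' z) V V))"
    using max_ratio[OF h0] by (elim exE) (rule that)
  then have c: "c \<in> A" "q \<in> img c" and v: "v \<noteq> 0" and eq: "Re (herm_form (pullback11 c q) v v) = \<kappa> * Re (herm_form (h0 c q) v v)"
    and le: "\<And>c' z V. c' \<in> A \<Longrightarrow> z \<in> img c' \<Longrightarrow> Re (herm_form (pullback11 c' z) V V) \<le> \<kappa> * Re (herm_form (h0 c' z) V V)"
    by simp_all
  have "\<kappa> \<le> 0"
  proof (rule ccontr)
    assume k: "\<not> \<kappa> \<le> 0"
    let ?d = "chart_at (param c q)"
    note d = chart_at(1)[of "param c q"]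
    interpret map_coords "img ?d" "g ?d" "local_dom c ?d f" "local_rep c ?d f" by (rule map_coords_chart[OF c(1) d])
    let ?W = "local_dom c ?d f"
    have q: "q \<in> ?W" by (rule chart_at_local_dom[OF c])
    have sub: "z \<in> img c" if "z \<in> ?W" for z using that by (simp add: local_dom_iff[OF chartA[OF c(1)]])
    have "Ck_on 2 (img c) (h0 c)" using hermitian_metricD(1)[OF h0 c(1)] unfolding smooth_on_def by blast
    then have "Ck_on 2 ?W (h0 c)" by (rule Ck_on_subset) (use sub in blast)
    then have Ch: "Ck_on 2 ?W (\<lambda>z. h0 c z $ a $ b)" for a b by (intro Ck_on_vec_nth open_U)
    obtain u where u: "\<And>v. v \<noteq> 0 \<Longrightarrow> 0 < Re (chern_form (h0 c) q u v)"
      using rc c unfolding uniformly_RC_positive_def by blast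
    \<comment> \<open>The curvature form vanishes in the zero direction; a nonzero coordinate of u
      is needed to build the function l of the twist.\<close>
    have u0: "u \<noteq> 0" using u[OF v] by (auto simp: chern_form_def)
    obtain w where w: "Levi_twist (h0 c) u v w q = - chern_form (h0 c) q u v"
      using Levi_twist_chern_form[OF open_U q Ch hermitian_metricD(2)[OF h0 c(1) sub]] by blast
    have "Re (Levi_twist pullback_mat u v w q) \<le> \<kappa> * Re (Levi_twist (h0 c) u v w q)"
    proof (rule Levi_twist_le[OF open_U q Ck_pullback_mat Ch _ _ u0])
      show "Re (herm_form (pullback_mat z) V V) \<le> \<kappa> * Re (herm_form (h0 c z) V V)" if "z \<in> ?W" for z V
        using le[OF c(1) sub[OF that]] pullback11_eq[OF c(1) d that] by simp
      show "Re (herm_form (pullback_mat q) v v) = \<kappa> * Re (herm_form (h0 c q) v v)" using eq pullback11_eq[OF c(1) d q] by simp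
    qed
    moreover have "0 \<le> Re (Levi_twist pullback_mat u v w q)" unfolding Levi_twist_def
      by (rule pluriharmonic_hessian_nonneg[OF q curv_at[OF c(1) d q] pluriharmonic[OF c(1) d]])
    moreover have "0 < \<kappa> * Re (chern_form (h0 c) q u v)" using k u[OF v] by simp
    ultimately show False unfolding w by simp
  qed
  show ?thesis
  proof (rule constant_of_derivative_zero)
    fix c d z and V :: "complex^'m"
    assume c: "c \<in> A" "d \<in> B" "z \<in> local_dom c d f"
    interpret map_coords "img d" "g d" "local_dom c d f" "local_rep c d f" by (rule map_coords_chart[OF c(1,2)])
    have z: "z \<in> img c" using c(3) by (simp add: local_dom_iff[OF chartA[OF c(1)]])
    have "0 \<le> Re (herm_form (h0 c z) V V)"
      using hermitian_metricD(2)[OF h0 c(1) z] unfolding herm_pos_def by (cases "V = 0") (auto simp: less_imp_le)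
    then have "Re (herm_form (pullback_mat z) V V) \<le> 0"
      using le[OF c(1) z, of V] mult_nonpos_nonneg[OF \<open>\<kappa> \<le> 0\<close>] pullback11_eq[OF c] by fastforce
    then show "frechet_derivative (local_rep c d f) (at z) V = 0"
      using pullback_mat_pos[OF c(3), of V] by simp
  qed
qed

end

theorem theorem1p8:
  fixes A :: "('a::{t2_space,second_countable_topology}, complex^'m) chart set"
    and B :: "('b::{t2_space,second_countable_topology}, real^'n) chart set"
    and h h0 :: "('a, 'm) herm_metric"
    and g :: "('b, 'n) real_metric"
    and f :: "'a \<Rightarrow> 'b"
  assumes "complex_manifold A" and "compact (UNIV :: 'a set)"
    and "hermitian_metric A h" and "astheno_kaehler A h"
    and "smooth_manifold B" and "riemannian_metric B g"
    and "nonpos_complex_sectional_curvature B g"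
    and "smooth_map A B f" and "hermitian_harmonic A h B g f"
    and "hermitian_metric A h0" and "uniformly_RC_positive A h0"
  shows "f constant_on UNIV"
proof -
  interpret harmonic_map A B g f h
    using assms by unfold_locales
  show ?thesis using assms(10,11) by (rule constant_if_RC_positive)
qed

end
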